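(* Let $(v_{j,h}^{n+1},w_{j,h}^{n+1},q_{j,h}^{n+1},r_{j,h}^{n+1})$ and $(\hat v_{j,h}^{n+1},\hat w_{j,h}^{n+1},\hat q_{j,h}^{n+1},\hat r_{j,h}^{n+1})$, $j=1,\dots,N_{sc}$, $n=0,1,\dots,M-1$, be the solutions of the Coupled-SMHD scheme and of the SCM-SPP-SMHD scheme, respectively (both defined in the context, with the same data $\nu_j,\nu_{m,j},f_{1,j},f_{2,j}$, initial conditions, mesh, $\Delta t$ and $\mu$). Assume $\alpha_{\min}>0$, and let $C_*$ be a constant, independent of $h$, $\Delta t$ and $\gamma$, such that for all $j=1,\dots,N_{sc}$ $$\max_{1\le n\le M}\Big(\|\nabla v_{j,h}^n\|_{L^3}+\|\nabla w_{j,h}^n\|_{L^3}+\|v_{j,h}^n\|_\infty+\|w_{j,h}^n\|_\infty\Big)\le C_*,\qquad \max_{1\le n\le M}\big\{\|\hat v_{j,h}^n\|_\infty,\|\hat w_{j,h}^n\|_\infty\big\}\le C_*.$$ Then $$\Delta t\sum_{n=1}^{M}\Big(\|\nabla\langle v_h\rangle^n-\nabla\langle\hat v_h\rangle^n\|^2+\|\nabla\langle w_h\rangle^n-\nabla\langle\hat w_h\rangle^n\|^2\Big)$$ $$\le\frac{C\,C_R^2}{\gamma^2}\left(\frac{1}{\alpha_{\min}^3\Delta t}+\frac{1}{\alpha_{\min}\Delta t}+\frac{\Delta t}{\alpha_{\min}}+1\right)\exp\left(\frac{C\,C_*^2}{\alpha_{\min}}+\frac{C\,\Delta t}{h^3\alpha_{\min}}\right)\left(\Delta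 t\sum_{n=0}^{M-1}\sum_{j=1}^{N_{sc}}\Big(\|q_{j,h}^{n+1}-\hat q_{j,h}^n\|^2+\|r_{j,h}^{n+1}-\hat r_{j,h}^n\|^2\Big)\right),$$ where $C$ denotes generic positive constants independent of $h$, $\Delta t$ and $\gamma$, and $C_R$ is the constant defined in the context.
   Context: Setting. $\mathcal{D}\subset\mathbb{R}^d$, $d\in\{2,3\}$, is a convex polygonal/polyhedral domain; $(\cdot,\cdot)$ and $\|\cdot\|$ are the $L^2(\mathcal{D})$ inner product and norm, $\|\cdot\|_\infty$ the $L^\infty(\mathcal{D})$ norm. $X:=\mathbf{H}_0^1(\mathcal{D})$, $Q:=L_0^2(\mathcal{D})$ (mean-zero $L^2$ functions), $\tilde Y:=\{v\in\mathbf{H}^1(\mathcal{D}): v\cdot\hat n=0 \text{ on }\partial\mathcal{D}\}$, $\hat n$ the outward unit normal. On a regular triangulation of $\mathcal{D}$ (regular enough for the inverse inequality) with maximum element diameter $h$, $X_h\subset X$, $Q_h\subset Q$, $\tilde Y_h\subset\tilde Y$ are conforming finite element spaces with $X_h\subset\tilde Y_h$; the pair $(X_h,Q_h)$ satisfies the discrete inf-sup condition $\inf_{q_h\in Q_h}\sup_{v_h\in X_h}\frac{(q_h,\nabla\cdot v_h)}{\|q_h\|\|\nabla v_h\|}\ge\beta>0$ with $\beta$ independent of $h$, and is taken to be the Scott-Vogelius pair $((P_k)^d,P_{k-1}^{disc})$, $k\ge d$, on a barycenter-refined mesh, so that $\nabla\cdot X_h\subset Q_h$. $V_h:=\{v_h\in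 X_h:(\nabla\cdot v_h,q_h)=0\ \forall q_h\in Q_h\}$, and $R_h:=V_h^\perp\subset X_h$ is the orthogonal complement of $V_h$ in $X_h$ with respect to the $\mathbf{H}^1$ inner product. $C_R$ is a constant independent of $h$ such that $\|\nabla v_h\|\le C_R\|\nabla\cdot v_h\|$ for all $v_h\in R_h$ (such a constant exists by known results). The trilinear form is $b(u,v,w):=(u\cdot\nabla v,w)$. Data. For each realization $j=1,\dots,N_{sc}$, $\nu_j(x)$ and $\nu_{m,j}(x)$ are the (space-dependent) viscosity and magnetic diffusivity and $f_{1,j},f_{2,j}\in L^2(0,T;\mathbf{H}^{-1}(\mathcal{D}))$ (for the Coupled-SMHD scheme $L^\infty(0,T;\mathbf{H}^{-1}(\mathcal{D}))$) are the forces. For a family $(z_j)$: $\langle z\rangle:=\frac1{N_{sc}}\sum_{j=1}^{N_{sc}}z_j$ (with time superscript $n$ when the $z_j$ are at time level $n$), $z_j':=z_j-\langle z\rangle$. Also $\bar\nu:=\frac1{N_{sc}}\sum_j\nu_j$, $\bar\nu_m:=\frac1{N_{sc}}\sum_j\nu_{m,j}$, $\nu_j':=\nu_j-\bar\nu$, $\nu_{m,j}':=\nu_{m,j}-\bar\nu_m$, $\bar\nu_{\min}:=\min_{x\in\mathcal{D}}\bar\nu(x)$, $\bar\nu_{m,\min}:=\min_{x\in\mathcal{D}}\bar\nu_m(x)$, $$\alpha_j:=\bar\nu_{\min}+\bar\nu_{m,\min}-\|\nu_j-\nu_{m,j}\|_\infty-\|\nu_j'+\nu_{m,j}'\|_\infty,\qquad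 \alpha_{\min}:=\min_{1\le j\le N_{sc}}\alpha_j.$$ The eddy viscosity is $\nu_T(z',t^n):=\mu\Delta t\,(l_z^n)^2$, $(l_z^n)^2:=\sum_{j=1}^{N_{sc}}|z_j'^{\,n}|^2$, with parameter $\mu>0$ and $|\cdot|$ the Euclidean length. $T>0$, $\Delta t>0$, $M=T/\Delta t$, $t^n=n\Delta t$. Coupled-SMHD scheme. Given $v_{j,h}^0,w_{j,h}^0\in V_h$, for $n=0,1,\dots,M-1$ and all $j$ find $(v_{j,h}^{n+1},q_{j,h}^{n+1})\in X_h\times Q_h$ such that for all $(\chi_h,\zeta_h)\in X_h\times Q_h$ $$\Big(\tfrac{v_{j,h}^{n+1}-v_{j,h}^n}{\Delta t},\chi_h\Big)+b(\langle w_h\rangle^n,v_{j,h}^{n+1},\chi_h)+\Big(\tfrac{\bar\nu+\bar\nu_m}{2}\nabla v_{j,h}^{n+1},\nabla\chi_h\Big)+(2\nu_T(w_h',t^n)\nabla v_{j,h}^{n+1},\nabla\chi_h)-(q_{j,h}^{n+1},\nabla\cdot\chi_h)$$ $$=(f_{1,j}(t^{n+1}),\chi_h)-b(w_{j,h}'^{\,n},v_{j,h}^n,\chi_h)-\Big(\tfrac{\nu_j-\nu_{m,j}}{2}\nabla w_{j,h}^n,\nabla\chi_h\Big)-\Big(\tfrac{\nu_j'+\nu_{m,j}'}{2}\nabla v_{j,h}^n,\nabla\chi_h\Big),\qquad(\nabla\cdot v_{j,h}^{n+1},\zeta_h)=0,$$ and find $(w_{j,h}^{n+1},r_{j,h}^{n+1})\in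 X_h\times Q_h$ satisfying the same equations with the roles of $v$ and $w$ exchanged, $q$ replaced by $r$ and $f_{1,j}$ by $f_{2,j}$. SCM-SPP-SMHD scheme. Given a grad-div parameter $\gamma>0$ and starting values $\hat v_{j,h}^0=\tilde v_{j,h}^0=v_{j,h}^0$, $\hat w_{j,h}^0=\tilde w_{j,h}^0=w_{j,h}^0$ in $V_h$, with $\hat q_{j,h}^0=\hat r_{j,h}^0=0$, compute for $n=0,1,\dots,M-1$ and all $j$: Step 1: $\hat v_{j,h}^{n+1}\in X_h$ such that for all $\chi_h\in X_h$ $$\Big(\tfrac{\hat v_{j,h}^{n+1}-\tilde v_{j,h}^n}{\Delta t},\chi_h\Big)+b(\langle\hat w_h\rangle^n,\hat v_{j,h}^{n+1},\chi_h)+\Big(\tfrac{\bar\nu+\bar\nu_m}{2}\nabla\hat v_{j,h}^{n+1},\nabla\chi_h\Big)+\gamma(\nabla\cdot\hat v_{j,h}^{n+1},\nabla\cdot\chi_h)+(2\nu_T(\hat w_h',t^n)\nabla\hat v_{j,h}^{n+1},\nabla\chi_h)$$ $$=(f_{1,j}(t^{n+1}),\chi_h)-b(\hat w_{j,h}'^{\,n},\hat v_{j,h}^n,\chi_h)-\Big(\tfrac{\nu_j-\nu_{m,j}}{2}\nabla\hat w_{j,h}^n,\nabla\chi_h\Big)-\Big(\tfrac{\nu_j'+\nu_{m,j}'}{2}\nabla\hat v_{j,h}^n,\nabla\chi_h\Big).$$ Step 2: $(\tilde v_{j,h}^{n+1},\hat q_{j,h}^{n+1})\in\tilde Y_h\times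 Q_h$ such that for all $(\xi_h,\zeta_h)\in\tilde Y_h\times Q_h$: $\big(\tfrac{\tilde v_{j,h}^{n+1}-\hat v_{j,h}^{n+1}}{\Delta t},\xi_h\big)-(\hat q_{j,h}^{n+1},\nabla\cdot\xi_h)=0$ and $(\nabla\cdot\tilde v_{j,h}^{n+1},\zeta_h)=0$. Step 3: $\hat w_{j,h}^{n+1}\in X_h$ such that for all $l_h\in X_h$ the equation of Step 1 holds with the roles of $v$ and $w$ exchanged and $f_{1,j}$ replaced by $f_{2,j}$ (i.e. $\hat v\leftrightarrow\hat w$, $\tilde v\to\tilde w$, $\chi_h\to l_h$). Step 4: $(\tilde w_{j,h}^{n+1},\hat r_{j,h}^{n+1})\in\tilde Y_h\times Q_h$ defined from $\hat w_{j,h}^{n+1}$ exactly as $(\tilde v_{j,h}^{n+1},\hat q_{j,h}^{n+1})$ is defined from $\hat v_{j,h}^{n+1}$ in Step 2. *)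

theory Defs
  imports "HOL-Analysis.Analysis" "HOL-Probability.Essential_Supremum"
begin

section \<open>Lebesgue and Sobolev spaces on a domain\<close>

text \<open>
  Elements of function spaces over \<open>D\<close> are represented by functions on the whole of \<open>\<real>\<^sup>d\<close>, of which
  only the restriction to \<open>D\<close> (up to null sets) matters. For matrices \<open>real^'d^'d\<close> the inner product
  and the norm are those of Frobenius.
\<close>

definition L2 :: "(real^'d) set \<Rightarrow> (real^'d \<Rightarrow> 'b::euclidean_space) set" where
  "L2 D = {u. u \<in> borel_measurable (lebesgue_on D) \<and> integrable (lebesgue_on D) (\<lambda>x. (norm (u x))\<^sup>2)}"

definition L2_inner :: "(real^'d) set \<Rightarrow> (real^'d \<Rightarrow> 'b::euclidean_space) \<Rightarrow> (real^'d \<Rightarrow> 'b) \<Rightarrow> real" where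
  "L2_inner D u v = (\<integral>x. u x \<bullet> v x \<partial>lebesgue_on D)"

definition L2_norm :: "(real^'d) set \<Rightarrow> (real^'d \<Rightarrow> 'b::euclidean_space) \<Rightarrow> real" where
  "L2_norm D u = sqrt (L2_inner D u u)"

definition L3_norm :: "(real^'d) set \<Rightarrow> (real^'d \<Rightarrow> 'b::euclidean_space) \<Rightarrow> real" where
  "L3_norm D u = root 3 (\<integral>x. norm (u x) ^ 3 \<partial>lebesgue_on D)"

text \<open>Only meaningful for essentially bounded \<open>u\<close>.\<close>

definition Linf_norm :: "(real^'d) set \<Rightarrow> (real^'d \<Rightarrow> 'b::euclidean_space) \<Rightarrow> real" where
  "Linf_norm D u = real_of_ereal (esssup (lebesgue_on D) (\<lambda>x. ereal (norm (u x))))"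

definition partial :: "'d \<Rightarrow> (real^'d \<Rightarrow> real) \<Rightarrow> real^'d \<Rightarrow> real" where
  "partial i \<phi> x = frechet_derivative \<phi> (at x) (axis i 1)"

text \<open>Infinitely differentiable: all iterated partial derivatives exist and are differentiable.\<close>

coinductive smooth :: "(real^'d \<Rightarrow> real) \<Rightarrow> bool" where
  "(\<And>x. \<phi> differentiable (at x)) \<Longrightarrow> (\<And>i. smooth (partial i \<phi>)) \<Longrightarrow> smooth \<phi>"

definition test_functions :: "(real^'d) set \<Rightarrow> (real^'d \<Rightarrow> real) set" where
  "test_functions D = {\<phi>. smooth \<phi> \<and> (\<exists>K. compact K \<and> K \<subseteq> D \<and> (\<forall>x. x \<notin> K \<longrightarrow> \<phi> x = 0))}"

text \<open>Convention for gradients: \<open>G x $ i $ j\<close> is the \<open>j\<close>-th partial derivative of the component \<open>v\<^sub>i\<close>.\<close>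

definition has_weak_gradient ::
  "(real^'d) set \<Rightarrow> (real^'d \<Rightarrow> real^'d) \<Rightarrow> (real^'d \<Rightarrow> real^'d^'d) \<Rightarrow> bool" where
  "has_weak_gradient D v G \<longleftrightarrow> v \<in> L2 D \<and> G \<in> L2 D \<and>
     (\<forall>\<phi>\<in>test_functions D. \<forall>i j.
        (\<integral>x. v x $ i * partial j \<phi> x \<partial>lebesgue_on D) = - (\<integral>x. G x $ i $ j * \<phi> x \<partial>lebesgue_on D))"

definition H1 :: "(real^'d) set \<Rightarrow> (real^'d \<Rightarrow> real^'d) set" where
  "H1 D = {v. \<exists>G. has_weak_gradient D v G}"

definition grad :: "(real^'d) set \<Rightarrow> (real^'d \<Rightarrow> real^'d) \<Rightarrow> real^'d \<Rightarrow> real^'d^'d" where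
  "grad D v = (SOME G. has_weak_gradient D v G)"

definition dvg :: "(real^'d) set \<Rightarrow> (real^'d \<Rightarrow> real^'d) \<Rightarrow> real^'d \<Rightarrow> real" where
  "dvg D v x = (\<Sum>i\<in>UNIV. grad D v x $ i $ i)"

definition H1_inner :: "(real^'d) set \<Rightarrow> (real^'d \<Rightarrow> real^'d) \<Rightarrow> (real^'d \<Rightarrow> real^'d) \<Rightarrow> real" where
  "H1_inner D u v = L2_inner D u v + L2_inner D (grad D u) (grad D v)"

text \<open>The closure of the test functions in \<open>H1 D\<close>.\<close>

definition H10 :: "(real^'d) set \<Rightarrow> (real^'d \<Rightarrow> real^'d) set" where
  "H10 D = {v \<in> H1 D. \<forall>\<epsilon>>0. \<exists>\<phi>. (\<forall>i. (\<lambda>x. \<phi> x $ i) \<in> test_functions D) \<and>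
     sqrt (H1_inner D (\<lambda>x. v x - \<phi> x) (\<lambda>x. v x - \<phi> x)) < \<epsilon>}"

definition L20 :: "(real^'d) set \<Rightarrow> (real^'d \<Rightarrow> real) set" where
  "L20 D = {q \<in> L2 D. (\<integral>x. q x \<partial>lebesgue_on D) = 0}"

text \<open>
  The normal trace \<open>v \<bullet> n\<close> on the boundary is the functional given by Green's formula,
  \<open>\<langle>v \<bullet> n, \<phi>\<rangle> = (v, \<nabla>\<phi>) + (\<nabla>\<cdot>v, \<phi>)\<close>.
\<close>

definition normal_trace :: "(real^'d) set \<Rightarrow> (real^'d \<Rightarrow> real^'d) \<Rightarrow> (real^'d \<Rightarrow> real) \<Rightarrow> real" where
  "normal_trace D v \<phi> = L2_inner D v (\<lambda>x. \<chi> i. partial i \<phi> x) + L2_inner D (dvg D v) \<phi>"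

definition Ytilde :: "(real^'d) set \<Rightarrow> (real^'d \<Rightarrow> real^'d) set" where
  "Ytilde D = {v \<in> H1 D. \<forall>\<phi>. smooth \<phi> \<longrightarrow> normal_trace D v \<phi> = 0}"

text \<open>The dual of \<open>H10 D\<close>, normed by \<open>sup \<bar>F v\<bar> / \<parallel>\<nabla>v\<parallel>\<close>.\<close>

definition Hm1 :: "(real^'d) set \<Rightarrow> ((real^'d \<Rightarrow> real^'d) \<Rightarrow> real) set" where
  "Hm1 D = {F. (\<forall>u\<in>H10 D. \<forall>v\<in>H10 D. \<forall>a b. F (\<lambda>x. a *\<^sub>R u x + b *\<^sub>R v x) = a * F u + b * F v) \<and>
               (\<exists>c. \<forall>v\<in>H10 D. \<bar>F v\<bar> \<le> c * L2_norm D (grad D v))}"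

definition Hm1_norm :: "(real^'d) set \<Rightarrow> ((real^'d \<Rightarrow> real^'d) \<Rightarrow> real) \<Rightarrow> real" where
  "Hm1_norm D F = (SUP v\<in>{v \<in> H10 D. L2_norm D (grad D v) \<noteq> 0}. \<bar>F v\<bar> / L2_norm D (grad D v))"

text \<open>
  Bochner spaces over \<open>[0,T]\<close>. As \<open>Hm1 D\<close> is separable and \<open>H10 D\<close> reflexive, measurability is
  measurability of all evaluations (Pettis). The representatives are defined at every time because the
  schemes evaluate the forces pointwise.
\<close>

definition Hm1_measurable ::
  "(real^'d) set \<Rightarrow> real \<Rightarrow> (real \<Rightarrow> (real^'d \<Rightarrow> real^'d) \<Rightarrow> real) \<Rightarrow> bool" where
  "Hm1_measurable D T f \<longleftrightarrow> (\<forall>t\<in>{0..T}. f t \<in> Hm1 D) \<and>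
     (\<forall>v\<in>H10 D. (\<lambda>t. f t v) \<in> borel_measurable (lebesgue_on {0..T}))"

definition L2_Hm1 :: "(real^'d) set \<Rightarrow> real \<Rightarrow> (real \<Rightarrow> (real^'d \<Rightarrow> real^'d) \<Rightarrow> real) set" where
  "L2_Hm1 D T = {f. Hm1_measurable D T f \<and>
     integrable (lebesgue_on {0..T}) (\<lambda>t. (Hm1_norm D (f t))\<^sup>2)}"

definition Linf_Hm1 :: "(real^'d) set \<Rightarrow> real \<Rightarrow> (real \<Rightarrow> (real^'d \<Rightarrow> real^'d) \<Rightarrow> real) set" where
  "Linf_Hm1 D T = {f. Hm1_measurable D T f \<and>
     (\<exists>c. AE t in lebesgue_on {0..T}. Hm1_norm D (f t) \<le> c)}"


section \<open>Meshes and finite element spaces\<close>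

text \<open>Convex polygonal (\<open>d = 2\<close>) or polyhedral (\<open>d = 3\<close>) domain.\<close>

definition convex_polytopal_domain :: "(real^'d) set \<Rightarrow> bool" where
  "convex_polytopal_domain D \<longleftrightarrow> open D \<and> D \<noteq> {} \<and> convex D \<and> polytope (closure D)"

definition triangulation_of :: "(real^'d) set \<Rightarrow> (real^'d) set set \<Rightarrow> bool" where
  "triangulation_of D \<T> \<longleftrightarrow>
     triangulation \<T> \<and> (\<forall>K\<in>\<T>. int CARD('d) simplex K) \<and> \<Union>\<T> = closure D"

definition vertices :: "(real^'d) set \<Rightarrow> (real^'d) set" where
  "vertices K = {x. x extreme_point_of K}"

definition barycenter :: "(real^'d) set \<Rightarrow> real^'d" where
  "barycenter K = (1 / real (card (vertices K))) *\<^sub>R (\<Sum>a\<in>vertices K. a)"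

definition barycenter_refinement :: "(real^'d) set set \<Rightarrow> (real^'d) set set" where
  "barycenter_refinement \<T> =
     {convex hull (insert (barycenter K) (vertices K - {a})) | K a. K \<in> \<T> \<and> a \<in> vertices K}"

definition mesh_size :: "(real^'d) set set \<Rightarrow> real" where
  "mesh_size \<T> = Max (diameter ` \<T>)"

text \<open>
  Quasi-uniformity with constant \<open>\<sigma>\<close>, the usual regularity under which the inverse inequality holds with
  the global mesh size.
\<close>

definition quasi_uniform :: "real \<Rightarrow> (real^'d) set set \<Rightarrow> bool" where
  "quasi_uniform \<sigma> \<T> \<longleftrightarrow> (\<forall>K\<in>\<T>. \<exists>x. cball x (mesh_size \<T> / \<sigma>) \<subseteq> K)"

text \<open>Polynomials of total degree at most \<open>k\<close>; \<open>\<alpha>\<close> is a multi-index.\<close>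

definition polys :: "nat \<Rightarrow> (real^'d \<Rightarrow> real) set" where
  "polys k = {p. \<exists>c. \<forall>x. p x =
     (\<Sum>\<alpha> | (\<Sum>i\<in>UNIV. \<alpha> i) \<le> k. c \<alpha> * (\<Prod>i\<in>UNIV. (x $ i) ^ \<alpha> i))}"

definition polys_disc :: "(real^'d) set set \<Rightarrow> nat \<Rightarrow> (real^'d \<Rightarrow> real) set" where
  "polys_disc \<T> k = {q. \<forall>K\<in>\<T>. \<exists>p\<in>polys k. \<forall>x\<in>interior K. q x = p x}"

text \<open>Scott-Vogelius pair of order \<open>k\<close> on the mesh \<open>\<T>\<close>.\<close>

definition SV_velocity :: "(real^'d) set \<Rightarrow> (real^'d) set set \<Rightarrow> nat \<Rightarrow> (real^'d \<Rightarrow> real^'d) set" where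
  "SV_velocity D \<T> k =
     {v \<in> H10 D. continuous_on (closure D) v \<and> (\<forall>i. (\<lambda>x. v x $ i) \<in> polys_disc \<T> k)}"

definition SV_pressure :: "(real^'d) set \<Rightarrow> (real^'d) set set \<Rightarrow> nat \<Rightarrow> (real^'d \<Rightarrow> real) set" where
  "SV_pressure D \<T> k = L20 D \<inter> polys_disc \<T> (k - 1)"

text \<open>Conforming finite element subspaces of \<open>Ytilde D\<close>, of any fixed polynomial degree \<open>m\<close>.\<close>

definition conforming_Ytilde :: "(real^'d) set \<Rightarrow> (real^'d) set set \<Rightarrow> (real^'d \<Rightarrow> real^'d) set \<Rightarrow> bool" where
  "conforming_Ytilde D \<T> Yh \<longleftrightarrow> Yh \<subseteq> Ytilde D \<and>
     (\<forall>u\<in>Yh. \<forall>v\<in>Yh. \<forall>a b. (\<lambda>x. a *\<^sub>R u x + b *\<^sub>R v x) \<in> Yh) \<and>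
     (\<exists>m. \<forall>v\<in>Yh. \<forall>i. (\<lambda>x. v x $ i) \<in> polys_disc \<T> m)"

definition inf_sup ::
  "real \<Rightarrow> (real^'d) set \<Rightarrow> (real^'d \<Rightarrow> real^'d) set \<Rightarrow> (real^'d \<Rightarrow> real) set \<Rightarrow> bool" where
  "inf_sup \<beta> D Xh Qh \<longleftrightarrow>
     ereal \<beta> \<le> (INF q\<in>{q \<in> Qh. L2_norm D q \<noteq> 0}. SUP v\<in>{v \<in> Xh. L2_norm D (grad D v) \<noteq> 0}.
        ereal (L2_inner D q (dvg D v) / (L2_norm D q * L2_norm D (grad D v))))"

definition Vspace ::
  "(real^'d) set \<Rightarrow> (real^'d \<Rightarrow> real^'d) set \<Rightarrow> (real^'d \<Rightarrow> real) set \<Rightarrow> (real^'d \<Rightarrow> real^'d) set" where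
  "Vspace D Xh Qh = {v \<in> Xh. \<forall>q\<in>Qh. L2_inner D (dvg D v) q = 0}"

definition Rspace ::
  "(real^'d) set \<Rightarrow> (real^'d \<Rightarrow> real^'d) set \<Rightarrow> (real^'d \<Rightarrow> real) set \<Rightarrow> (real^'d \<Rightarrow> real^'d) set" where
  "Rspace D Xh Qh = {v \<in> Xh. \<forall>u\<in>Vspace D Xh Qh. H1_inner D v u = 0}"


section \<open>Ensemble data\<close>

text \<open>Realizations are numbered by \<open>j \<in> {1..N}\<close>.\<close>

definition avg :: "nat \<Rightarrow> (nat \<Rightarrow> real^'d \<Rightarrow> 'b::real_vector) \<Rightarrow> real^'d \<Rightarrow> 'b" where
  "avg N z x = (1 / real N) *\<^sub>R (\<Sum>j=1..N. z j x)"

definition fluct :: "nat \<Rightarrow> (nat \<Rightarrow> real^'d \<Rightarrow> 'b::real_vector) \<Rightarrow> nat \<Rightarrow> real^'d \<Rightarrow> 'b" where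
  "fluct N z j x = z j x - avg N z x"

text \<open>
  The minima over the open set \<open>D\<close> are infima; they are used for coefficients bounded on \<open>D\<close> only.
\<close>

definition alpha ::
  "(real^'d) set \<Rightarrow> nat \<Rightarrow> (nat \<Rightarrow> real^'d \<Rightarrow> real) \<Rightarrow> (nat \<Rightarrow> real^'d \<Rightarrow> real) \<Rightarrow> nat \<Rightarrow> real" where
  "alpha D N \<nu> \<nu>m j = (INF x\<in>D. avg N \<nu> x) + (INF x\<in>D. avg N \<nu>m x)
     - Linf_norm D (\<lambda>x. \<nu> j x - \<nu>m j x) - Linf_norm D (\<lambda>x. fluct N \<nu> j x + fluct N \<nu>m j x)"

definition alpha_min ::
  "(real^'d) set \<Rightarrow> nat \<Rightarrow> (nat \<Rightarrow> real^'d \<Rightarrow> real) \<Rightarrow> (nat \<Rightarrow> real^'d \<Rightarrow> real) \<Rightarrow> real" where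
  "alpha_min D N \<nu> \<nu>m = Min (alpha D N \<nu> \<nu>m ` {1..N})"

definition eddy_viscosity ::
  "nat \<Rightarrow> real \<Rightarrow> real \<Rightarrow> (nat \<Rightarrow> real^'d \<Rightarrow> real^'d) \<Rightarrow> real^'d \<Rightarrow> real" where
  "eddy_viscosity N \<mu> \<Delta>t z x = \<mu> * \<Delta>t * (\<Sum>j=1..N. (norm (fluct N z j x))\<^sup>2)"


section \<open>The two schemes\<close>

definition trilinear ::
  "(real^'d) set \<Rightarrow> (real^'d \<Rightarrow> real^'d) \<Rightarrow> (real^'d \<Rightarrow> real^'d) \<Rightarrow> (real^'d \<Rightarrow> real^'d) \<Rightarrow> real" where
  "trilinear D u v w = L2_inner D (\<lambda>x. grad D v x *v u x) w"

definition weighted_grad_inner ::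
  "(real^'d) set \<Rightarrow> (real^'d \<Rightarrow> real) \<Rightarrow> (real^'d \<Rightarrow> real^'d) \<Rightarrow> (real^'d \<Rightarrow> real^'d) \<Rightarrow> real" where
  "weighted_grad_inner D a u v = L2_inner D (\<lambda>x. a x *\<^sub>R grad D u x) (grad D v)"

text \<open>
  In both schemes a field \<open>u\<close> (one of \<open>v\<close>, \<open>w\<close>) is advanced using the other field \<open>z\<close> at the old time
  level. \<open>implicit_form\<close> collects the terms containing the new value \<open>u\<close> and \<open>explicit_form\<close> those in
  the old values \<open>uo = u\<^sup>n\<close> and \<open>zo = z\<^sup>n\<close>, as far as they are common to the two schemes.
\<close>

definition implicit_form ::
  "(real^'d) set \<Rightarrow> nat \<Rightarrow> (nat \<Rightarrow> real^'d \<Rightarrow> real) \<Rightarrow> (nat \<Rightarrow> real^'d \<Rightarrow> real) \<Rightarrow> real \<Rightarrow> real \<Rightarrow>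
   (nat \<Rightarrow> real^'d \<Rightarrow> real^'d) \<Rightarrow> (real^'d \<Rightarrow> real^'d) \<Rightarrow> (real^'d \<Rightarrow> real^'d) \<Rightarrow> real" where
  "implicit_form D N \<nu> \<nu>m \<mu> \<Delta>t zo u \<chi>h =
     trilinear D (avg N zo) u \<chi>h
     + weighted_grad_inner D (\<lambda>x. (avg N \<nu> x + avg N \<nu>m x) / 2) u \<chi>h
     + weighted_grad_inner D (\<lambda>x. 2 * eddy_viscosity N \<mu> \<Delta>t zo x) u \<chi>h"

definition explicit_form ::
  "(real^'d) set \<Rightarrow> nat \<Rightarrow> (nat \<Rightarrow> real^'d \<Rightarrow> real) \<Rightarrow> (nat \<Rightarrow> real^'d \<Rightarrow> real) \<Rightarrow>
   (nat \<Rightarrow> real^'d \<Rightarrow> real^'d) \<Rightarrow> (nat \<Rightarrow> real^'d \<Rightarrow> real^'d) \<Rightarrow> nat \<Rightarrow> (real^'d \<Rightarrow> real^'d) \<Rightarrow> real" where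
  "explicit_form D N \<nu> \<nu>m zo uo j \<chi>h =
     trilinear D (fluct N zo j) (uo j) \<chi>h
     + weighted_grad_inner D (\<lambda>x. (\<nu> j x - \<nu>m j x) / 2) (zo j) \<chi>h
     + weighted_grad_inner D (\<lambda>x. (fluct N \<nu> j x + fluct N \<nu>m j x) / 2) (uo j) \<chi>h"

text \<open>
  Discrete functions are indexed by the time level first and the realization second: \<open>u n j\<close> is \<open>u\<^sub>j\<^sup>n\<close>.
\<close>

definition coupled_half ::
  "(real^'d) set \<Rightarrow> (real^'d \<Rightarrow> real^'d) set \<Rightarrow> (real^'d \<Rightarrow> real) set \<Rightarrow> nat \<Rightarrow>
   (nat \<Rightarrow> real^'d \<Rightarrow> real) \<Rightarrow> (nat \<Rightarrow> real^'d \<Rightarrow> real) \<Rightarrow> real \<Rightarrow> real \<Rightarrow> nat \<Rightarrow>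
   (nat \<Rightarrow> real \<Rightarrow> (real^'d \<Rightarrow> real^'d) \<Rightarrow> real) \<Rightarrow>
   (nat \<Rightarrow> nat \<Rightarrow> real^'d \<Rightarrow> real^'d) \<Rightarrow> (nat \<Rightarrow> nat \<Rightarrow> real^'d \<Rightarrow> real^'d) \<Rightarrow>
   (nat \<Rightarrow> nat \<Rightarrow> real^'d \<Rightarrow> real) \<Rightarrow> bool" where
  "coupled_half D Xh Qh N \<nu> \<nu>m \<mu> \<Delta>t M f u z p \<longleftrightarrow>
     (\<forall>j\<in>{1..N}. u 0 j \<in> Vspace D Xh Qh) \<and>
     (\<forall>n<M. \<forall>j\<in>{1..N}. u (Suc n) j \<in> Xh \<and> p (Suc n) j \<in> Qh \<and>
        (\<forall>\<chi>h\<in>Xh.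
           L2_inner D (\<lambda>x. (1 / \<Delta>t) *\<^sub>R (u (Suc n) j x - u n j x)) \<chi>h
           + implicit_form D N \<nu> \<nu>m \<mu> \<Delta>t (z n) (u (Suc n) j) \<chi>h
           - L2_inner D (p (Suc n) j) (dvg D \<chi>h)
           = f j (real (Suc n) * \<Delta>t) \<chi>h - explicit_form D N \<nu> \<nu>m (z n) (u n) j \<chi>h) \<and>
        (\<forall>\<zeta>h\<in>Qh. L2_inner D (dvg D (u (Suc n) j)) \<zeta>h = 0))"

definition coupled_SMHD ::
  "(real^'d) set \<Rightarrow> (real^'d \<Rightarrow> real^'d) set \<Rightarrow> (real^'d \<Rightarrow> real) set \<Rightarrow> nat \<Rightarrow>
   (nat \<Rightarrow> real^'d \<Rightarrow> real) \<Rightarrow> (nat \<Rightarrow> real^'d \<Rightarrow> real) \<Rightarrow> real \<Rightarrow> real \<Rightarrow> nat \<Rightarrow>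
   (nat \<Rightarrow> real \<Rightarrow> (real^'d \<Rightarrow> real^'d) \<Rightarrow> real) \<Rightarrow> (nat \<Rightarrow> real \<Rightarrow> (real^'d \<Rightarrow> real^'d) \<Rightarrow> real) \<Rightarrow>
   (nat \<Rightarrow> nat \<Rightarrow> real^'d \<Rightarrow> real^'d) \<Rightarrow> (nat \<Rightarrow> nat \<Rightarrow> real^'d \<Rightarrow> real^'d) \<Rightarrow>
   (nat \<Rightarrow> nat \<Rightarrow> real^'d \<Rightarrow> real) \<Rightarrow> (nat \<Rightarrow> nat \<Rightarrow> real^'d \<Rightarrow> real) \<Rightarrow> bool" where
  "coupled_SMHD D Xh Qh N \<nu> \<nu>m \<mu> \<Delta>t M f1 f2 v w q r \<longleftrightarrow>
     coupled_half D Xh Qh N \<nu> \<nu>m \<mu> \<Delta>t M f1 v w q \<and>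
     coupled_half D Xh Qh N \<nu> \<nu>m \<mu> \<Delta>t M f2 w v r"

text \<open>
  Penalty-projection: \<open>uh\<close>, \<open>zh\<close>, \<open>ph\<close> are the hatted quantities and \<open>ut\<close> is the projected field.
\<close>

definition SPP_half ::
  "(real^'d) set \<Rightarrow> (real^'d \<Rightarrow> real^'d) set \<Rightarrow> (real^'d \<Rightarrow> real^'d) set \<Rightarrow> (real^'d \<Rightarrow> real) set \<Rightarrow> nat \<Rightarrow>
   (nat \<Rightarrow> real^'d \<Rightarrow> real) \<Rightarrow> (nat \<Rightarrow> real^'d \<Rightarrow> real) \<Rightarrow> real \<Rightarrow> real \<Rightarrow> real \<Rightarrow> nat \<Rightarrow>
   (nat \<Rightarrow> real \<Rightarrow> (real^'d \<Rightarrow> real^'d) \<Rightarrow> real) \<Rightarrow> (nat \<Rightarrow> real^'d \<Rightarrow> real^'d) \<Rightarrow>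
   (nat \<Rightarrow> nat \<Rightarrow> real^'d \<Rightarrow> real^'d) \<Rightarrow> (nat \<Rightarrow> nat \<Rightarrow> real^'d \<Rightarrow> real^'d) \<Rightarrow>
   (nat \<Rightarrow> nat \<Rightarrow> real^'d \<Rightarrow> real^'d) \<Rightarrow> (nat \<Rightarrow> nat \<Rightarrow> real^'d \<Rightarrow> real) \<Rightarrow> bool" where
  "SPP_half D Xh Yh Qh N \<nu> \<nu>m \<mu> \<gamma> \<Delta>t M f u0 uh ut zh ph \<longleftrightarrow>
     (\<forall>j\<in>{1..N}. u0 j \<in> Vspace D Xh Qh \<and> uh 0 j = u0 j \<and> ut 0 j = u0 j \<and> ph 0 j = (\<lambda>x. 0)) \<and>
     (\<forall>n<M. \<forall>j\<in>{1..N}. uh (Suc n) j \<in> Xh \<and> ut (Suc n) j \<in> Yh \<and> ph (Suc n) j \<in> Qh \<and>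
        (\<forall>\<chi>h\<in>Xh.
           L2_inner D (\<lambda>x. (1 / \<Delta>t) *\<^sub>R (uh (Suc n) j x - ut n j x)) \<chi>h
           + implicit_form D N \<nu> \<nu>m \<mu> \<Delta>t (zh n) (uh (Suc n) j) \<chi>h
           + \<gamma> * L2_inner D (dvg D (uh (Suc n) j)) (dvg D \<chi>h)
           = f j (real (Suc n) * \<Delta>t) \<chi>h - explicit_form D N \<nu> \<nu>m (zh n) (uh n) j \<chi>h) \<and>
        (\<forall>\<xi>h\<in>Yh.
           L2_inner D (\<lambda>x. (1 / \<Delta>t) *\<^sub>R (ut (Suc n) j x - uh (Suc n) j x)) \<xi>h
           - L2_inner D (ph (Suc n) j) (dvg D \<xi>h) = 0) \<and>
        (\<forall>\<zeta>h\<in>Qh. L2_inner D (dvg D (ut (Suc n) j)) \<zeta>h = 0))"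

definition SCM_SPP_SMHD ::
  "(real^'d) set \<Rightarrow> (real^'d \<Rightarrow> real^'d) set \<Rightarrow> (real^'d \<Rightarrow> real^'d) set \<Rightarrow> (real^'d \<Rightarrow> real) set \<Rightarrow> nat \<Rightarrow>
   (nat \<Rightarrow> real^'d \<Rightarrow> real) \<Rightarrow> (nat \<Rightarrow> real^'d \<Rightarrow> real) \<Rightarrow> real \<Rightarrow> real \<Rightarrow> real \<Rightarrow> nat \<Rightarrow>
   (nat \<Rightarrow> real \<Rightarrow> (real^'d \<Rightarrow> real^'d) \<Rightarrow> real) \<Rightarrow> (nat \<Rightarrow> real \<Rightarrow> (real^'d \<Rightarrow> real^'d) \<Rightarrow> real) \<Rightarrow>
   (nat \<Rightarrow> real^'d \<Rightarrow> real^'d) \<Rightarrow> (nat \<Rightarrow> real^'d \<Rightarrow> real^'d) \<Rightarrow>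
   (nat \<Rightarrow> nat \<Rightarrow> real^'d \<Rightarrow> real^'d) \<Rightarrow> (nat \<Rightarrow> nat \<Rightarrow> real^'d \<Rightarrow> real^'d) \<Rightarrow>
   (nat \<Rightarrow> nat \<Rightarrow> real^'d \<Rightarrow> real^'d) \<Rightarrow> (nat \<Rightarrow> nat \<Rightarrow> real^'d \<Rightarrow> real^'d) \<Rightarrow>
   (nat \<Rightarrow> nat \<Rightarrow> real^'d \<Rightarrow> real) \<Rightarrow> (nat \<Rightarrow> nat \<Rightarrow> real^'d \<Rightarrow> real) \<Rightarrow> bool" where
  "SCM_SPP_SMHD D Xh Yh Qh N \<nu> \<nu>m \<mu> \<gamma> \<Delta>t M f1 f2 v0 w0 vh wh vt wt qh rh \<longleftrightarrow>
     SPP_half D Xh Yh Qh N \<nu> \<nu>m \<mu> \<gamma> \<Delta>t M f1 v0 vh vt wh qh \<and>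
     SPP_half D Xh Yh Qh N \<nu> \<nu>m \<mu> \<gamma> \<Delta>t M f2 w0 wh wt vh rh"

end

theory Submission
  imports Defs
begin

text \<open>
  Let \<open>e\<close> be the difference of the two solutions. On \<open>X\<^sub>h\<close>, which is contained in the space of the
  projected fields, the projection step only adds the old pressure to the first step of the
  penalty-projection scheme, so \<open>e\<close> solves a linearized coupled scheme with the grad-div term and the
  pressure differences \<open>q\<^sup>n\<^sup>+\<^sup>1 - q\<^sub>h\<^sup>n\<close> as data, both acting on divergences only. Testing with \<open>e\<close> and a
  discrete Gronwall argument give \<open>\<Delta>t \<Sum> \<parallel>div e\<parallel>\<^sup>2 = O(\<gamma>\<^sup>-\<^sup>2)\<close>. Next, decompose \<open>e = e\<^sub>V + e\<^sub>R\<close> along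
  \<open>V\<^sub>h\<close> and \<open>R\<^sub>h\<close>. Since \<open>div X\<^sub>h\<close> is contained in \<open>Q\<^sub>h\<close>, the part \<open>e\<^sub>V\<close> is pointwise divergence free, so testing with
  it removes the pressures and the penalty, and \<open>\<parallel>\<nabla>e\<^sub>R\<parallel> \<le> C\<^sub>R \<parallel>div e\<parallel>\<close> controls what is lost; a second
  Gronwall argument bounds \<open>\<nabla>e\<close>. The explicit viscous terms are absorbed because \<open>\<alpha>\<close> is positive, and
  inverse inequalities trade gradients of \<open>e\<close> for factors \<open>h\<^sup>-\<^sup>3\<^sup>/\<^sup>2\<close>, which enter only as
  \<open>\<Delta>t / h\<^sup>3\<close>.
\<close>


section \<open>Test functions\<close>

text \<open>Testing with \<open>e\<^sub>V\<close> leaves the product of \<open>e\<^sub>R\<close>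
  with the increment of \<open>e\<close>, divided by \<Delta>t. The numerical dissipation, the
  squared increment over 2 \<Delta>t, absorbs the increment and leaves the squared gradient norm of
  \<open>e\<^sub>R\<close> over \<Delta>t: the origin of the factor 1 / \<Delta>t in the bound. The
  advecting field of the penalty scheme is not divergence free, so its trilinear form does not
  vanish on the diagonal; but its divergence is minus that of the error of the other field, which
  makes the defect a product of errors. At time level 0 only L2 bounds are available; there the
  errors vanish, and where the size of the initial field counts, an inverse inequality replaces the
  sup bound. All mesh-independent quantities are collected in one number \<open>L\<close>, fixed
  before the mesh, which then enters through \<open>H\<close> alone. As only values on
  \<open>D\<close> matter, X_h is not finite-dimensional as a set of functions on the whole space,
  and its H1 form is only semidefinite; the projection onto V_h exists because the sizes of
  orthonormal families are bounded.\<close>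

lemma has_real_derivative_zero_if_small:
  fixes f :: "real \<Rightarrow> real"
  assumes "((\<lambda>t. f t / t) \<longlongrightarrow> 0) (at 0)" "f 0 = 0"
  shows "(f has_real_derivative 0) (at 0)"
  using assms by (simp add: has_field_derivative_iff)

section \<open>Smooth functions built from exp(-1/t)\<close>

text \<open>The classical function exp(-1/t), continued by 0, with a polynomial factor in 1/t. The
  factor makes the family closed under differentiation, so that one derivative formula yields all
  orders.\<close>

definition flat :: "real poly \<Rightarrow> real \<Rightarrow> real" where
  "flat P t = (if 0 < t then poly P (1 / t) * exp (- (1 / t)) else 0)"

lemma tendsto_poly_div_exp_0: "((\<lambda>s. poly P s / exp s) \<longlongrightarrow> (0::real)) at_top"
proof -
  have "((\<lambda>s. \<Sum>i\<le>degree P. coeff P i * (s ^ i / exp s)) \<longlongrightarrow> (\<Sum>i\<le>degree P. coeff P i * 0)) at_top"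
    by (intro tendsto_intros tendsto_power_div_exp_0)
  then show ?thesis
    by (simp add: poly_altdef sum_divide_distrib)
qed

text \<open>With s = 1/t, the derivative of P(s) exp(-s) with respect to t is s^2 (P(s) - P'(s))
  exp(-s), and \<open>[:0, 0, 1:]\<close> is the polynomial s^2. At 0 the exponential beats every
  polynomial.\<close>

lemma flat_deriv:
  "(flat P has_real_derivative flat ([:0, 0, 1:] * (P - pderiv P)) t) (at t)"
proof -
  consider "t < 0" | "t = 0" | "0 < t" by linarith
  then show ?thesis
  proof cases
    case 1
    have "((\<lambda>_. 0) has_real_derivative 0) (at t)" by simp
    then have "(flat P has_real_derivative 0) (at t)"
      by (rule has_field_derivative_transform_within_open[where S="{..<0}"])
         (use 1 in \<open>auto simp: flat_def\<close>)
    then show ?thesis using 1 by (simp add: flat_def)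
  next
    case 2
    have "((\<lambda>t. flat P t / t) \<longlongrightarrow> 0) (at_right 0)"
    proof -
      \<comment> \<open>Dividing by t multiplies the polynomial in 1/t by its variable, hence
        \<open>pCons 0 P\<close>.\<close>
      have "((\<lambda>t. poly (pCons 0 P) (inverse t) / exp (inverse t)) \<longlongrightarrow> 0) (at_right 0)"
        by (rule filterlim_compose[OF tendsto_poly_div_exp_0 filterlim_inverse_at_top_right])
      then show ?thesis
        by (rule Lim_transform_eventually)
           (auto simp: eventually_at_filter flat_def exp_minus field_simps)
    qed
    moreover have "((\<lambda>t. flat P t / t) \<longlongrightarrow> 0) (at_left 0)"
      by (rule Lim_transform_eventually[where f="\<lambda>_. 0"]) (auto simp: eventually_at_filter flat_def)
    ultimately have "((\<lambda>t. flat P t / t) \<longlongrightarrow> 0) (at 0)"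
      by (simp add: filterlim_split_at)
    then have "(flat P has_real_derivative 0) (at 0)"
      by (rule has_real_derivative_zero_if_small) (simp add: flat_def)
    then show ?thesis using 2 by (simp add: flat_def)
  next
    case 3
    have "((\<lambda>t. poly P (1 / t) * exp (- (1 / t))) has_real_derivative
            poly ([:0, 0, 1:] * (P - pderiv P)) (1 / t) * exp (- (1 / t))) (at t)"
      using 3 by (auto intro!: derivative_eq_intros simp: field_simps power2_eq_square)
    then have "(flat P has_real_derivative
            poly ([:0, 0, 1:] * (P - pderiv P)) (1 / t) * exp (- (1 / t))) (at t)"
      by (rule has_field_derivative_transform_within_open[where S="{0<..}"])
         (use 3 in \<open>auto simp: flat_def\<close>)
    then show ?thesis using 3 by (simp add: flat_def)
  qed
qed

lemma partial_eqI:
  assumes "(\<phi> has_derivative \<phi>') (at x)"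
  shows "partial i \<phi> x = \<phi>' (axis i 1)"
  using frechet_derivative_at[OF assms] by (simp add: partial_def)

lemma smooth_differentiable: "smooth \<phi> \<Longrightarrow> \<phi> differentiable (at x)"
  by (auto elim: smooth.cases)

lemma smooth_partial: "smooth \<phi> \<Longrightarrow> smooth (partial i \<phi>)"
  by (auto elim: smooth.cases)

text \<open>Invariant for coinduction. The derivative of a product is a sum of products, so closure
  of \<open>smooth\<close> under products cannot be proved without closure under sums; the hull
  contains both, and the clause \<open>base\<close> lets smooth functions enter as building
  blocks.\<close>

inductive smooth_hull :: "(real^'d \<Rightarrow> real) \<Rightarrow> bool" where
  flat: "smooth_hull (\<lambda>x. flat P (a + s * x $ i))"
| base: "smooth \<phi> \<Longrightarrow> smooth_hull \<phi>"
| const: "smooth_hull (\<lambda>x. c)"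
| add: "smooth_hull f \<Longrightarrow> smooth_hull g \<Longrightarrow> smooth_hull (\<lambda>x. f x + g x)"
| mult: "smooth_hull f \<Longrightarrow> smooth_hull g \<Longrightarrow> smooth_hull (\<lambda>x. f x * g x)"

lemma smooth_hull_step:
  fixes f :: "real^'d \<Rightarrow> real"
  shows "smooth_hull f \<Longrightarrow> (\<forall>x. f differentiable (at x)) \<and> (\<forall>i. smooth_hull (partial i f))"
proof (induction rule: smooth_hull.induct)
  case (flat P a s i)
  have d: "((\<lambda>x. flat P (a + s * x $ i)) has_derivative
      (\<lambda>h. flat ([:0, 0, 1:] * (P - pderiv P)) (a + s * x $ i) * (s * h $ i))) (at x)" for x :: "real^'d"
    by (rule has_derivative_compose[of "\<lambda>x. a + s * x $ i", OF _ flat_deriv[unfolded has_field_derivative_def]])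
       (auto intro!: derivative_eq_intros bounded_linear_imp_has_derivative[OF bounded_linear_vec_nth])
  have "partial j (\<lambda>x. flat P (a + s * x $ i)) =
      (\<lambda>x. flat ([:0, 0, 1:] * (P - pderiv P)) (a + s * x $ i) * (s * axis j 1 $ i))" for j
    by (rule ext, rule partial_eqI[OF d])
  then show ?case using d
    by (auto simp: differentiable_def intro!: smooth_hull.mult smooth_hull.flat smooth_hull.const)
next
  case (base \<phi>)
  then show ?case by (auto intro: smooth_hull.base smooth_differentiable smooth_partial)
next
  case (const c)
  have "partial i (\<lambda>x::real^'d. c) = (\<lambda>x. 0)" for i
    by (rule ext, rule partial_eqI[of _ "\<lambda>_. 0", simplified]) simp
  then show ?case by (auto intro: smooth_hull.const)
next
  case (add f g)
  have d: "((\<lambda>x. f x + g x) has_derivative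
     (\<lambda>h. frechet_derivative f (at x) h + frechet_derivative g (at x) h)) (at x)" for x
    using add.IH by (auto intro!: has_derivative_add simp: frechet_derivative_works[symmetric])
  have "partial i (\<lambda>x. f x + g x) = (\<lambda>x. partial i f x + partial i g x)" for i
    by (rule ext, subst partial_eqI[OF d]) (simp add: partial_def)
  then show ?case using add.IH d
    by (auto simp: differentiable_def intro!: smooth_hull.add)
next
  case (mult f g)
  have d: "((\<lambda>x. f x * g x) has_derivative
     (\<lambda>h. f x * frechet_derivative g (at x) h + frechet_derivative f (at x) h * g x)) (at x)" for x
    using mult.IH by (auto intro!: has_derivative_mult simp: frechet_derivative_works[symmetric])
  have "partial i (\<lambda>x. f x * g x) = (\<lambda>x. f x * partial i g x + partial i f x * g x)" for i
    by (rule ext, subst partial_eqI[OF d]) (simp add: partial_def)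
  then show ?case using mult d
    by (auto simp: differentiable_def intro!: smooth_hull.add smooth_hull.mult)
qed

lemma smooth_hull_smooth:
  assumes "smooth_hull f"
  shows "smooth f"
  using assms
proof (coinduction arbitrary: f rule: smooth.coinduct)
  case smooth
  then show ?case using smooth_hull_step[of f] by auto
qed

lemma smooth_add: "smooth f \<Longrightarrow> smooth g \<Longrightarrow> smooth (\<lambda>x. f x + g x)"
  and smooth_mult: "smooth f \<Longrightarrow> smooth g \<Longrightarrow> smooth (\<lambda>x. f x * g x)"
  and smooth_const: "smooth (\<lambda>x. c)"
  and smooth_flat: "smooth (\<lambda>x. flat P (a + s * x $ i))"
  by (rule smooth_hull_smooth; auto intro: smooth_hull.intros)+

lemma smooth_prod:
  assumes "finite I" "\<And>i. i \<in> I \<Longrightarrow> smooth (f i)"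
  shows "smooth (\<lambda>x. \<Prod>i\<in>I. f i x)"
  using assms by (induction rule: finite_induct) (auto intro: smooth_const smooth_mult)

lemma test_functions_lincomb:
  assumes "\<phi> \<in> test_functions D" "\<psi> \<in> test_functions D"
  shows "(\<lambda>x. a * \<phi> x + b * \<psi> x) \<in> test_functions D"
proof -
  obtain K L where "compact K" "K \<subseteq> D" "\<And>x. x \<notin> K \<Longrightarrow> \<phi> x = 0"
     "compact L" "L \<subseteq> D" "\<And>x. x \<notin> L \<Longrightarrow> \<psi> x = 0"
    using assms by (auto simp: test_functions_def)
  then have "\<exists>K. compact K \<and> K \<subseteq> D \<and> (\<forall>x. x \<notin> K \<longrightarrow> a * \<phi> x + b * \<psi> x = 0)"
    by (intro exI[of _ "K \<union> L"]) auto
  then show ?thesis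
    using assms by (auto simp: test_functions_def intro!: smooth_add smooth_mult smooth_const)
qed

text \<open>Approximates the indicator of the open box from below: exp(-1/(m t)) tends to 1 for t >
  0, and every factor is 0 on the wrong side of its face.\<close>

definition box_bump :: "nat \<Rightarrow> real^'d \<Rightarrow> real^'d \<Rightarrow> real^'d \<Rightarrow> real" where
  "box_bump m a b x = (\<Prod>i\<in>UNIV. flat 1 (- (real m * a $ i) + real m * x $ i) * flat 1 (real m * b $ i + (- real m) * x $ i))"

lemma flat_1_bounds: "0 \<le> flat 1 t" "flat 1 t \<le> 1"
  by (auto simp: flat_def)

lemma flat_1_LIMSEQ: "(\<lambda>m. flat 1 (real m * t)) \<longlonglongrightarrow> (if 0 < t then 1 else 0)"
proof (cases "0 < t")
  case True
  have "(\<lambda>m. exp (- ((1/t) * (1 / real m)))) \<longlonglongrightarrow> exp (- ((1/t) * 0))"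
    by (intro tendsto_intros lim_1_over_n)
  then have "(\<lambda>m. exp (- ((1/t) * (1 / real m)))) \<longlonglongrightarrow> 1" by simp
  moreover have "\<forall>\<^sub>F m in sequentially. exp (- ((1/t) * (1 / real m))) = flat 1 (real m * t)"
    using eventually_gt_at_top[of "0::nat"] by eventually_elim (use True in \<open>simp add: flat_def field_simps\<close>)
  ultimately have "(\<lambda>m. flat 1 (real m * t)) \<longlonglongrightarrow> 1" by (rule Lim_transform_eventually)
  then show ?thesis using True by simp
next
  case False
  then have "flat 1 (real m * t) = 0" for m
    by (simp add: flat_def not_less mult_nonneg_nonpos)
  then show ?thesis using False by simp
qed

lemma box_bump_bounds: "0 \<le> box_bump m a b x" "box_bump m a b x \<le> 1"
  unfolding box_bump_def
  by (auto intro!: prod_nonneg prod_le_1 mult_nonneg_nonneg mult_le_one flat_1_bounds)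

lemma box_bump_LIMSEQ: "(\<lambda>m. box_bump m a b x) \<longlonglongrightarrow> indicator (box a b) x"
proof -
  have "(\<lambda>m. flat 1 (real m * (x $ i - a $ i)) * flat 1 (real m * (b $ i - x $ i)))
    \<longlonglongrightarrow> (if 0 < x $ i - a $ i then 1 else 0) * (if 0 < b $ i - x $ i then 1 else 0)" for i
    by (intro tendsto_mult flat_1_LIMSEQ)
  then have "(\<lambda>m. box_bump m a b x) \<longlonglongrightarrow>
     (\<Prod>i\<in>UNIV. (if 0 < x $ i - a $ i then 1 else 0) * (if 0 < b $ i - x $ i then 1 else 0))"
    unfolding box_bump_def by (intro tendsto_prod) (simp add: algebra_simps)
  also have "(\<Prod>i\<in>UNIV. (if 0 < x $ i - a $ i then 1 else 0) * (if 0 < b $ i - x $ i then 1 else 0::real)) = indicator (box a b) x"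
  proof (cases "x \<in> box a b")
    case True then show ?thesis by (simp add: mem_box_cart)
  next
    case False
    then obtain i where "\<not> (0 < x $ i - a $ i \<and> 0 < b $ i - x $ i)" by (auto simp: mem_box_cart)
    then show ?thesis using False by (auto simp: indicator_def prod_zero_iff)
  qed
  finally show ?thesis .
qed

lemma box_bump_test_function:
  assumes "cbox a b \<subseteq> D"
  shows "box_bump m a b \<in> test_functions D"
proof -
  have "smooth (box_bump m a b)"
    unfolding box_bump_def by (intro smooth_prod smooth_mult smooth_flat) auto
  moreover have "box_bump m a b x = 0" if out: "x \<notin> cbox a b" for x
  proof -
    have "\<not> (\<forall>i. a $ i \<le> x $ i \<and> x $ i \<le> b $ i)" using out by (simp add: mem_box_cart)
    then obtain i where "\<not> (a $ i \<le> x $ i \<and> x $ i \<le> b $ i)" by blast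
    then have "x $ i < a $ i \<or> b $ i < x $ i" by linarith
    then have "real m * (x $ i - a $ i) \<le> 0 \<or> real m * (b $ i - x $ i) \<le> 0"
      by (auto intro: mult_nonneg_nonpos)
    moreover have "- (real m * a $ i) + real m * x $ i = real m * (x $ i - a $ i)"
      "real m * b $ i + (- real m) * x $ i = real m * (b $ i - x $ i)"
      by (simp_all add: right_diff_distrib)
    ultimately have f0: "flat 1 (- (real m * a $ i) + real m * x $ i) * flat 1 (real m * b $ i + (- real m) * x $ i) = 0"
      by (elim disjE) (simp_all add: flat_def not_less[symmetric] del: not_less)
    show ?thesis unfolding box_bump_def
      by (rule prod_zero[OF finite], rule bexI[where x=i], rule f0, rule UNIV_I)
  qed
  ultimately show ?thesis using assms by (auto simp: test_functions_def intro!: exI[of _ "cbox a b"])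
qed

lemma AE_lebesgue_on_iff:
  "D \<in> sets lebesgue \<Longrightarrow> (AE x in lebesgue_on D. P x) \<longleftrightarrow> (AE x in lebesgue. x \<in> D \<longrightarrow> P x)"
  by (simp add: AE_restrict_space_iff)

section \<open>The fundamental lemma of the calculus of variations\<close>

text \<open>Boxes are an intersection-stable generator of the Borel sets, and the sets over which
  \<open>g\<close> integrates to 0 form a Dynkin system; the vanishing total integral supplies the
  complements.\<close>

lemma AE_zero_if_box_integrals_zero:
  fixes g :: "'a::euclidean_space \<Rightarrow> real"
  assumes g: "integrable lebesgue g"
    and zero: "\<And>a b. (\<integral>x. indicator (box a b) x * g x \<partial>lebesgue) = 0"
    and total: "(\<integral>x. g x \<partial>lebesgue) = 0"
  shows "AE x in lebesgue. g x = 0"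
proof (rule density_unique_real[OF g integrable_zero])
  have int: "integrable lebesgue (\<lambda>x. indicator A x * g x)" if "A \<in> sets lebesgue" for A
    using integrable_mult_indicator[OF that g] by simp
  have borel: "(\<integral>x. indicator A x * g x \<partial>lebesgue) = 0" if "A \<in> sets borel" for A
  proof -
    have sb: "sets borel = sigma_sets UNIV (range (\<lambda>(a, b). box a b :: 'a set))"
      by (subst borel_eq_box) simp
    then have A: "A \<in> sigma_sets UNIV (range (\<lambda>(a, b). box a b))"
      using that by simp
    have st: "Int_stable (range (\<lambda>(a, b). box a b :: 'a set))"
      by (auto simp: Int_stable_def box_Int_box image_iff)
    have "range (\<lambda>(a, b). box a b :: 'a set) \<subseteq> Pow UNIV" by simp
    from st this A show ?thesis
    proof (induction rule: sigma_sets_induct_disjoint)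
      case (basic A)
      then show ?case using zero by auto
    next
      case empty
      then show ?case by simp
    next
      case (compl A)
      then have A: "A \<in> sets lebesgue"
        using sb by (simp add: sets_completionI_sets)
      have "(\<integral>x. indicator (UNIV - A) x * g x \<partial>lebesgue) = (\<integral>x. g x - indicator A x * g x \<partial>lebesgue)"
        by (intro Bochner_Integration.integral_cong) (auto simp: indicator_def)
      also have "\<dots> = 0"
        using compl total g int[OF A] by simp
      finally show ?case .
    next
      case (union A)
      have A: "A i \<in> sets lebesgue" for i
      proof -
        have "A i \<in> sets borel" using union(2) sb by blast
        then show ?thesis by (simp add: sets_completionI_sets)
      qed
      have "set_integrable lebesgue (\<Union>i. A i) g"
        unfolding set_integrable_def using int[of "\<Union>i. A i"] A by auto
      with union A have "(LINT x:(\<Union>i. A i)|lebesgue. g x) = (\<Sum>i. (LINT x:(A i)|lebesgue. g x))"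
        by (intro lebesgue_integral_countable_add) (auto simp: disjoint_family_on_def)
      then show ?case using union by (simp add: set_lebesgue_integral_def)
    qed
  qed
  fix A :: "'a set" assume "A \<in> sets lebesgue"
  \<comment> \<open>A Lebesgue set is a Borel set up to a null set, which does not affect the
    integral.\<close>
  then obtain B N where AB: "B \<in> sets borel" "N \<in> null_sets lebesgue" "A = B \<union> N"
    by (metis sets_completionE null_sets_completionI null_sets_completion_subset sets_lborel)
  have "AE x in lebesgue. indicator A x * g x = indicator B x * g x"
    using AE_not_in[OF AB(2)] by eventually_elim (auto simp: AB(3) indicator_def)
  then have "(\<integral>x. indicator A x * g x \<partial>lebesgue) = (\<integral>x. indicator B x * g x \<partial>lebesgue)"
    using int \<open>A \<in> _\<close> AB(1) g by (intro integral_cong_AE) (auto intro: borel_measurable_integrable)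
  then show "set_lebesgue_integral lebesgue A g = (LINT x:A|lebesgue. 0)"
    using borel[OF AB(1)] by (simp add: set_lebesgue_integral_def)
qed

text \<open>Dominated convergence along the bumps gives vanishing integrals over all boxes with
  closure in \<open>D\<close>; countably many closed boxes exhaust \<open>D\<close>.\<close>

lemma AE_zero_if_test_integrals_zero:
  fixes g :: "real^'d \<Rightarrow> real"
  assumes D: "open D" and g: "integrable (lebesgue_on D) g"
    and zero: "\<And>\<phi>. \<phi> \<in> test_functions D \<Longrightarrow> (\<integral>x. g x * \<phi> x \<partial>lebesgue_on D) = 0"
  shows "AE x in lebesgue_on D. g x = 0"
proof -
  have DL: "D \<in> sets lebesgue" using D by auto
  have [measurable]: "g \<in> borel_measurable (lebesgue_on D)" using g by auto
  have box0: "(\<integral>x. indicator (box a b) x * g x \<partial>lebesgue_on D) = 0" if "cbox a b \<subseteq> D" for a b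
  proof -
    have mb: "box_bump m a b \<in> borel_measurable (lebesgue_on D)" for m
    proof -
      have "box_bump m a b \<in> test_functions D" using that by (rule box_bump_test_function)
      then have "continuous_on UNIV (box_bump m a b)"
        by (auto simp: test_functions_def continuous_on_eq_continuous_at
            intro!: differentiable_imp_continuous_within smooth_differentiable)
      then show ?thesis
        by (intro measurable_restrict_space1 measurable_completion) (simp add: borel_measurable_continuous_onI)
    qed
    have "(\<lambda>m. \<integral>x. g x * box_bump m a b x \<partial>lebesgue_on D) \<longlonglongrightarrow> (\<integral>x. g x * indicator (box a b) x \<partial>lebesgue_on D)"
    proof (rule integral_dominated_convergence[where w="\<lambda>x. norm (g x)"])
      show "(\<lambda>x. g x * indicator (box a b) x) \<in> borel_measurable (lebesgue_on D)"
        using order_trans[OF box_subset_cbox that]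
        by (intro borel_measurable_times borel_measurable_indicator) (auto simp: sets_restrict_space_iff DL)
      show "(\<lambda>x. g x * box_bump m a b x) \<in> borel_measurable (lebesgue_on D)" for m
        using mb by auto
      show "integrable (lebesgue_on D) (\<lambda>x. norm (g x))" using g by auto
      show "AE x in lebesgue_on D. (\<lambda>m. g x * box_bump m a b x) \<longlonglongrightarrow> g x * indicator (box a b) x"
        by (intro always_eventually allI tendsto_intros box_bump_LIMSEQ)
      show "AE x in lebesgue_on D. norm (g x * box_bump m a b x) \<le> norm (g x)" for m
        by (intro always_eventually allI) (simp add: abs_mult mult_left_le box_bump_bounds)
    qed
    then have "(\<integral>x. g x * indicator (box a b) x \<partial>lebesgue_on D) = 0"
      using zero[OF box_bump_test_function[OF that]] by (simp add: LIMSEQ_const_iff)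
    then show ?thesis by (simp add: mult.commute)
  qed
  have onbox: "AE x in lebesgue. x \<in> cbox a b \<longrightarrow> g x = 0" if ab: "cbox a b \<subseteq> D" for a b
  proof -
    \<comment> \<open>Cut off to one box, \<open>g\<close> is integrable over the whole space, and
      its integral over any other box is one over the intersection, which is again a box inside
      \<open>D\<close>.\<close>
    define g' where "g' = (\<lambda>x. indicator (box a b) x * g x)"
    have g'1: "g' = (\<lambda>x. indicator D x *\<^sub>R (indicator (box a b) x * g x))"
      using subsetD[OF order_trans[OF box_subset_cbox ab]] by (force simp: g'_def indicator_def fun_eq_iff)
    have "integrable (lebesgue_on D) (\<lambda>x. indicator (box a b) x *\<^sub>R g x)"
      by (rule integrable_mult_indicator[OF _ g]) (use order_trans[OF box_subset_cbox ab] DL in \<open>auto simp: sets_restrict_space_iff\<close>)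
    then have g'i: "integrable lebesgue g'"
      unfolding g'1 using DL by (subst integrable_restrict_space[symmetric]) auto
    have *: "(\<integral>x. indicator (box c d) x * g' x \<partial>lebesgue) = 0" for c d
    proof -
      obtain c' d' where cd: "box c d \<inter> box a b = box c' d'" "cbox c' d' \<subseteq> D"
      proof (rule that[OF box_Int_box])
        show "cbox (\<Sum>i\<in>Basis. max (c \<bullet> i) (a \<bullet> i) *\<^sub>R i) (\<Sum>i\<in>Basis. min (d \<bullet> i) (b \<bullet> i) *\<^sub>R i) \<subseteq> D"
          unfolding Int_interval[symmetric] using ab by blast
      qed
      have "(\<integral>x. indicator (box c d) x * g' x \<partial>lebesgue)
          = (\<integral>x. indicator D x *\<^sub>R (indicator (box c' d') x * g x) \<partial>lebesgue)"
        using cd subsetD[OF order_trans[OF box_subset_cbox ab]]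
        by (intro Bochner_Integration.integral_cong) (auto simp: g'_def indicator_def set_eq_iff)
      also have "\<dots> = (\<integral>x. indicator (box c' d') x * g x \<partial>lebesgue_on D)"
        using DL by (subst integral_restrict_space) auto
      finally show ?thesis using box0[OF cd(2)] by simp
    qed
    have "(\<integral>x. g' x \<partial>lebesgue) = (\<integral>x. indicator (box a b) x * g' x \<partial>lebesgue)"
      by (intro Bochner_Integration.integral_cong) (auto simp: g'_def indicator_def)
    then have "AE x in lebesgue. g' x = 0"
      using AE_zero_if_box_integrals_zero[OF g'i] * by simp
    moreover have "AE x in lebesgue. x \<notin> cbox a b - box a b"
      using negligible_frontier_interval[of a b] by (intro AE_not_in) (simp add: negligible_iff_null_sets)
    ultimately show ?thesis
      by eventually_elim (auto simp: g'_def indicator_def split: if_splits)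
  qed
  obtain \<B> where \<B>: "countable \<B>" "\<And>X. X \<in> \<B> \<Longrightarrow> X \<subseteq> D" "\<And>X. X \<in> \<B> \<Longrightarrow> \<exists>a b. X = cbox a b" "\<Union>\<B> = D"
    using open_countable_Union_open_cbox[OF D] by (metis PowD in_mono)
  have "\<forall>X\<in>\<B>. AE x in lebesgue. x \<in> X \<longrightarrow> g x = 0"
  proof
    fix X assume "X \<in> \<B>"
    then obtain a b where "X = cbox a b" "X \<subseteq> D" using \<B> by blast
    then show "AE x in lebesgue. x \<in> X \<longrightarrow> g x = 0" using onbox by blast
  qed
  then have "AE x in lebesgue. \<forall>X\<in>\<B>. x \<in> X \<longrightarrow> g x = 0"
    unfolding AE_ball_countable[OF \<B>(1)] .
  then have "AE x in lebesgue. x \<in> D \<longrightarrow> g x = 0"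
    by eventually_elim (use \<B>(4) in auto)
  then show ?thesis using AE_lebesgue_on_iff[OF DL] by simp
qed

section \<open>Integration by parts for Lipschitz functions\<close>

lemma integral_lebesgue_translation:
  fixes f :: "'a::euclidean_space \<Rightarrow> real"
  assumes "f \<in> borel_measurable borel"
  shows "(\<integral>x. f (x + c) \<partial>lebesgue) = (\<integral>x. f x \<partial>lebesgue)"
    and "integrable lebesgue f \<Longrightarrow> integrable lebesgue (\<lambda>x. f (x + c))"
proof -
  have [measurable]: "f \<in> borel_measurable borel" by fact
  have "(\<integral>x. f x \<partial>lborel) = (\<integral>x. f x \<partial>distr lborel borel ((+) c))"
    by (simp add: lborel_distr_plus)
  also have "\<dots> = (\<integral>x. f (c + x) \<partial>lborel)" by (subst integral_distr) auto
  finally show "(\<integral>x. f (x + c) \<partial>lebesgue) = (\<integral>x. f x \<partial>lebesgue)"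
    by (simp add: integral_completion add.commute)
  assume "integrable lebesgue f"
  then have "integrable (distr lborel borel ((+) c)) f" by (simp add: integrable_completion lborel_distr_plus)
  then have "integrable lborel (\<lambda>x. f (c + x))" by (subst (asm) integrable_distr_eq) auto
  then show "integrable lebesgue (\<lambda>x. f (x + c))" by (simp add: integrable_completion add.commute)
qed

lemma has_derivative_quotient_LIMSEQ:
  fixes f :: "'a::real_normed_vector \<Rightarrow> real"
  assumes "(f has_derivative f') (at x)"
  shows "(\<lambda>n. (f (x + (1 / real (Suc n)) *\<^sub>R e) - f x) / (1 / real (Suc n))) \<longlonglongrightarrow> f' e"
proof -
  have "((\<lambda>t. x + t *\<^sub>R e) has_derivative (\<lambda>t. t *\<^sub>R e)) (at 0)"
    by (auto intro!: derivative_eq_intros)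
  then have "((\<lambda>t. f (x + t *\<^sub>R e)) has_derivative (\<lambda>t. f' (t *\<^sub>R e))) (at 0)"
    by (rule has_derivative_compose) (use assms in simp)
  moreover have "f' (t *\<^sub>R e) = f' e * t" for t
    using linear_scale[OF has_derivative_linear[OF assms]] by simp
  ultimately have "((\<lambda>t. f (x + t *\<^sub>R e)) has_real_derivative f' e) (at 0)"
    by (simp add: has_field_derivative_def)
  then have *: "((\<lambda>t. (f (x + t *\<^sub>R e) - f x) / t) \<longlongrightarrow> f' e) (at 0)"
    by (simp add: has_field_derivative_iff)
  have "filterlim (\<lambda>n. 1 / real (Suc n)) (at 0) sequentially"
    using LIMSEQ_inverse_real_of_nat by (simp add: filterlim_at inverse_eq_divide)
  from filterlim_compose[OF * this] show ?thesis .
qed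

text \<open>Translation invariance makes the integrals of all difference quotients vanish.\<close>

lemma integral_directional_derivative_eq_0:
  fixes f g :: "'a::euclidean_space \<Rightarrow> real"
  assumes lip: "L-lipschitz_on UNIV f"
    and S: "bounded S" "\<And>x. x \<notin> S \<Longrightarrow> f x = 0"
    and der: "AE x in lebesgue. \<exists>f'. (f has_derivative f') (at x) \<and> g x = f' e"
    and [measurable]: "g \<in> borel_measurable lebesgue"
  shows "(\<integral>x. g x \<partial>lebesgue) = 0"
proof -
  have L0: "0 \<le> L" using lip by (rule lipschitz_on_nonneg)
  have lip': "\<bar>f x - f y\<bar> \<le> L * norm (x - y)" for x y
    using lipschitz_onD[OF lip, of x y] by (simp add: dist_norm)
  have [measurable]: "f \<in> borel_measurable borel"
    using lipschitz_on_continuous_on[OF lip] by (rule borel_measurable_continuous_onI)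
  obtain R where R: "0 < R" "\<And>x. x \<in> S \<Longrightarrow> norm x \<le> R"
    using S(1) by (auto simp: bounded_pos)
  have "S \<noteq> UNIV" using S(1) not_bounded_UNIV by auto
  \<comment> \<open>A zero of \<open>f\<close> turns the Lipschitz estimate into a bound on
    \<open>f\<close> itself.\<close>
  then obtain z where z: "z \<notin> S" by blast
  have fb: "\<bar>f x\<bar> \<le> L * (R + norm z)" for x
  proof (cases "x \<in> S")
    case True
    have "\<bar>f x\<bar> \<le> L * norm (x - z)" using lip'[of x z] S(2)[OF z] by simp
    also have "\<dots> \<le> L * (R + norm z)"
      using R(2)[OF True] norm_triangle_ineq4[of x z] by (intro mult_left_mono L0) linarith
    finally show ?thesis .
  next
    case False
    then show ?thesis using S(2)[OF False] L0 R(1) by simp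
  qed
  have mf: "f \<in> borel_measurable lebesgue" by (intro measurable_completion) auto
  have indi: "integrable lebesgue (\<lambda>x. c * indicator (cball 0 r) x :: real)" for c r and z :: 'a
    using lmeasurable_cball[of 0 r] by (intro integrable_mult_right) (simp add: lmeasurable_iff_integrable)
  have fi: "integrable lebesgue f"
  proof (rule Bochner_Integration.integrable_bound[OF indi[of "L * (R + norm z)" R]])
    show "AE x in lebesgue. norm (f x) \<le> norm (L * (R + norm z) * indicator (cball 0 R) x)"
    proof (intro always_eventually allI)
      fix x
      show "norm (f x) \<le> norm (L * (R + norm z) * indicator (cball 0 R) x)"
        using fb[of x] S(2)[of x] R(2)[of x] L0 R(1) by (cases "x \<in> cball 0 R") (auto simp: abs_mult)
    qed
  qed (rule mf)
  let ?q = "\<lambda>n x. (f (x + (1 / real (Suc n)) *\<^sub>R e) - f x) / (1 / real (Suc n))"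
  have q0: "(\<integral>x. ?q n x \<partial>lebesgue) = 0" for n
    using fi integral_lebesgue_translation[of f "(1 / real (Suc n)) *\<^sub>R e"] by simp
  \<comment> \<open>The step sizes are at most 1, so all quotients vanish outside the ball enlarged
    by \<open>norm e\<close>; inside it the Lipschitz constant bounds them.\<close>
  have "(\<lambda>n. \<integral>x. ?q n x \<partial>lebesgue) \<longlonglongrightarrow> (\<integral>x. g x \<partial>lebesgue)"
  proof (rule integral_dominated_convergence[where w="\<lambda>x. L * norm e * indicator (cball 0 (R + norm e)) x"])
    have tm: "(\<lambda>x. f (x + c)) \<in> borel_measurable lebesgue" for c
      by (rule measurable_completion) measurable
    show "?q n \<in> borel_measurable lebesgue" for n
      by (intro borel_measurable_divide borel_measurable_diff borel_measurable_const mf tm)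
    show "AE x in lebesgue. (\<lambda>n. ?q n x) \<longlonglongrightarrow> g x"
      using der
    proof eventually_elim
      case (elim x)
      then obtain f' where f': "(f has_derivative f') (at x)" "g x = f' e" by blast
      show ?case unfolding f'(2) by (rule has_derivative_quotient_LIMSEQ[OF f'(1)])
    qed
    show "AE x in lebesgue. norm (?q n x) \<le> L * norm e * indicator (cball 0 (R + norm e)) x" for n
    proof (intro always_eventually allI)
      fix x
      define t where "t = 1 / real (Suc n)"
      have t: "0 < t" "t \<le> 1" by (auto simp: t_def)
      show "norm (?q n x) \<le> L * norm e * indicator (cball 0 (R + norm e)) x"
      proof (cases "x \<in> cball 0 (R + norm e)")
        case True
        have "norm (?q n x) \<le> L * norm (t *\<^sub>R e) / t"
          using lip'[of "x + t *\<^sub>R e" x] t unfolding t_def[symmetric] by (simp add: pos_divide_le_eq mult_ac)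
        also have "\<dots> = L * norm e" using t by simp
        finally show ?thesis using True by simp
      next
        case False
        then have "R + norm e < norm x" by simp
        moreover have "norm x \<le> norm (x + t *\<^sub>R e) + norm (t *\<^sub>R e)"
          using norm_triangle_ineq4[of "x + t *\<^sub>R e" "t *\<^sub>R e"] by simp
        moreover have "norm (t *\<^sub>R e) \<le> norm e" using t by (simp add: mult_left_le_one_le)
        ultimately have "R < norm x" "R < norm (x + t *\<^sub>R e)"
          using norm_ge_zero[of e] by linarith+
        then have "x \<notin> S" "x + t *\<^sub>R e \<notin> S" using R(2) leD by blast+
        then show ?thesis using S(2) False unfolding t_def[symmetric] by simp
      qed
    qed
  qed (use indi in auto)
  then show ?thesis using q0 by (simp add: LIMSEQ_const_iff)
qed

lemma smooth_continuous: "smooth \<phi> \<Longrightarrow> continuous_on S \<phi>"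
  by (intro continuous_at_imp_continuous_on ballI differentiable_imp_continuous_within smooth_differentiable)

lemma differentiable_has_derivative_partial:
  fixes \<phi> :: "real^'d \<Rightarrow> real"
  assumes "\<phi> differentiable (at x)"
  shows "(\<phi> has_derivative (\<lambda>h. \<Sum>i\<in>UNIV. h $ i * partial i \<phi> x)) (at x)"
proof -
  have d: "(\<phi> has_derivative frechet_derivative \<phi> (at x)) (at x)"
    using assms frechet_derivative_works by blast
  have "frechet_derivative \<phi> (at x) h = (\<Sum>i\<in>UNIV. h $ i * partial i \<phi> x)" for h
  proof -
    have "frechet_derivative \<phi> (at x) h = frechet_derivative \<phi> (at x) (\<Sum>i\<in>UNIV. h $ i *\<^sub>R axis i 1)"
      using basis_expansion[of h] by (simp add: scalar_mult_eq_scaleR)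
    also have "\<dots> = (\<Sum>i\<in>UNIV. h $ i * partial i \<phi> x)"
      using has_derivative_linear[OF d] by (simp add: linear_sum linear_scale partial_def o_def)
    finally show ?thesis .
  qed
  then have "frechet_derivative \<phi> (at x) = (\<lambda>h. \<Sum>i\<in>UNIV. h $ i * partial i \<phi> x)" ..
  then show ?thesis by (rule has_derivative_eq_rhs[OF d])
qed

lemma smooth_has_derivative:
  assumes "smooth (\<phi> :: real^'d \<Rightarrow> real)"
  shows "(\<phi> has_derivative (\<lambda>h. \<Sum>i\<in>UNIV. h $ i * partial i \<phi> x)) (at x)"
  by (rule differentiable_has_derivative_partial[OF smooth_differentiable[OF assms]])

text \<open>All bounds come from continuity on the compact support; the partial derivatives vanish
  off \<open>K\<close> because the complement of \<open>K\<close> is open. The mean value inequality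
  on the whole space then gives a global Lipschitz constant.\<close>

lemma test_function_facts:
  assumes "\<phi> \<in> test_functions D"
  obtains K L B where "compact K" "K \<subseteq> D" "\<And>x. x \<notin> K \<Longrightarrow> \<phi> x = 0" "\<And>x i. x \<notin> K \<Longrightarrow> partial i \<phi> x = 0"
    "L-lipschitz_on UNIV \<phi>" "\<And>x. \<bar>\<phi> x\<bar> \<le> B" "\<And>x i. \<bar>partial i \<phi> x\<bar> \<le> B" "smooth \<phi>" "0 \<le> B"
proof -
  obtain K where K: "compact K" "K \<subseteq> D" "\<And>x. x \<notin> K \<Longrightarrow> \<phi> x = 0" and s: "smooth \<phi>"
    using assms by (auto simp: test_functions_def)
  have pz: "partial i \<phi> x = 0" if "x \<notin> K" for x i
  proof -
    have "(\<phi> has_derivative (\<lambda>_. 0)) (at x)"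
      by (rule has_derivative_transform_within_open[of "\<lambda>_. 0" _ _ _ "- K"])
         (use that K compact_imp_closed[OF K(1)] in auto)
    then show ?thesis by (simp add: partial_eqI)
  qed
  have bdd: "\<exists>B. \<forall>x. \<bar>f x\<bar> \<le> B" if "smooth f" "\<And>x. x \<notin> K \<Longrightarrow> f x = 0" for f
  proof -
    have "bounded (f ` K)"
      using smooth_continuous[OF that(1)] K(1) by (intro compact_imp_bounded compact_continuous_image)
    then obtain B where B: "\<And>x. x \<in> K \<Longrightarrow> \<bar>f x\<bar> \<le> B" by (auto simp: bounded_iff)
    have "\<bar>f x\<bar> \<le> max B 0" for x
      using B[of x] that(2)[of x] by (cases "x \<in> K") auto
    then show ?thesis by blast
  qed
  obtain B0 where B0: "\<And>x. \<bar>\<phi> x\<bar> \<le> B0" using bdd[OF s K(3)] by blast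
  have "\<exists>B. \<forall>x. \<bar>partial i \<phi> x\<bar> \<le> B" for i
    by (rule bdd) (auto intro: smooth_partial s pz)
  then obtain Bi where Bi: "\<And>i x. \<bar>partial i \<phi> x\<bar> \<le> Bi i" by metis
  define B where "B = \<bar>B0\<bar> + (\<Sum>i\<in>UNIV. \<bar>Bi i\<bar>)"
  have b1: "\<bar>\<phi> x\<bar> \<le> B" for x
  proof -
    have "0 \<le> (\<Sum>i\<in>UNIV. \<bar>Bi i\<bar>)" by (rule sum_nonneg) simp
    then show ?thesis using B0[of x] unfolding B_def by linarith
  qed
  have b2: "\<bar>partial i \<phi> x\<bar> \<le> B" for i x
    using Bi[of i x] member_le_sum[of i UNIV "\<lambda>i. \<bar>Bi i\<bar>"] unfolding B_def by force
  have "0 \<le> B" using b1[of undefined] abs_ge_zero order_trans by blast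
  have "norm (\<phi> x - \<phi> y) \<le> (real CARD('a) * B) * norm (x - y)" for x y
  proof (rule differentiable_bound[OF convex_UNIV])
    fix x :: "real^'a"
    show "(\<phi> has_derivative (\<lambda>h. \<Sum>i\<in>UNIV. h $ i * partial i \<phi> x)) (at x)"
      using s by (rule smooth_has_derivative)
    show "onorm (\<lambda>h. \<Sum>i\<in>UNIV. h $ i * partial i \<phi> x) \<le> real CARD('a) * B"
    proof (rule onorm_le)
      fix h :: "real^'a"
      have "norm (\<Sum>i\<in>UNIV. h $ i * partial i \<phi> x) \<le> (\<Sum>i\<in>(UNIV::'a set). norm h * B)"
        by (rule sum_norm_le) (auto simp: abs_mult intro!: mult_mono component_le_norm_cart b2)
      then show "norm (\<Sum>i\<in>UNIV. h $ i * partial i \<phi> x) \<le> real CARD('a) * B * norm h" by (simp add: mult_ac)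
    qed
  qed auto
  then have lip: "(real CARD('a) * B)-lipschitz_on UNIV \<phi>"
    using \<open>0 \<le> B\<close> by (intro lipschitz_onI) (auto simp: dist_norm)
  show thesis by (rule that[OF K(1) K(2) K(3) pz lip b1 b2 s \<open>0 \<le> B\<close>])
qed

text \<open>Extended by zero, the product of a test function and \<open>\<psi>\<close> is globally Lipschitz.\<close>

lemma test_function_integration_by_parts:
  fixes \<psi> :: "real^'d \<Rightarrow> real"
  assumes D: "open D" "bounded D" and \<phi>: "\<phi> \<in> test_functions D"
    and \<psi>: "M-lipschitz_on D \<psi>"
    and der: "AE x in lebesgue_on D. \<exists>\<psi>'. (\<psi> has_derivative \<psi>') (at x) \<and> g x = \<psi>' (axis j 1)"
    and g: "g \<in> borel_measurable (lebesgue_on D)"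
  shows "(\<integral>x. partial j \<phi> x * \<psi> x + \<phi> x * g x \<partial>lebesgue_on D) = 0"
proof -
  obtain K L B where K: "compact K" "K \<subseteq> D" "\<And>x. x \<notin> K \<Longrightarrow> \<phi> x = 0" "\<And>x i. x \<notin> K \<Longrightarrow> partial i \<phi> x = 0"
    "L-lipschitz_on UNIV \<phi>" "\<And>x. \<bar>\<phi> x\<bar> \<le> B" "\<And>x i. \<bar>partial i \<phi> x\<bar> \<le> B" "smooth \<phi>" "0 \<le> B"
    by (rule test_function_facts[OF \<phi>]) (rule that)
  have DL: "D \<in> sets lebesgue" using D by auto
  have L0: "0 \<le> L" and M0: "0 \<le> M" using K(5) \<psi> lipschitz_on_nonneg by blast+
  have "bounded (\<psi> ` D)"
    using \<psi> D(2) by (intro bounded_uniformly_continuous_image lipschitz_on_uniformly_continuous)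
  then obtain P where P: "0 < P" "\<forall>y\<in>\<psi> ` D. norm y \<le> P"
    unfolding bounded_pos by blast
  then have P: "0 \<le> P" "\<And>x. x \<in> D \<Longrightarrow> \<bar>\<psi> x\<bar> \<le> P" by auto
  define f where "f = (\<lambda>x. if x \<in> D then \<phi> x * \<psi> x else 0)"
  define G where "G = (\<lambda>x. indicator D x *\<^sub>R (partial j \<phi> x * \<psi> x + \<phi> x * g x))"
  \<comment> \<open>The point outside \<open>D\<close> also lies outside the support of
    \<open>\<phi>\<close>, so the difference is \<open>\<phi> x - \<phi> y\<close> times
    \<open>\<psi> x\<close>, and \<open>\<psi>\<close> is evaluated in \<open>D\<close>
    only.\<close>
  have in_out: "\<bar>f x - f y\<bar> \<le> (L * P + B * M) * norm (x - y)" if "x \<in> D" "y \<notin> D" for x y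
  proof -
    have "\<phi> y = 0" using that K(2,3) by blast
    then have "\<bar>f x - f y\<bar> = \<bar>\<phi> x - \<phi> y\<bar> * \<bar>\<psi> x\<bar>"
      using that by (simp add: f_def abs_mult)
    also have "\<dots> \<le> (L * norm (x - y)) * P"
      using lipschitz_onD[OF K(5), of x y] P that L0 by (intro mult_mono) (auto simp: dist_norm)
    also have "\<dots> \<le> (L * P + B * M) * norm (x - y)"
      using K(9) M0 by (simp add: algebra_simps)
    finally show ?thesis .
  qed
  have "\<bar>f x - f y\<bar> \<le> (L * P + B * M) * norm (x - y)" for x y
  proof -
    consider "x \<in> D" "y \<in> D" | "x \<in> D" "y \<notin> D" | "x \<notin> D" "y \<in> D" | "x \<notin> D" "y \<notin> D" by blast
    then show ?thesis
    proof cases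
      case 1
      have "f x - f y = (\<phi> x - \<phi> y) * \<psi> x + \<phi> y * (\<psi> x - \<psi> y)"
        using 1 by (simp add: f_def algebra_simps)
      then have "\<bar>f x - f y\<bar> \<le> \<bar>\<phi> x - \<phi> y\<bar> * \<bar>\<psi> x\<bar> + \<bar>\<phi> y\<bar> * \<bar>\<psi> x - \<psi> y\<bar>"
        by (metis abs_mult abs_triangle_ineq)
      also have "\<dots> \<le> (L * norm (x - y)) * P + B * (M * norm (x - y))"
        using lipschitz_onD[OF K(5), of x y] lipschitz_onD[OF \<psi>, of x y] P K L0 1
        by (intro add_mono mult_mono) (auto simp: dist_norm)
      finally show ?thesis by (simp add: algebra_simps)
    next
      case 2 then show ?thesis by (rule in_out)
    next
      case 3 then show ?thesis using in_out[of y x] by (simp add: norm_minus_commute abs_minus_commute)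
    next
      case 4 then show ?thesis using L0 M0 P(1) K(9) by (simp add: f_def)
    qed
  qed
  then have lip: "(L * P + B * M)-lipschitz_on UNIV f"
    using L0 M0 P(1) K(9) by (intro lipschitz_onI) (auto simp: dist_norm)
  have mc: "h \<in> borel_measurable (lebesgue_on D)" if "continuous_on D h" for h :: "real^'d \<Rightarrow> real"
    using continuous_imp_measurable_on_sets_lebesgue[OF that DL] .
  have Gm: "(\<lambda>x. partial j \<phi> x * \<psi> x + \<phi> x * g x) \<in> borel_measurable (lebesgue_on D)"
    using g mc[OF lipschitz_on_continuous_on[OF \<psi>]] mc[OF smooth_continuous[OF K(8)]]
      mc[OF smooth_continuous[OF smooth_partial[OF K(8)]]] by auto
  have "(\<integral>x. G x \<partial>lebesgue) = 0"
  proof (rule integral_directional_derivative_eq_0[OF lip D(2)])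
    show "G \<in> borel_measurable lebesgue"
      unfolding G_def using Gm by (subst borel_measurable_restrict_space_iff[symmetric]) (use DL in auto)
    have "AE x in lebesgue. x \<in> D \<longrightarrow> (\<exists>\<psi>'. (\<psi> has_derivative \<psi>') (at x) \<and> g x = \<psi>' (axis j 1))"
      using der AE_lebesgue_on_iff[OF DL] by simp
    then show "AE x in lebesgue. \<exists>f'. (f has_derivative f') (at x) \<and> G x = f' (axis j 1)"
    proof eventually_elim
      case (elim x)
      show ?case
      proof (cases "x \<in> D")
        case True
        then obtain \<psi>' where \<psi>': "(\<psi> has_derivative \<psi>') (at x)" "g x = \<psi>' (axis j 1)" using elim by blast
        have "((\<lambda>x. \<phi> x * \<psi> x) has_derivative
           (\<lambda>h. \<phi> x * \<psi>' h + frechet_derivative \<phi> (at x) h * \<psi> x)) (at x)"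
          using smooth_differentiable[OF K(8)]
          by (intro has_derivative_mult \<psi>') (simp add: frechet_derivative_works[symmetric])
        then have "(f has_derivative (\<lambda>h. \<phi> x * \<psi>' h + frechet_derivative \<phi> (at x) h * \<psi> x)) (at x)"
          by (rule has_derivative_transform_within_open[OF _ D(1) True]) (simp add: f_def)
        then show ?thesis using True \<psi>'(2)
          by (intro exI[of _ "\<lambda>h. \<phi> x * \<psi>' h + frechet_derivative \<phi> (at x) h * \<psi> x"]) (simp add: G_def partial_def)
      next
        case False
        have "(f has_derivative (\<lambda>_. 0)) (at x)"
          by (rule has_derivative_transform_within_open[of "\<lambda>_. 0" _ _ _ "- K"])
             (use False K compact_imp_closed[OF K(1)] in \<open>auto simp: f_def\<close>)
        then show ?thesis using False by (intro exI[of _ "\<lambda>_. 0"]) (simp add: G_def)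
      qed
    qed
  qed (simp add: f_def)
  moreover have "(\<integral>x. partial j \<phi> x * \<psi> x + \<phi> x * g x \<partial>lebesgue_on D) = (\<integral>x. G x \<partial>lebesgue)"
    unfolding G_def by (rule integral_restrict_space) (use DL in simp)
  ultimately show ?thesis by simp
qed


section \<open>Weak gradients and \<open>H10\<close>\<close>

lemma bounded_bilinear_matvec: "bounded_bilinear ((*v) :: real^'n^'m \<Rightarrow> real^'n \<Rightarrow> real^'m)"
proof -
  have "bilinear ((*v) :: real^'n^'m \<Rightarrow> real^'n \<Rightarrow> real^'m)"
    unfolding bilinear_def
    by (intro conjI allI linearI)
       (simp_all add: matrix_vector_mult_def vec_eq_iff sum.distrib[symmetric] sum_distrib_left algebra_simps)
  then show ?thesis by (simp add: bilinear_conv_bounded_bilinear)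
qed

locale bounded_domain =
  fixes D :: "(real^'d) set"
  assumes open_D: "open D" and bounded_D: "bounded D"
begin

lemma lmeasurable_D: "D \<in> lmeasurable"
  using bounded_D open_D by (rule lmeasurable_open)

lemma sets_D: "D \<in> sets lebesgue"
  using lmeasurable_D by (rule fmeasurableD)

sublocale fin: finite_measure "lebesgue_on D"
  using lmeasurable_D by (rule finite_measure_lebesgue_on)

section \<open>Essentially bounded functions\<close>

text \<open>In contrast to \<open>L2 D\<close> this class is closed under products, and on a bounded
  domain its members are integrable. Finite element functions and their gradients belong to it, so
  it settles the integrability questions raised by the schemes.\<close>

definition essbdd :: "(real^'d \<Rightarrow> 'b::euclidean_space) \<Rightarrow> bool" where
  "essbdd f \<longleftrightarrow> f \<in> borel_measurable (lebesgue_on D) \<and> (\<exists>B. AE x in lebesgue_on D. norm (f x) \<le> B)"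

lemma essbddI:
  "f \<in> borel_measurable (lebesgue_on D) \<Longrightarrow> AE x in lebesgue_on D. norm (f x) \<le> B \<Longrightarrow> essbdd f"
  unfolding essbdd_def by (intro conjI exI)

lemma essbdd_measurable: "essbdd f \<Longrightarrow> f \<in> borel_measurable (lebesgue_on D)"
  by (simp add: essbdd_def)

lemma essbddE:
  assumes "essbdd f"
  obtains B where "0 < B" "AE x in lebesgue_on D. norm (f x) \<le> B"
proof -
  obtain B where B: "AE x in lebesgue_on D. norm (f x) \<le> B" using assms by (auto simp: essbdd_def)
  have "AE x in lebesgue_on D. norm (f x) \<le> max B 1" using B by eventually_elim simp
  then show thesis by (intro that[of "max B 1"]) auto
qed

lemma essbdd_integrable:
  assumes "essbdd f"
  shows "integrable (lebesgue_on D) f"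
proof -
  obtain B where "AE x in lebesgue_on D. norm (f x) \<le> B" using assms by (rule essbddE)
  then show ?thesis using essbdd_measurable[OF assms] by (rule fin.integrable_const_bound)
qed

lemma essbdd_linear:
  assumes "essbdd u" "bounded_linear f"
  shows "essbdd (\<lambda>x. f (u x))"
proof -
  obtain B where B: "AE x in lebesgue_on D. norm (u x) \<le> B" using assms(1) by (rule essbddE)
  obtain K where K: "\<And>y. norm (f y) \<le> norm y * K" "0 < K"
    using bounded_linear.pos_bounded[OF assms(2)] by blast
  show ?thesis
  proof (rule essbddI)
    show "(\<lambda>x. f (u x)) \<in> borel_measurable (lebesgue_on D)"
      by (rule borel_measurable_continuous_on[OF linear_continuous_on[OF assms(2)] essbdd_measurable[OF assms(1)]])
    show "AE x in lebesgue_on D. norm (f (u x)) \<le> B * K"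
      using B
    proof eventually_elim
      case (elim x)
      have "norm (f (u x)) \<le> norm (u x) * K" by (rule K)
      also have "\<dots> \<le> B * K" using elim K(2) by (intro mult_right_mono) auto
      finally show ?case .
    qed
  qed
qed

lemma essbdd_bilinear:
  assumes "essbdd u" "essbdd v" "bounded_bilinear p"
  shows "essbdd (\<lambda>x. p (u x) (v x))"
proof -
  obtain B where B: "AE x in lebesgue_on D. norm (u x) \<le> B" "0 < B" using assms(1) by (rule essbddE)
  obtain B' where B': "AE x in lebesgue_on D. norm (v x) \<le> B'" "0 < B'" using assms(2) by (rule essbddE)
  obtain K where K: "\<And>a b. norm (p a b) \<le> norm a * norm b * K" "0 < K"
    using bounded_bilinear.pos_bounded[OF assms(3)] by blast
  show ?thesis
  proof (rule essbddI)
    show "(\<lambda>x. p (u x) (v x)) \<in> borel_measurable (lebesgue_on D)"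
      by (rule borel_measurable_continuous_Pair[OF assms(1,2)[THEN essbdd_measurable]])
         (intro bounded_bilinear.continuous_on[OF assms(3)] continuous_intros)
    show "AE x in lebesgue_on D. norm (p (u x) (v x)) \<le> B * B' * K"
      using B(1) B'(1)
    proof eventually_elim
      case (elim x)
      have "norm (p (u x) (v x)) \<le> norm (u x) * norm (v x) * K" by (rule K)
      also have "\<dots> \<le> B * B' * K" using elim K(2) B(2) B'(2) by (intro mult_right_mono mult_mono) auto
      finally show ?case .
    qed
  qed
qed

lemma essbdd_const: "essbdd (\<lambda>x. c)"
  by (rule essbddI[of _ "norm c"]) auto

lemma essbdd_add:
  assumes "essbdd u" "essbdd v"
  shows "essbdd (\<lambda>x. u x + v x)"
proof -
  obtain B where B: "AE x in lebesgue_on D. norm (u x) \<le> B" using assms(1) by (rule essbddE)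
  obtain B' where B': "AE x in lebesgue_on D. norm (v x) \<le> B'" using assms(2) by (rule essbddE)
  show ?thesis
  proof (rule essbddI)
    show "(\<lambda>x. u x + v x) \<in> borel_measurable (lebesgue_on D)"
      using assms by (intro borel_measurable_add essbdd_measurable)
    show "AE x in lebesgue_on D. norm (u x + v x) \<le> B + B'"
      using B B' by eventually_elim (auto intro: order_trans[OF norm_triangle_ineq] add_mono)
  qed
qed

lemma essbdd_mult: "essbdd u \<Longrightarrow> essbdd v \<Longrightarrow> essbdd (\<lambda>x. u x * v x :: real)"
  by (rule essbdd_bilinear) (auto intro: bounded_bilinear_mult)

lemma essbdd_scaleR: "essbdd u \<Longrightarrow> essbdd v \<Longrightarrow> essbdd (\<lambda>x. u x *\<^sub>R v x)"
  by (rule essbdd_bilinear) (auto intro: bounded_bilinear_scaleR)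

lemma essbdd_inner: "essbdd u \<Longrightarrow> essbdd v \<Longrightarrow> essbdd (\<lambda>x. u x \<bullet> v x)"
  by (rule essbdd_bilinear) (auto intro: bounded_bilinear_inner)

lemma essbdd_scaleR_const: "essbdd u \<Longrightarrow> essbdd (\<lambda>x. c *\<^sub>R u x)"
  by (rule essbdd_scaleR[OF essbdd_const])

lemma essbdd_mult_const: "essbdd u \<Longrightarrow> essbdd (\<lambda>x. c * u x :: real)"
  by (rule essbdd_mult[OF essbdd_const])

lemma essbdd_diff: "essbdd u \<Longrightarrow> essbdd v \<Longrightarrow> essbdd (\<lambda>x. u x - v x)"
  using essbdd_add[OF _ essbdd_scaleR_const[of v "-1"]] by simp

lemma essbdd_nth: "essbdd u \<Longrightarrow> essbdd (\<lambda>x. u x $ i)"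
  by (rule essbdd_linear) (auto intro: bounded_linear_vec_nth)

lemma essbdd_sum: "(\<And>i. i \<in> I \<Longrightarrow> essbdd (f i)) \<Longrightarrow> essbdd (\<lambda>x. \<Sum>i\<in>I. f i x)"
  by (induction I rule: infinite_finite_induct) (auto intro: essbdd_const essbdd_add)

lemma essbdd_matvec:
  fixes u :: "real^'d \<Rightarrow> real^'n^'m"
  shows "essbdd u \<Longrightarrow> essbdd v \<Longrightarrow> essbdd (\<lambda>x. u x *v v x)"
  by (rule essbdd_bilinear) (auto intro: bounded_bilinear_matvec)

lemma essbdd_vecI:
  fixes f :: "real^'d \<Rightarrow> 'b::euclidean_space^'d"
  assumes "\<And>i. essbdd (\<lambda>x. f x $ i)"
  shows "essbdd f"
proof -
  have "essbdd (\<lambda>x. \<Sum>i\<in>UNIV. axis i (f x $ i))"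
  proof (intro essbdd_sum essbdd_linear[OF assms])
    show "bounded_linear (axis i :: 'b \<Rightarrow> 'b^'d)" for i
      by (intro linear_conv_bounded_linear[THEN iffD1] linearI) (auto simp: axis_def vec_eq_iff)
  qed
  moreover have "(\<Sum>i\<in>UNIV. axis i (f x $ i)) = f x" for x
    by (simp add: vec_eq_iff axis_def if_distrib sum.delta cong: if_cong)
  ultimately show ?thesis by simp
qed

lemma essbdd_norm:
  assumes "essbdd u" shows "essbdd (\<lambda>x. norm (u x))"
proof -
  obtain B where B: "AE x in lebesgue_on D. norm (u x) \<le> B" using assms by (rule essbddE)
  show ?thesis
    by (rule essbddI[of _ B]) (use B essbdd_measurable[OF assms] in auto)
qed

lemma essbdd_power2: "essbdd u \<Longrightarrow> essbdd (\<lambda>x. (u x)\<^sup>2 :: real)"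
  unfolding power2_eq_square by (rule essbdd_mult)

lemma essbdd_L2: "essbdd u \<Longrightarrow> u \<in> L2 D"
  unfolding L2_def mem_Collect_eq
  by (intro conjI essbdd_measurable essbdd_integrable essbdd_power2 essbdd_norm)

section \<open>Square-integrable functions\<close>

lemma L2_measurable: "u \<in> L2 D \<Longrightarrow> u \<in> borel_measurable (lebesgue_on D)"
  and L2_square_integrable: "u \<in> L2 D \<Longrightarrow> integrable (lebesgue_on D) (\<lambda>x. (norm (u x))\<^sup>2)"
  by (auto simp: L2_def)

lemma L2_norm_integrable:
  assumes "u \<in> L2 D" "v \<in> L2 D"
  shows "integrable (lebesgue_on D) (\<lambda>x. norm (u x) * norm (v x))"
proof (rule Bochner_Integration.integrable_bound)
  show "integrable (lebesgue_on D) (\<lambda>x. (norm (u x))\<^sup>2 + (norm (v x))\<^sup>2)"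
    using assms by (auto intro: L2_square_integrable)
  show "(\<lambda>x. norm (u x) * norm (v x)) \<in> borel_measurable (lebesgue_on D)"
    using assms[THEN L2_measurable] by auto
  show "AE x in lebesgue_on D. norm (norm (u x) * norm (v x)) \<le> norm ((norm (u x))\<^sup>2 + (norm (v x))\<^sup>2)"
  proof (intro always_eventually allI)
    fix x
    have "2 * (norm (u x) * norm (v x)) \<le> (norm (u x))\<^sup>2 + (norm (v x))\<^sup>2"
      using sum_squares_bound[of "norm (u x)" "norm (v x)"] by simp
    moreover have "0 \<le> norm (u x) * norm (v x)" by simp
    ultimately have "norm (u x) * norm (v x) \<le> (norm (u x))\<^sup>2 + (norm (v x))\<^sup>2" by linarith
    then show "norm (norm (u x) * norm (v x)) \<le> norm ((norm (u x))\<^sup>2 + (norm (v x))\<^sup>2)"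
      by (simp add: abs_mult)
  qed
qed

lemma L2_norm_power2: "(L2_norm D u)\<^sup>2 = (\<integral>x. (norm (u x))\<^sup>2 \<partial>lebesgue_on D)"
  unfolding L2_norm_def L2_inner_def
  by (simp add: power2_norm_eq_inner integral_nonneg_AE)

lemma L2_norm_nonneg: "0 \<le> L2_norm D u"
  by (simp add: L2_norm_def L2_inner_def integral_nonneg_AE)

lemma L2_norm_eq_0:
  assumes "u \<in> L2 D"
  shows "L2_norm D u = 0 \<longleftrightarrow> (AE x in lebesgue_on D. u x = 0)"
proof -
  have "L2_norm D u = 0 \<longleftrightarrow> (\<integral>x. (norm (u x))\<^sup>2 \<partial>lebesgue_on D) = 0"
    by (simp flip: L2_norm_power2)
  also have "\<dots> \<longleftrightarrow> (AE x in lebesgue_on D. (norm (u x))\<^sup>2 = 0)"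
    using L2_square_integrable[OF assms] by (intro integral_nonneg_eq_0_iff_AE) auto
  finally show ?thesis by simp
qed

text \<open>Integrates the pointwise Young inequality with the weights \<open>b / a\<close> and
  \<open>a / b\<close>, which make both terms equal to half of \<open>a * b\<close>. If one of the
  norms is 0, the integrand vanishes almost everywhere.\<close>

lemma L2_norm_Cauchy_Schwarz:
  assumes u: "u \<in> L2 D" and v: "v \<in> L2 D"
  shows "(\<integral>x. norm (u x) * norm (v x) \<partial>lebesgue_on D) \<le> L2_norm D u * L2_norm D v"
proof (cases "L2_norm D u = 0 \<or> L2_norm D v = 0")
  case True
  then have "AE x in lebesgue_on D. norm (u x) * norm (v x) = 0"
    using L2_norm_eq_0[OF u] L2_norm_eq_0[OF v] by (auto elim: eventually_mono)
  then have "(\<integral>x. norm (u x) * norm (v x) \<partial>lebesgue_on D) = 0"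
    by (rule integral_eq_zero_AE)
  then show ?thesis by (simp add: L2_norm_nonneg)
next
  case False
  define a b where "a = L2_norm D u" and "b = L2_norm D v"
  have ab: "0 < a" "0 < b" using False L2_norm_nonneg[of u] L2_norm_nonneg[of v] by (auto simp: a_def b_def)
  have "(\<integral>x. norm (u x) * norm (v x) \<partial>lebesgue_on D)
      \<le> (\<integral>x. (b / a * (norm (u x))\<^sup>2 + a / b * (norm (v x))\<^sup>2) / 2 \<partial>lebesgue_on D)"
  proof (rule integral_mono)
    show "integrable (lebesgue_on D) (\<lambda>x. norm (u x) * norm (v x))"
      using u v by (rule L2_norm_integrable)
    show "integrable (lebesgue_on D) (\<lambda>x. (b / a * (norm (u x))\<^sup>2 + a / b * (norm (v x))\<^sup>2) / 2)"
      using u v by (intro Bochner_Integration.integrable_divide Bochner_Integration.integrable_add integrable_mult_right L2_square_integrable)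
    fix x
    have "0 \<le> (b * norm (u x) - a * norm (v x))\<^sup>2 / (a * b)" using ab by simp
    also have "\<dots> = b / a * (norm (u x))\<^sup>2 + a / b * (norm (v x))\<^sup>2 - 2 * (norm (u x) * norm (v x))"
      using ab by (simp add: field_simps power2_eq_square)
    finally show "norm (u x) * norm (v x) \<le> (b / a * (norm (u x))\<^sup>2 + a / b * (norm (v x))\<^sup>2) / 2"
      by simp
  qed
  also have "\<dots> = (b / a * a\<^sup>2 + a / b * b\<^sup>2) / 2"
    using u v by (simp add: L2_square_integrable a_def b_def L2_norm_power2)
  also have "\<dots> = a * b" using ab by (simp add: power2_eq_square)
  finally show ?thesis by (simp add: a_def b_def)
qed

text \<open>Form in which the Cauchy-Schwarz inequality is applied to products of three or more
  factors: all factors but two are bounded pointwise and collected in \<open>c\<close>.\<close>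

lemma integral_bound_L2:
  fixes h :: "real^'d \<Rightarrow> real"
  assumes a: "a \<in> L2 D" and b: "b \<in> L2 D" and h: "h \<in> borel_measurable (lebesgue_on D)"
    and le: "AE x in lebesgue_on D. \<bar>h x\<bar> \<le> c * (norm (a x) * norm (b x))" and c: "0 \<le> c"
  shows "integrable (lebesgue_on D) h"
    and "\<bar>\<integral>x. h x \<partial>lebesgue_on D\<bar> \<le> c * L2_norm D a * L2_norm D b"
proof -
  have i: "integrable (lebesgue_on D) (\<lambda>x. c * (norm (a x) * norm (b x)))"
    using L2_norm_integrable[OF a b] by simp
  show hi: "integrable (lebesgue_on D) h"
    by (rule Bochner_Integration.integrable_bound[OF i h])
       (use le in eventually_elim, use c in \<open>simp add: abs_mult\<close>)
  have "\<bar>\<integral>x. h x \<partial>lebesgue_on D\<bar> \<le> (\<integral>x. \<bar>h x\<bar> \<partial>lebesgue_on D)"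
    by (rule integral_abs_bound)
  also have "\<dots> \<le> (\<integral>x. c * (norm (a x) * norm (b x)) \<partial>lebesgue_on D)"
    by (rule integral_mono_AE) (use hi i le in auto)
  also have "\<dots> \<le> c * (L2_norm D a * L2_norm D b)"
    using L2_norm_Cauchy_Schwarz[OF a b] c by (simp add: mult_left_mono)
  finally show "\<bar>\<integral>x. h x \<partial>lebesgue_on D\<bar> \<le> c * L2_norm D a * L2_norm D b" by simp
qed

lemma L2_inner_integrable:
  assumes "u \<in> L2 D" "v \<in> L2 D"
  shows "integrable (lebesgue_on D) (\<lambda>x. u x \<bullet> v x)"
  by (rule integral_bound_L2(1)[OF assms, where c=1])
     (use assms[THEN L2_measurable] in \<open>auto simp: Cauchy_Schwarz_ineq2\<close>)

lemma L2_lincomb: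
  assumes "u \<in> L2 D" "v \<in> L2 D"
  shows "(\<lambda>x. a *\<^sub>R u x + b *\<^sub>R v x) \<in> L2 D"
proof -
  have m: "(\<lambda>x. a *\<^sub>R u x + b *\<^sub>R v x) \<in> borel_measurable (lebesgue_on D)"
    using assms[THEN L2_measurable] by auto
  have "integrable (lebesgue_on D) (\<lambda>x. (norm (a *\<^sub>R u x + b *\<^sub>R v x))\<^sup>2)"
  proof (rule Bochner_Integration.integrable_bound)
    show "integrable (lebesgue_on D) (\<lambda>x. 2 * a\<^sup>2 * (norm (u x))\<^sup>2 + 2 * b\<^sup>2 * (norm (v x))\<^sup>2)"
      using assms by (intro Bochner_Integration.integrable_add integrable_mult_right L2_square_integrable)
    show "(\<lambda>x. (norm (a *\<^sub>R u x + b *\<^sub>R v x))\<^sup>2) \<in> borel_measurable (lebesgue_on D)" using m by auto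
    show "AE x in lebesgue_on D. norm ((norm (a *\<^sub>R u x + b *\<^sub>R v x))\<^sup>2) \<le> norm (2 * a\<^sup>2 * (norm (u x))\<^sup>2 + 2 * b\<^sup>2 * (norm (v x))\<^sup>2)"
    proof (intro always_eventually allI)
      fix x
      have "(norm (a *\<^sub>R u x + b *\<^sub>R v x))\<^sup>2 \<le> (\<bar>a\<bar> * norm (u x) + \<bar>b\<bar> * norm (v x))\<^sup>2"
        by (intro power_mono order_trans[OF norm_triangle_ineq]) auto
      also have "\<dots> \<le> 2 * a\<^sup>2 * (norm (u x))\<^sup>2 + 2 * b\<^sup>2 * (norm (v x))\<^sup>2"
        using sum_squares_bound[of "\<bar>a\<bar> * norm (u x)" "\<bar>b\<bar> * norm (v x)"]
        by (simp add: power2_sum power_mult_distrib)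
      finally show "norm ((norm (a *\<^sub>R u x + b *\<^sub>R v x))\<^sup>2) \<le> norm (2 * a\<^sup>2 * (norm (u x))\<^sup>2 + 2 * b\<^sup>2 * (norm (v x))\<^sup>2)"
        by simp
    qed
  qed
  with m show ?thesis by (simp add: L2_def)
qed

lemma L2_norm_sq_lincomb_le:
  assumes "u \<in> L2 D" "v \<in> L2 D"
  shows "(L2_norm D (\<lambda>x. a *\<^sub>R u x + b *\<^sub>R v x))\<^sup>2 \<le> 2 * a\<^sup>2 * (L2_norm D u)\<^sup>2 + 2 * b\<^sup>2 * (L2_norm D v)\<^sup>2"
proof -
  have "(\<integral>x. (norm (a *\<^sub>R u x + b *\<^sub>R v x))\<^sup>2 \<partial>lebesgue_on D)
     \<le> (\<integral>x. 2 * a\<^sup>2 * (norm (u x))\<^sup>2 + 2 * b\<^sup>2 * (norm (v x))\<^sup>2 \<partial>lebesgue_on D)"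
  proof (rule integral_mono)
    fix x
    have "(norm (a *\<^sub>R u x + b *\<^sub>R v x))\<^sup>2 \<le> (\<bar>a\<bar> * norm (u x) + \<bar>b\<bar> * norm (v x))\<^sup>2"
      by (intro power_mono order_trans[OF norm_triangle_ineq]) auto
    also have "\<dots> \<le> 2 * a\<^sup>2 * (norm (u x))\<^sup>2 + 2 * b\<^sup>2 * (norm (v x))\<^sup>2"
      using sum_squares_bound[of "\<bar>a\<bar> * norm (u x)" "\<bar>b\<bar> * norm (v x)"]
      by (simp add: power2_sum power_mult_distrib)
    finally show "(norm (a *\<^sub>R u x + b *\<^sub>R v x))\<^sup>2 \<le> 2 * a\<^sup>2 * (norm (u x))\<^sup>2 + 2 * b\<^sup>2 * (norm (v x))\<^sup>2" .
  qed (use assms L2_square_integrable[OF L2_lincomb[OF assms]] in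
      \<open>auto intro!: Bochner_Integration.integrable_add integrable_mult_right L2_square_integrable\<close>)
  also have "\<dots> = 2 * a\<^sup>2 * (L2_norm D u)\<^sup>2 + 2 * b\<^sup>2 * (L2_norm D v)\<^sup>2"
    using assms by (simp add: L2_square_integrable L2_norm_power2)
  finally show ?thesis by (simp add: L2_norm_power2)
qed

lemma L2_norm_cong_AE:
  assumes "AE x in lebesgue_on D. u x = v x" "u \<in> borel_measurable (lebesgue_on D)" "v \<in> borel_measurable (lebesgue_on D)"
  shows "L2_norm D u = L2_norm D v"
  unfolding L2_norm_def L2_inner_def
  by (intro arg_cong[where f=sqrt] integral_cong_AE) (use assms in auto)

lemma L2_nth: "u \<in> L2 D \<Longrightarrow> (\<lambda>x. u x $ i) \<in> L2 D"
  for u :: "real^'d \<Rightarrow> 'b::euclidean_space^'n"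
proof -
  assume u: "u \<in> L2 D"
  have m: "(\<lambda>x. u x $ i) \<in> borel_measurable (lebesgue_on D)"
    by (rule borel_measurable_continuous_on[OF linear_continuous_on[OF bounded_linear_vec_nth] L2_measurable[OF u]])
  have "integrable (lebesgue_on D) (\<lambda>x. (norm (u x $ i))\<^sup>2)"
    by (rule Bochner_Integration.integrable_bound[OF L2_square_integrable[OF u]])
       (use m in \<open>auto intro!: always_eventually power_mono Finite_Cartesian_Product.norm_nth_le\<close>)
  with m show ?thesis by (simp add: L2_def)
qed

lemma L2_integrable: "u \<in> L2 D \<Longrightarrow> integrable (lebesgue_on D) u"
  for u :: "real^'d \<Rightarrow> real"
  using L2_inner_integrable[OF _ essbdd_L2[OF essbdd_const[of "1::real"]]] by simp

lemma test_function_essbdd: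
  assumes "\<phi> \<in> test_functions D"
  shows "essbdd \<phi>" "essbdd (partial i \<phi>)"
proof -
  obtain K L B where *: "compact K" "K \<subseteq> D" "\<And>x. x \<notin> K \<Longrightarrow> \<phi> x = 0" "\<And>x i. x \<notin> K \<Longrightarrow> partial i \<phi> x = 0"
    "L-lipschitz_on UNIV \<phi>" "\<And>x. \<bar>\<phi> x\<bar> \<le> B" "\<And>x i. \<bar>partial i \<phi> x\<bar> \<le> B" "smooth \<phi>" "0 \<le> B"
    by (rule test_function_facts[OF assms]) (rule that)
  show "essbdd \<phi>" "essbdd (partial i \<phi>)"
    by (rule essbddI[of _ B]; use * sets_D in
        \<open>auto intro!: continuous_imp_measurable_on_sets_lebesgue smooth_continuous smooth_partial\<close>)+
qed

section \<open>Weak gradients\<close>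

text \<open>All test functions annihilate the difference. Since \<open>grad\<close> is an arbitrary
  choice among the weak gradients, this is why formulas for \<open>grad\<close> hold almost
  everywhere.\<close>

lemma has_weak_gradient_unique:
  assumes "has_weak_gradient D v G" "has_weak_gradient D v G'"
  shows "AE x in lebesgue_on D. G x = G' x"
proof -
  have L: "(\<lambda>x. G x $ i $ j) \<in> L2 D" "(\<lambda>x. G' x $ i $ j) \<in> L2 D" for i j
    using assms L2_nth[OF L2_nth] by (auto simp: has_weak_gradient_def)
  have "AE x in lebesgue_on D. G x $ i $ j - G' x $ i $ j = 0" for i j
  proof (rule AE_zero_if_test_integrals_zero[OF open_D])
    show "integrable (lebesgue_on D) (\<lambda>x. G x $ i $ j - G' x $ i $ j)"
      using L by (intro Bochner_Integration.integrable_diff L2_integrable)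
    fix \<phi> assume \<phi>: "\<phi> \<in> test_functions D"
    have "integrable (lebesgue_on D) (\<lambda>x. G x $ i $ j * \<phi> x)" "integrable (lebesgue_on D) (\<lambda>x. G' x $ i $ j * \<phi> x)"
      using L2_inner_integrable[OF L(1) essbdd_L2[OF test_function_essbdd(1)[OF \<phi>]]]
        L2_inner_integrable[OF L(2) essbdd_L2[OF test_function_essbdd(1)[OF \<phi>]]] by simp_all
    then show "(\<integral>x. (G x $ i $ j - G' x $ i $ j) * \<phi> x \<partial>lebesgue_on D) = 0"
      using assms \<phi> by (simp add: left_diff_distrib has_weak_gradient_def)
  qed
  then have "AE x in lebesgue_on D. \<forall>i j. G x $ i $ j - G' x $ i $ j = 0"
    by (simp add: AE_all_countable)
  then show ?thesis by eventually_elim (simp add: vec_eq_iff)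
qed

lemma has_weak_gradient_lincomb:
  assumes "has_weak_gradient D u G" "has_weak_gradient D v G'"
  shows "has_weak_gradient D (\<lambda>x. a *\<^sub>R u x + b *\<^sub>R v x) (\<lambda>x. a *\<^sub>R G x + b *\<^sub>R G' x)"
  unfolding has_weak_gradient_def
proof (intro conjI ballI allI)
  show "(\<lambda>x. a *\<^sub>R u x + b *\<^sub>R v x) \<in> L2 D" "(\<lambda>x. a *\<^sub>R G x + b *\<^sub>R G' x) \<in> L2 D"
    using assms by (auto simp: has_weak_gradient_def intro: L2_lincomb)
  fix \<phi> i j assume \<phi>: "\<phi> \<in> test_functions D"
  have L: "(\<lambda>x. u x $ i) \<in> L2 D" "(\<lambda>x. v x $ i) \<in> L2 D" "(\<lambda>x. G x $ i $ j) \<in> L2 D" "(\<lambda>x. G' x $ i $ j) \<in> L2 D"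
    using assms by (auto simp: has_weak_gradient_def intro: L2_nth)
  note e = test_function_essbdd[OF \<phi>, THEN essbdd_L2]
  note I = L2_inner_integrable[OF L(1) e(2)[of j]] L2_inner_integrable[OF L(2) e(2)[of j]]
    L2_inner_integrable[OF L(3) e(1)] L2_inner_integrable[OF L(4) e(1)]
  show "(\<integral>x. (a *\<^sub>R u x + b *\<^sub>R v x) $ i * partial j \<phi> x \<partial>lebesgue_on D) =
     - (\<integral>x. (a *\<^sub>R G x + b *\<^sub>R G' x) $ i $ j * \<phi> x \<partial>lebesgue_on D)"
    using assms \<phi> I by (simp add: has_weak_gradient_def distrib_right mult.assoc)
qed

lemma has_weak_gradient_grad:
  assumes "v \<in> H1 D"
  shows "has_weak_gradient D v (grad D v)"
proof -
  have "\<exists>G. has_weak_gradient D v G" using assms by (simp add: H1_def)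
  then show ?thesis unfolding grad_def by (rule someI_ex)
qed

lemma grad_AE_eqI: "has_weak_gradient D v G \<Longrightarrow> AE x in lebesgue_on D. grad D v x = G x"
  using has_weak_gradient_unique[OF has_weak_gradient_grad] by (auto simp: H1_def)

lemma H1_L2: "v \<in> H1 D \<Longrightarrow> v \<in> L2 D" "v \<in> H1 D \<Longrightarrow> grad D v \<in> L2 D"
  using has_weak_gradient_grad by (auto simp: has_weak_gradient_def)

lemma H1_lincomb:
  assumes "u \<in> H1 D" "v \<in> H1 D"
  shows "(\<lambda>x. a *\<^sub>R u x + b *\<^sub>R v x) \<in> H1 D"
    and "AE x in lebesgue_on D. grad D (\<lambda>x. a *\<^sub>R u x + b *\<^sub>R v x) x = a *\<^sub>R grad D u x + b *\<^sub>R grad D v x"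
proof -
  note * = has_weak_gradient_lincomb[OF assms[THEN has_weak_gradient_grad], of a b]
  show "(\<lambda>x. a *\<^sub>R u x + b *\<^sub>R v x) \<in> H1 D" using * by (auto simp: H1_def)
  show "AE x in lebesgue_on D. grad D (\<lambda>x. a *\<^sub>R u x + b *\<^sub>R v x) x = a *\<^sub>R grad D u x + b *\<^sub>R grad D v x"
    using grad_AE_eqI[OF *] .
qed

lemma H1_inner_self: "H1_inner D u u = (L2_norm D u)\<^sup>2 + (L2_norm D (grad D u))\<^sup>2"
  unfolding H1_inner_def L2_inner_def L2_norm_power2 by (simp add: power2_norm_eq_inner)

lemma H1_inner_lincomb_le:
  assumes "u \<in> H1 D" "v \<in> H1 D"
  shows "H1_inner D (\<lambda>x. a *\<^sub>R u x + b *\<^sub>R v x) (\<lambda>x. a *\<^sub>R u x + b *\<^sub>R v x)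
     \<le> 2 * a\<^sup>2 * H1_inner D u u + 2 * b\<^sup>2 * H1_inner D v v"
proof -
  have "L2_norm D (grad D (\<lambda>x. a *\<^sub>R u x + b *\<^sub>R v x)) = L2_norm D (\<lambda>x. a *\<^sub>R grad D u x + b *\<^sub>R grad D v x)"
    using assms H1_L2(2)[OF H1_lincomb(1)[OF assms]] L2_lincomb[OF assms[THEN H1_L2(2)]]
    by (intro L2_norm_cong_AE H1_lincomb(2)) (auto intro: L2_measurable)
  then show ?thesis
    using L2_norm_sq_lincomb_le[OF assms[THEN H1_L2(1)], of a b]
      L2_norm_sq_lincomb_le[OF assms[THEN H1_L2(2)], of a b]
    by (simp add: H1_inner_self algebra_simps)
qed

lemma test_vector_weak_gradient:
  assumes \<phi>: "\<And>i. (\<lambda>x. \<phi> x $ i) \<in> test_functions D"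
  shows "has_weak_gradient D \<phi> (\<lambda>x. \<chi> i j. partial j (\<lambda>x. \<phi> x $ i) x)"
  unfolding has_weak_gradient_def
proof (intro conjI ballI allI)
  have s: "smooth (\<lambda>x. \<phi> x $ i)" for i using \<phi> by (simp add: test_functions_def)
  have e: "essbdd (\<lambda>x. \<phi> x $ i)" "essbdd (\<lambda>x. partial j (\<lambda>x. \<phi> x $ i) x)" for i j
    using test_function_essbdd[OF \<phi>] by auto
  show "\<phi> \<in> L2 D" by (intro essbdd_L2 essbdd_vecI e)
  show "(\<lambda>x. \<chi> i j. partial j (\<lambda>x. \<phi> x $ i) x) \<in> L2 D"
    by (intro essbdd_L2 essbdd_vecI) (simp add: e)
  fix \<psi> i j assume \<psi>: "\<psi> \<in> test_functions D"
  obtain L where L: "L-lipschitz_on UNIV (\<lambda>x. \<phi> x $ i)" using test_function_facts[OF \<phi>[of i]] .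
  have "(\<integral>x. partial j \<psi> x * \<phi> x $ i + \<psi> x * partial j (\<lambda>x. \<phi> x $ i) x \<partial>lebesgue_on D) = 0"
  proof (rule test_function_integration_by_parts[OF open_D bounded_D \<psi>])
    show "L-lipschitz_on D (\<lambda>x. \<phi> x $ i)" using L by (rule lipschitz_on_subset) simp
    show "AE x in lebesgue_on D. \<exists>\<psi>'. ((\<lambda>x. \<phi> x $ i) has_derivative \<psi>') (at x) \<and>
        partial j (\<lambda>x. \<phi> x $ i) x = \<psi>' (axis j 1)"
      by (rule always_eventually, rule allI, rule exI, rule conjI, rule smooth_has_derivative[OF s],
          rule partial_eqI[OF smooth_has_derivative[OF s]])
    show "(\<lambda>x. partial j (\<lambda>x. \<phi> x $ i) x) \<in> borel_measurable (lebesgue_on D)"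
      using e(2) by (rule essbdd_measurable)
  qed
  moreover have "integrable (lebesgue_on D) (\<lambda>x. partial j \<psi> x * \<phi> x $ i)"
    "integrable (lebesgue_on D) (\<lambda>x. \<psi> x * partial j (\<lambda>x. \<phi> x $ i) x)"
    by (rule essbdd_integrable, rule essbdd_mult, rule test_function_essbdd[OF \<psi>], rule e,
        rule essbdd_integrable, rule essbdd_mult, rule test_function_essbdd[OF \<psi>], rule e)
  ultimately show "(\<integral>x. \<phi> x $ i * partial j \<psi> x \<partial>lebesgue_on D) =
     - (\<integral>x. (\<chi> i j. partial j (\<lambda>x. \<phi> x $ i) x) $ i $ j * \<psi> x \<partial>lebesgue_on D)"
    by (simp add: mult.commute)
qed

section \<open>Fields with vanishing boundary values\<close>

lemma H10_lincomb:
  assumes u: "u \<in> H10 D" and v: "v \<in> H10 D"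
  shows "(\<lambda>x. a *\<^sub>R u x + b *\<^sub>R v x) \<in> H10 D"
proof -
  have uH: "u \<in> H1 D" and vH: "v \<in> H1 D" using u v by (auto simp: H10_def)
  have "\<exists>\<phi>. (\<forall>i. (\<lambda>x. \<phi> x $ i) \<in> test_functions D) \<and>
     sqrt (H1_inner D (\<lambda>x. a *\<^sub>R u x + b *\<^sub>R v x - \<phi> x) (\<lambda>x. a *\<^sub>R u x + b *\<^sub>R v x - \<phi> x)) < \<epsilon>"
    if \<epsilon>: "0 < \<epsilon>" for \<epsilon>
  proof -
    \<comment> \<open>The denominator dominates the factor that the combination puts on
      \<open>\<delta>\<close>, because \<open>a^2 + b^2\<close> is below twice the square of
      \<open>\<bar>a\<bar> + \<bar>b\<bar> + 1\<close>; the 1 keeps it positive.\<close>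
    define \<delta> where "\<delta> = \<epsilon> / (2 * (\<bar>a\<bar> + \<bar>b\<bar> + 1))"
    have \<delta>: "0 < \<delta>" using \<epsilon> by (simp add: \<delta>_def)
    obtain p q where p: "\<And>i. (\<lambda>x. p x $ i) \<in> test_functions D" "sqrt (H1_inner D (\<lambda>x. u x - p x) (\<lambda>x. u x - p x)) < \<delta>"
      and q: "\<And>i. (\<lambda>x. q x $ i) \<in> test_functions D" "sqrt (H1_inner D (\<lambda>x. v x - q x) (\<lambda>x. v x - q x)) < \<delta>"
      using u v \<delta> unfolding H10_def by blast
    have pH: "p \<in> H1 D" "q \<in> H1 D"
      using test_vector_weak_gradient[OF p(1)] test_vector_weak_gradient[OF q(1)] by (auto simp: H1_def)
    have up: "(\<lambda>x. u x - p x) \<in> H1 D" "(\<lambda>x. v x - q x) \<in> H1 D"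
      using H1_lincomb(1)[OF uH pH(1), of 1 "-1"] H1_lincomb(1)[OF vH pH(2), of 1 "-1"] by simp_all
    have sq: "H < \<delta>\<^sup>2" if "sqrt H < \<delta>" for H
    proof -
      have "sqrt H < sqrt (\<delta>\<^sup>2)" using that \<delta> by simp
      then show ?thesis by (simp only: real_sqrt_less_iff)
    qed
    define w where "w = (\<lambda>x. a *\<^sub>R p x + b *\<^sub>R q x)"
    have eq: "(\<lambda>x. a *\<^sub>R u x + b *\<^sub>R v x - w x) = (\<lambda>x. a *\<^sub>R (u x - p x) + b *\<^sub>R (v x - q x))"
      by (simp add: w_def algebra_simps fun_eq_iff)
    have "H1_inner D (\<lambda>x. a *\<^sub>R u x + b *\<^sub>R v x - w x) (\<lambda>x. a *\<^sub>R u x + b *\<^sub>R v x - w x)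
        \<le> 2 * a\<^sup>2 * H1_inner D (\<lambda>x. u x - p x) (\<lambda>x. u x - p x) + 2 * b\<^sup>2 * H1_inner D (\<lambda>x. v x - q x) (\<lambda>x. v x - q x)"
      unfolding eq by (rule H1_inner_lincomb_le[OF up])
    also have "\<dots> \<le> 2 * a\<^sup>2 * \<delta>\<^sup>2 + 2 * b\<^sup>2 * \<delta>\<^sup>2"
      using sq[OF p(2)] sq[OF q(2)] by (intro add_mono mult_left_mono) auto
    also have "\<dots> < (2 * (\<bar>a\<bar> + \<bar>b\<bar> + 1) * \<delta>)\<^sup>2"
    proof -
      have "a\<^sup>2 + b\<^sup>2 < 2 * (\<bar>a\<bar> + \<bar>b\<bar> + 1)\<^sup>2"
      proof -
        have "\<bar>a\<bar>\<^sup>2 \<le> (\<bar>a\<bar> + \<bar>b\<bar> + 1)\<^sup>2" by (rule power_mono) auto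
        moreover have "\<bar>b\<bar>\<^sup>2 < (\<bar>a\<bar> + \<bar>b\<bar> + 1)\<^sup>2" by (rule power_strict_mono) auto
        ultimately show ?thesis by simp
      qed
      then have "2 * (a\<^sup>2 + b\<^sup>2) * \<delta>\<^sup>2 < 4 * (\<bar>a\<bar> + \<bar>b\<bar> + 1)\<^sup>2 * \<delta>\<^sup>2" using \<delta> by simp
      moreover have "(2 * (\<bar>a\<bar> + \<bar>b\<bar> + 1) * \<delta>)\<^sup>2 = 4 * (\<bar>a\<bar> + \<bar>b\<bar> + 1)\<^sup>2 * \<delta>\<^sup>2"
        by (simp only: power_mult_distrib) simp
      ultimately show ?thesis by (simp add: algebra_simps)
    qed
    also have "2 * (\<bar>a\<bar> + \<bar>b\<bar> + 1) * \<delta> = \<epsilon>" unfolding \<delta>_def by (simp add: add_nonneg_eq_0_iff)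
    finally have "sqrt (H1_inner D (\<lambda>x. a *\<^sub>R u x + b *\<^sub>R v x - w x) (\<lambda>x. a *\<^sub>R u x + b *\<^sub>R v x - w x)) < \<epsilon>"
      using \<epsilon> by (intro real_less_lsqrt) auto
    moreover have "(\<lambda>x. w x $ i) \<in> test_functions D" for i
      using test_functions_lincomb[OF p(1) q(1), of a i b i] by (simp add: w_def)
    ultimately show ?thesis by blast
  qed
  then show ?thesis using H1_lincomb(1)[OF uH vH] by (simp add: H10_def)
qed

text \<open>For test vector fields this is known, and since \<open>\<psi>\<close> and
  \<open>g\<close> are bounded, the left-hand side is continuous in the H1 norm; density gives it
  for \<open>u\<close>. The function \<open>\<psi>\<close> may be nonzero on the boundary, which is
  used with constants and with coordinates.\<close>

lemma H10_integration_by_parts: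
  fixes \<psi> :: "real^'d \<Rightarrow> real"
  assumes u: "u \<in> H10 D" and \<psi>: "M-lipschitz_on D \<psi>" and g: "essbdd g"
    and der: "AE x in lebesgue_on D. \<exists>\<psi>'. (\<psi> has_derivative \<psi>') (at x) \<and> g x = \<psi>' (axis j 1)"
  shows "(\<integral>x. u x $ i * g x + grad D u x $ i $ j * \<psi> x \<partial>lebesgue_on D) = 0"
proof -
  have uH: "u \<in> H1 D" using u by (simp add: H10_def)
  have "bounded (\<psi> ` D)"
    using \<psi> bounded_D by (intro bounded_uniformly_continuous_image lipschitz_on_uniformly_continuous)
  then obtain P where P: "0 < P" "\<forall>y\<in>\<psi> ` D. norm y \<le> P" unfolding bounded_pos by blast
  have e\<psi>: "essbdd \<psi>"
  proof (rule essbddI)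
    show "\<psi> \<in> borel_measurable (lebesgue_on D)"
      using lipschitz_on_continuous_on[OF \<psi>] sets_D by (rule continuous_imp_measurable_on_sets_lebesgue)
    show "AE x in lebesgue_on D. norm (\<psi> x) \<le> P"
      unfolding AE_lebesgue_on_iff[OF sets_D] using P(2) by (intro always_eventually) auto
  qed
  obtain B where B: "0 < B" "AE x in lebesgue_on D. norm (g x) \<le> B" using g by (rule essbddE)
  have AP: "AE x in lebesgue_on D. norm (\<psi> x) \<le> P"
    unfolding AE_lebesgue_on_iff[OF sets_D] using P(2) by (intro always_eventually) auto
  define V where "V = L2_norm D (\<lambda>x. 1::real)"
  have V: "0 \<le> V" by (simp add: V_def L2_norm_nonneg)
  define I where "I = (\<lambda>w. \<integral>x. w x $ i * g x + grad D w x $ i $ j * \<psi> x \<partial>lebesgue_on D)"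
  have L1: "(\<lambda>x. 1::real) \<in> L2 D" by (intro essbdd_L2 essbdd_const)
  have b1: "integrable (lebesgue_on D) (\<lambda>x. w x $ i * g x)"
     "\<bar>\<integral>x. w x $ i * g x \<partial>lebesgue_on D\<bar> \<le> B * L2_norm D w * V" if w: "w \<in> H1 D" for w
  proof -
    have m: "(\<lambda>x. w x $ i * g x) \<in> borel_measurable (lebesgue_on D)"
      using L2_measurable[OF L2_nth[OF H1_L2(1)[OF w]]] essbdd_measurable[OF g] by auto
    have a: "AE x in lebesgue_on D. \<bar>w x $ i * g x\<bar> \<le> B * (norm (w x) * norm (1::real))"
      using B(2)
    proof eventually_elim
      case (elim x)
      then show ?case using component_le_norm_cart[of "w x" i] B(1)
        by (simp add: abs_mult mult.commute mult_mono)
    qed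
    note * = integral_bound_L2[OF H1_L2(1)[OF w] L1 m a less_imp_le[OF B(1)]]
    show "integrable (lebesgue_on D) (\<lambda>x. w x $ i * g x)"
     "\<bar>\<integral>x. w x $ i * g x \<partial>lebesgue_on D\<bar> \<le> B * L2_norm D w * V" using * by (auto simp: V_def)
  qed
  have b2: "integrable (lebesgue_on D) (\<lambda>x. grad D w x $ i $ j * \<psi> x)"
     "\<bar>\<integral>x. grad D w x $ i $ j * \<psi> x \<partial>lebesgue_on D\<bar> \<le> P * L2_norm D (grad D w) * V" if w: "w \<in> H1 D" for w
  proof -
    have m: "(\<lambda>x. grad D w x $ i $ j * \<psi> x) \<in> borel_measurable (lebesgue_on D)"
      using L2_measurable[OF L2_nth[OF L2_nth[OF H1_L2(2)[OF w]]]] essbdd_measurable[OF e\<psi>] by auto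
    have a: "AE x in lebesgue_on D. \<bar>grad D w x $ i $ j * \<psi> x\<bar> \<le> P * (norm (grad D w x) * norm (1::real))"
      using AP
    proof eventually_elim
      case (elim x)
      have "\<bar>grad D w x $ i $ j\<bar> \<le> norm (grad D w x)"
        using component_le_norm_cart[of "grad D w x $ i" j] Finite_Cartesian_Product.norm_nth_le[where x="grad D w x" and i=i] by linarith
      then show ?case using elim P(1) by (simp add: abs_mult mult.commute mult_mono)
    qed
    note * = integral_bound_L2[OF H1_L2(2)[OF w] L1 m a less_imp_le[OF P(1)]]
    show "integrable (lebesgue_on D) (\<lambda>x. grad D w x $ i $ j * \<psi> x)"
     "\<bar>\<integral>x. grad D w x $ i $ j * \<psi> x \<partial>lebesgue_on D\<bar> \<le> P * L2_norm D (grad D w) * V" using * by (auto simp: V_def)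
  qed
  have small: "\<bar>I u\<bar> \<le> (B + P) * V * \<epsilon>" if \<epsilon>: "0 < \<epsilon>" for \<epsilon>
  proof -
    obtain p where p: "\<And>i. (\<lambda>x. p x $ i) \<in> test_functions D" "sqrt (H1_inner D (\<lambda>x. u x - p x) (\<lambda>x. u x - p x)) < \<epsilon>"
      using u \<epsilon> unfolding H10_def by blast
    note pw = test_vector_weak_gradient[OF p(1)]
    have pH: "p \<in> H1 D" using pw by (auto simp: H1_def)
    define w where "w = (\<lambda>x. u x - p x)"
    have wH: "w \<in> H1 D" and gw: "AE x in lebesgue_on D. grad D w x = grad D u x - grad D p x"
      using H1_lincomb[OF uH pH, of 1 "-1"] by (simp_all add: w_def)
    have gp: "AE x in lebesgue_on D. grad D p x = (\<chi> i j. partial j (\<lambda>x. p x $ i) x)"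
      using grad_AE_eqI[OF pw] .
    have "I p = (\<integral>x. partial j (\<lambda>x. p x $ i) x * \<psi> x + p x $ i * g x \<partial>lebesgue_on D)"
      unfolding I_def
    proof (rule integral_cong_AE)
      show "(\<lambda>x. p x $ i * g x + grad D p x $ i $ j * \<psi> x) \<in> borel_measurable (lebesgue_on D)"
        using b1(1)[OF pH] b2(1)[OF pH] by auto
      show "(\<lambda>x. partial j (\<lambda>x. p x $ i) x * \<psi> x + p x $ i * g x) \<in> borel_measurable (lebesgue_on D)"
        using test_function_essbdd[OF p(1)[of i]] e\<psi> g
        by (intro essbdd_measurable essbdd_add essbdd_mult) auto
      show "AE x in lebesgue_on D. p x $ i * g x + grad D p x $ i $ j * \<psi> x = partial j (\<lambda>x. p x $ i) x * \<psi> x + p x $ i * g x"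
        using gp by eventually_elim simp
    qed
    also have "\<dots> = 0"
      by (rule test_function_integration_by_parts[OF open_D bounded_D p(1) \<psi> der essbdd_measurable[OF g]])
    finally have Ip: "I p = 0" .
    have "I w = I u - I p"
    proof -
      have "I w = (\<integral>x. (u x $ i * g x + grad D u x $ i $ j * \<psi> x) - (p x $ i * g x + grad D p x $ i $ j * \<psi> x) \<partial>lebesgue_on D)"
        unfolding I_def
      proof (rule integral_cong_AE)
        show "AE x in lebesgue_on D. w x $ i * g x + grad D w x $ i $ j * \<psi> x =
           (u x $ i * g x + grad D u x $ i $ j * \<psi> x) - (p x $ i * g x + grad D p x $ i $ j * \<psi> x)"
          using gw
        proof eventually_elim
          case (elim x)
          have "w x = u x - p x" by (simp add: w_def)
          then show ?case unfolding elim by (simp add: left_diff_distrib)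
        qed
      qed (use b1(1)[OF uH] b2(1)[OF uH] b1(1)[OF pH] b2(1)[OF pH] b1(1)[OF wH] b2(1)[OF wH] in auto)
      then show ?thesis unfolding I_def
        using b1(1)[OF uH] b2(1)[OF uH] b1(1)[OF pH] b2(1)[OF pH] by simp
    qed
    then have "\<bar>I u\<bar> = \<bar>I w\<bar>" using Ip by simp
    also have "\<dots> \<le> \<bar>\<integral>x. w x $ i * g x \<partial>lebesgue_on D\<bar> + \<bar>\<integral>x. grad D w x $ i $ j * \<psi> x \<partial>lebesgue_on D\<bar>"
      unfolding I_def using b1(1)[OF wH] b2(1)[OF wH] by (simp add: abs_triangle_ineq)
    also have "\<dots> \<le> B * L2_norm D w * V + P * L2_norm D (grad D w) * V"
      using b1(2)[OF wH] b2(2)[OF wH] by (rule add_mono)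
    also have "\<dots> \<le> B * \<epsilon> * V + P * \<epsilon> * V"
    proof -
      have "L2_norm D w \<le> sqrt (H1_inner D w w)" "L2_norm D (grad D w) \<le> sqrt (H1_inner D w w)"
        by (auto simp: H1_inner_self intro!: real_le_rsqrt)
      then have "L2_norm D w \<le> \<epsilon>" "L2_norm D (grad D w) \<le> \<epsilon>" using p(2) by (auto simp: w_def)
      then show ?thesis using B(1) P(1) V by (intro add_mono mult_right_mono mult_left_mono) auto
    qed
    finally show ?thesis by (simp add: algebra_simps)
  qed
  have "I u = 0"
  proof (rule ccontr)
    assume "I u \<noteq> 0"
    define c where "c = (B + P) * V + 1"
    have c: "0 < c" using B(1) P(1) V by (simp add: c_def add_nonneg_pos)
    have "\<bar>I u\<bar> \<le> (B + P) * V * (\<bar>I u\<bar> / (2 * c))"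
      using \<open>I u \<noteq> 0\<close> c by (intro small) simp
    also have "\<dots> \<le> c * (\<bar>I u\<bar> / (2 * c))" using c by (intro mult_right_mono) (auto simp: c_def)
    also have "\<dots> = \<bar>I u\<bar> / 2" using c by simp
    finally show False using \<open>I u \<noteq> 0\<close> by simp
  qed
  then show ?thesis by (simp add: I_def)
qed

end


section \<open>Polynomials\<close>

definition monomial :: "('d \<Rightarrow> nat) \<Rightarrow> real^'d \<Rightarrow> real" where
  "monomial \<alpha> x = (\<Prod>i\<in>UNIV. (x $ i) ^ \<alpha> i)"

lemma finite_multi_indices: "finite {\<alpha> :: 'd::finite \<Rightarrow> nat. (\<Sum>i\<in>UNIV. \<alpha> i) \<le> k}"
proof (rule finite_subset)
  show "{\<alpha> :: 'd \<Rightarrow> nat. (\<Sum>i\<in>UNIV. \<alpha> i) \<le> k} \<subseteq> (\<Pi>\<^sub>E i\<in>UNIV. {..k})"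
  proof
    fix \<alpha> :: "'d \<Rightarrow> nat" assume "\<alpha> \<in> {\<alpha>. (\<Sum>i\<in>UNIV. \<alpha> i) \<le> k}"
    then have "\<alpha> i \<le> k" for i using member_le_sum[of i UNIV \<alpha>] by simp
    then show "\<alpha> \<in> (\<Pi>\<^sub>E i\<in>UNIV. {..k})" by (simp add: PiE_def)
  qed
  show "finite (\<Pi>\<^sub>E i\<in>(UNIV::'d set). {..k})" by (rule finite_PiE) auto
qed

lemma polys_iff: "p \<in> polys k \<longleftrightarrow> (\<exists>c. p = (\<lambda>x. \<Sum>\<alpha> | (\<Sum>i\<in>UNIV. \<alpha> i) \<le> k. c \<alpha> * monomial \<alpha> x))"
  by (auto simp: polys_def monomial_def fun_eq_iff)

lemma monomial_in_polys:
  assumes "(\<Sum>i\<in>UNIV. \<alpha> i) \<le> k"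
  shows "monomial \<alpha> \<in> polys k"
proof -
  have "monomial \<alpha> = (\<lambda>x. \<Sum>\<beta> | (\<Sum>i\<in>UNIV. \<beta> i) \<le> k. (if \<beta> = \<alpha> then 1 else 0) * monomial \<beta> x)"
  proof
    fix x :: "real^'a"
    have "(\<Sum>\<beta> | (\<Sum>i\<in>UNIV. \<beta> i) \<le> k. (if \<beta> = \<alpha> then 1 else 0) * monomial \<beta> x)
        = (\<Sum>\<beta> | (\<Sum>i\<in>UNIV. \<beta> i) \<le> k. if \<beta> = \<alpha> then monomial \<beta> x else 0)"
      by (rule sum.cong) auto
    then show "monomial \<alpha> x = (\<Sum>\<beta> | (\<Sum>i\<in>UNIV. \<beta> i) \<le> k. (if \<beta> = \<alpha> then 1 else 0) * monomial \<beta> x)"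
      using assms by (simp add: finite_multi_indices)
  qed
  then show ?thesis unfolding polys_iff by (intro exI)
qed

lemma polys_zero: "(\<lambda>x. 0) \<in> polys k"
  unfolding polys_iff by (rule exI[of _ "\<lambda>_. 0"]) simp

lemma polys_add:
  assumes "p \<in> polys k" "q \<in> polys k"
  shows "(\<lambda>x. p x + q x) \<in> polys k"
proof -
  obtain c d where "p = (\<lambda>x. \<Sum>\<alpha> | (\<Sum>i\<in>UNIV. \<alpha> i) \<le> k. c \<alpha> * monomial \<alpha> x)"
     "q = (\<lambda>x. \<Sum>\<alpha> | (\<Sum>i\<in>UNIV. \<alpha> i) \<le> k. d \<alpha> * monomial \<alpha> x)"
    using assms unfolding polys_iff by blast
  then show ?thesis unfolding polys_iff
    by (intro exI[of _ "\<lambda>\<alpha>. c \<alpha> + d \<alpha>"]) (simp add: sum.distrib distrib_right)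
qed

lemma polys_mult_const:
  assumes "p \<in> polys k"
  shows "(\<lambda>x. c * p x) \<in> polys k"
proof -
  obtain d where "p = (\<lambda>x. \<Sum>\<alpha> | (\<Sum>i\<in>UNIV. \<alpha> i) \<le> k. d \<alpha> * monomial \<alpha> x)"
    using assms unfolding polys_iff by blast
  then show ?thesis unfolding polys_iff
    by (intro exI[of _ "\<lambda>\<alpha>. c * d \<alpha>"]) (simp add: sum_distrib_left mult.assoc)
qed

lemma polys_sum: "(\<And>i. i \<in> I \<Longrightarrow> p i \<in> polys k) \<Longrightarrow> (\<lambda>x. \<Sum>i\<in>I. p i x) \<in> polys k"
  by (induction I rule: infinite_finite_induct) (auto intro: polys_zero polys_add)

lemma monomial_has_derivative:
  "(monomial \<alpha> has_derivative
     (\<lambda>h. \<Sum>i\<in>UNIV. of_nat (\<alpha> i) * (h $ i) * (x $ i) ^ (\<alpha> i - 1) * (\<Prod>j\<in>UNIV - {i}. (x $ j) ^ \<alpha> j))) (at x)"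
  unfolding monomial_def[abs_def]
  by (rule has_derivative_prod) (auto intro!: derivative_eq_intros bounded_linear_imp_has_derivative[OF bounded_linear_vec_nth])

lemma partial_monomial:
  fixes \<alpha> :: "'d::finite \<Rightarrow> nat"
  shows "partial j (monomial \<alpha>) = (\<lambda>x. of_nat (\<alpha> j) * monomial (\<alpha>(j := \<alpha> j - 1)) x)"
proof
  fix x :: "real^'d"
  have "partial j (monomial \<alpha>) x = (\<Sum>i\<in>UNIV. of_nat (\<alpha> i) * (axis j 1 $ i) * (x $ i) ^ (\<alpha> i - 1) * (\<Prod>l\<in>UNIV - {i}. (x $ l) ^ \<alpha> l))"
    by (rule partial_eqI[OF monomial_has_derivative])
  also have "\<dots> = (\<Sum>i\<in>UNIV. if i = j then of_nat (\<alpha> j) * (x $ j) ^ (\<alpha> j - 1) * (\<Prod>l\<in>UNIV - {j}. (x $ l) ^ \<alpha> l) else 0)"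
    by (rule sum.cong) (auto simp: axis_def)
  also have "\<dots> = of_nat (\<alpha> j) * ((x $ j) ^ (\<alpha> j - 1) * (\<Prod>l\<in>UNIV - {j}. (x $ l) ^ \<alpha> l))"
    by (simp add: sum.delta)
  also have "(x $ j) ^ (\<alpha> j - 1) * (\<Prod>l\<in>UNIV - {j}. (x $ l) ^ \<alpha> l) = monomial (\<alpha>(j := \<alpha> j - 1)) x"
    unfolding monomial_def by (subst prod.remove[of UNIV j]) (auto intro!: prod.cong)
  finally show "partial j (monomial \<alpha>) x = of_nat (\<alpha> j) * monomial (\<alpha>(j := \<alpha> j - 1)) x" .
qed

lemma partial_poly:
  assumes "p \<in> polys k"
  shows "partial j p \<in> polys (k - 1)" and "p differentiable (at x)"
proof -
  obtain c where p: "p = (\<lambda>x. \<Sum>\<alpha> | (\<Sum>i\<in>UNIV. \<alpha> i) \<le> k. c \<alpha> * monomial \<alpha> x)"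
    using assms unfolding polys_iff by blast
  have d: "(p has_derivative (\<lambda>h. \<Sum>\<alpha> | (\<Sum>i\<in>UNIV. \<alpha> i) \<le> k. c \<alpha> * frechet_derivative (monomial \<alpha>) (at x) h)) (at x)" for x
  proof -
    have "(monomial \<alpha> has_derivative frechet_derivative (monomial \<alpha>) (at x)) (at x)" for \<alpha>
      using differentiableI[OF monomial_has_derivative] by (simp add: frechet_derivative_works[symmetric])
    then show ?thesis unfolding p by (intro has_derivative_sum has_derivative_mult_right)
  qed
  then show "p differentiable (at x)" by (rule differentiableI)
  have e: "partial j p = (\<lambda>x. \<Sum>\<alpha> | (\<Sum>i\<in>UNIV. \<alpha> i) \<le> k. c \<alpha> * partial j (monomial \<alpha>) x)"
    by (rule ext, subst partial_eqI[OF d]) (simp only: partial_def)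
  have m: "(\<lambda>x. c \<alpha> * partial j (monomial \<alpha>) x) \<in> polys (k - 1)" if "(\<Sum>i\<in>UNIV. \<alpha> i) \<le> k" for \<alpha>
  proof (cases "\<alpha> j = 0")
    case True
    then show ?thesis by (simp add: partial_monomial polys_zero)
  next
    case False
    have "(\<Sum>i\<in>UNIV. (\<alpha>(j := \<alpha> j - 1)) i) = (\<alpha> j - 1) + (\<Sum>i\<in>UNIV - {j}. \<alpha> i)"
      by (subst sum.remove[of UNIV j]) (auto intro!: sum.cong)
    moreover have "(\<Sum>i\<in>UNIV. \<alpha> i) = \<alpha> j + (\<Sum>i\<in>UNIV - {j}. \<alpha> i)"
      by (subst sum.remove[of UNIV j]) auto
    ultimately have "(\<Sum>i\<in>UNIV. (\<alpha>(j := \<alpha> j - 1)) i) \<le> k - 1" using that False by linarith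
    then show ?thesis unfolding partial_monomial by (intro polys_mult_const monomial_in_polys)
  qed
  show "partial j p \<in> polys (k - 1)" unfolding e by (rule polys_sum) (use m in simp)
qed

lemma polys_continuous: "p \<in> polys k \<Longrightarrow> continuous_on S p"
  by (intro continuous_at_imp_continuous_on ballI differentiable_imp_continuous_within partial_poly(2))

section \<open>Inverse estimates for a single polynomial\<close>

text \<open>Reduces estimates in several variables to polynomials in one variable, which
  \<open>k + 1\<close> values determine.\<close>

lemma polys_line_restriction:
  assumes "p \<in> polys k"
  obtains g :: "real poly" where "degree g \<le> k" "\<And>t. poly g t = p (x + t *\<^sub>R y)"
proof -
  obtain c where p: "p = (\<lambda>x. \<Sum>\<alpha> | (\<Sum>i\<in>UNIV. \<alpha> i) \<le> k. c \<alpha> * monomial \<alpha> x)"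
    using assms unfolding polys_iff by blast
  define g where "g = (\<Sum>\<alpha> | (\<Sum>i\<in>UNIV. \<alpha> i) \<le> k. smult (c \<alpha>) (\<Prod>i\<in>UNIV. [:x $ i, y $ i:] ^ \<alpha> i))"
  have "degree g \<le> k"
    unfolding g_def
  proof (rule degree_sum_le[OF finite_multi_indices])
    fix \<alpha> :: "'a \<Rightarrow> nat" assume "\<alpha> \<in> {\<alpha>. (\<Sum>i\<in>UNIV. \<alpha> i) \<le> k}"
    have "degree (smult (c \<alpha>) (\<Prod>i\<in>UNIV. [:x $ i, y $ i:] ^ \<alpha> i)) \<le> degree (\<Prod>i\<in>UNIV. [:x $ i, y $ i:] ^ \<alpha> i)"
      by (rule degree_smult_le)
    also have "\<dots> \<le> (\<Sum>i\<in>UNIV. degree ([:x $ i, y $ i:] ^ \<alpha> i))"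
      using degree_prod_sum_le[of UNIV "\<lambda>i. [:x $ i, y $ i:] ^ \<alpha> i"] by (simp add: o_def)
    also have "\<dots> \<le> (\<Sum>i\<in>UNIV. \<alpha> i)"
    proof (rule sum_mono)
      fix i
      have "degree ([:x $ i, y $ i:] ^ \<alpha> i) \<le> degree [:x $ i, y $ i:] * \<alpha> i" by (rule degree_power_le)
      also have "\<dots> \<le> \<alpha> i" by simp
      finally show "degree ([:x $ i, y $ i:] ^ \<alpha> i) \<le> \<alpha> i" .
    qed
    also have "\<dots> \<le> k" using \<open>\<alpha> \<in> _\<close> by simp
    finally show "degree (smult (c \<alpha>) (\<Prod>i\<in>UNIV. [:x $ i, y $ i:] ^ \<alpha> i)) \<le> k" .
  qed
  moreover have "poly g t = p (x + t *\<^sub>R y)" for t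
    by (simp add: g_def p poly_sum poly_prod monomial_def mult.commute)
  ultimately show thesis by (rule that)
qed

text \<open>Coefficients are controlled by point values, one point at a time by synthetic division.\<close>

lemma coeff_bound_by_values:
  fixes A :: "real set"
  assumes "finite A"
  shows "\<exists>C\<ge>0. \<forall>g. degree g < card A \<longrightarrow> (\<forall>i. \<bar>coeff g i\<bar> \<le> C * (\<Sum>a\<in>A. \<bar>poly g a\<bar>))"
  using assms
proof (induction A rule: finite_induct)
  case empty
  then show ?case by auto
next
  case (insert a A)
  then obtain C where C: "0 \<le> C" "\<And>g i. degree g < card A \<Longrightarrow> \<bar>coeff g i\<bar> \<le> C * (\<Sum>a\<in>A. \<bar>poly g a\<bar>)" by blast
  define E where "E = (\<Sum>b\<in>A. 1 / \<bar>b - a\<bar>)"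
  have E: "0 \<le> E" by (simp add: E_def sum_nonneg)
  define C' where "C' = (\<bar>a\<bar> + 1) * (C * E) + 1"
  have C': "0 \<le> C'" using C(1) E by (simp add: C'_def)
  have "\<bar>coeff g i\<bar> \<le> C' * (\<Sum>a\<in>insert a A. \<bar>poly g a\<bar>)" if deg: "degree g < card (insert a A)" for g i
  proof -
    define S where "S = (\<Sum>a\<in>insert a A. \<bar>poly g a\<bar>)"
    have S: "\<bar>poly g b\<bar> \<le> S" if "b \<in> insert a A" for b
      unfolding S_def using that insert(1) by (intro member_le_sum) auto
    have S0: "0 \<le> S" by (simp add: S_def sum_nonneg)
    define h where "h = synthetic_div g a"
    have g: "g = [:- a, 1:] * h + [:poly g a:]" unfolding h_def by (rule synthetic_div_correct'[symmetric])
    have coh: "\<bar>coeff h i\<bar> \<le> C * E * S" for i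
    proof (cases "A = {}")
      case True
      then have "degree g = 0" using deg by simp
      then have "h = 0" unfolding h_def by (simp add: synthetic_div_eq_0_iff)
      then show ?thesis using C(1) E S0 by simp
    next
      case False
      have "0 < card A" using False insert(1) by (simp add: card_gt_0_iff)
      moreover have "degree g < Suc (card A)" using deg insert(1,2) by simp
      ultimately have "degree h < card A" unfolding h_def degree_synthetic_div by linarith
      then have "\<bar>coeff h i\<bar> \<le> C * (\<Sum>b\<in>A. \<bar>poly h b\<bar>)" by (rule C(2))
      also have "(\<Sum>b\<in>A. \<bar>poly h b\<bar>) \<le> (\<Sum>b\<in>A. (1 / \<bar>b - a\<bar>) * S)"
      proof (rule sum_mono)
        fix b assume b: "b \<in> A"
        then have ba: "b \<noteq> a" using insert(2) by auto
        \<comment> \<open>At the remaining nodes the quotient \<open>h\<close> takes the values of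
          difference quotients of \<open>g\<close>, so the induction hypothesis for \<open>h\<close>
          is fed by values of \<open>g\<close>.\<close>
        have "poly g b = (b - a) * poly h b + poly g a" by (subst g) (simp add: algebra_simps)
        then have "\<bar>b - a\<bar> * \<bar>poly h b\<bar> = \<bar>poly g b - poly g a\<bar>" by (simp add: abs_mult)
        also have "\<dots> \<le> S"
        proof -
          have "\<bar>poly g b\<bar> + \<bar>poly g a\<bar> \<le> S"
          proof -
            have "(\<Sum>x\<in>{a, b}. \<bar>poly g x\<bar>) \<le> S" unfolding S_def using b insert(1) by (intro sum_mono2) auto
            then show ?thesis using ba by simp
          qed
          then show ?thesis by linarith
        qed
        finally show "\<bar>poly h b\<bar> \<le> (1 / \<bar>b - a\<bar>) * S" using ba by (simp add: field_simps)
      qed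
      also have "(\<Sum>b\<in>A. (1 / \<bar>b - a\<bar>) * S) = E * S" by (simp add: E_def sum_distrib_right)
      finally show ?thesis using C(1) by (simp add: mult_left_mono mult.assoc)
    qed
    have "\<bar>coeff ([:- a, 1:] * h) i\<bar> \<le> (\<bar>a\<bar> + 1) * (C * E * S)"
    proof (cases i)
      case 0
      have "\<bar>coeff ([:- a, 1:] * h) i\<bar> = \<bar>a\<bar> * \<bar>coeff h 0\<bar>" using 0 by (simp add: abs_mult)
      also have "\<dots> \<le> \<bar>a\<bar> * (C * E * S)" by (intro mult_left_mono coh) simp
      also have "\<dots> \<le> (\<bar>a\<bar> + 1) * (C * E * S)" using C(1) E S0 by (intro mult_right_mono) auto
      finally show ?thesis .
    next
      case (Suc m)
      have "\<bar>coeff ([:- a, 1:] * h) i\<bar> = \<bar>coeff h m - a * coeff h i\<bar>" using Suc by simp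
      also have "\<dots> \<le> \<bar>coeff h m\<bar> + \<bar>a\<bar> * \<bar>coeff h i\<bar>" 
        using abs_triangle_ineq4[of "coeff h m" "a * coeff h i"] by (simp add: abs_mult)
      also have "\<dots> \<le> C * E * S + \<bar>a\<bar> * (C * E * S)" by (intro add_mono mult_left_mono coh) simp
      finally show ?thesis by (simp add: algebra_simps)
    qed
    moreover have "\<bar>coeff [:poly g a:] i\<bar> \<le> S" using S[of a] S0 by (cases i) auto
    moreover have "\<bar>coeff g i\<bar> \<le> \<bar>coeff ([:- a, 1:] * h) i\<bar> + \<bar>coeff [:poly g a:] i\<bar>"
      using arg_cong[OF g, of "\<lambda>p. coeff p i"] abs_triangle_ineq by (simp only: coeff_add)
    ultimately have "\<bar>coeff g i\<bar> \<le> (\<bar>a\<bar> + 1) * (C * E * S) + S" by linarith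
    then show ?thesis by (simp add: C'_def S_def[symmetric] algebra_simps)
  qed
  with C' show ?case by blast
qed

lemma lborel_integral_affine:
  fixes f :: "'a::euclidean_space \<Rightarrow> real"
  assumes [measurable]: "f \<in> borel_measurable borel" and c: "c \<noteq> 0"
  shows "(\<integral>x. f x \<partial>lborel) = \<bar>c\<bar> ^ DIM('a) * (\<integral>x. f (t + c *\<^sub>R x) \<partial>lborel)"
  by (subst lborel_affine[OF c, of t]) (simp add: integral_density integral_distr)

lemma lborel_integrable_affine:
  fixes f :: "'a::euclidean_space \<Rightarrow> real"
  assumes [measurable]: "f \<in> borel_measurable borel" and c: "c \<noteq> 0" and f: "integrable lborel f"
  shows "integrable lborel (\<lambda>x. f (t + c *\<^sub>R x))"
  using f c by (subst (asm) lborel_affine[OF c, of t]) (simp add: integrable_density integrable_distr_eq)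

text \<open>
  A value far away is extrapolated from values on a line that are close to an arbitrary point
  \<open>y\<close> of the small ball, and the resulting bound is averaged over \<open>y\<close>.
\<close>

lemma polys_value_bound:
  assumes \<sigma>: "0 < \<sigma>"
  shows "\<exists>C>0. \<forall>p\<in>polys k. \<forall>(x0::real^'d) h x. 0 < h \<longrightarrow> x \<in> cball x0 (2 * h) \<longrightarrow>
     (p x)\<^sup>2 \<le> C / h ^ CARD('d) * (\<integral>z. indicator (cball x0 (h / \<sigma>)) z * (p z)\<^sup>2 \<partial>lborel)"
proof -
  \<comment> \<open>The nodes \<open>1 + i * \<epsilon>\<close> lie on the line from
    \<open>x\<close> through \<open>y\<close>, at or just beyond \<open>y\<close>. The overshoot is
    so small that for \<open>y\<close> in the ball of radius \<open>\<rho> / 2\<close> all of them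
    stay in the ball of radius \<open>\<rho>\<close>, although \<open>x\<close> may be at distance
    \<open>2 * h\<close> from its centre.\<close>
  define \<epsilon> where "\<epsilon> = 1 / (real (Suc k) * (4 * \<sigma> + 1))"
  have \<epsilon>: "0 < \<epsilon>" using \<sigma> by (simp add: \<epsilon>_def)
  define A where "A = (\<lambda>i. 1 + real i * \<epsilon>) ` {..k}"
  have A: "finite A" "card A = Suc k"
    unfolding A_def using \<epsilon> by (auto simp: card_image inj_on_def)
  have A1: "1 \<le> a" "(a - 1) * (4 * \<sigma> + 1) \<le> 1" if aA: "a \<in> A" for a
  proof -
    obtain i where i: "i \<le> k" "a = 1 + real i * \<epsilon>" using aA by (auto simp: A_def)
    show "1 \<le> a" using i \<epsilon> by simp
    have "(a - 1) * (4 * \<sigma> + 1) = real i / real (Suc k)" using i \<sigma> by (simp add: \<epsilon>_def)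
    also have "\<dots> \<le> 1" using i by simp
    finally show "(a - 1) * (4 * \<sigma> + 1) \<le> 1" .
  qed
  obtain C1 where C1: "0 \<le> C1" "\<And>g i. degree g < card A \<Longrightarrow> \<bar>coeff g i\<bar> \<le> C1 * (\<Sum>a\<in>A. \<bar>poly g a\<bar>)"
    using coeff_bound_by_values[OF A(1)] by blast
  define w where "w = unit_ball_vol (real CARD('d))"
  have w: "0 < w" unfolding w_def by simp
  \<comment> \<open>The factor \<open>(2 * \<sigma>) ^ CARD('d) / w\<close> is the reciprocal of the
    volume of the ball of averaging, up to the power of \<open>h\<close>; the added 1 makes
    \<open>C\<close> positive.\<close>
  define C where "C = (C1\<^sup>2 * real (Suc k) * real (Suc k) + 1) * (2 * \<sigma>) ^ CARD('d) / w"
  have C: "0 < C" unfolding C_def using w \<sigma> by (intro divide_pos_pos mult_pos_pos add_nonneg_pos) auto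
  have "(p x)\<^sup>2 \<le> C / h ^ CARD('d) * (\<integral>z. indicator (cball x0 (h / \<sigma>)) z * (p z)\<^sup>2 \<partial>lborel)"
    if p: "p \<in> polys k" and h: "0 < h" and x: "x \<in> cball x0 (2 * h)" for p and x0 x :: "real^'d" and h
  proof -
    define \<rho> where "\<rho> = h / \<sigma>"
    have \<rho>: "0 < \<rho>" using h \<sigma> by (simp add: \<rho>_def)
    define q where "q = (\<lambda>z. indicator (cball x0 \<rho>) z * (p z)\<^sup>2)"
    have pm [measurable]: "p \<in> borel_measurable borel"
      using polys_continuous[OF p] by (rule borel_measurable_continuous_onI)
    have qi: "integrable lborel q"
      using borel_integrable_compact[OF compact_cball, of x0 \<rho> "\<lambda>z. (p z)\<^sup>2"] polys_continuous[OF p]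
      by (simp add: q_def continuous_on_power)
    have qm [measurable]: "q \<in> borel_measurable borel" unfolding q_def
      by (intro borel_measurable_times borel_measurable_indicator borel_measurable_power pm) (simp add: borel_closed)
    define J where "J = (\<integral>z. q z \<partial>lborel)"
    have J: "0 \<le> J" unfolding J_def q_def by (intro integral_nonneg_AE) auto
    let ?B = "cball x0 (\<rho> / 2)"
    have pt: "(p x)\<^sup>2 \<le> C1\<^sup>2 * real (Suc k) * (\<Sum>a\<in>A. q ((1 - a) *\<^sub>R x + a *\<^sub>R y))" if y: "y \<in> ?B" for y
    proof -
      obtain g where g: "degree g \<le> k" "\<And>t. poly g t = p (x + t *\<^sub>R (y - x))"
        using polys_line_restriction[OF p] by blast
      have "p x = coeff g 0" using g(2)[of 0] by (simp add: poly_0_coeff_0)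
      then have "\<bar>p x\<bar> \<le> C1 * (\<Sum>a\<in>A. \<bar>poly g a\<bar>)" using C1(2)[of g 0] g(1) A(2) by simp
      then have "(p x)\<^sup>2 \<le> (C1 * (\<Sum>a\<in>A. \<bar>poly g a\<bar>))\<^sup>2"
        using power_mono[of "\<bar>p x\<bar>" _ 2] by simp
      also have "\<dots> = C1\<^sup>2 * (\<Sum>a\<in>A. 1 * \<bar>poly g a\<bar>)\<^sup>2" by (simp add: power_mult_distrib)
      also have "\<dots> \<le> C1\<^sup>2 * ((\<Sum>a\<in>A. 1\<^sup>2) * (\<Sum>a\<in>A. \<bar>poly g a\<bar>\<^sup>2))"
        by (intro mult_left_mono Cauchy_Schwarz_ineq_sum) simp
      also have "\<dots> = C1\<^sup>2 * real (Suc k) * (\<Sum>a\<in>A. (poly g a)\<^sup>2)" using A by simp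
      also have "(\<Sum>a\<in>A. (poly g a)\<^sup>2) = (\<Sum>a\<in>A. q ((1 - a) *\<^sub>R x + a *\<^sub>R y))"
      proof (rule sum.cong[OF refl])
        fix a assume a: "a \<in> A"
        have e: "x + a *\<^sub>R (y - x) = (1 - a) *\<^sub>R x + a *\<^sub>R y" by (simp add: algebra_simps)
        have "dist x0 ((1 - a) *\<^sub>R x + a *\<^sub>R y) \<le> dist x0 y + (a - 1) * dist x y"
        proof -
          have "dist x0 ((1 - a) *\<^sub>R x + a *\<^sub>R y) \<le> dist x0 y + dist y ((1 - a) *\<^sub>R x + a *\<^sub>R y)"
            by (rule dist_triangle)
          also have "y - ((1 - a) *\<^sub>R x + a *\<^sub>R y) = (a - 1) *\<^sub>R (x - y)" by (simp add: algebra_simps)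
          then have "dist y ((1 - a) *\<^sub>R x + a *\<^sub>R y) = (a - 1) * dist x y"
            using A1(1)[OF a] by (simp add: dist_norm)
          finally show ?thesis .
        qed
        also have "\<dots> \<le> \<rho> / 2 + (a - 1) * (2 * h + \<rho> / 2)"
        proof -
          have "dist x y \<le> dist x x0 + dist x0 y" by (rule dist_triangle)
          then have "dist x y \<le> 2 * h + \<rho> / 2" using x y by (simp add: dist_commute)
          then show ?thesis using y A1(1)[OF a] by (intro add_mono mult_left_mono) auto
        qed
        also have "2 * h + \<rho> / 2 = \<rho> / 2 * (4 * \<sigma> + 1)" using \<sigma> by (simp add: \<rho>_def field_simps)
        also have "\<rho> / 2 + (a - 1) * (\<rho> / 2 * (4 * \<sigma> + 1)) \<le> \<rho>"
        proof -
          have "(a - 1) * (\<rho> / 2 * (4 * \<sigma> + 1)) = \<rho> / 2 * ((a - 1) * (4 * \<sigma> + 1))" by (simp only: mult_ac)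
          also have "\<dots> \<le> \<rho> / 2 * 1" using A1(2)[OF a] \<rho> by (intro mult_left_mono) auto
          finally show ?thesis by simp
        qed
        finally have "(1 - a) *\<^sub>R x + a *\<^sub>R y \<in> cball x0 \<rho>" by simp
        then show "(poly g a)\<^sup>2 = q ((1 - a) *\<^sub>R x + a *\<^sub>R y)" by (simp add: q_def g(2) e)
      qed
      finally show ?thesis .
    qed
    \<comment> \<open>The map from \<open>y\<close> to \<open>(1 - a) x + a y\<close> has Jacobian
      \<open>a\<close> to the power of the dimension. This is at least 1 because the nodes start at
      1, so the substitution does not increase the integral.\<close>
    have qa: "integrable lborel (\<lambda>y. q ((1 - a) *\<^sub>R x + a *\<^sub>R y))"
      "(\<integral>y. q ((1 - a) *\<^sub>R x + a *\<^sub>R y) \<partial>lborel) \<le> J" if "a \<in> A" for a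
    proof -
      have a: "1 \<le> a" using A1(1)[OF that] .
      show "integrable lborel (\<lambda>y. q ((1 - a) *\<^sub>R x + a *\<^sub>R y))"
        by (rule lborel_integrable_affine[OF qm _ qi]) (use a in simp)
      have "J = \<bar>a\<bar> ^ DIM(real^'d) * (\<integral>y. q ((1 - a) *\<^sub>R x + a *\<^sub>R y) \<partial>lborel)"
        unfolding J_def by (rule lborel_integral_affine[OF qm]) (use a in simp)
      moreover have "1 \<le> \<bar>a\<bar> ^ DIM(real^'d)" using a by (intro one_le_power) simp
      moreover have "0 \<le> (\<integral>y. q ((1 - a) *\<^sub>R x + a *\<^sub>R y) \<partial>lborel)"
        unfolding q_def by (intro integral_nonneg_AE) auto
      ultimately show "(\<integral>y. q ((1 - a) *\<^sub>R x + a *\<^sub>R y) \<partial>lborel) \<le> J"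
        using mult_right_mono[of 1 "\<bar>a\<bar> ^ DIM(real^'d)" "\<integral>y. q ((1 - a) *\<^sub>R x + a *\<^sub>R y) \<partial>lborel"] by simp
    qed
    have "measure lborel ?B * (p x)\<^sup>2 = (\<integral>y. (p x)\<^sup>2 * indicator ?B y \<partial>lborel)"
      by simp
    also have "\<dots> \<le> (\<integral>y. C1\<^sup>2 * real (Suc k) * (\<Sum>a\<in>A. q ((1 - a) *\<^sub>R x + a *\<^sub>R y)) \<partial>lborel)"
    proof (rule integral_mono)
      show "integrable lborel (\<lambda>y. (p x)\<^sup>2 * indicator ?B y)"
        by (intro integrable_mult_right integrable_real_indicator) (simp, rule emeasure_lborel_cball_finite)
      show "integrable lborel (\<lambda>y. C1\<^sup>2 * real (Suc k) * (\<Sum>a\<in>A. q ((1 - a) *\<^sub>R x + a *\<^sub>R y)))"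
        by (intro integrable_mult_right Bochner_Integration.integrable_sum qa(1))
      fix y
      show "(p x)\<^sup>2 * indicator ?B y \<le> C1\<^sup>2 * real (Suc k) * (\<Sum>a\<in>A. q ((1 - a) *\<^sub>R x + a *\<^sub>R y))"
      proof (cases "y \<in> ?B")
        case True then show ?thesis using pt[OF True] by simp
      next
        case False
        have "0 \<le> C1\<^sup>2 * real (Suc k) * (\<Sum>a\<in>A. q ((1 - a) *\<^sub>R x + a *\<^sub>R y))"
          by (intro mult_nonneg_nonneg sum_nonneg) (auto simp: q_def)
        then show ?thesis using False by simp
      qed
    qed
    also have "\<dots> = C1\<^sup>2 * real (Suc k) * (\<Sum>a\<in>A. (\<integral>y. q ((1 - a) *\<^sub>R x + a *\<^sub>R y) \<partial>lborel))"
      using qa(1) by simp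
    also have "\<dots> \<le> C1\<^sup>2 * real (Suc k) * (\<Sum>a\<in>A. J)"
      by (intro mult_left_mono sum_mono qa(2)) auto
    also have "\<dots> = C1\<^sup>2 * real (Suc k) * real (Suc k) * J" using A by simp
    also have "\<dots> \<le> (C1\<^sup>2 * real (Suc k) * real (Suc k) + 1) * J" using J by (simp add: distrib_right)
    finally have main: "measure lborel ?B * (p x)\<^sup>2 \<le> (C1\<^sup>2 * real (Suc k) * real (Suc k) + 1) * J" .
    have "measure lborel ?B = (\<rho> / 2) ^ CARD('d) * w"
      using content_cball[of "\<rho> / 2" x0] \<rho> by (simp add: w_def)
    also have "(\<rho> / 2) ^ CARD('d) * w = h ^ CARD('d) * w / (2 * \<sigma>) ^ CARD('d)"
      by (simp add: \<rho>_def power_divide power_mult_distrib)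
    finally have mB: "measure lborel ?B = h ^ CARD('d) * w / (2 * \<sigma>) ^ CARD('d)" .
    have "(p x)\<^sup>2 \<le> (C1\<^sup>2 * real (Suc k) * real (Suc k) + 1) * J / measure lborel ?B"
    proof -
      have "0 < measure lborel ?B" using h w \<sigma> by (simp add: mB)
      then show ?thesis using main by (subst pos_le_divide_eq) (simp_all only: mult.commute)
    qed
    also have "\<dots> = C / h ^ CARD('d) * J" by (simp add: mB C_def mult_ac)
    finally show ?thesis by (simp add: J_def q_def \<rho>_def)
  qed
  with C show ?thesis by blast
qed

text \<open>On the line through \<open>x\<close> in direction \<open>i\<close>, scaled by
  \<open>h\<close>, the linear coefficient is \<open>h\<close> times the partial derivative, and
  values at parameters in [0,1] control it. These points lie in the ball of radius
  \<open>2 * h\<close>, which is why the value bound is stated for the doubled radius.\<close>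

lemma polys_partial_bound:
  assumes \<sigma>: "0 < \<sigma>"
  shows "\<exists>C>0. \<forall>p\<in>polys k. \<forall>(x0::real^'d) h x i. 0 < h \<longrightarrow> x \<in> cball x0 h \<longrightarrow>
     (partial i p x)\<^sup>2 \<le> C / (h ^ CARD('d) * h\<^sup>2) * (\<integral>z. indicator (cball x0 (h / \<sigma>)) z * (p z)\<^sup>2 \<partial>lborel)"
proof -
  obtain C where C: "0 < C" "\<And>p (x0::real^'d) h x. p \<in> polys k \<Longrightarrow> 0 < h \<Longrightarrow> x \<in> cball x0 (2 * h) \<Longrightarrow>
     (p x)\<^sup>2 \<le> C / h ^ CARD('d) * (\<integral>z. indicator (cball x0 (h / \<sigma>)) z * (p z)\<^sup>2 \<partial>lborel)"
    using polys_value_bound[OF \<sigma>, of k] by blast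
  define A where "A = (\<lambda>j. real j / real (Suc k)) ` {..k}"
  have A: "finite A" "card A = Suc k"
    unfolding A_def by (auto simp: card_image inj_on_def)
  have A1: "0 \<le> a" "a \<le> 1" if "a \<in> A" for a
    using that by (auto simp: A_def)
  obtain C1 where C1: "0 \<le> C1" "\<And>g i. degree g < card A \<Longrightarrow> \<bar>coeff g i\<bar> \<le> C1 * (\<Sum>a\<in>A. \<bar>poly g a\<bar>)"
    using coeff_bound_by_values[OF A(1)] by blast
  define C' where "C' = (C1 * real (Suc k))\<^sup>2 * C + 1"
  have C': "0 < C'" unfolding C'_def using C(1) by (intro add_nonneg_pos) auto
  have "(partial i p x)\<^sup>2 \<le> C' / (h ^ CARD('d) * h\<^sup>2) * (\<integral>z. indicator (cball x0 (h / \<sigma>)) z * (p z)\<^sup>2 \<partial>lborel)"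
    if p: "p \<in> polys k" and h: "0 < h" and x: "x \<in> cball x0 h" for p and x0 x :: "real^'d" and h i
  proof -
    define J where "J = (\<integral>z. indicator (cball x0 (h / \<sigma>)) z * (p z)\<^sup>2 \<partial>lborel)"
    have J: "0 \<le> J" unfolding J_def by (intro integral_nonneg_AE) auto
    define m where "m = sqrt (C / h ^ CARD('d) * J)"
    have m: "0 \<le> m" "m\<^sup>2 = C / h ^ CARD('d) * J" using C(1) h J by (simp_all add: m_def)
    obtain g where g: "degree g \<le> k" "\<And>t. poly g t = p (x + t *\<^sub>R (h *\<^sub>R axis i 1))"
      using polys_line_restriction[OF p] by blast
    have "((\<lambda>t. p (x + t *\<^sub>R (h *\<^sub>R axis i 1))) has_derivative (\<lambda>t. frechet_derivative p (at x) (t *\<^sub>R (h *\<^sub>R axis i 1)))) (at 0)"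
    proof (rule has_derivative_compose[of "\<lambda>t. x + t *\<^sub>R (h *\<^sub>R axis i 1)" _ _ _ p])
      show "((\<lambda>t. x + t *\<^sub>R (h *\<^sub>R axis i 1)) has_derivative (\<lambda>t. t *\<^sub>R (h *\<^sub>R axis i 1))) (at 0)"
        by (auto intro!: derivative_eq_intros)
      show "(p has_derivative frechet_derivative p (at x)) (at (x + 0 *\<^sub>R (h *\<^sub>R axis i 1)))"
        using partial_poly(2)[OF p, of x] by (simp add: frechet_derivative_works[symmetric])
    qed
    moreover have "frechet_derivative p (at x) (t *\<^sub>R (h *\<^sub>R axis i 1)) = (h * partial i p x) * t" for t
      using linear_frechet_derivative[OF partial_poly(2)[OF p, of x]] by (simp add: linear_scale partial_def)
    moreover have "poly g = (\<lambda>t. p (x + t *\<^sub>R (h *\<^sub>R axis i 1)))"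
      by (rule ext) (rule g(2))
    ultimately have "(poly g has_real_derivative (h * partial i p x)) (at 0)"
      by (simp add: has_field_derivative_def)
    then have "h * partial i p x = poly (pderiv g) 0" using poly_DERIV DERIV_unique by blast
    then have e: "h * partial i p x = coeff g 1" by (simp add: poly_0_coeff_0 coeff_pderiv)
    have "\<bar>coeff g 1\<bar> \<le> C1 * (\<Sum>a\<in>A. \<bar>poly g a\<bar>)" using C1(2)[of g 1] g(1) A(2) by simp
    also have "\<dots> \<le> C1 * (\<Sum>a\<in>A. m)"
    proof (intro mult_left_mono sum_mono C1(1))
      fix a assume a: "a \<in> A"
      have "x + a *\<^sub>R (h *\<^sub>R axis i 1) \<in> cball x0 (2 * h)"
      proof -
        have "dist x0 (x + a *\<^sub>R (h *\<^sub>R axis i 1)) \<le> dist x0 x + dist x (x + a *\<^sub>R (h *\<^sub>R axis i 1))"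
          by (rule dist_triangle)
        also have "dist x (x + a *\<^sub>R (h *\<^sub>R axis i 1)) = a * h" using A1[OF a] h by (simp add: dist_norm)
        also have "a * h \<le> 1 * h" using A1[OF a] h by (intro mult_right_mono) auto
        finally show ?thesis using x by simp
      qed
      then have "(poly g a)\<^sup>2 \<le> m\<^sup>2" unfolding m(2) g(2) J_def by (rule C(2)[OF p h])
      then show "\<bar>poly g a\<bar> \<le> m" using m(1) by (simp add: abs_le_square_iff[symmetric])
    qed
    also have "\<dots> = C1 * real (Suc k) * m" using A by simp
    finally have "\<bar>h * partial i p x\<bar> \<le> C1 * real (Suc k) * m" by (simp add: e)
    then have "(h * partial i p x)\<^sup>2 \<le> (C1 * real (Suc k) * m)\<^sup>2"
      using power_mono[of "\<bar>h * partial i p x\<bar>" _ 2] by simp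
    also have "\<dots> = (C1 * real (Suc k))\<^sup>2 * C / h ^ CARD('d) * J" by (simp add: power_mult_distrib m(2))
    also have "\<dots> \<le> C' / h ^ CARD('d) * J"
      using h J by (intro mult_right_mono divide_right_mono) (auto simp: C'_def)
    finally have "h\<^sup>2 * (partial i p x)\<^sup>2 \<le> C' / h ^ CARD('d) * J" by (simp add: power_mult_distrib)
    then have "(partial i p x)\<^sup>2 \<le> C' / h ^ CARD('d) * J / h\<^sup>2" using h by (simp add: pos_le_divide_eq mult_ac)
    then show ?thesis by (simp add: J_def)
  qed
  with C' show ?thesis by blast
qed


section \<open>Piecewise Lipschitz functions\<close>

text \<open>Rests on completeness: every subset of a null set is measurable. It serves
  \<open>partial\<close> and \<open>grad\<close>, whose values on null sets are arbitrary.\<close>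

lemma measurable_lebesgue_AE:
  fixes F G :: "'a::euclidean_space \<Rightarrow> 'b::topological_space"
  assumes G: "G \<in> borel_measurable lebesgue" and eq: "AE x in lebesgue. F x = G x"
  shows "F \<in> borel_measurable lebesgue"
proof (rule borel_measurableI)
  fix S :: "'b set" assume "open S"
  obtain N where N: "{x. F x \<noteq> G x} \<subseteq> N" "N \<in> null_sets lebesgue"
    using eq by (auto simp: eventually_ae_filter)
  have "F -` S \<inter> N \<in> null_sets lebesgue"
    using N(2) by (rule null_sets_completion_subset[rotated]) auto
  moreover have "G -` S \<inter> space lebesgue \<in> sets lebesgue"
    using G \<open>open S\<close> by (intro measurable_sets[OF G]) auto
  ultimately have "(G -` S - N) \<union> (F -` S \<inter> N) \<in> sets lebesgue"
    using N(2) by (intro sets.Un sets.Diff) auto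
  moreover have "F -` S \<inter> space lebesgue = (G -` S - N) \<union> (F -` S \<inter> N)"
    using N(1) by auto
  ultimately show "F -` S \<inter> space lebesgue \<in> sets lebesgue" by simp
qed

context bounded_domain
begin

lemma measurable_on_D_AE:
  fixes f g :: "real^'d \<Rightarrow> real"
  assumes g: "g \<in> borel_measurable (lebesgue_on D)" and eq: "AE x in lebesgue_on D. f x = g x"
  shows "f \<in> borel_measurable (lebesgue_on D)"
proof -
  have "(\<lambda>x. indicator D x *\<^sub>R g x) \<in> borel_measurable lebesgue"
    using g sets_D by (subst borel_measurable_restrict_space_iff[symmetric]) auto
  moreover have "AE x in lebesgue. indicator D x *\<^sub>R f x = indicator D x *\<^sub>R g x"
    using eq unfolding AE_lebesgue_on_iff[OF sets_D] by eventually_elim (auto simp: indicator_def)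
  ultimately have "(\<lambda>x. indicator D x *\<^sub>R f x) \<in> borel_measurable lebesgue"
    by (rule measurable_lebesgue_AE)
  then show ?thesis using sets_D by (subst borel_measurable_restrict_space_iff) auto
qed

lemma essbdd_AE_cong:
  fixes f g :: "real^'d \<Rightarrow> real"
  assumes g: "essbdd g" and eq: "AE x in lebesgue_on D. f x = g x"
  shows "essbdd f"
proof -
  obtain B where B: "AE x in lebesgue_on D. norm (g x) \<le> B" using g by (rule essbddE)
  show ?thesis
    by (rule essbddI[OF measurable_on_D_AE[OF essbdd_measurable[OF g] eq], of B])
       (use B eq in eventually_elim, simp)
qed

text \<open>The regularity of continuous piecewise polynomials that integration by parts uses.
  Differentiability almost everywhere is a clause of its own, as for piecewise polynomials it is
  read off inside the cells.\<close>

definition plip :: "(real^'d \<Rightarrow> real) \<Rightarrow> bool" where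
  "plip \<psi> \<longleftrightarrow> (\<exists>M. M-lipschitz_on D \<psi>) \<and> (AE x in lebesgue_on D. \<psi> differentiable (at x))"

lemma plip_bounded:
  assumes "plip \<psi>"
  obtains P where "0 < P" "\<And>x. x \<in> D \<Longrightarrow> \<bar>\<psi> x\<bar> \<le> P"
proof -
  obtain M where "M-lipschitz_on D \<psi>" using assms by (auto simp: plip_def)
  then have "bounded (\<psi> ` D)"
    using bounded_D by (intro bounded_uniformly_continuous_image lipschitz_on_uniformly_continuous)
  then obtain P where "0 < P" "\<forall>y\<in>\<psi> ` D. norm y \<le> P" unfolding bounded_pos by blast
  then show thesis by (intro that[of P]) auto
qed

lemma AE_in_D: "(\<And>x. x \<in> D \<Longrightarrow> P x) \<Longrightarrow> AE x in lebesgue_on D. P x"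
  unfolding AE_lebesgue_on_iff[OF sets_D] by (rule always_eventually) simp

lemma plip_essbdd:
  assumes "plip \<psi>"
  shows "essbdd \<psi>"
proof -
  obtain P where P: "\<And>x. x \<in> D \<Longrightarrow> \<bar>\<psi> x\<bar> \<le> P" using plip_bounded[OF assms] by blast
  obtain M where M: "M-lipschitz_on D \<psi>" using assms by (auto simp: plip_def)
  show ?thesis
  proof (rule essbddI)
    show "\<psi> \<in> borel_measurable (lebesgue_on D)"
      using lipschitz_on_continuous_on[OF M] sets_D by (rule continuous_imp_measurable_on_sets_lebesgue)
    show "AE x in lebesgue_on D. norm (\<psi> x) \<le> P" by (rule AE_in_D) (simp add: P)
  qed
qed

lemma plip_const: "plip (\<lambda>x. c)"
  unfolding plip_def by (intro conjI exI[of _ 0]) (auto intro: lipschitz_on_constant)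

lemma plip_mult:
  assumes f: "plip f" and g: "plip g"
  shows "plip (\<lambda>x. f x * g x)"
proof -
  obtain P where P: "0 < P" "\<And>x. x \<in> D \<Longrightarrow> \<bar>f x\<bar> \<le> P" using plip_bounded[OF f] by blast
  obtain Q where Q: "0 < Q" "\<And>x. x \<in> D \<Longrightarrow> \<bar>g x\<bar> \<le> Q" using plip_bounded[OF g] by blast
  obtain L where L: "L-lipschitz_on D f" using f by (auto simp: plip_def)
  obtain M where M: "M-lipschitz_on D g" using g by (auto simp: plip_def)
  have LM: "0 \<le> L" "0 \<le> M" using L M lipschitz_on_nonneg by auto
  have "(L * Q + P * M)-lipschitz_on D (\<lambda>x. f x * g x)"
  proof (rule lipschitz_onI)
    fix x y assume xy: "x \<in> D" "y \<in> D"
    have "f x * g x - f y * g y = (f x - f y) * g x + f y * (g x - g y)" by (simp add: algebra_simps)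
    then have "\<bar>f x * g x - f y * g y\<bar> \<le> \<bar>f x - f y\<bar> * \<bar>g x\<bar> + \<bar>f y\<bar> * \<bar>g x - g y\<bar>"
      using abs_triangle_ineq[of "(f x - f y) * g x" "f y * (g x - g y)"] by (simp add: abs_mult)
    also have "\<dots> \<le> (L * dist x y) * Q + P * (M * dist x y)"
      using lipschitz_onD[OF L xy] lipschitz_onD[OF M xy] P Q xy LM
      by (intro add_mono mult_mono) (auto simp: dist_real_def)
    finally show "dist (f x * g x) (f y * g y) \<le> (L * Q + P * M) * dist x y"
      by (simp add: dist_real_def algebra_simps)
  qed (use P Q LM in auto)
  moreover have "AE x in lebesgue_on D. f differentiable (at x)" "AE x in lebesgue_on D. g differentiable (at x)"
    using f g by (simp_all add: plip_def)
  then have "AE x in lebesgue_on D. (\<lambda>x. f x * g x) differentiable (at x)"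
    by eventually_elim (rule differentiable_mult)
  ultimately show ?thesis by (auto simp: plip_def)
qed

lemma plip_nth: "plip (\<lambda>x. x $ j)"
  unfolding plip_def
proof (intro conjI exI always_eventually allI)
  show "1-lipschitz_on D (\<lambda>x. x $ j)"
    by (rule lipschitz_onI) (auto simp: dist_vec_nth_le)
  show "(\<lambda>x. x $ j) differentiable (at x)" for x :: "real^'d"
    by (rule bounded_linear_imp_differentiable[OF bounded_linear_vec_nth])
qed

text \<open>Measurability comes from the difference quotients of the extension by zero: these are
  Borel functions, and they converge wherever \<open>\<psi>\<close> is differentiable. The Lipschitz
  constant bounds them as soon as the shifted point lies in the open set \<open>D\<close>.\<close>

lemma plip_partial_essbdd:
  assumes "plip \<psi>"
  shows "essbdd (partial j \<psi>)"
proof -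
  obtain M where M: "M-lipschitz_on D \<psi>" using assms by (auto simp: plip_def)
  have M0: "0 \<le> M" using M by (rule lipschitz_on_nonneg)
  have dif: "AE x in lebesgue_on D. \<psi> differentiable (at x)" using assms by (simp add: plip_def)
  define f where "f = (\<lambda>x. indicator D x *\<^sub>R \<psi> x)"
  have fm [measurable]: "f \<in> borel_measurable borel"
    unfolding f_def using open_D lipschitz_on_continuous_on[OF M]
    by (intro borel_measurable_continuous_on_indicator) auto
  define q where "q = (\<lambda>n x. (f (x + (1 / real (Suc n)) *\<^sub>R axis j 1) - f x) / (1 / real (Suc n)))"
  have qm: "q n \<in> borel_measurable borel" for n unfolding q_def by measurable
  define g where "g = (\<lambda>x. lim (\<lambda>n. q n x))"
  have gm: "g \<in> borel_measurable borel" unfolding g_def by (rule borel_measurable_lim_metric[OF qm])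
  have lim: "(\<lambda>n. q n x) \<longlonglongrightarrow> partial j \<psi> x" if x: "x \<in> D" "\<psi> differentiable (at x)" for x
  proof -
    have "(f has_derivative frechet_derivative \<psi> (at x)) (at x)"
      by (rule has_derivative_transform_within_open[of \<psi> _ _ _ D])
         (use x open_D in \<open>auto simp: f_def frechet_derivative_works[symmetric]\<close>)
    from has_derivative_quotient_LIMSEQ[OF this, of "axis j 1"] show ?thesis
      by (simp only: q_def partial_def)
  qed
  have eq: "AE x in lebesgue_on D. partial j \<psi> x = g x"
    using dif unfolding AE_lebesgue_on_iff[OF sets_D]
    by eventually_elim (auto simp: g_def limI[OF lim])
  show ?thesis
  proof (rule essbddI)
    show "partial j \<psi> \<in> borel_measurable (lebesgue_on D)"
    proof (rule measurable_on_D_AE[OF _ eq])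
      show "g \<in> borel_measurable (lebesgue_on D)"
        using gm by (intro measurable_restrict_space1 measurable_completion) simp
    qed
    have bd: "\<bar>partial j \<psi> x\<bar> \<le> M" if x: "x \<in> D" "\<psi> differentiable (at x)" for x
    proof (rule tendsto_upperbound[OF tendsto_rabs[OF lim[OF x]]])
      obtain e where e: "0 < e" "ball x e \<subseteq> D" using open_D x(1) by (auto simp: open_contains_ball)
      obtain n0 where n0: "1 / real (Suc n0) < e" using e(1) nat_approx_posE by blast
      show "\<forall>\<^sub>F n in sequentially. \<bar>q n x\<bar> \<le> M"
        using eventually_ge_at_top[of n0]
      proof eventually_elim
        case (elim n)
        define t where "t = 1 / real (Suc n)"
        have t: "0 < t" by (simp add: t_def)
        have "t \<le> 1 / real (Suc n0)" using elim unfolding t_def by (intro divide_left_mono) auto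
        then have "t < e" using n0 by linarith
        then have xt: "x + t *\<^sub>R axis j 1 \<in> D" using e(2) t by (auto simp: dist_norm)
        have "\<bar>\<psi> (x + t *\<^sub>R axis j 1) - \<psi> x\<bar> \<le> M * t"
          using lipschitz_onD[OF M xt x(1)] t by (simp add: dist_norm)
        then show ?case using t x(1) xt unfolding q_def t_def[symmetric]
          by (simp add: f_def pos_divide_le_eq)
      qed
    qed simp
    show "AE x in lebesgue_on D. norm (partial j \<psi> x) \<le> M"
      using dif unfolding AE_lebesgue_on_iff[OF sets_D] by eventually_elim (simp add: bd)
  qed
qed

lemma plip_der:
  assumes "plip \<psi>"
  shows "AE x in lebesgue_on D. \<exists>\<psi>'. (\<psi> has_derivative \<psi>') (at x) \<and> partial j \<psi> x = \<psi>' (axis j 1)"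
proof -
  have "AE x in lebesgue_on D. \<psi> differentiable (at x)" using assms by (simp add: plip_def)
  then show ?thesis
  proof eventually_elim
    case (elim x)
    then have "(\<psi> has_derivative frechet_derivative \<psi> (at x)) (at x)"
      by (simp add: frechet_derivative_works[symmetric])
    then show ?case by (intro exI[of _ "frechet_derivative \<psi> (at x)"]) (simp add: partial_def)
  qed
qed

lemma plip_integration_by_parts:
  assumes "u \<in> H10 D" "plip \<psi>"
  shows "(\<integral>x. u x $ i * partial j \<psi> x + grad D u x $ i $ j * \<psi> x \<partial>lebesgue_on D) = 0"
proof -
  obtain M where M: "M-lipschitz_on D \<psi>" using assms(2) by (auto simp: plip_def)
  show ?thesis
    by (rule H10_integration_by_parts[OF assms(1) M plip_partial_essbdd[OF assms(2)] plip_der[OF assms(2)]])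
qed

lemma partial_mult:
  assumes "f differentiable (at x)" "g differentiable (at x)"
  shows "partial j (\<lambda>x. f x * g x) x = f x * partial j g x + partial j f x * g x"
proof -
  have "((\<lambda>x. f x * g x) has_derivative
     (\<lambda>h. f x * frechet_derivative g (at x) h + frechet_derivative f (at x) h * g x)) (at x)"
    using assms by (intro has_derivative_mult) (auto simp: frechet_derivative_works[symmetric])
  from partial_eqI[OF this] show ?thesis by (simp add: partial_def)
qed

section \<open>Skew symmetry of the trilinear form and the Poincare inequality\<close>

definition vplip :: "(real^'d \<Rightarrow> real^'d) \<Rightarrow> bool" where
  "vplip v \<longleftrightarrow> (\<forall>i. plip (\<lambda>x. v x $ i))"

lemma vplip_essbdd: "vplip v \<Longrightarrow> essbdd v"
  by (rule essbdd_vecI) (auto simp: vplip_def intro: plip_essbdd)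

lemma vplip_weak_gradient:
  assumes "vplip v"
  shows "has_weak_gradient D v (\<lambda>x. \<chi> i j. partial j (\<lambda>y. v y $ i) x)"
  unfolding has_weak_gradient_def
proof (intro conjI ballI allI)
  show "v \<in> L2 D" by (intro essbdd_L2 vplip_essbdd assms)
  have e: "essbdd (\<lambda>x. partial j (\<lambda>y. v y $ i) x)" for i j
    using assms by (intro plip_partial_essbdd) (simp add: vplip_def)
  show "(\<lambda>x. \<chi> i j. partial j (\<lambda>y. v y $ i) x) \<in> L2 D"
    by (intro essbdd_L2 essbdd_vecI) (simp add: e)
  fix \<phi> i j assume \<phi>: "\<phi> \<in> test_functions D"
  have p: "plip (\<lambda>y. v y $ i)" using assms by (simp add: vplip_def)
  then obtain M where M: "M-lipschitz_on D (\<lambda>y. v y $ i)" by (auto simp: plip_def)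
  have 1: "(\<integral>x. partial j \<phi> x * v x $ i + \<phi> x * partial j (\<lambda>y. v y $ i) x \<partial>lebesgue_on D) = 0"
    by (rule test_function_integration_by_parts[OF open_D bounded_D \<phi> M plip_der[OF p] essbdd_measurable[OF e]])
  have "integrable (lebesgue_on D) (\<lambda>x. partial j \<phi> x * v x $ i)"
    by (intro essbdd_integrable essbdd_mult test_function_essbdd(2)[OF \<phi>] plip_essbdd[OF p])
  moreover have "integrable (lebesgue_on D) (\<lambda>x. \<phi> x * partial j (\<lambda>y. v y $ i) x)"
    by (intro essbdd_integrable essbdd_mult test_function_essbdd(1)[OF \<phi>] e)
  ultimately show "(\<integral>x. v x $ i * partial j \<phi> x \<partial>lebesgue_on D) =
     - (\<integral>x. (\<chi> i j. partial j (\<lambda>y. v y $ i) x) $ i $ j * \<phi> x \<partial>lebesgue_on D)"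
    using 1 by (simp add: mult.commute)
qed

lemma vplip_H1: "vplip v \<Longrightarrow> v \<in> H1 D"
  unfolding H1_def using vplip_weak_gradient by blast

lemma vplip_grad:
  assumes "vplip v"
  shows "AE x in lebesgue_on D. \<forall>i j. (\<lambda>y. v y $ i) differentiable (at x) \<and> grad D v x $ i $ j = partial j (\<lambda>y. v y $ i) x"
proof -
  have "AE x in lebesgue_on D. \<forall>i. (\<lambda>y. v y $ i) differentiable (at x)"
    using assms by (simp add: AE_all_countable vplip_def plip_def)
  moreover have "AE x in lebesgue_on D. grad D v x = (\<chi> i j. partial j (\<lambda>y. v y $ i) x)"
    by (rule grad_AE_eqI[OF vplip_weak_gradient[OF assms]])
  ultimately show ?thesis by eventually_elim simp
qed

lemma vplip_grad_essbdd:
  assumes "vplip v"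
  shows "essbdd (grad D v)"
proof (intro essbdd_vecI)
  fix i j
  have "essbdd (partial j (\<lambda>y. v y $ i))" using assms by (intro plip_partial_essbdd) (simp add: vplip_def)
  then show "essbdd (\<lambda>x. grad D v x $ i $ j)"
    by (rule essbdd_AE_cong) (use vplip_grad[OF assms] in eventually_elim, simp)
qed

lemma vplip_dvg_essbdd: "vplip v \<Longrightarrow> essbdd (dvg D v)"
  unfolding dvg_def[abs_def] by (intro essbdd_sum essbdd_nth vplip_grad_essbdd)

lemma integral_dvg_eq_0:
  assumes u: "u \<in> H10 D"
  shows "(\<integral>x. dvg D u x \<partial>lebesgue_on D) = 0"
proof -
  have uH: "u \<in> H1 D" using u by (simp add: H10_def)
  have i: "integrable (lebesgue_on D) (\<lambda>x. grad D u x $ i $ i)" for i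
    by (intro L2_integrable L2_nth H1_L2(2)[OF uH])
  have "(\<integral>x. u x $ i * partial i (\<lambda>x. 1) x + grad D u x $ i $ i * 1 \<partial>lebesgue_on D) = 0" for i
    by (rule plip_integration_by_parts[OF u plip_const])
  moreover have "partial i (\<lambda>x. 1) x = 0" for i and x :: "real^'d"
    using partial_eqI[of "\<lambda>x. 1" "\<lambda>_. 0" x i] by simp
  ultimately have "(\<integral>x. grad D u x $ i $ i \<partial>lebesgue_on D) = 0" for i by simp
  then show ?thesis unfolding dvg_def using i by simp
qed

text \<open>The divergence theorem for the field \<open>u\<close> times the scalar product of
  \<open>v\<close> and \<open>w\<close>; the boundary term is absent because \<open>u\<close> lies
  in \<open>H10 D\<close>. The divergence of \<open>u\<close> is kept, since the fields of the
  penalty scheme are not divergence free.\<close>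

lemma trilinear_skew:
  assumes u: "u \<in> H10 D" "vplip u" and v: "vplip v" and w: "vplip w"
  shows "trilinear D u v w = - trilinear D u w v - L2_inner D (dvg D u) (\<lambda>x. v x \<bullet> w x)"
proof -
  note e = vplip_essbdd[OF u(2)] vplip_essbdd[OF v] vplip_essbdd[OF w]
    vplip_grad_essbdd[OF u(2)] vplip_grad_essbdd[OF v] vplip_grad_essbdd[OF w] vplip_dvg_essbdd[OF u(2)]
  have vi: "plip (\<lambda>x. v x $ i)" and wi: "plip (\<lambda>x. w x $ i)" for i
    using v w by (auto simp: vplip_def)
  \<comment> \<open>Almost everywhere this is the \<open>j\<close>-th partial derivative of
    \<open>u_j v_i w_i\<close>.\<close>
  define F where "F = (\<lambda>i j x. u x $ j * partial j (\<lambda>x. v x $ i * w x $ i) x + grad D u x $ j $ j * (v x $ i * w x $ i))"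
  have Fe: "essbdd (F i j)" for i j
    unfolding F_def
    by (intro essbdd_add essbdd_mult plip_partial_essbdd plip_mult vi wi essbdd_nth e)
  have F0: "(\<integral>x. F i j x \<partial>lebesgue_on D) = 0" for i j
    unfolding F_def by (rule plip_integration_by_parts[OF u(1) plip_mult[OF vi wi]])
  have "AE x in lebesgue_on D. (grad D v x *v u x) \<bullet> w x + (grad D w x *v u x) \<bullet> v x + dvg D u x \<bullet> (v x \<bullet> w x)
      = (\<Sum>i\<in>UNIV. \<Sum>j\<in>UNIV. F i j x)"
    using vplip_grad[OF v] vplip_grad[OF w]
  proof eventually_elim
    case (elim x)
    have "(\<Sum>i\<in>UNIV. \<Sum>j\<in>UNIV. F i j x) = (\<Sum>i\<in>UNIV. \<Sum>j\<in>UNIV.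
       u x $ j * (v x $ i * grad D w x $ i $ j + grad D v x $ i $ j * w x $ i) + grad D u x $ j $ j * (v x $ i * w x $ i))"
      using elim by (simp add: F_def partial_mult)
    also have "\<dots> = (\<Sum>i\<in>UNIV. \<Sum>j\<in>UNIV. grad D v x $ i $ j * u x $ j * w x $ i)
        + (\<Sum>i\<in>UNIV. \<Sum>j\<in>UNIV. grad D w x $ i $ j * u x $ j * v x $ i)
        + (\<Sum>i\<in>UNIV. \<Sum>j\<in>UNIV. grad D u x $ j $ j * (v x $ i * w x $ i))"
      by (simp add: sum.distrib[symmetric] algebra_simps)
    also have "(\<Sum>i\<in>UNIV. \<Sum>j\<in>UNIV. grad D u x $ j $ j * (v x $ i * w x $ i)) = dvg D u x * (v x \<bullet> w x)"
      unfolding dvg_def inner_vec_def sum_product by (subst sum.swap) simp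
    finally show ?case
      by (simp add: inner_vec_def matrix_vector_mult_def sum_distrib_right)
  qed
  then have "(\<integral>x. (grad D v x *v u x) \<bullet> w x + (grad D w x *v u x) \<bullet> v x + dvg D u x \<bullet> (v x \<bullet> w x) \<partial>lebesgue_on D)
     = (\<integral>x. (\<Sum>i\<in>UNIV. \<Sum>j\<in>UNIV. F i j x) \<partial>lebesgue_on D)"
    using e Fe by (intro integral_cong_AE essbdd_measurable essbdd_add essbdd_inner essbdd_matvec essbdd_sum) auto
  also have "\<dots> = 0" using Fe F0 by (simp add: essbdd_integrable)
  finally have s: "(\<integral>x. (grad D v x *v u x) \<bullet> w x + (grad D w x *v u x) \<bullet> v x + dvg D u x \<bullet> (v x \<bullet> w x) \<partial>lebesgue_on D) = 0" .
  have "integrable (lebesgue_on D) (\<lambda>x. (grad D v x *v u x) \<bullet> w x)"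
    "integrable (lebesgue_on D) (\<lambda>x. (grad D w x *v u x) \<bullet> v x)"
    "integrable (lebesgue_on D) (\<lambda>x. dvg D u x \<bullet> (v x \<bullet> w x))"
    by (intro essbdd_integrable essbdd_inner essbdd_matvec e)+
  then show ?thesis using s by (simp add: trilinear_def L2_inner_def)
qed

text \<open>The derivatives of \<open>x_i u_i^2\<close> in direction \<open>i\<close> integrate to
  0, so the squared norm of \<open>u\<close> equals minus the integral of the sum of
  \<open>2 x_i u_i\<close> times the \<open>i\<close>-th derivative of \<open>u_i\<close>; each
  \<open>x_i\<close> is at most \<open>R\<close> in modulus.\<close>

lemma Poincare:
  assumes u: "u \<in> H10 D" "vplip u" and R: "\<And>x. x \<in> D \<Longrightarrow> norm x \<le> R" "0 \<le> R"
  shows "L2_norm D u \<le> 2 * real CARD('d) * R * L2_norm D (grad D u)"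
proof -
  note e = vplip_essbdd[OF u(2)] vplip_grad_essbdd[OF u(2)]
  have ui: "plip (\<lambda>x. u x $ i)" for i using u by (auto simp: vplip_def)
  define F where "F = (\<lambda>i x. u x $ i * partial i (\<lambda>x. x $ i * u x $ i) x + grad D u x $ i $ i * (x $ i * u x $ i))"
  have Fe: "essbdd (F i)" for i
    unfolding F_def
    by (intro essbdd_add essbdd_mult plip_partial_essbdd plip_mult plip_nth ui essbdd_nth e plip_essbdd[OF plip_nth])
  have F0: "(\<integral>x. F i x \<partial>lebesgue_on D) = 0" for i
    unfolding F_def by (rule plip_integration_by_parts[OF u(1) plip_mult[OF plip_nth ui]])
  define g where "g = (\<lambda>x. \<Sum>i\<in>UNIV. 2 * (x $ i * u x $ i * grad D u x $ i $ i))"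
  have ge: "essbdd g"
    unfolding g_def by (intro essbdd_sum essbdd_mult essbdd_const essbdd_nth e plip_essbdd[OF plip_nth])
  have "AE x in lebesgue_on D. (norm (u x))\<^sup>2 + g x = (\<Sum>i\<in>UNIV. F i x)"
    using vplip_grad[OF u(2)]
  proof eventually_elim
    case (elim x)
    have px: "partial i (\<lambda>x. x $ i) x = 1" for i :: 'd
    proof -
      have "((\<lambda>x. x $ i) has_derivative (\<lambda>h. h $ i)) (at x)"
        by (rule bounded_linear_imp_has_derivative[OF bounded_linear_vec_nth])
      from partial_eqI[OF this] show ?thesis by (simp add: axis_def)
    qed
    have dx: "(\<lambda>x. x $ i) differentiable (at x)" for i :: 'd
      by (rule bounded_linear_imp_differentiable[OF bounded_linear_vec_nth])
    have "F i x = u x $ i * u x $ i + 2 * (x $ i * u x $ i * grad D u x $ i $ i)" for i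
    proof -
      have "partial i (\<lambda>x. x $ i * u x $ i) x = x $ i * grad D u x $ i $ i + u x $ i"
        using elim dx px by (simp add: partial_mult)
      then show ?thesis by (simp add: F_def algebra_simps)
    qed
    then show ?case
      by (simp add: g_def sum.distrib power2_norm_eq_inner inner_vec_def)
  qed
  then have "(\<integral>x. (norm (u x))\<^sup>2 + g x \<partial>lebesgue_on D) = (\<integral>x. (\<Sum>i\<in>UNIV. F i x) \<partial>lebesgue_on D)"
    using e Fe ge by (intro integral_cong_AE essbdd_measurable essbdd_add essbdd_sum essbdd_power2 essbdd_norm) auto
  also have "\<dots> = 0" using Fe F0 by (simp add: essbdd_integrable)
  finally have "(L2_norm D u)\<^sup>2 = - (\<integral>x. g x \<partial>lebesgue_on D)"
    using essbdd_integrable[OF ge] essbdd_integrable[OF essbdd_power2[OF essbdd_norm[OF e(1)]]]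
    by (simp add: L2_norm_power2)
  also have "\<dots> \<le> \<bar>\<integral>x. g x \<partial>lebesgue_on D\<bar>" by simp
  also have "\<dots> \<le> (2 * real CARD('d) * R) * L2_norm D u * L2_norm D (grad D u)"
  proof (rule integral_bound_L2(2)[OF e[THEN essbdd_L2] essbdd_measurable[OF ge]])
    show "AE x in lebesgue_on D. \<bar>g x\<bar> \<le> 2 * real CARD('d) * R * (norm (u x) * norm (grad D u x))"
    proof (rule AE_in_D)
      fix x assume x: "x \<in> D"
      have "\<bar>g x\<bar> \<le> (\<Sum>i\<in>(UNIV::'d set). 2 * (R * norm (u x) * norm (grad D u x)))"
        unfolding g_def
      proof (rule order_trans[OF sum_abs], rule sum_mono)
        fix i
        have "\<bar>x $ i\<bar> \<le> R" using component_le_norm_cart[of x i] R(1)[OF x] by linarith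
        moreover have "\<bar>u x $ i\<bar> \<le> norm (u x)" by (rule component_le_norm_cart)
        moreover have "\<bar>grad D u x $ i $ i\<bar> \<le> norm (grad D u x)"
          using component_le_norm_cart[of "grad D u x $ i" i]
            Finite_Cartesian_Product.norm_nth_le[where x="grad D u x" and i=i] by linarith
        ultimately show "\<bar>2 * (x $ i * u x $ i * grad D u x $ i $ i)\<bar> \<le> 2 * (R * norm (u x) * norm (grad D u x))"
          unfolding abs_mult using R(2) by (simp add: mult_mono)
      qed
      then show "\<bar>g x\<bar> \<le> 2 * real CARD('d) * R * (norm (u x) * norm (grad D u x))" by (simp add: mult_ac)
    qed
  qed (use R in auto)
  finally have "L2_norm D u * L2_norm D u \<le> L2_norm D u * (2 * real CARD('d) * R * L2_norm D (grad D u))"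
    by (simp add: power2_eq_square mult_ac)
  then show ?thesis
    using L2_norm_nonneg[of u] L2_norm_nonneg[of "grad D u"] R(2)
    by (cases "L2_norm D u = 0") (auto simp: mult_le_cancel_left)
qed

end


section \<open>Scott-Vogelius spaces\<close>

lemma vertices_convex_hull:
  "\<not> affine_dependent C \<Longrightarrow> vertices (convex hull C) = C"
  by (simp add: vertices_def extreme_point_of_convex_hull_affine_independent)

lemma AE_not_in_frontier:
  fixes K :: "'a::euclidean_space set"
  assumes "convex K"
  shows "AE x in lebesgue. x \<notin> frontier K"
  using negligible_convex_frontier[OF assms] by (intro AE_not_in) (simp add: negligible_iff_null_sets)

lemma interior_disjoint_of_faces:
  fixes K L :: "'a::euclidean_space set"
  assumes "K \<inter> L face_of K" "K \<inter> L face_of L" "K \<noteq> L"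
  shows "interior K \<inter> interior L = {}"
proof (cases "K \<inter> L = K")
  case True
  then have "K \<inter> interior L = {}" using face_of_disjoint_interior[OF assms(2)] assms(3) by auto
  then show ?thesis using interior_subset by blast
next
  case False
  then have "K \<inter> L \<inter> interior K = {}" using face_of_disjoint_interior[OF assms(1)] by blast
  then show ?thesis using interior_subset by blast
qed

locale sv_mesh = bounded_domain D for D :: "(real^'d) set" +
  fixes \<T>0 \<T> :: "(real^'d) set set" and k :: nat and \<sigma> h :: real
  assumes convex_D: "convex D" and D_nonempty: "D \<noteq> {}"
    and tri: "triangulation_of D \<T>0"
    and \<T>_def: "\<T> = barycenter_refinement \<T>0"
    and qu: "quasi_uniform \<sigma> \<T>"
    and h_def: "h = mesh_size \<T>"
    and \<sigma>_pos: "0 < \<sigma>"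
begin

lemma macro_cell:
  assumes "K \<in> \<T>0"
  obtains "finite (vertices K)" "card (vertices K) = CARD('d) + 1" "K = convex hull (vertices K)"
    "barycenter K \<in> K" "compact K" "convex K" "K \<subseteq> closure D"
proof -
  have "int CARD('d) simplex K" using tri assms by (auto simp: triangulation_of_def)
  then obtain C where C: "\<not> affine_dependent C" "int (card C) = int CARD('d) + 1" "K = convex hull C"
    by (auto simp: simplex_def)
  have v: "vertices K = C" using C vertices_convex_hull by simp
  have fin: "finite C" using C(1) by (rule aff_independent_finite)
  have cd: "card C = CARD('d) + 1" using C(2) by linarith
  have "barycenter K \<in> convex hull C"
  proof -
    have "(\<Sum>a\<in>C. (1 / real (card C)) *\<^sub>R a) \<in> convex hull C"
      using cd fin by (intro convex_sum convex_convex_hull hull_inc) auto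
    then show ?thesis by (simp add: barycenter_def v scaleR_sum_right)
  qed
  moreover have "K \<subseteq> closure D" using tri assms by (auto simp: triangulation_of_def)
  ultimately show thesis
    using that C(3) fin cd v by (simp add: finite_imp_compact_convex_hull)
qed

lemma finite_macro: "finite \<T>0"
  using tri by (auto simp: triangulation_of_def triangulation_def)

text \<open>The cone with apex the barycenter over the facet opposite to the vertex
  \<open>a\<close>.\<close>

definition subcell :: "(real^'d) set \<Rightarrow> real^'d \<Rightarrow> (real^'d) set" where
  "subcell K a = convex hull (insert (barycenter K) (vertices K - {a}))"

lemma \<T>_subcells: "\<T> = (\<Union>K\<in>\<T>0. subcell K ` vertices K)"
  by (auto simp: \<T>_def barycenter_refinement_def subcell_def)

lemma finite_\<T>: "finite \<T>"
  unfolding \<T>_subcells using finite_macro macro_cell by (intro finite_UN_I finite_imageI) blast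

lemma subcells_Union: "K \<in> \<T>0 \<Longrightarrow> (\<Union>a\<in>vertices K. subcell K a) = K"
proof -
  assume K: "K \<in> \<T>0"
  have "barycenter K \<in> convex hull (vertices K)" "K = convex hull (vertices K)"
    using macro_cell[OF K] by auto
  then show ?thesis unfolding subcell_def using convex_hull_exchange_Union[of "barycenter K" "vertices K"] by simp
qed

lemma Union_\<T>: "\<Union>\<T> = closure D"
proof -
  have "\<Union>\<T> = (\<Union>K\<in>\<T>0. \<Union>a\<in>vertices K. subcell K a)" by (auto simp: \<T>_subcells)
  also have "\<dots> = \<Union>\<T>0" using subcells_Union by simp
  finally show ?thesis using tri by (simp add: triangulation_of_def)
qed

lemma cell_compact_convex:
  assumes "K \<in> \<T>"
  shows "compact K" "convex K"
proof -
  obtain L a where L: "L \<in> \<T>0" "a \<in> vertices L" "K = subcell L a" using assms by (auto simp: \<T>_subcells)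
  have "finite (vertices L)" by (rule macro_cell[OF L(1)])
  then show "compact K" "convex K" unfolding L(3) subcell_def
    by (auto intro!: finite_imp_compact_convex_hull convex_convex_hull)
qed

lemma \<T>_nonempty: "\<T> \<noteq> {}"
  using Union_\<T> D_nonempty closure_subset by fastforce

lemma cell_diameter: "K \<in> \<T> \<Longrightarrow> diameter K \<le> h"
  unfolding h_def mesh_size_def using finite_\<T> by (intro Max_ge) auto

lemma cell_dist: "K \<in> \<T> \<Longrightarrow> x \<in> K \<Longrightarrow> y \<in> K \<Longrightarrow> dist x y \<le> h"
  using diameter_bounded_bound[OF compact_imp_bounded[OF cell_compact_convex(1)]] cell_diameter
  by (meson order_trans)

text \<open>Otherwise every cell would have at most one point, and the open set \<open>D\<close>,
  covered by finitely many cells, would be finite.\<close>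

lemma h_pos: "0 < h"
proof (rule ccontr)
  assume "\<not> 0 < h"
  then have single: "x = y" if "K \<in> \<T>" "x \<in> K" "y \<in> K" for K x y
  proof -
    have "dist x y \<le> 0" using cell_dist[OF that] \<open>\<not> 0 < h\<close> by linarith
    then show ?thesis by simp
  qed
  obtain x where "x \<in> D" using D_nonempty by blast
  have "finite (\<Union>\<T>)"
  proof (rule finite_Union[OF finite_\<T>])
    fix K assume K: "K \<in> \<T>"
    show "finite K"
    proof (cases "K = {}")
      case False
      then obtain x where "x \<in> K" by blast
      then have "K \<subseteq> {x}" using single[OF K] by blast
      then show ?thesis by (rule finite_subset) simp
    qed simp
  qed
  then have "finite D" unfolding Union_\<T> using closure_subset finite_subset by blast
  then show False using empty_interior_finite[of D] interior_open[OF open_D] D_nonempty by simp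
qed

lemma cell_ball:
  assumes "K \<in> \<T>"
  obtains x where "cball x (h / \<sigma>) \<subseteq> K" "K \<subseteq> cball x h"
proof -
  obtain x where x: "cball x (h / \<sigma>) \<subseteq> K" using qu assms by (auto simp: quasi_uniform_def h_def)
  have "x \<in> K" using x h_pos \<sigma>_pos by (auto simp: subset_eq)
  then have "K \<subseteq> cball x h" using cell_dist[OF assms] by auto
  with x show thesis by (rule that)
qed

text \<open>The ball from quasi-uniformity makes the interior nonempty, so the convex cell is the
  closure of its interior. An open convex set is the interior of its closure, which keeps cell
  interiors inside \<open>D\<close>.\<close>

lemma cell_interior:
  assumes "K \<in> \<T>"
  shows "interior K \<noteq> {}" "closure (interior K) = K" "interior K \<subseteq> D"
proof -
  obtain x where x: "cball x (h / \<sigma>) \<subseteq> K" using cell_ball[OF assms] .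
  have "ball x (h / \<sigma>) \<subseteq> interior K"
    using x ball_subset_cball[of x "h / \<sigma>"] by (intro interior_maximal) auto
  then show ne: "interior K \<noteq> {}" using h_pos \<sigma>_pos by (metis centre_in_ball divide_pos_pos empty_iff subsetD)
  show "closure (interior K) = K"
    using convex_closure_interior[OF cell_compact_convex(2)[OF assms] ne] compact_imp_closed[OF cell_compact_convex(1)[OF assms]]
    by simp
  have "interior K \<subseteq> interior (closure D)" using Union_\<T> assms by (intro interior_mono) auto
  then show "interior K \<subseteq> D"
    using convex_interior_closure[OF convex_D] interior_open[OF open_D] by simp
qed

lemma AE_interior:
  "AE x in lebesgue. \<forall>K\<in>\<T>. x \<in> K \<longrightarrow> x \<in> interior K"
proof -
  have "AE x in lebesgue. \<forall>K\<in>\<T>. x \<notin> frontier K"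
    using AE_not_in_frontier[OF cell_compact_convex(2)] finite_\<T> by (simp add: AE_finite_all)
  then show ?thesis
    by eventually_elim (auto simp: frontier_def dest: subsetD[OF closure_subset])
qed

lemma AE_cell: "AE x in lebesgue_on D. \<exists>K\<in>\<T>. x \<in> interior K"
  unfolding AE_lebesgue_on_iff[OF sets_D] using AE_interior
proof eventually_elim
  case (elim x)
  show ?case
  proof
    assume "x \<in> D"
    then have "x \<in> \<Union>\<T>" unfolding Union_\<T> using closure_subset by blast
    then show "\<exists>K\<in>\<T>. x \<in> interior K" using elim by blast
  qed
qed

text \<open>Macro cells meet in common faces, so their interiors are disjoint and almost every point
  lies in a single macro cell, which has \<open>CARD('d) + 1\<close> subcells. This count stands in
  for disjointness of the subcell interiors and costs a dimensional factor.\<close>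

lemma cell_overlap: "AE x in lebesgue. card {K\<in>\<T>. x \<in> K} \<le> CARD('d) + 1"
proof -
  have "\<forall>L\<in>\<T>0. AE x in lebesgue. x \<notin> frontier L"
  proof
    fix L assume "L \<in> \<T>0"
    then have "convex L" by (rule macro_cell)
    then show "AE x in lebesgue. x \<notin> frontier L" by (rule AE_not_in_frontier)
  qed
  then have "AE x in lebesgue. \<forall>L\<in>\<T>0. x \<notin> frontier L"
    by (simp add: AE_finite_all finite_macro)
  then show ?thesis
  proof eventually_elim
    case (elim x)
    show ?case
    proof (cases "{K\<in>\<T>. x \<in> K} = {}")
      case False
      then obtain L a where L: "L \<in> \<T>0" "a \<in> vertices L" "x \<in> subcell L a" by (auto simp: \<T>_subcells)
      have int: "x \<in> interior L'" if "L' \<in> \<T>0" "x \<in> L'" for L'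
        using elim that closure_subset[of L'] by (auto simp: frontier_def)
      have "x \<in> L" using L subcells_Union by blast
      have "{K\<in>\<T>. x \<in> K} \<subseteq> subcell L ` vertices L"
      proof
        fix K assume "K \<in> {K\<in>\<T>. x \<in> K}"
        then obtain L' a' where L': "L' \<in> \<T>0" "a' \<in> vertices L'" "x \<in> subcell L' a'" "K = subcell L' a'"
          by (auto simp: \<T>_subcells)
        then have "x \<in> L'" using subcells_Union by blast
        then have ne: "interior L \<inter> interior L' \<noteq> {}" using int L(1) L'(1) \<open>x \<in> L\<close> by blast
        have f: "K \<inter> K' face_of K" if "K \<in> \<T>0" "K' \<in> \<T>0" for K K'
          using tri that unfolding triangulation_of_def triangulation_def by blast
        moreover have "L \<inter> L' face_of L" "L \<inter> L' face_of L'"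
          using f[OF L(1) L'(1)] f[OF L'(1) L(1)] by (simp_all add: Int_commute)
        ultimately have "L = L'" using ne interior_disjoint_of_faces[of L L'] by blast
        then show "K \<in> subcell L ` vertices L" using L' by blast
      qed
      then have "card {K\<in>\<T>. x \<in> K} \<le> card (subcell L ` vertices L)"
        using macro_cell[OF L(1)] by (intro card_mono finite_imageI) auto
      also have "\<dots> \<le> card (vertices L)"
        using macro_cell[OF L(1)] by (intro card_image_le) auto
      also have "\<dots> = CARD('d) + 1" using macro_cell[OF L(1)] .
      finally show ?thesis .
    next
      case True
      then have "card {K\<in>\<T>. x \<in> K} = 0" by (simp only: card.empty)
      then show ?thesis by linarith
    qed
  qed
qed

section \<open>Discrete velocities and pressures\<close>

abbreviation Xh :: "(real^'d \<Rightarrow> real^'d) set" where "Xh \<equiv> SV_velocity D \<T> k"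
abbreviation Qh :: "(real^'d \<Rightarrow> real) set" where "Qh \<equiv> SV_pressure D \<T> k"

text \<open>The definition gives the polynomial on the interior; continuity up to the boundary of
  \<open>D\<close> carries it to the closed cell, which is the closure of its interior.\<close>

lemma SV_poly:
  assumes v: "v \<in> Xh" and K: "K \<in> \<T>"
  obtains p where "p \<in> polys k" "\<And>x. x \<in> K \<Longrightarrow> v x $ i = p x"
proof -
  have "\<exists>p\<in>polys k. \<forall>x\<in>interior K. v x $ i = p x"
    using v K by (simp add: SV_velocity_def polys_disc_def)
  then obtain p where p: "p \<in> polys k" "\<And>x. x \<in> interior K \<Longrightarrow> v x $ i = p x" by blast
  have KD: "K \<subseteq> closure D" using Union_\<T> K by blast
  have c: "continuous_on (closure (interior K)) (\<lambda>x. v x $ i)" "continuous_on (closure (interior K)) p"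
    using v KD polys_continuous[OF p(1)] unfolding cell_interior(2)[OF K]
    by (auto simp: SV_velocity_def intro!: continuous_on_component elim: continuous_on_subset)
  have "v x $ i = p x" if "x \<in> K" for x
  proof -
    have "v x $ i - p x = 0"
    proof (rule continuous_constant_on_closure[OF continuous_on_diff[OF c]])
      show "x \<in> closure (interior K)" using that cell_interior(2)[OF K] by simp
    qed (simp add: p(2))
    then show ?thesis by simp
  qed
  with p(1) show thesis by (rule that)
qed

lemma polys_lipschitz_on_cell:
  assumes p: "p \<in> polys k'" and K: "K \<in> \<T>"
  shows "\<exists>M. M-lipschitz_on K p"
proof -
  note cK = cell_compact_convex[OF K]
  have "\<exists>B. \<forall>x\<in>K. \<bar>partial i p x\<bar> \<le> B" for i
  proof -
    have "bounded (partial i p ` K)"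
      by (intro compact_imp_bounded compact_continuous_image cK polys_continuous[OF partial_poly(1)[OF p]])
    then show ?thesis by (auto simp: bounded_iff)
  qed
  then obtain B where B: "\<And>i x. x \<in> K \<Longrightarrow> \<bar>partial i p x\<bar> \<le> B i" by metis
  define M where "M = (\<Sum>i\<in>UNIV. \<bar>B i\<bar>)"
  have M0: "0 \<le> M" by (simp add: M_def sum_nonneg)
  have "norm (p x - p y) \<le> M * norm (x - y)" if "x \<in> K" "y \<in> K" for x y
  proof (rule differentiable_bound[where f'="\<lambda>z h. \<Sum>i\<in>UNIV. h $ i * partial i p z" and B=M, OF cK(2)])
    fix z assume z: "z \<in> K"
    show "(p has_derivative (\<lambda>h. \<Sum>i\<in>UNIV. h $ i * partial i p z)) (at z within K)"
      by (rule has_derivative_at_withinI, rule differentiable_has_derivative_partial, rule partial_poly(2)[OF p])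
    show "onorm (\<lambda>h. \<Sum>i\<in>UNIV. h $ i * partial i p z) \<le> M"
    proof (rule onorm_le)
      fix h :: "real^'d"
      have "norm (\<Sum>i\<in>UNIV. h $ i * partial i p z) \<le> (\<Sum>i\<in>UNIV. norm h * \<bar>B i\<bar>)"
      proof (rule sum_norm_le)
        fix i
        have "\<bar>partial i p z\<bar> \<le> \<bar>B i\<bar>" using B[OF z, of i] by linarith
        then show "norm (h $ i * partial i p z) \<le> norm h * \<bar>B i\<bar>"
          by (simp add: abs_mult mult_mono component_le_norm_cart)
      qed
      then show "norm (\<Sum>i\<in>UNIV. h $ i * partial i p z) \<le> M * norm h"
        by (simp add: M_def sum_distrib_left mult.commute)
    qed
  qed (use that in auto)
  then have "M-lipschitz_on K p" using M0 by (intro lipschitz_onI) (auto simp: dist_norm)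
  then show ?thesis by blast
qed

text \<open>The segment between two points of the convex set \<open>D\<close> is cut by the cells
  into finitely many closed pieces. On each piece one common constant works, and Lipschitz
  continuity along the segment follows.\<close>

lemma SV_plip:
  assumes v: "v \<in> Xh"
  shows "plip (\<lambda>x. v x $ i)"
proof -
  let ?f = "\<lambda>x. v x $ i"
  have "\<exists>M. M-lipschitz_on K ?f" if K: "K \<in> \<T>" for K
  proof -
    obtain p where p: "p \<in> polys k" "\<And>x. x \<in> K \<Longrightarrow> v x $ i = p x" using SV_poly[OF v K] by blast
    obtain M where "M-lipschitz_on K p" using polys_lipschitz_on_cell[OF p(1) K] by blast
    then show ?thesis using p(2) lipschitz_on_transform[of M K p ?f] by auto
  qed
  then obtain MK where MK: "\<And>K. K \<in> \<T> \<Longrightarrow> (MK K)-lipschitz_on K ?f" by metis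
  define M where "M = (\<Sum>K\<in>\<T>. \<bar>MK K\<bar>)"
  have M0: "0 \<le> M" by (simp add: M_def sum_nonneg)
  have lipM: "M-lipschitz_on K ?f" if "K \<in> \<T>" for K
  proof (rule lipschitz_on_mono[OF MK[OF that] subset_refl])
    have "MK K \<le> \<bar>MK K\<bar>" by simp
    also have "\<dots> \<le> M" unfolding M_def using finite_\<T> that by (intro member_le_sum) auto
    finally show "MK K \<le> M" .
  qed
  have "M-lipschitz_on D ?f"
  proof (rule lipschitz_onI[OF _ M0])
    fix x y assume xy: "x \<in> D" "y \<in> D"
    define \<gamma> where "\<gamma> = (\<lambda>t::real. x + t *\<^sub>R (y - x))"
    have "(M * norm (y - x))-lipschitz_on {0..1} (?f \<circ> \<gamma>)"
    proof (rule lipschitz_on_closed_Union[where I=\<T> and U="\<lambda>K. {0..1} \<inter> \<gamma> -` K"])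
      fix K assume K: "K \<in> \<T>"
      show "(M * norm (y - x))-lipschitz_on ({0..1} \<inter> \<gamma> -` K) (?f \<circ> \<gamma>)"
      proof (rule lipschitz_onI)
        fix s t assume st: "s \<in> {0..1} \<inter> \<gamma> -` K" "t \<in> {0..1} \<inter> \<gamma> -` K"
        have "\<gamma> s - \<gamma> t = (s - t) *\<^sub>R (y - x)" by (simp add: \<gamma>_def algebra_simps)
        then have "dist (\<gamma> s) (\<gamma> t) = \<bar>s - t\<bar> * norm (y - x)" by (simp add: dist_norm)
        moreover have "dist (?f (\<gamma> s)) (?f (\<gamma> t)) \<le> M * dist (\<gamma> s) (\<gamma> t)"
          using lipschitz_onD[OF lipM[OF K], of "\<gamma> s" "\<gamma> t"] st by simp
        ultimately show "dist ((?f \<circ> \<gamma>) s) ((?f \<circ> \<gamma>) t) \<le> M * norm (y - x) * dist s t"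
          by (simp add: dist_real_def mult_ac)
      qed (simp add: M0)
      have "continuous_on UNIV \<gamma>" unfolding \<gamma>_def by (intro continuous_intros)
      then show "closed ({0..1} \<inter> \<gamma> -` K)"
        using compact_imp_closed[OF cell_compact_convex(1)[OF K]]
        by (intro closed_Int closed_atLeastAtMost continuous_closed_vimage) (auto simp: continuous_on_eq_continuous_at)
    next
      show "{0..1} \<subseteq> (\<Union>K\<in>\<T>. {0..1} \<inter> \<gamma> -` K)"
      proof
        fix t :: real assume t: "t \<in> {0..1}"
        have "(1 - t) *\<^sub>R x + t *\<^sub>R y \<in> D" using convexD_alt[OF convex_D xy, of t] t by simp
        then have "\<gamma> t \<in> closure D" using closure_subset by (auto simp: \<gamma>_def algebra_simps)
        then show "t \<in> (\<Union>K\<in>\<T>. {0..1} \<inter> \<gamma> -` K)" using t unfolding Union_\<T>[symmetric] by blast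
      qed
    qed (use finite_\<T> M0 in auto)
    from lipschitz_onD[OF this, of 0 1] show "dist (v x $ i) (v y $ i) \<le> M * dist x y"
      by (simp add: \<gamma>_def dist_norm norm_minus_commute)
  qed
  moreover have "AE x in lebesgue_on D. ?f differentiable (at x)"
    using AE_cell
  proof eventually_elim
    case (elim x)
    then obtain K where K: "K \<in> \<T>" "x \<in> interior K" by blast
    obtain p where p: "p \<in> polys k" "\<And>x. x \<in> K \<Longrightarrow> v x $ i = p x" using SV_poly[OF v K(1)] by blast
    have "(p has_derivative frechet_derivative p (at x)) (at x)"
      using partial_poly(2)[OF p(1)] by (simp add: frechet_derivative_works[symmetric])
    then have "(?f has_derivative frechet_derivative p (at x)) (at x)"
      by (rule has_derivative_transform_within_open[OF _ open_interior K(2)])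
         (simp add: p(2)[OF subsetD[OF interior_subset]])
    then show ?case by (rule differentiableI)
  qed
  ultimately show ?thesis by (auto simp: plip_def)
qed

lemma SV_vplip: "v \<in> Xh \<Longrightarrow> vplip v"
  by (simp add: vplip_def SV_plip)

lemma SV_H10: "v \<in> Xh \<Longrightarrow> v \<in> H10 D"
  by (simp add: SV_velocity_def)

lemma SV_lincomb:
  assumes "u \<in> Xh" "v \<in> Xh"
  shows "(\<lambda>x. a *\<^sub>R u x + b *\<^sub>R v x) \<in> Xh"
proof -
  have "\<exists>p\<in>polys k. \<forall>x\<in>interior K. (a *\<^sub>R u x + b *\<^sub>R v x) $ i = p x" if K: "K \<in> \<T>" for K i
  proof -
    obtain p where p: "p \<in> polys k" "\<And>x. x \<in> K \<Longrightarrow> u x $ i = p x" using SV_poly[OF assms(1) K] by blast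
    obtain q where q: "q \<in> polys k" "\<And>x. x \<in> K \<Longrightarrow> v x $ i = q x" using SV_poly[OF assms(2) K] by blast
    have "(\<lambda>x. a * p x + b * q x) \<in> polys k"
      by (intro polys_add polys_mult_const p q)
    then show ?thesis
      by (rule bexI[rotated]) (use p(2) q(2) interior_subset[of K] in auto)
  qed
  then show ?thesis using assms
    by (auto simp: SV_velocity_def polys_disc_def intro!: H10_lincomb continuous_intros)
qed

lemma SV_partial_poly:
  assumes v: "v \<in> Xh" and K: "K \<in> \<T>"
  obtains p where "p \<in> polys k" "\<And>x. x \<in> K \<Longrightarrow> v x $ i = p x"
    "\<And>x j. x \<in> interior K \<Longrightarrow> partial j (\<lambda>y. v y $ i) x = partial j p x"
proof -
  obtain p where p: "p \<in> polys k" "\<And>x. x \<in> K \<Longrightarrow> v x $ i = p x" using SV_poly[OF v K] by blast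
  have "partial j (\<lambda>y. v y $ i) x = partial j p x" if x: "x \<in> interior K" for x j
  proof -
    have "(p has_derivative frechet_derivative p (at x)) (at x)"
      using partial_poly(2)[OF p(1)] by (simp add: frechet_derivative_works[symmetric])
    then have "((\<lambda>y. v y $ i) has_derivative frechet_derivative p (at x)) (at x)"
      by (rule has_derivative_transform_within_open[OF _ open_interior x])
         (simp add: p(2)[OF subsetD[OF interior_subset]])
    from partial_eqI[OF this] show ?thesis by (simp add: partial_def)
  qed
  with p show thesis by (rule that)
qed

text \<open>Differentiation lowers the degree on each cell by one, pressures may jump between cells,
  and the divergence has mean zero because the field vanishes on the boundary. The witness is built
  from classical derivatives, as \<open>dvg\<close> is fixed only up to null sets.\<close>

lemma SV_dvg_pressure:
  assumes v: "v \<in> Xh"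
  obtains q where "q \<in> Qh" "AE x in lebesgue_on D. dvg D v x = q x"
proof -
  define q where "q = (\<lambda>x. \<Sum>i\<in>UNIV. partial i (\<lambda>y. v y $ i) x)"
  have eq: "AE x in lebesgue_on D. dvg D v x = q x"
    using vplip_grad[OF SV_vplip[OF v]] by eventually_elim (simp add: dvg_def q_def)
  have qe: "essbdd q" unfolding q_def by (intro essbdd_sum plip_partial_essbdd SV_plip v)
  have "(\<integral>x. q x \<partial>lebesgue_on D) = (\<integral>x. dvg D v x \<partial>lebesgue_on D)"
    using eq qe vplip_dvg_essbdd[OF SV_vplip[OF v]]
    by (intro integral_cong_AE essbdd_measurable) (auto elim: eventually_mono)
  then have "q \<in> L20 D"
    using integral_dvg_eq_0[OF SV_H10[OF v]] essbdd_L2[OF qe] by (simp add: L20_def)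
  moreover have "q \<in> polys_disc \<T> (k - 1)"
    unfolding polys_disc_def mem_Collect_eq
  proof
    fix K assume K: "K \<in> \<T>"
    have "\<exists>p. p \<in> polys (k - 1) \<and> (\<forall>x\<in>interior K. partial i (\<lambda>y. v y $ i) x = p x)" for i
    proof -
      obtain p where p: "p \<in> polys k" "\<And>x. x \<in> K \<Longrightarrow> v x $ i = p x"
        "\<And>x j. x \<in> interior K \<Longrightarrow> partial j (\<lambda>y. v y $ i) x = partial j p x"
        by (rule SV_partial_poly[OF v K]) (rule that)
      show ?thesis
        by (intro exI[of _ "partial i p"] conjI partial_poly(1)[OF p(1)]) (simp add: p(3))
    qed
    then obtain P where P: "\<And>i. P i \<in> polys (k - 1)" "\<And>i x. x \<in> interior K \<Longrightarrow> partial i (\<lambda>y. v y $ i) x = P i x"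
      by metis
    show "\<exists>p\<in>polys (k - 1). \<forall>x\<in>interior K. q x = p x"
      by (rule bexI[of _ "\<lambda>x. \<Sum>i\<in>UNIV. P i x"]) (use P in \<open>auto simp: q_def intro: polys_sum\<close>)
  qed
  ultimately have "q \<in> Qh" by (simp add: SV_pressure_def)
  then show thesis using eq by (rule that)
qed

lemma polys_disc_essbdd:
  assumes q: "q \<in> polys_disc \<T> m" "q \<in> borel_measurable (lebesgue_on D)"
  shows "essbdd q"
proof -
  have "\<exists>B. \<forall>x\<in>interior K. \<bar>q x\<bar> \<le> B" if K: "K \<in> \<T>" for K
  proof -
    obtain p where p: "p \<in> polys m" "\<And>x. x \<in> interior K \<Longrightarrow> q x = p x"
      using q(1) K by (auto simp: polys_disc_def)
    have "bounded (p ` K)"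
      by (intro compact_imp_bounded compact_continuous_image polys_continuous[OF p(1)] cell_compact_convex[OF K])
    then obtain B where "\<forall>y\<in>p ` K. norm y \<le> B" by (auto simp: bounded_iff)
    then have "\<forall>x\<in>interior K. \<bar>q x\<bar> \<le> B" using p(2) interior_subset[of K] by auto
    then show ?thesis by blast
  qed
  then obtain B where B: "\<And>K x. K \<in> \<T> \<Longrightarrow> x \<in> interior K \<Longrightarrow> \<bar>q x\<bar> \<le> B K" by metis
  show ?thesis
  proof (rule essbddI[OF q(2)])
    show "AE x in lebesgue_on D. norm (q x) \<le> (\<Sum>K\<in>\<T>. \<bar>B K\<bar>)"
      using AE_cell
    proof eventually_elim
      case (elim x)
      then obtain K where K: "K \<in> \<T>" "x \<in> interior K" by blast
      have "\<bar>q x\<bar> \<le> \<bar>B K\<bar>" using B[OF K] by linarith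
      also have "\<dots> \<le> (\<Sum>K\<in>\<T>. \<bar>B K\<bar>)" using finite_\<T> K by (intro member_le_sum) auto
      finally show ?case by simp
    qed
  qed
qed

text \<open>The divergence itself is, up to a null set, an admissible pressure; testing with it
  gives its squared norm.\<close>

lemma Vspace_dvg:
  assumes v: "v \<in> Vspace D Xh Qh"
  shows "AE x in lebesgue_on D. dvg D v x = 0"
proof -
  have vX: "v \<in> Xh" using v by (simp add: Vspace_def)
  obtain q where q: "q \<in> Qh" "AE x in lebesgue_on D. dvg D v x = q x" using SV_dvg_pressure[OF vX] .
  have qm: "q \<in> borel_measurable (lebesgue_on D)"
    using q(1) by (auto simp: SV_pressure_def L20_def intro: L2_measurable)
  have de: "essbdd (dvg D v)" by (rule vplip_dvg_essbdd[OF SV_vplip[OF vX]])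
  have "(\<integral>x. dvg D v x \<bullet> dvg D v x \<partial>lebesgue_on D) = (\<integral>x. dvg D v x \<bullet> q x \<partial>lebesgue_on D)"
    using q(2) qm essbdd_measurable[OF de] by (intro integral_cong_AE) (auto elim: eventually_mono)
  also have "\<dots> = 0" using v q(1) by (simp add: Vspace_def L2_inner_def)
  finally have "L2_norm D (dvg D v) = 0" by (simp add: L2_norm_def L2_inner_def)
  then show ?thesis using L2_norm_eq_0[OF essbdd_L2[OF de]] by simp
qed

end

lemma norm_matrix_power2: "(norm (G :: real^'n^'m))\<^sup>2 = (\<Sum>i\<in>UNIV. \<Sum>j\<in>UNIV. (G $ i $ j)\<^sup>2)"
  unfolding power2_norm_eq_inner inner_vec_def by (simp add: power2_eq_square)

lemma norm_vector_power2: "(norm (v :: real^'n))\<^sup>2 = (\<Sum>i\<in>UNIV. (v $ i)\<^sup>2)"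
  unfolding power2_norm_eq_inner inner_vec_def by (simp add: power2_eq_square)

context sv_mesh
begin

section \<open>Inverse inequalities on the mesh\<close>

definition cell_mass :: "(real^'d \<Rightarrow> real^'d) \<Rightarrow> (real^'d) set \<Rightarrow> real" where
  "cell_mass v K = (\<integral>x. indicator K x * (norm (v x))\<^sup>2 \<partial>lebesgue_on D)"

lemma cell_mass_integrable:
  assumes v: "v \<in> Xh" and K: "K \<in> \<T>"
  shows "integrable (lebesgue_on D) (\<lambda>x. indicator K x * (norm (v x))\<^sup>2)"
proof -
  have "K \<in> sets lebesgue" using compact_imp_closed[OF cell_compact_convex(1)[OF K]] by auto
  then have "K \<inter> space lebesgue \<in> sets lebesgue" by simp
  then have "essbdd (\<lambda>x. indicator K x :: real)"
    by (intro essbddI[where B=1] always_eventually measurable_restrict_space1) (auto simp: indicator_def)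
  then show ?thesis
    by (intro essbdd_integrable essbdd_mult essbdd_power2 essbdd_norm vplip_essbdd SV_vplip v)
qed

lemma cell_mass_le:
  assumes v: "v \<in> Xh" and K: "K \<in> \<T>"
  shows "0 \<le> cell_mass v K" "cell_mass v K \<le> (L2_norm D v)\<^sup>2"
proof -
  show "0 \<le> cell_mass v K" unfolding cell_mass_def by (intro integral_nonneg_AE always_eventually) auto
  show "cell_mass v K \<le> (L2_norm D v)\<^sup>2"
    unfolding cell_mass_def L2_norm_power2
    by (rule integral_mono[OF cell_mass_integrable[OF v K]])
       (auto simp: indicator_def intro!: essbdd_integrable essbdd_power2 essbdd_norm vplip_essbdd SV_vplip v)
qed

text \<open>Passes from the polynomial on the inscribed ball, integrated with respect to Borel
  measure, to the finite element function on the cell, integrated over \<open>D\<close>.\<close>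

lemma ball_mass_le_cell_mass:
  assumes v: "v \<in> Xh" and K: "K \<in> \<T>" and p: "p \<in> polys k" "\<And>x. x \<in> K \<Longrightarrow> v x $ i = p x"
    and ball: "cball x0 r \<subseteq> K"
  shows "(\<integral>z. indicator (cball x0 r) z * (p z)\<^sup>2 \<partial>lborel) \<le> cell_mass v K"
proof -
  have pm: "p \<in> borel_measurable borel"
    using polys_continuous[OF p(1)] by (rule borel_measurable_continuous_onI)
  have bm: "(\<lambda>z. indicator (cball x0 r) z * (p z)\<^sup>2) \<in> borel_measurable lborel"
    using pm by (auto intro!: borel_measurable_times borel_measurable_indicator borel_measurable_power simp: borel_closed)
  have bi: "integrable lborel (\<lambda>z. indicator (cball x0 r) z * (p z)\<^sup>2)"
    using borel_integrable_compact[OF compact_cball, of x0 r "\<lambda>z. (p z)\<^sup>2"] polys_continuous[OF p(1)]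
    by (simp add: continuous_on_power)
  have "(\<integral>z. indicator (cball x0 r) z * (p z)\<^sup>2 \<partial>lborel) = (\<integral>z. indicator (cball x0 r) z * (p z)\<^sup>2 \<partial>lebesgue)"
    using integral_completion[OF bm] by simp
  also have "\<dots> \<le> (\<integral>x. indicator D x *\<^sub>R (indicator K x * (norm (v x))\<^sup>2) \<partial>lebesgue)"
  proof (rule integral_mono_AE)
    show "integrable lebesgue (\<lambda>z. indicator (cball x0 r) z * (p z)\<^sup>2)"
      using bi by (simp add: integrable_completion bm)
    show "integrable lebesgue (\<lambda>x. indicator D x *\<^sub>R (indicator K x * (norm (v x))\<^sup>2))"
      using cell_mass_integrable[OF v K] sets_D by (subst integrable_restrict_space[symmetric]) auto
    show "AE z in lebesgue. indicator (cball x0 r) z * (p z)\<^sup>2 \<le> indicator D z *\<^sub>R (indicator K z * (norm (v z))\<^sup>2)"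
      using AE_interior
    proof eventually_elim
      case (elim z)
      show ?case
      proof (cases "z \<in> cball x0 r")
        case True
        then have zK: "z \<in> K" using ball by blast
        then have "z \<in> D" using elim K cell_interior(3)[OF K] by blast
        moreover have "(p z)\<^sup>2 \<le> (norm (v z))\<^sup>2"
          using component_le_norm_cart[of "v z" i] p(2)[OF zK] by (metis abs_ge_zero power2_abs power_mono)
        ultimately show ?thesis using True zK by simp
      qed simp
    qed
  qed
  also have "\<dots> = cell_mass v K"
    unfolding cell_mass_def using sets_D by (subst integral_restrict_space) auto
  finally show ?thesis .
qed

text \<open>The polynomial estimate enters as a hypothesis on \<open>C\<close> rather than through
  its existence, so that one constant, chosen before the mesh, serves all meshes. The next inverse
  bound has the same form.\<close>

lemma value_bound_on_cell:
  assumes C: "\<And>p (x0::real^'d) h x. p \<in> polys k \<Longrightarrow> 0 < h \<Longrightarrow> x \<in> cball x0 (2 * h) \<Longrightarrow>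
     (p x)\<^sup>2 \<le> C / h ^ CARD('d) * (\<integral>z. indicator (cball x0 (h / \<sigma>)) z * (p z)\<^sup>2 \<partial>lborel)" and C0: "0 < C"
    and v: "v \<in> Xh" and x: "x \<in> closure D"
  shows "(norm (v x))\<^sup>2 \<le> real CARD('d) * C / h ^ CARD('d) * (L2_norm D v)\<^sup>2"
proof -
  obtain K where K: "K \<in> \<T>" "x \<in> K" using x Union_\<T> by blast
  obtain x0 where x0: "cball x0 (h / \<sigma>) \<subseteq> K" "K \<subseteq> cball x0 h" using cell_ball[OF K(1)] .
  have "(v x $ i)\<^sup>2 \<le> C / h ^ CARD('d) * (L2_norm D v)\<^sup>2" for i
  proof -
    obtain p where p: "p \<in> polys k" "\<And>x. x \<in> K \<Longrightarrow> v x $ i = p x" using SV_poly[OF v K(1)] by blast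
    have "x \<in> cball x0 (2 * h)" using K(2) x0(2) h_pos by force
    then have "(p x)\<^sup>2 \<le> C / h ^ CARD('d) * (\<integral>z. indicator (cball x0 (h / \<sigma>)) z * (p z)\<^sup>2 \<partial>lborel)"
      by (rule C[OF p(1) h_pos])
    also have "\<dots> \<le> C / h ^ CARD('d) * (L2_norm D v)\<^sup>2"
      using C0 h_pos ball_mass_le_cell_mass[OF v K(1) p x0(1)] cell_mass_le(2)[OF v K(1)]
      by (intro mult_left_mono) auto
    finally show ?thesis using p(2)[OF K(2)] by simp
  qed
  then have "(\<Sum>i\<in>UNIV. (v x $ i)\<^sup>2) \<le> (\<Sum>i\<in>(UNIV::'d set). C / h ^ CARD('d) * (L2_norm D v)\<^sup>2)"
    by (intro sum_mono)
  then show ?thesis by (simp add: norm_vector_power2)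
qed

lemma sum_cell_mass:
  assumes v: "v \<in> Xh"
  shows "(\<Sum>K\<in>\<T>. cell_mass v K) \<le> real (CARD('d) + 1) * (L2_norm D v)\<^sup>2"
proof -
  have vi: "integrable (lebesgue_on D) (\<lambda>x. (norm (v x))\<^sup>2)"
    by (intro essbdd_integrable essbdd_power2 essbdd_norm vplip_essbdd SV_vplip v)
  have "(\<Sum>K\<in>\<T>. cell_mass v K) = (\<integral>x. (\<Sum>K\<in>\<T>. indicator K x * (norm (v x))\<^sup>2) \<partial>lebesgue_on D)"
    unfolding cell_mass_def using cell_mass_integrable[OF v] by simp
  also have "\<dots> \<le> (\<integral>x. real (CARD('d) + 1) * (norm (v x))\<^sup>2 \<partial>lebesgue_on D)"
  proof (rule integral_mono_AE)
    show "integrable (lebesgue_on D) (\<lambda>x. \<Sum>K\<in>\<T>. indicator K x * (norm (v x))\<^sup>2)"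
      using cell_mass_integrable[OF v] by simp
    show "integrable (lebesgue_on D) (\<lambda>x. real (CARD('d) + 1) * (norm (v x))\<^sup>2)" using vi by simp
    show "AE x in lebesgue_on D. (\<Sum>K\<in>\<T>. indicator K x * (norm (v x))\<^sup>2) \<le> real (CARD('d) + 1) * (norm (v x))\<^sup>2"
      unfolding AE_lebesgue_on_iff[OF sets_D] using cell_overlap
    proof eventually_elim
      case (elim x)
      have "(\<Sum>K\<in>\<T>. indicator K x :: real) = real (card {K\<in>\<T>. x \<in> K})"
        using finite_\<T> by (simp add: indicator_def sum.If_cases Int_def)
      then have "(\<Sum>K\<in>\<T>. indicator K x * (norm (v x))\<^sup>2) = real (card {K\<in>\<T>. x \<in> K}) * (norm (v x))\<^sup>2"
        by (simp add: sum_distrib_right[symmetric])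
      also have "\<dots> \<le> real (CARD('d) + 1) * (norm (v x))\<^sup>2"
        using elim by (intro mult_right_mono) auto
      finally show ?case by simp
    qed
  qed
  also have "\<dots> = real (CARD('d) + 1) * (L2_norm D v)\<^sup>2" by (simp add: L2_norm_power2)
  finally show ?thesis .
qed

text \<open>The pointwise bound on a cell is multiplied by the volume of the cell, at most that of a
  ball of radius \<open>h\<close>; this cancels the dimensional power and leaves
  \<open>1 / h^2\<close>. Summing the cell masses costs the overlap factor.\<close>

lemma gradient_inverse_bound:
  assumes C: "\<And>p (x0::real^'d) h x i. p \<in> polys k \<Longrightarrow> 0 < h \<Longrightarrow> x \<in> cball x0 h \<Longrightarrow>
     (partial i p x)\<^sup>2 \<le> C / (h ^ CARD('d) * h\<^sup>2) * (\<integral>z. indicator (cball x0 (h / \<sigma>)) z * (p z)\<^sup>2 \<partial>lborel)" and C0: "0 < C"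
    and v: "v \<in> Xh"
  shows "(L2_norm D (grad D v))\<^sup>2 \<le> (real CARD('d))\<^sup>2 * unit_ball_vol (real CARD('d)) * real (CARD('d) + 1) * C / h\<^sup>2 * (L2_norm D v)\<^sup>2"
proof -
  define c where "c = (real CARD('d))\<^sup>2 * (C / (h ^ CARD('d) * h\<^sup>2))"
  have c: "0 \<le> c" using C0 h_pos by (simp add: c_def)
  have gb: "(norm (grad D v x))\<^sup>2 \<le> c * cell_mass v K"
    if K: "K \<in> \<T>" and x: "x \<in> interior K" and g: "\<forall>i j. grad D v x $ i $ j = partial j (\<lambda>y. v y $ i) x" for x K
  proof -
    obtain x0 where x0: "cball x0 (h / \<sigma>) \<subseteq> K" "K \<subseteq> cball x0 h" using cell_ball[OF K] .
    have "(grad D v x $ i $ j)\<^sup>2 \<le> C / (h ^ CARD('d) * h\<^sup>2) * cell_mass v K" for i j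
    proof -
      obtain p where p: "p \<in> polys k" "\<And>x. x \<in> K \<Longrightarrow> v x $ i = p x"
        "\<And>x j. x \<in> interior K \<Longrightarrow> partial j (\<lambda>y. v y $ i) x = partial j p x"
        by (rule SV_partial_poly[OF v K]) (rule that)
      have "x \<in> cball x0 h" using x x0(2) interior_subset by blast
      then have "(partial j p x)\<^sup>2 \<le> C / (h ^ CARD('d) * h\<^sup>2) * (\<integral>z. indicator (cball x0 (h / \<sigma>)) z * (p z)\<^sup>2 \<partial>lborel)"
        by (rule C[OF p(1) h_pos])
      also have "\<dots> \<le> C / (h ^ CARD('d) * h\<^sup>2) * cell_mass v K"
        using C0 h_pos ball_mass_le_cell_mass[OF v K p(1,2) x0(1)] by (intro mult_left_mono) auto
      finally show ?thesis using p(3)[OF x] g by simp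
    qed
    then have "(\<Sum>i\<in>UNIV. \<Sum>j\<in>UNIV. (grad D v x $ i $ j)\<^sup>2)
       \<le> (\<Sum>i\<in>(UNIV::'d set). \<Sum>j\<in>(UNIV::'d set). C / (h ^ CARD('d) * h\<^sup>2) * cell_mass v K)"
      by (intro sum_mono)
    then show ?thesis unfolding norm_matrix_power2 by (simp add: c_def power2_eq_square mult_ac)
  qed
  have Ki: "integrable (lebesgue_on D) (\<lambda>x. indicator K x * (c * cell_mass v K))"
    and Kle: "(\<integral>x. indicator K x * (c * cell_mass v K) \<partial>lebesgue_on D)
       \<le> unit_ball_vol (real CARD('d)) * h ^ CARD('d) * (c * cell_mass v K)" if K: "K \<in> \<T>" for K
  proof -
    have Ks: "K \<in> sets lebesgue" using compact_imp_closed[OF cell_compact_convex(1)[OF K]] by auto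
    obtain x0 where x0: "K \<subseteq> cball x0 h" using cell_ball[OF K] .
    have Kl: "K \<in> lmeasurable" using cell_compact_convex(1)[OF K] by (rule lmeasurable_compact)
    have i0: "integrable lebesgue (\<lambda>x. indicator D x *\<^sub>R (indicator K x :: real))"
      using integrable_mult_indicator[OF sets_D lmeasurable_iff_integrable[THEN iffD1, OF Kl]] .
    have i1: "integrable (lebesgue_on D) (indicator K :: _ \<Rightarrow> real)"
      using i0 sets_D by (subst integrable_restrict_space) auto
    then show "integrable (lebesgue_on D) (\<lambda>x. indicator K x * (c * cell_mass v K))" by simp
    have "(\<integral>x. indicator K x \<partial>lebesgue_on D) = (\<integral>x. indicator D x *\<^sub>R (indicator K x :: real) \<partial>lebesgue)"
      using sets_D by (subst integral_restrict_space) auto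
    also have "\<dots> \<le> (\<integral>x. indicator K x \<partial>lebesgue)"
      by (rule integral_mono[OF i0 lmeasurable_iff_integrable[THEN iffD1, OF Kl]]) (simp add: indicator_def)
    also have "\<dots> = measure lebesgue K" using Kl by (simp add: lmeasure_integral)
    also have "\<dots> \<le> measure lebesgue (cball x0 h)"
      using x0 Kl by (intro measure_mono_fmeasurable) (auto simp: Ks)
    also have "\<dots> = unit_ball_vol (real CARD('d)) * h ^ CARD('d)"
      using content_cball[of h x0] h_pos by simp
    finally have "(\<integral>x. indicator K x \<partial>lebesgue_on D) * (c * cell_mass v K)
       \<le> unit_ball_vol (real CARD('d)) * h ^ CARD('d) * (c * cell_mass v K)"
      using c cell_mass_le(1)[OF v K] by (intro mult_right_mono) auto
    then show "(\<integral>x. indicator K x * (c * cell_mass v K) \<partial>lebesgue_on D)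
       \<le> unit_ball_vol (real CARD('d)) * h ^ CARD('d) * (c * cell_mass v K)"
      by simp
  qed
  have ge: "essbdd (grad D v)" by (rule vplip_grad_essbdd[OF SV_vplip[OF v]])
  have "(\<integral>x. (norm (grad D v x))\<^sup>2 \<partial>lebesgue_on D) \<le> (\<integral>x. (\<Sum>K\<in>\<T>. indicator K x * (c * cell_mass v K)) \<partial>lebesgue_on D)"
  proof (rule integral_mono_AE)
    show "integrable (lebesgue_on D) (\<lambda>x. (norm (grad D v x))\<^sup>2)"
      by (intro essbdd_integrable essbdd_power2 essbdd_norm ge)
    show "integrable (lebesgue_on D) (\<lambda>x. \<Sum>K\<in>\<T>. indicator K x * (c * cell_mass v K))"
      by (intro Bochner_Integration.integrable_sum Ki)
    show "AE x in lebesgue_on D. (norm (grad D v x))\<^sup>2 \<le> (\<Sum>K\<in>\<T>. indicator K x * (c * cell_mass v K))"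
      using AE_cell vplip_grad[OF SV_vplip[OF v]]
    proof eventually_elim
      case (elim x)
      then obtain K where K: "K \<in> \<T>" "x \<in> interior K" by blast
      then have xK: "x \<in> K" using interior_subset by blast
      have "(norm (grad D v x))\<^sup>2 \<le> indicator K x * (c * cell_mass v K)"
        using gb[OF K] elim(2) xK by simp
      also have "\<dots> \<le> (\<Sum>K\<in>\<T>. indicator K x * (c * cell_mass v K))"
      proof (rule member_le_sum[OF K(1) _ finite_\<T>])
        fix L assume "L \<in> \<T> - {K}"
        then show "0 \<le> indicator L x * (c * cell_mass v L)"
          using c cell_mass_le(1)[OF v] by (intro mult_nonneg_nonneg) auto
      qed
      finally show ?case .
    qed
  qed
  also have "\<dots> = (\<Sum>K\<in>\<T>. \<integral>x. indicator K x * (c * cell_mass v K) \<partial>lebesgue_on D)"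
    using Ki by (rule Bochner_Integration.integral_sum)
  also have "\<dots> \<le> (\<Sum>K\<in>\<T>. unit_ball_vol (real CARD('d)) * h ^ CARD('d) * (c * cell_mass v K))"
    by (intro sum_mono Kle)
  also have "\<dots> = unit_ball_vol (real CARD('d)) * h ^ CARD('d) * c * (\<Sum>K\<in>\<T>. cell_mass v K)"
    by (simp add: sum_distrib_left mult.assoc)
  also have "\<dots> \<le> unit_ball_vol (real CARD('d)) * h ^ CARD('d) * c * (real (CARD('d) + 1) * (L2_norm D v)\<^sup>2)"
    using c h_pos by (intro mult_left_mono sum_cell_mass[OF v]) auto
  also have "\<dots> = (real CARD('d))\<^sup>2 * unit_ball_vol (real CARD('d)) * real (CARD('d) + 1) * C / h\<^sup>2 * (L2_norm D v)\<^sup>2"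
  proof -
    have hc: "h ^ CARD('d) * c = (real CARD('d))\<^sup>2 * (C / h\<^sup>2)" using h_pos by (simp add: c_def)
    have "unit_ball_vol (real CARD('d)) * h ^ CARD('d) * c * (real (CARD('d) + 1) * (L2_norm D v)\<^sup>2)
        = unit_ball_vol (real CARD('d)) * (h ^ CARD('d) * c) * (real (CARD('d) + 1) * (L2_norm D v)\<^sup>2)"
      by (simp only: mult.assoc)
    then show ?thesis unfolding hc by (simp add: mult_ac)
  qed
  finally show ?thesis by (simp add: L2_norm_power2)
qed

end

section \<open>Orthogonal projection onto the discretely divergence-free fields\<close>

text \<open>The form is only semidefinite because functions that agree almost everywhere on
  \<open>D\<close> are not identified.\<close>

locale semi_inner_space =
  fixes X :: "('a \<Rightarrow> 'b::real_vector) set" and B :: "('a \<Rightarrow> 'b) \<Rightarrow> ('a \<Rightarrow> 'b) \<Rightarrow> real"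
  assumes zero: "(\<lambda>x. 0) \<in> X"
    and lincomb: "u \<in> X \<Longrightarrow> v \<in> X \<Longrightarrow> (\<lambda>x. a *\<^sub>R u x + b *\<^sub>R v x) \<in> X"
    and B_lin: "u \<in> X \<Longrightarrow> v \<in> X \<Longrightarrow> w \<in> X \<Longrightarrow> B (\<lambda>x. a *\<^sub>R u x + b *\<^sub>R v x) w = a * B u w + b * B v w"
    and B_sym: "u \<in> X \<Longrightarrow> v \<in> X \<Longrightarrow> B u v = B v u"
    and B_nonneg: "u \<in> X \<Longrightarrow> 0 \<le> B u u"
begin

lemma sum_closed:
  fixes m :: nat
  assumes "\<And>i. i < m \<Longrightarrow> \<phi> i \<in> X"
  shows "(\<lambda>x. \<Sum>i<m. c i *\<^sub>R \<phi> i x) \<in> X"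
  using assms
proof (induction m)
  case (Suc m)
  have "(\<lambda>x. 1 *\<^sub>R (\<Sum>i<m. c i *\<^sub>R \<phi> i x) + c m *\<^sub>R \<phi> m x) \<in> X"
    using Suc by (intro lincomb) auto
  then show ?case by simp
qed (simp add: zero)

lemma B_zero: "w \<in> X \<Longrightarrow> B (\<lambda>x. 0) w = 0"
  using B_lin[OF zero zero, of w 0 0] by simp

lemma B_sum:
  fixes m :: nat
  assumes "\<And>i. i < m \<Longrightarrow> \<phi> i \<in> X" "w \<in> X"
  shows "B (\<lambda>x. \<Sum>i<m. c i *\<^sub>R \<phi> i x) w = (\<Sum>i<m. c i * B (\<phi> i) w)"
  using assms
proof (induction m)
  case (Suc m)
  have "B (\<lambda>x. 1 *\<^sub>R (\<Sum>i<m. c i *\<^sub>R \<phi> i x) + c m *\<^sub>R \<phi> m x) w = 1 * B (\<lambda>x. \<Sum>i<m. c i *\<^sub>R \<phi> i x) w + c m * B (\<phi> m) w"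
    using Suc by (intro B_lin sum_closed) auto
  then show ?case using Suc by simp
qed (simp add: B_zero)

text \<open>Otherwise a suitable multiple of \<open>r\<close> added to \<open>u\<close> would have
  square -1; the number \<open>t\<close> is chosen for this value. Null vectors are thus orthogonal
  to everything and harmless for a projection.\<close>

lemma B_null:
  assumes u: "u \<in> X" and r: "r \<in> X" and null: "B r r = 0"
  shows "B u r = 0"
proof (rule ccontr)
  assume ne: "B u r \<noteq> 0"
  define t where "t = - (B u u + 1) / (2 * B u r)"
  have w: "(\<lambda>x. 1 *\<^sub>R u x + t *\<^sub>R r x) \<in> X" using u r by (rule lincomb)
  have "B (\<lambda>x. 1 *\<^sub>R u x + t *\<^sub>R r x) (\<lambda>x. 1 *\<^sub>R u x + t *\<^sub>R r x) = B u u + 2 * t * B u r + t\<^sup>2 * B r r"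
  proof -
    have "B u (\<lambda>x. 1 *\<^sub>R u x + t *\<^sub>R r x) = B u u + t * B u r"
      using B_lin[OF u r u, of 1 t] B_sym[OF u w] B_sym[OF u r] by simp
    moreover have "B r (\<lambda>x. 1 *\<^sub>R u x + t *\<^sub>R r x) = B u r + t * B r r"
      using B_lin[OF u r r, of 1 t] B_sym[OF r w] by simp
    ultimately show ?thesis using B_lin[OF u r w, of 1 t] by (simp add: algebra_simps power2_eq_square)
  qed
  also have "\<dots> = - 1"
  proof -
    have "t * B u r = - (B u u + 1) / 2" using ne by (simp add: t_def)
    then show ?thesis by (simp add: null mult.assoc)
  qed
  finally show False using B_nonneg[OF w] by simp
qed

definition orthonormal :: "('a \<Rightarrow> 'b) set \<Rightarrow> nat \<Rightarrow> (nat \<Rightarrow> 'a \<Rightarrow> 'b) \<Rightarrow> bool" where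
  "orthonormal V m \<phi> \<longleftrightarrow> (\<forall>i<m. \<phi> i \<in> V) \<and> (\<forall>i<m. \<forall>j<m. B (\<phi> i) (\<phi> j) = (if i = j then 1 else 0))"

text \<open>A maximal orthonormal family exists as soon as the sizes of all of them are bounded.\<close>

lemma orthogonal_projection_exists:
  assumes V: "V \<subseteq> X" "(\<lambda>x. 0) \<in> V" "\<And>u v a b. u \<in> V \<Longrightarrow> v \<in> V \<Longrightarrow> (\<lambda>x. a *\<^sub>R u x + b *\<^sub>R v x) \<in> V"
    and bound: "\<And>m \<phi>. orthonormal V m \<phi> \<Longrightarrow> m \<le> m0" and u: "u \<in> X"
  obtains u0 where "u0 \<in> V" "\<And>v. v \<in> V \<Longrightarrow> B (\<lambda>x. u x - u0 x) v = 0"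
proof -
  define S where "S = {n. \<exists>\<phi>. orthonormal V n \<phi>}"
  have "S \<subseteq> {..m0}" using bound by (auto simp: S_def)
  then have S: "finite S" by (rule finite_subset) simp
  have "0 \<in> S" by (simp add: S_def orthonormal_def)
  define m where "m = Max S"
  have "m \<in> S" unfolding m_def using S \<open>0 \<in> S\<close> by (intro Max_in) auto
  then have m: "\<exists>\<phi>. orthonormal V m \<phi>" by (simp add: S_def)
  have m2: "n \<le> m" if "orthonormal V n \<phi>" for n \<phi>
    unfolding m_def using S that by (intro Max_ge) (auto simp: S_def)
  obtain \<phi> where on: "orthonormal V m \<phi>" using m by blast
  have \<phi>V: "\<phi> i \<in> V" if "i < m" for i using on that by (simp add: orthonormal_def)
  then have \<phi>X: "\<phi> i \<in> X" if "i < m" for i using that V(1) by blast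
  interpret V: semi_inner_space V B
    by unfold_locales (use V B_lin B_sym B_nonneg in \<open>auto simp: subset_iff\<close>)
  define P where "P = (\<lambda>v x. \<Sum>i<m. B v (\<phi> i) *\<^sub>R \<phi> i x)"
  have PV: "P v \<in> V" for v unfolding P_def by (rule V.sum_closed[OF \<phi>V])
  have BP: "B (P v) (\<phi> j) = B v (\<phi> j)" if j: "j < m" for v j
  proof -
    have "B (P v) (\<phi> j) = (\<Sum>i<m. B v (\<phi> i) * B (\<phi> i) (\<phi> j))"
      unfolding P_def by (rule B_sum[OF \<phi>X \<phi>X[OF j]])
    also have "\<dots> = (\<Sum>i<m. if i = j then B v (\<phi> i) else 0)"
      using on j by (intro sum.cong) (auto simp: orthonormal_def)
    also have "\<dots> = B v (\<phi> j)" using j by simp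
    finally show ?thesis .
  qed
  have orth: "B (\<lambda>x. v x - P v x) (\<phi> j) = 0" if j: "j < m" and v: "v \<in> X" for v j
    using B_lin[of v "P v" "\<phi> j" 1 "-1"] v PV[of v] V(1) \<phi>X[OF j] BP[OF j, of v] by auto
  \<comment> \<open>If the remainder of a vector of \<open>V\<close> had positive square, its
    normalization would extend the maximal orthonormal family.\<close>
  have null: "B (\<lambda>x. v x - P v x) (\<lambda>x. v x - P v x) = 0" and rV: "(\<lambda>x. v x - P v x) \<in> V" if v: "v \<in> V" for v
  proof -
    define r where "r = (\<lambda>x. v x - P v x)"
    show rV: "(\<lambda>x. v x - P v x) \<in> V" using V(3)[OF v PV[of v], of 1 "-1"] by simp
    then have r: "r \<in> V" "r \<in> X" using V(1) by (auto simp: r_def)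
    show "B (\<lambda>x. v x - P v x) (\<lambda>x. v x - P v x) = 0"
    proof (rule ccontr)
      assume "B (\<lambda>x. v x - P v x) (\<lambda>x. v x - P v x) \<noteq> 0"
      then have pos: "0 < B r r" using B_nonneg[OF r(2)] by (simp add: r_def)
      define c where "c = 1 / sqrt (B r r)"
      define s where "s = (\<lambda>x. c *\<^sub>R r x + 0 *\<^sub>R r x)"
      have s: "s \<in> V" "s \<in> X" unfolding s_def using V(3)[OF r(1) r(1)] V(1) by blast+
      have Bs: "B s w = c * B r w" if "w \<in> X" for w
        unfolding s_def using B_lin[OF r(2) r(2) that, of c 0] by simp
      have "B s s = c * (c * B r r)" using Bs[OF s(2)] Bs[OF r(2)] B_sym[OF r(2) s(2)] by simp
      also have "\<dots> = 1" using pos by (simp add: c_def field_simps flip: power2_eq_square)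
      finally have ss: "B s s = 1" .
      have s\<phi>: "B s (\<phi> j) = 0" if "j < m" for j
        using Bs[OF \<phi>X[OF that]] orth[OF that] v V(1) by (auto simp: r_def)
      have "orthonormal V (Suc m) (\<phi>(m := s))"
        using on s ss s\<phi> B_sym[OF s(2) \<phi>X] unfolding orthonormal_def by (auto simp: less_Suc_eq)
      then have "Suc m \<le> m" by (rule m2)
      then show False by simp
    qed
  qed
  define e where "e = (\<lambda>x. u x - P u x)"
  have eX: "e \<in> X" using lincomb[OF u, of "P u" 1 "-1"] PV[of u] V(1) by (auto simp: e_def)
  have "B (\<lambda>x. u x - P u x) v = 0" if v: "v \<in> V" for v
  proof -
    define r where "r = (\<lambda>x. v x - P v x)"
    have r: "r \<in> X" using rV[OF v] V(1) by (auto simp: r_def)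
    have pX: "P v \<in> X" using PV V(1) by blast
    have "B v e = B (\<lambda>x. 1 *\<^sub>R r x + 1 *\<^sub>R P v x) e" by (simp add: r_def)
    also have "\<dots> = B r e + B (P v) e" using B_lin[OF r pX eX, of 1 1] by simp
    also have "B r e = 0" using B_null[OF eX r] null[OF v] B_sym[OF eX r] by (simp add: r_def)
    also have "B (P v) e = (\<Sum>i<m. B v (\<phi> i) * B (\<phi> i) e)"
      unfolding P_def by (rule B_sum[OF \<phi>X eX])
    also have "\<dots> = 0"
      using orth[OF _ u] B_sym[OF \<phi>X eX] by (intro sum.neutral) (auto simp: e_def)
    finally show ?thesis using B_sym[OF _ eX, of v] v V(1) by (auto simp: e_def)
  qed
  then show thesis using PV[of u] that by blast
qed

end

context bounded_domain
begin

lemma L2_inner_lincomb_left: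
  assumes "essbdd u" "essbdd v" "essbdd w"
  shows "L2_inner D (\<lambda>x. a *\<^sub>R u x + b *\<^sub>R v x) w = a * L2_inner D u w + b * L2_inner D v w"
  unfolding L2_inner_def using essbdd_integrable[OF essbdd_inner[OF assms(1,3)]] essbdd_integrable[OF essbdd_inner[OF assms(2,3)]]
  by (simp add: inner_add_left)

lemma L2_inner_commute: "L2_inner D u v = L2_inner D v u"
  by (simp add: L2_inner_def inner_commute)

lemma L2_inner_cong_AE:
  assumes "AE x in lebesgue_on D. u x = u' x" "essbdd u" "essbdd u'" "essbdd w"
  shows "L2_inner D u w = L2_inner D u' w"
  unfolding L2_inner_def using assms
  by (intro integral_cong_AE essbdd_measurable essbdd_inner) (auto elim: eventually_mono)

lemma vplip_grad_lincomb:
  assumes "vplip u" "vplip v"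
  shows "AE x in lebesgue_on D. grad D (\<lambda>x. a *\<^sub>R u x + b *\<^sub>R v x) x = a *\<^sub>R grad D u x + b *\<^sub>R grad D v x"
  by (rule H1_lincomb(2)[OF assms[THEN vplip_H1]])

end

context sv_mesh
begin

lemma H1_inner_lincomb:
  assumes u: "u \<in> Xh" and v: "v \<in> Xh" and w: "w \<in> Xh"
  shows "H1_inner D (\<lambda>x. a *\<^sub>R u x + b *\<^sub>R v x) w = a * H1_inner D u w + b * H1_inner D v w"
proof -
  note e = SV_vplip[OF u] SV_vplip[OF v] SV_vplip[OF w]
  have "L2_inner D (grad D (\<lambda>x. a *\<^sub>R u x + b *\<^sub>R v x)) (grad D w)
      = L2_inner D (\<lambda>x. a *\<^sub>R grad D u x + b *\<^sub>R grad D v x) (grad D w)"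
    by (rule L2_inner_cong_AE[OF vplip_grad_lincomb[OF e(1,2)]])
       (intro vplip_grad_essbdd e SV_vplip[OF SV_lincomb[OF u v]] essbdd_add essbdd_scaleR_const)+
  then show ?thesis
    using e by (simp add: H1_inner_def L2_inner_lincomb_left vplip_essbdd vplip_grad_essbdd algebra_simps)
qed

lemma SV_zero:
  assumes "u \<in> Xh"
  shows "(\<lambda>x. 0) \<in> Xh"
  using SV_lincomb[OF assms assms, of 0 0] by simp

lemma Vspace_lincomb:
  assumes v: "v \<in> Vspace D Xh Qh" and w: "w \<in> Vspace D Xh Qh"
  shows "(\<lambda>x. a *\<^sub>R v x + b *\<^sub>R w x) \<in> Vspace D Xh Qh"
proof -
  have vX: "v \<in> Xh" "w \<in> Xh" using v w by (auto simp: Vspace_def)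
  have "AE x in lebesgue_on D. dvg D (\<lambda>x. a *\<^sub>R v x + b *\<^sub>R w x) x = 0"
    using vplip_grad_lincomb[OF vX[THEN SV_vplip], of a b] Vspace_dvg[OF v] Vspace_dvg[OF w]
    by eventually_elim (simp add: dvg_def sum.distrib sum_distrib_left[symmetric])
  then have "AE x in lebesgue_on D. dvg D (\<lambda>x. a *\<^sub>R v x + b *\<^sub>R w x) x \<bullet> q x = 0" for q
    by eventually_elim simp
  then have "L2_inner D (dvg D (\<lambda>x. a *\<^sub>R v x + b *\<^sub>R w x)) q = 0" for q
    unfolding L2_inner_def by (rule integral_eq_zero_AE)
  then show ?thesis using SV_lincomb[OF vX, of a b] by (simp add: Vspace_def)
qed

text \<open>The bound on the size of orthonormal families is a reproducing-kernel argument: the sup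
  bound limits the sum of the squares of an orthonormal family at every point, integration over
  \<open>D\<close> limits the sum of the L2 norms, and by the inverse inequality each L2 norm is
  bounded below.\<close>

lemma Rspace_projection:
  assumes \<sigma>: "0 < \<sigma>" and u: "u \<in> Xh"
  obtains u0 where "u0 \<in> Vspace D Xh Qh" "(\<lambda>x. u x - u0 x) \<in> Rspace D Xh Qh"
proof -
  interpret H: semi_inner_space Xh "H1_inner D"
    by unfold_locales
       (use SV_zero[OF u] SV_lincomb H1_inner_lincomb in \<open>auto simp: H1_inner_def L2_inner_commute H1_inner_self[unfolded H1_inner_def]\<close>)
  let ?V = "Vspace D Xh Qh"
  have VX: "?V \<subseteq> Xh" by (auto simp: Vspace_def)
  have V0: "(\<lambda>x. 0) \<in> ?V"
  proof -
    have "AE x in lebesgue_on D. grad D (\<lambda>x. 0 *\<^sub>R u x + 0 *\<^sub>R u x) x = 0 *\<^sub>R grad D u x + 0 *\<^sub>R grad D u x"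
      by (rule vplip_grad_lincomb[OF SV_vplip[OF u] SV_vplip[OF u]])
    then have "AE x in lebesgue_on D. dvg D (\<lambda>x. 0) x \<bullet> q x = 0" for q
      by eventually_elim (simp add: dvg_def)
    then have "L2_inner D (dvg D (\<lambda>x. 0)) q = 0" for q
      unfolding L2_inner_def by (rule integral_eq_zero_AE)
    then show ?thesis using SV_zero[OF u] by (simp add: Vspace_def)
  qed
  obtain C1 where C1: "0 < C1" "\<And>p (x0::real^'d) h x. p \<in> polys k \<Longrightarrow> 0 < h \<Longrightarrow> x \<in> cball x0 (2 * h) \<Longrightarrow>
     (p x)\<^sup>2 \<le> C1 / h ^ CARD('d) * (\<integral>z. indicator (cball x0 (h / \<sigma>)) z * (p z)\<^sup>2 \<partial>lborel)"
    using polys_value_bound[OF \<sigma>, of k] by blast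
  obtain C2 where C2: "0 < C2" "\<And>p (x0::real^'d) h x i. p \<in> polys k \<Longrightarrow> 0 < h \<Longrightarrow> x \<in> cball x0 h \<Longrightarrow>
     (partial i p x)\<^sup>2 \<le> C2 / (h ^ CARD('d) * h\<^sup>2) * (\<integral>z. indicator (cball x0 (h / \<sigma>)) z * (p z)\<^sup>2 \<partial>lborel)"
    using polys_partial_bound[OF \<sigma>, of k] by blast
  define A1 where "A1 = real CARD('d) * C1 / h ^ CARD('d)"
  define A2 where "A2 = (real CARD('d))\<^sup>2 * unit_ball_vol (real CARD('d)) * real (CARD('d) + 1) * C2 / h\<^sup>2"
  have A: "0 \<le> A1" "0 \<le> A2" using C1(1) C2(1) h_pos by (simp_all add: A1_def A2_def)
  have val: "(norm (v x))\<^sup>2 \<le> A1 * (L2_norm D v)\<^sup>2" if "v \<in> Xh" "x \<in> D" for v x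
    unfolding A1_def by (rule value_bound_on_cell[OF C1(2) C1(1) that(1)]) (assumption | rule subsetD[OF closure_subset that(2)])+
  have gra: "(L2_norm D (grad D v))\<^sup>2 \<le> A2 * (L2_norm D v)\<^sup>2" if "v \<in> Xh" for v
    unfolding A2_def by (rule gradient_inverse_bound[OF C2(2) C2(1) that])
  define V where "V = measure (lebesgue_on D) D"
  define m0 where "m0 = nat \<lceil>(1 + A2) * (real CARD('d) * A1 * V)\<rceil>"
  have bound: "m \<le> m0" if on: "H.orthonormal ?V m \<phi>" for m \<phi>
  proof -
    have \<phi>X: "\<phi> i \<in> Xh" if "i < m" for i using on that VX by (auto simp: H.orthonormal_def)
    have pt: "(\<Sum>i<m. (norm (\<phi> i x))\<^sup>2) \<le> real CARD('d) * A1" if x: "x \<in> D" for x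
    proof -
      have "(\<Sum>i<m. (\<phi> i x $ l)\<^sup>2) \<le> A1" for l
      proof -
        define s where "s = (\<Sum>i<m. (\<phi> i x $ l)\<^sup>2)"
        have s0: "0 \<le> s" by (simp add: s_def sum_nonneg)
        \<comment> \<open>The kernel function of the point \<open>x\<close> and component
          \<open>l\<close>: its value there and its squared H1 norm are both \<open>s\<close>, so
          the sup bound reads \<open>s^2 \<le> A1 * s\<close>.\<close>
        define w where "w = (\<lambda>y. \<Sum>i<m. (\<phi> i x $ l) *\<^sub>R \<phi> i y)"
        have wX: "w \<in> Xh" unfolding w_def by (rule H.sum_closed[OF \<phi>X])
        have "H1_inner D w w = (\<Sum>i<m. (\<phi> i x $ l) * H1_inner D (\<phi> i) w)"
          unfolding w_def by (rule H.B_sum[OF \<phi>X wX[unfolded w_def]])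
        also have "\<dots> = (\<Sum>i<m. (\<phi> i x $ l)\<^sup>2)"
        proof (rule sum.cong[OF refl])
          fix i assume "i \<in> {..<m}"
          then have i: "i < m" by simp
          have "H1_inner D w (\<phi> i) = (\<Sum>j<m. (\<phi> j x $ l) * H1_inner D (\<phi> j) (\<phi> i))"
            unfolding w_def by (rule H.B_sum[OF \<phi>X \<phi>X[OF i]])
          also have "\<dots> = (\<Sum>j<m. if j = i then \<phi> j x $ l else 0)"
            using on i by (intro sum.cong) (auto simp: H.orthonormal_def)
          also have "\<dots> = \<phi> i x $ l" using i by simp
          finally show "(\<phi> i x $ l) * H1_inner D (\<phi> i) w = (\<phi> i x $ l)\<^sup>2"
            using H.B_sym[OF \<phi>X[OF i] wX] by (simp add: power2_eq_square)
        qed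
        finally have Hw: "H1_inner D w w = s" by (simp add: s_def)
        have "w x $ l = s" by (simp add: w_def s_def power2_eq_square)
        then have "s\<^sup>2 \<le> (norm (w x))\<^sup>2"
          using component_le_norm_cart[of "w x" l] s0 by (intro power_mono) auto
        also have "\<dots> \<le> A1 * (L2_norm D w)\<^sup>2" using wX x by (rule val)
        also have "\<dots> \<le> A1 * s" using Hw H1_inner_self[of w] A(1) by (intro mult_left_mono) auto
        finally have "s * s \<le> A1 * s" by (simp add: power2_eq_square)
        then have "s \<le> A1" using s0 A(1) by (cases "s = 0") auto
        then show ?thesis by (simp add: s_def)
      qed
      then have "(\<Sum>l\<in>UNIV. \<Sum>i<m. (\<phi> i x $ l)\<^sup>2) \<le> (\<Sum>l\<in>(UNIV::'d set). A1)" by (intro sum_mono)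
      then show ?thesis by (subst (asm) sum.swap) (simp add: norm_vector_power2)
    qed
    have ii: "integrable (lebesgue_on D) (\<lambda>x. (norm (\<phi> i x))\<^sup>2)" if "i < m" for i
      by (intro essbdd_integrable essbdd_power2 essbdd_norm vplip_essbdd SV_vplip \<phi>X that)
    have "(\<Sum>i<m. (L2_norm D (\<phi> i))\<^sup>2) = (\<integral>x. (\<Sum>i<m. (norm (\<phi> i x))\<^sup>2) \<partial>lebesgue_on D)"
      using ii by (simp add: L2_norm_power2)
    also have "\<dots> \<le> (\<integral>x. real CARD('d) * A1 \<partial>lebesgue_on D)"
      using ii pt by (intro integral_mono_AE AE_in_D) auto
    also have "\<dots> = real CARD('d) * A1 * V" by (simp add: V_def space_restrict_space)
    finally have sum: "(\<Sum>i<m. (L2_norm D (\<phi> i))\<^sup>2) \<le> real CARD('d) * A1 * V" .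
    have "real m = (\<Sum>i<m. 1)" by simp
    also have "\<dots> \<le> (\<Sum>i<m. (1 + A2) * (L2_norm D (\<phi> i))\<^sup>2)"
    proof (rule sum_mono)
      fix i assume "i \<in> {..<m}"
      then have i: "i < m" by simp
      have "1 = H1_inner D (\<phi> i) (\<phi> i)" using on i by (simp add: H.orthonormal_def)
      then show "1 \<le> (1 + A2) * (L2_norm D (\<phi> i))\<^sup>2"
        using gra[OF \<phi>X[OF i]] by (simp add: H1_inner_self algebra_simps)
    qed
    also have "\<dots> \<le> (1 + A2) * (real CARD('d) * A1 * V)"
      unfolding sum_distrib_left[symmetric] using sum A(2) by (intro mult_left_mono) auto
    finally show ?thesis unfolding m0_def by linarith
  qed
  obtain u0 where u0: "u0 \<in> ?V" "\<And>v. v \<in> ?V \<Longrightarrow> H1_inner D (\<lambda>x. u x - u0 x) v = 0"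
    by (rule H.orthogonal_projection_exists[OF VX V0 Vspace_lincomb bound u]) (assumption | rule that)+
  have "(\<lambda>x. u x - u0 x) \<in> Xh" using SV_lincomb[OF u, of u0 1 "-1"] u0(1) VX by auto
  then have "(\<lambda>x. u x - u0 x) \<in> Rspace D Xh Qh" using u0(2) by (simp add: Rspace_def)
  with u0(1) show thesis by (rule that)
qed

end


section \<open>The energy inequality of a time step\<close>

lemma norm_matrix_vector_mult_le: "norm ((A :: real^'n^'m) *v x) \<le> norm A * norm x"
proof (rule power2_le_imp_le)
  have "(norm (A *v x))\<^sup>2 = (\<Sum>i\<in>UNIV. (A $ i \<bullet> x)\<^sup>2)"
    by (simp add: norm_vector_power2 matrix_vector_mul_component)
  also have "\<dots> \<le> (\<Sum>i\<in>UNIV. (norm (A $ i))\<^sup>2 * (norm x)\<^sup>2)"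
  proof (rule sum_mono)
    fix i
    have "\<bar>A $ i \<bullet> x\<bar> \<le> norm (A $ i) * norm x" by (rule Cauchy_Schwarz_ineq2)
    then have "\<bar>A $ i \<bullet> x\<bar>\<^sup>2 \<le> (norm (A $ i) * norm x)\<^sup>2" by (rule power_mono) simp
    then show "(A $ i \<bullet> x)\<^sup>2 \<le> (norm (A $ i))\<^sup>2 * (norm x)\<^sup>2" by (simp add: power_mult_distrib)
  qed
  also have "\<dots> = (norm A * norm x)\<^sup>2"
    by (simp add: power_mult_distrib norm_matrix_power2 norm_vector_power2[of "A $ _"] sum_distrib_right)
  finally show "(norm (A *v x))\<^sup>2 \<le> (norm A * norm x)\<^sup>2" .
qed simp

lemma avg_diff: "avg N (\<lambda>i x. z i x - y i x) = (\<lambda>x. avg N z x - avg N y x)"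
  by (rule ext) (simp add: avg_def sum_subtractf scaleR_diff_right)

lemma fluct_diff: "fluct N (\<lambda>i x. z i x - y i x) j = (\<lambda>x. fluct N z j x - fluct N y j x)"
  by (rule ext) (simp add: fluct_def avg_diff)

text \<open>Stated for any set closed under linear combinations, since it is applied both to X_h and
  to V_h.\<close>

lemma avg_closed:
  assumes "\<And>u v a b. u \<in> S \<Longrightarrow> v \<in> S \<Longrightarrow> (\<lambda>x. a *\<^sub>R u x + b *\<^sub>R v x) \<in> S"
    and "\<And>i. i \<in> {1..N} \<Longrightarrow> z i \<in> S" "1 \<le> N"
  shows "avg N z \<in> S"
proof -
  have z1: "z 1 \<in> S" using assms(2,3) by simp
  have "(\<lambda>x. \<Sum>i=1..n. z i x) \<in> S" if "n \<le> N" for n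
    using that
  proof (induction n)
    case 0
    show ?case using assms(1)[OF z1 z1, of 0 0] by simp
  next
    case (Suc n)
    have "(\<lambda>x. 1 *\<^sub>R (\<Sum>i=1..n. z i x) + 1 *\<^sub>R z (Suc n) x) \<in> S"
      using Suc by (intro assms(1,2)) auto
    then show ?case by simp
  qed
  from assms(1)[OF this[OF order_refl] z1, of "1 / real N" 0]
  show ?thesis unfolding avg_def[abs_def] by simp
qed

lemma fluct_closed:
  assumes "\<And>u v a b. u \<in> S \<Longrightarrow> v \<in> S \<Longrightarrow> (\<lambda>x. a *\<^sub>R u x + b *\<^sub>R v x) \<in> S"
    and "\<And>i. i \<in> {1..N} \<Longrightarrow> z i \<in> S" "1 \<le> N" "j \<in> {1..N}"
  shows "fluct N z j \<in> S"
proof -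
  have a: "avg N z \<in> S" by (rule avg_closed[OF assms(1-3)])
  have "(\<lambda>x. 1 *\<^sub>R z j x + (-1) *\<^sub>R avg N z x) \<in> S" by (rule assms(1)[OF assms(2)[OF assms(4)] a])
  then show ?thesis unfolding fluct_def[abs_def] by simp
qed

lemma norm_avg_le:
  assumes "\<And>i. i \<in> {1..N} \<Longrightarrow> norm (z i x) \<le> M" "1 \<le> N"
  shows "norm (avg N z x) \<le> M"
proof -
  have "norm (\<Sum>i=1..N. z i x) \<le> (\<Sum>i=1..N. M)" by (rule sum_norm_le) (rule assms(1))
  then show ?thesis using assms(2) by (simp add: avg_def divide_le_eq mult.commute)
qed

lemma norm_fluct_le:
  assumes "\<And>i. i \<in> {1..N} \<Longrightarrow> norm (z i x) \<le> M" "1 \<le> N" "j \<in> {1..N}"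
  shows "norm (fluct N z j x) \<le> 2 * M"
  using norm_triangle_ineq4[of "z j x" "avg N z x"] assms(1)[OF assms(3)] norm_avg_le[of N z x M, OF assms(1,2)]
  by (simp add: fluct_def)

text \<open>A difference of squares: the sum of the two norms is controlled by the sup bounds, their
  difference by \<open>c\<close>. Hence the eddy viscosities differ linearly in the error, with a
  factor \<open>\<Delta>t\<close> that later meets an inverse inequality.\<close>

lemma eddy_viscosity_diff_le:
  assumes z: "\<And>i. i \<in> {1..N} \<Longrightarrow> norm (z i x) \<le> M" and y: "\<And>i. i \<in> {1..N} \<Longrightarrow> norm (y i x) \<le> M"
    and d: "\<And>i. i \<in> {1..N} \<Longrightarrow> norm (fluct N z i x - fluct N y i x) \<le> c"
    and N: "1 \<le> N" and pos: "0 \<le> \<mu> * \<Delta>t" "0 \<le> M"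
  shows "\<bar>eddy_viscosity N \<mu> \<Delta>t z x - eddy_viscosity N \<mu> \<Delta>t y x\<bar> \<le> \<mu> * \<Delta>t * (real N * (4 * M * c))"
proof -
  have "\<bar>(norm (fluct N z i x))\<^sup>2 - (norm (fluct N y i x))\<^sup>2\<bar> \<le> 4 * M * c" if i: "i \<in> {1..N}" for i
  proof -
    have "(norm (fluct N z i x))\<^sup>2 - (norm (fluct N y i x))\<^sup>2
        = (norm (fluct N z i x) + norm (fluct N y i x)) * (norm (fluct N z i x) - norm (fluct N y i x))"
      by (simp add: power2_eq_square algebra_simps)
    then have "\<bar>(norm (fluct N z i x))\<^sup>2 - (norm (fluct N y i x))\<^sup>2\<bar>
        = (norm (fluct N z i x) + norm (fluct N y i x)) * \<bar>norm (fluct N z i x) - norm (fluct N y i x)\<bar>"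
      by (simp add: abs_mult)
    also have "\<dots> \<le> (2 * M + 2 * M) * c"
    proof (rule mult_mono)
      show "norm (fluct N z i x) + norm (fluct N y i x) \<le> 2 * M + 2 * M"
        using norm_fluct_le[of N z x M i, OF z N i] norm_fluct_le[of N y x M i, OF y N i] by linarith
      show "\<bar>norm (fluct N z i x) - norm (fluct N y i x)\<bar> \<le> c"
        using norm_triangle_ineq3[of "fluct N z i x" "fluct N y i x"] d[OF i] by linarith
    qed (use pos in auto)
    finally show ?thesis by simp
  qed
  then have "(\<Sum>i=1..N. \<bar>(norm (fluct N z i x))\<^sup>2 - (norm (fluct N y i x))\<^sup>2\<bar>) \<le> (\<Sum>i=1..N. 4 * M * c)"
    by (intro sum_mono)
  then have "\<bar>\<Sum>i=1..N. (norm (fluct N z i x))\<^sup>2 - (norm (fluct N y i x))\<^sup>2\<bar> \<le> (\<Sum>i=1..N. 4 * M * c)"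
    by (rule order_trans[OF sum_abs])
  also have "\<dots> = real N * (4 * M * c)" by simp
  finally have "\<bar>\<Sum>i=1..N. (norm (fluct N z i x))\<^sup>2 - (norm (fluct N y i x))\<^sup>2\<bar> \<le> real N * (4 * M * c)" .
  then have "(\<mu> * \<Delta>t) * \<bar>\<Sum>i=1..N. (norm (fluct N z i x))\<^sup>2 - (norm (fluct N y i x))\<^sup>2\<bar> \<le> (\<mu> * \<Delta>t) * (real N * (4 * M * c))"
    using pos(1) by (rule mult_left_mono)
  moreover have "eddy_viscosity N \<mu> \<Delta>t z x - eddy_viscosity N \<mu> \<Delta>t y x
      = (\<mu> * \<Delta>t) * (\<Sum>i=1..N. (norm (fluct N z i x))\<^sup>2 - (norm (fluct N y i x))\<^sup>2)"
    by (simp add: eddy_viscosity_def sum_subtractf right_diff_distrib)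
  ultimately show ?thesis by (simp only: abs_mult[of "\<mu> * \<Delta>t"] abs_of_nonneg[OF pos(1)])
qed

lemma eddy_viscosity_bounds:
  assumes z: "\<And>i. i \<in> {1..N} \<Longrightarrow> norm (z i x) \<le> M" and N: "1 \<le> N" and pos: "0 \<le> \<mu> * \<Delta>t"
  shows "0 \<le> eddy_viscosity N \<mu> \<Delta>t z x" "eddy_viscosity N \<mu> \<Delta>t z x \<le> \<mu> * \<Delta>t * (real N * (4 * M\<^sup>2))"
proof -
  show "0 \<le> eddy_viscosity N \<mu> \<Delta>t z x"
    unfolding eddy_viscosity_def by (intro mult_nonneg_nonneg[OF pos] sum_nonneg) auto
  have "(\<Sum>i=1..N. (norm (fluct N z i x))\<^sup>2) \<le> (\<Sum>i=1..N. (2 * M)\<^sup>2)"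
    by (intro sum_mono power_mono norm_fluct_le z N) auto
  then have "(\<mu> * \<Delta>t) * (\<Sum>i=1..N. (norm (fluct N z i x))\<^sup>2) \<le> (\<mu> * \<Delta>t) * (\<Sum>i=1..N. (2 * M)\<^sup>2)"
    using pos by (rule mult_left_mono)
  then show "eddy_viscosity N \<mu> \<Delta>t z x \<le> \<mu> * \<Delta>t * (real N * (4 * M\<^sup>2))"
    by (simp add: eddy_viscosity_def power_mult_distrib)
qed

context bounded_domain
begin

abbreviation nrm :: "(real^'d \<Rightarrow> 'b::euclidean_space) \<Rightarrow> real" where "nrm u \<equiv> L2_norm D u"
abbreviation gnrm :: "(real^'d \<Rightarrow> real^'d) \<Rightarrow> real" where "gnrm u \<equiv> L2_norm D (grad D u)"

section \<open>Estimates for the forms in an abstract finite element space\<close>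

lemma L2_inner_bound:
  assumes "essbdd f" "essbdd g" "essbdd a" "essbdd b" "0 \<le> c"
    and "AE x in lebesgue_on D. norm (f x) * norm (g x) \<le> c * (norm (a x) * norm (b x))"
  shows "\<bar>L2_inner D f g\<bar> \<le> c * nrm a * nrm b"
  unfolding L2_inner_def
  by (rule integral_bound_L2(2)[OF essbdd_L2[OF assms(3)] essbdd_L2[OF assms(4)] essbdd_measurable[OF essbdd_inner[OF assms(1,2)]] _ assms(5)])
     (use assms(6) in eventually_elim, rule order_trans[OF Cauchy_Schwarz_ineq2])

lemma L2_inner_Cauchy_Schwarz: "essbdd f \<Longrightarrow> essbdd g \<Longrightarrow> \<bar>L2_inner D f g\<bar> \<le> nrm f * nrm g"
  using L2_inner_bound[of f g f g 1] by simp

lemma L2_inner_lincomb_right: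
  assumes "essbdd u" "essbdd v" "essbdd w"
  shows "L2_inner D w (\<lambda>x. a *\<^sub>R u x + b *\<^sub>R v x) = a * L2_inner D w u + b * L2_inner D w v"
  using L2_inner_lincomb_left[OF assms] by (simp add: L2_inner_commute)

lemma L2_inner_self: "L2_inner D u u = (nrm u)\<^sup>2"
  by (simp add: L2_norm_power2 L2_inner_def power2_norm_eq_inner)

lemma nrm_lincomb_le:
  assumes "essbdd u" "essbdd v"
  shows "nrm (\<lambda>x. a *\<^sub>R u x + b *\<^sub>R v x) \<le> \<bar>a\<bar> * nrm u + \<bar>b\<bar> * nrm v"
proof (rule power2_le_imp_le)
  have e: "essbdd (\<lambda>x. a *\<^sub>R u x + b *\<^sub>R v x)" using assms by (intro essbdd_add essbdd_scaleR_const)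
  have "(nrm (\<lambda>x. a *\<^sub>R u x + b *\<^sub>R v x))\<^sup>2 = a\<^sup>2 * (nrm u)\<^sup>2 + 2 * (a * b * L2_inner D u v) + b\<^sup>2 * (nrm v)\<^sup>2"
    using assms e unfolding L2_inner_self[symmetric]
    by (simp add: L2_inner_lincomb_left L2_inner_lincomb_right L2_inner_commute[of v u] power2_eq_square algebra_simps)
  also have "\<dots> \<le> a\<^sup>2 * (nrm u)\<^sup>2 + 2 * (\<bar>a\<bar> * \<bar>b\<bar> * (nrm u * nrm v)) + b\<^sup>2 * (nrm v)\<^sup>2"
  proof -
    have "a * b * L2_inner D u v \<le> \<bar>a * b * L2_inner D u v\<bar>" by simp
    also have "\<dots> \<le> \<bar>a\<bar> * \<bar>b\<bar> * (nrm u * nrm v)"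
      unfolding abs_mult using L2_inner_Cauchy_Schwarz[OF assms] by (intro mult_left_mono) auto
    finally show ?thesis by simp
  qed
  also have "\<dots> = (\<bar>a\<bar> * nrm u + \<bar>b\<bar> * nrm v)\<^sup>2"
    by (simp add: power2_sum power_mult_distrib)
  finally show "(nrm (\<lambda>x. a *\<^sub>R u x + b *\<^sub>R v x))\<^sup>2 \<le> (\<bar>a\<bar> * nrm u + \<bar>b\<bar> * nrm v)\<^sup>2" .
qed (simp add: L2_norm_nonneg)

lemma nrm_cong_AE:
  "AE x in lebesgue_on D. u x = v x \<Longrightarrow> essbdd u \<Longrightarrow> essbdd v \<Longrightarrow> nrm u = nrm v"
  by (intro L2_norm_cong_AE essbdd_measurable)

lemma L2_inner_eq_0_AE:
  assumes "AE x in lebesgue_on D. f x = 0"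
  shows "L2_inner D f g = 0" "L2_inner D g f = 0"
  unfolding L2_inner_def
  by (rule integral_eq_zero_AE, use assms in eventually_elim, simp)+

lemma norm_dvg_le: "\<bar>dvg D u x\<bar> \<le> real CARD('d) * norm (grad D u x)"
proof -
  have "\<bar>\<Sum>i\<in>UNIV. grad D u x $ i $ i\<bar> \<le> (\<Sum>i\<in>(UNIV::'d set). norm (grad D u x))"
  proof (rule order_trans[OF sum_abs], rule sum_mono)
    fix i
    show "\<bar>grad D u x $ i $ i\<bar> \<le> norm (grad D u x)"
      using component_le_norm_cart[of "grad D u x $ i" i]
        Finite_Cartesian_Product.norm_nth_le[where x="grad D u x" and i=i] by linarith
  qed
  then show ?thesis by (simp add: dvg_def)
qed

end

text \<open>What the energy argument uses of X_h. One number \<open>L\<close> stands for all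
  mesh-independent constants, and \<open>H\<close> becomes \<open>h\<close> to the power -3/2. The
  gradient inequality is weakened from \<open>1 / h\<close> to the same factor, as \<open>h\<close>
  is bounded by the size of the domain.\<close>

locale fe_space = bounded_domain D for D :: "(real^'d) set" +
  fixes X :: "(real^'d \<Rightarrow> real^'d) set" and L H :: real
  assumes X_lincomb: "\<And>u v a b. u \<in> X \<Longrightarrow> v \<in> X \<Longrightarrow> (\<lambda>x. a *\<^sub>R u x + b *\<^sub>R v x) \<in> X"
    and X_H10: "u \<in> X \<Longrightarrow> u \<in> H10 D"
    and X_vplip: "u \<in> X \<Longrightarrow> vplip u"
    and L1: "1 \<le> L" and H0: "0 < H" and dim_L: "real CARD('d) \<le> L"
    and X_Poincare: "u \<in> X \<Longrightarrow> nrm u \<le> L * gnrm u"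
    and X_inv_sup: "u \<in> X \<Longrightarrow> AE x in lebesgue_on D. norm (u x) \<le> L * H * nrm u"
    and X_inv_grad: "u \<in> X \<Longrightarrow> gnrm u \<le> L * H * nrm u"
begin

lemma L0: "0 \<le> L" using L1 by simp

lemma X_diff: "u \<in> X \<Longrightarrow> v \<in> X \<Longrightarrow> (\<lambda>x. u x - v x) \<in> X"
  using X_lincomb[of u v 1 "-1"] by simp

lemma X_essbdd: "u \<in> X \<Longrightarrow> essbdd u" "u \<in> X \<Longrightarrow> essbdd (grad D u)" "u \<in> X \<Longrightarrow> essbdd (dvg D u)"
  by (intro vplip_essbdd vplip_grad_essbdd vplip_dvg_essbdd X_vplip; assumption)+

lemma X_grad_diff:
  "u \<in> X \<Longrightarrow> v \<in> X \<Longrightarrow> AE x in lebesgue_on D. grad D (\<lambda>x. u x - v x) x = grad D u x - grad D v x"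
  using vplip_grad_lincomb[of u v 1 "-1"] X_vplip by simp

lemma X_dvg_diff:
  assumes "u \<in> X" "v \<in> X"
  shows "AE x in lebesgue_on D. dvg D (\<lambda>x. u x - v x) x = dvg D u x - dvg D v x"
  using X_grad_diff[OF assms] by eventually_elim (simp add: dvg_def sum_subtractf)

lemma gnrm_diff_le:
  assumes "u \<in> X" "v \<in> X"
  shows "gnrm (\<lambda>x. u x - v x) \<le> gnrm u + gnrm v"
proof -
  have "gnrm (\<lambda>x. u x - v x) = nrm (\<lambda>x. 1 *\<^sub>R grad D u x + (-1) *\<^sub>R grad D v x)"
    by (rule nrm_cong_AE) (use X_grad_diff[OF assms] X_essbdd(2)[OF X_diff[OF assms]] X_essbdd(2)[OF assms(1)] X_essbdd(2)[OF assms(2)] in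
        \<open>auto intro: essbdd_diff\<close>)
  also have "\<dots> \<le> \<bar>1\<bar> * gnrm u + \<bar>-1\<bar> * gnrm v"
    by (rule nrm_lincomb_le[OF X_essbdd(2)[OF assms(1)] X_essbdd(2)[OF assms(2)]])
  finally show ?thesis by simp
qed

lemma nrm_diff_le:
  assumes "u \<in> X" "v \<in> X"
  shows "nrm (\<lambda>x. u x - v x) \<le> nrm u + nrm v"
  using nrm_lincomb_le[OF X_essbdd(1)[OF assms(1)] X_essbdd(1)[OF assms(2)], of 1 "-1"] by simp

lemma nrm_dvg_le: "u \<in> X \<Longrightarrow> nrm (dvg D u) \<le> L * gnrm u"
proof -
  assume u: "u \<in> X"
  note e = X_essbdd[OF u]
  have "\<bar>L2_inner D (dvg D u) (dvg D u)\<bar> \<le> L * nrm (dvg D u) * gnrm u"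
  proof (rule L2_inner_bound[OF e(3) e(3) e(3) e(2) L0])
    show "AE x in lebesgue_on D. norm (dvg D u x) * norm (dvg D u x) \<le> L * (norm (dvg D u x) * norm (grad D u x))"
    proof (intro always_eventually allI)
      fix x
      have "\<bar>dvg D u x\<bar> \<le> L * norm (grad D u x)"
        using norm_dvg_le[of u x] mult_right_mono[OF dim_L norm_ge_zero[of "grad D u x"]] by linarith
      from mult_left_mono[OF this, of "\<bar>dvg D u x\<bar>"]
      show "norm (dvg D u x) * norm (dvg D u x) \<le> L * (norm (dvg D u x) * norm (grad D u x))" by (simp add: mult_ac)
    qed
  qed
  then have "nrm (dvg D u) * nrm (dvg D u) \<le> nrm (dvg D u) * (L * gnrm u)"
    by (simp add: L2_inner_self power2_eq_square mult_ac)
  then show ?thesis using L2_norm_nonneg[of "dvg D u"] L2_norm_nonneg[of "grad D u"] L0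
    by (cases "nrm (dvg D u) = 0") (auto simp: mult_le_cancel_left)
qed

lemma avg_X: "(\<And>i. i \<in> {1..N} \<Longrightarrow> z i \<in> X) \<Longrightarrow> 1 \<le> N \<Longrightarrow> avg N z \<in> X"
  by (rule avg_closed[OF X_lincomb])

lemma fluct_X: "(\<And>i. i \<in> {1..N} \<Longrightarrow> z i \<in> X) \<Longrightarrow> 1 \<le> N \<Longrightarrow> j \<in> {1..N} \<Longrightarrow> fluct N z j \<in> X"
  by (rule fluct_closed[OF X_lincomb])

lemma nrm_avg_le:
  assumes z: "\<And>i. i \<in> {1..N} \<Longrightarrow> z i \<in> X" and N: "1 \<le> N"
  shows "nrm (avg N z) \<le> (\<Sum>i=1..N. nrm (z i))" "gnrm (avg N z) \<le> (\<Sum>i=1..N. gnrm (z i))"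
proof -
  have z1: "z 1 \<in> X" using z N by simp
  have main: "(\<lambda>x. \<Sum>i=1..n. z i x) \<in> X \<and> nrm (\<lambda>x. \<Sum>i=1..n. z i x) \<le> (\<Sum>i=1..n. nrm (z i))
     \<and> gnrm (\<lambda>x. \<Sum>i=1..n. z i x) \<le> (\<Sum>i=1..n. gnrm (z i))" if "n \<le> N" for n
    using that
  proof (induction n)
    case 0
    have X0: "(\<lambda>x. 0) \<in> X" using X_lincomb[OF z1 z1, of 0 0] by simp
    have "nrm (\<lambda>x. 0 :: real^'d) = 0" by (simp add: L2_norm_def L2_inner_def)
    moreover have "gnrm (\<lambda>x. 0) = 0"
      using X_inv_grad[OF X0] L2_norm_nonneg[of "grad D (\<lambda>x. 0)"] calculation by simp
    ultimately show ?case using X0 by simp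
  next
    case (Suc n)
    have zS: "z (Suc n) \<in> X" using z Suc(2) by simp
    have IH: "(\<lambda>x. \<Sum>i=1..n. z i x) \<in> X" "nrm (\<lambda>x. \<Sum>i=1..n. z i x) \<le> (\<Sum>i=1..n. nrm (z i))"
      "gnrm (\<lambda>x. \<Sum>i=1..n. z i x) \<le> (\<Sum>i=1..n. gnrm (z i))" using Suc by auto
    have e: "(\<lambda>x. \<Sum>i=1..Suc n. z i x) = (\<lambda>x. 1 *\<^sub>R (\<Sum>i=1..n. z i x) + 1 *\<^sub>R z (Suc n) x)" by simp
    have m: "(\<lambda>x. \<Sum>i=1..Suc n. z i x) \<in> X" unfolding e by (rule X_lincomb[OF IH(1) zS])
    have n: "nrm (\<lambda>x. \<Sum>i=1..Suc n. z i x) \<le> nrm (\<lambda>x. \<Sum>i=1..n. z i x) + nrm (z (Suc n))"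
      unfolding e using nrm_lincomb_le[OF X_essbdd(1)[OF IH(1)] X_essbdd(1)[OF zS], of 1 1] by simp
    have "gnrm (\<lambda>x. \<Sum>i=1..Suc n. z i x) = nrm (\<lambda>x. 1 *\<^sub>R grad D (\<lambda>x. \<Sum>i=1..n. z i x) x + 1 *\<^sub>R grad D (z (Suc n)) x)"
      unfolding e
      by (rule nrm_cong_AE[OF vplip_grad_lincomb[OF X_vplip[OF IH(1)] X_vplip[OF zS]]])
         (intro X_essbdd(2) X_lincomb IH(1) zS essbdd_add essbdd_scaleR_const)+
    then have "gnrm (\<lambda>x. \<Sum>i=1..Suc n. z i x) \<le> gnrm (\<lambda>x. \<Sum>i=1..n. z i x) + gnrm (z (Suc n))"
      using nrm_lincomb_le[OF X_essbdd(2)[OF IH(1)] X_essbdd(2)[OF zS], of 1 1] by simp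
    then show ?case using m n IH by simp
  qed
  define S where "S = (\<lambda>x. \<Sum>i=1..N. z i x)"
  note S = main[OF order_refl, folded S_def]
  have e: "avg N z = (\<lambda>x. (1 / real N) *\<^sub>R S x + 0 *\<^sub>R S x)" by (simp add: avg_def[abs_def] S_def)
  have N1: "\<bar>1 / real N\<bar> \<le> 1" using N by simp
  have "nrm (avg N z) \<le> \<bar>1 / real N\<bar> * nrm S"
    unfolding e using nrm_lincomb_le[OF X_essbdd(1) X_essbdd(1), of S S "1 / real N" 0] S by simp
  also have "\<dots> \<le> 1 * nrm S" by (intro mult_right_mono N1 L2_norm_nonneg)
  finally show "nrm (avg N z) \<le> (\<Sum>i=1..N. nrm (z i))" using S by simp
  have SX: "S \<in> X" using S by simp
  have "gnrm (avg N z) = nrm (\<lambda>x. (1 / real N) *\<^sub>R grad D S x + 0 *\<^sub>R grad D S x)"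
    unfolding e
    by (rule nrm_cong_AE[OF vplip_grad_lincomb[OF X_vplip[OF SX] X_vplip[OF SX]]])
       (intro X_essbdd(2) X_lincomb SX essbdd_add essbdd_scaleR_const)+
  also have "\<dots> \<le> \<bar>1 / real N\<bar> * gnrm S"
    using nrm_lincomb_le[OF X_essbdd(2) X_essbdd(2), of S S "1 / real N" 0] S by simp
  also have "\<dots> \<le> 1 * gnrm S" by (intro mult_right_mono N1 L2_norm_nonneg)
  finally show "gnrm (avg N z) \<le> (\<Sum>i=1..N. gnrm (z i))" using S by simp
qed

lemma nrm_fluct_le:
  assumes z: "\<And>i. i \<in> {1..N} \<Longrightarrow> z i \<in> X" and N: "1 \<le> N" and j: "j \<in> {1..N}"
  shows "nrm (fluct N z j) \<le> 2 * (\<Sum>i=1..N. nrm (z i))" "gnrm (fluct N z j) \<le> 2 * (\<Sum>i=1..N. gnrm (z i))"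
proof -
  have e: "fluct N z j = (\<lambda>x. z j x - avg N z x)" by (simp add: fluct_def[abs_def])
  have zj: "z j \<in> X" by (rule z[OF j])
  have az: "avg N z \<in> X" by (rule avg_X[OF z N])
  have na: "nrm (avg N z) \<le> (\<Sum>i=1..N. nrm (z i))" "gnrm (avg N z) \<le> (\<Sum>i=1..N. gnrm (z i))"
    by (rule nrm_avg_le[OF z N]; assumption)+
  have "nrm (z j) \<le> (\<Sum>i=1..N. nrm (z i))"
    using j by (intro member_le_sum) (auto simp: L2_norm_nonneg)
  then show "nrm (fluct N z j) \<le> 2 * (\<Sum>i=1..N. nrm (z i))"
    unfolding e using nrm_diff_le[OF zj az] na(1) by linarith
  have "gnrm (z j) \<le> (\<Sum>i=1..N. gnrm (z i))"
    using j by (intro member_le_sum) (auto simp: L2_norm_nonneg)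
  then show "gnrm (fluct N z j) \<le> 2 * (\<Sum>i=1..N. gnrm (z i))"
    unfolding e using gnrm_diff_le[OF zj az] na(2) by linarith
qed

lemma trilinear_lincomb_3:
  assumes "u \<in> X" "v \<in> X" "w \<in> X" "w' \<in> X"
  shows "trilinear D u v (\<lambda>x. a *\<^sub>R w x + b *\<^sub>R w' x) = a * trilinear D u v w + b * trilinear D u v w'"
  unfolding trilinear_def
  by (rule L2_inner_lincomb_right[OF X_essbdd(1)[OF assms(3)] X_essbdd(1)[OF assms(4)] essbdd_matvec[OF X_essbdd(2)[OF assms(2)] X_essbdd(1)[OF assms(1)]]])

text \<open>Of the two ways to split the difference, this one pairs the difference of the advecting
  fields with \<open>v\<close>, in the application the bounded solution of the coupled
  scheme.\<close>

lemma trilinear_diff: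
  assumes "u \<in> X" "v \<in> X" "u' \<in> X" "v' \<in> X" "w \<in> X"
  shows "trilinear D u v w - trilinear D u' v' w = trilinear D (\<lambda>x. u x - u' x) v w + trilinear D u' (\<lambda>x. v x - v' x) w"
proof -
  note e = X_essbdd[OF assms(1)] X_essbdd[OF assms(2)] X_essbdd[OF assms(3)] X_essbdd[OF assms(4)] X_essbdd[OF assms(5)]
    X_essbdd[OF X_diff[OF assms(1,3)]] X_essbdd[OF X_diff[OF assms(2,4)]]
  let ?I = "\<lambda>f. (\<integral>x. f x \<partial>lebesgue_on D) :: real"
  have i: "integrable (lebesgue_on D) (\<lambda>x. (grad D v x *v u x) \<bullet> w x)" "integrable (lebesgue_on D) (\<lambda>x. (grad D v' x *v u' x) \<bullet> w x)"
    "integrable (lebesgue_on D) (\<lambda>x. (grad D v x *v (u x - u' x)) \<bullet> w x)"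
    "integrable (lebesgue_on D) (\<lambda>x. (grad D (\<lambda>x. v x - v' x) x *v u' x) \<bullet> w x)"
    by (intro essbdd_integrable essbdd_inner essbdd_matvec e)+
  have "?I (\<lambda>x. (grad D v x *v u x) \<bullet> w x - (grad D v' x *v u' x) \<bullet> w x)
      = ?I (\<lambda>x. (grad D v x *v (u x - u' x)) \<bullet> w x + (grad D (\<lambda>x. v x - v' x) x *v u' x) \<bullet> w x)"
  proof (rule integral_cong_AE)
    show "AE x in lebesgue_on D. (grad D v x *v u x) \<bullet> w x - (grad D v' x *v u' x) \<bullet> w x
      = (grad D v x *v (u x - u' x)) \<bullet> w x + (grad D (\<lambda>x. v x - v' x) x *v u' x) \<bullet> w x"
      using X_grad_diff[OF assms(2,4)]
      by eventually_elim (simp add: matrix_vector_mult_diff_distrib matrix_vector_mult_diff_rdistrib inner_diff_left)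
  qed (use i in auto)
  then show ?thesis using i by (simp add: trilinear_def L2_inner_def)
qed

lemma wgi_diff:
  assumes "essbdd a" "essbdd a'" "v \<in> X" "v' \<in> X" "w \<in> X"
  shows "weighted_grad_inner D a v w - weighted_grad_inner D a' v' w
     = weighted_grad_inner D (\<lambda>x. a x - a' x) v w + weighted_grad_inner D a' (\<lambda>x. v x - v' x) w"
proof -
  note e = assms(1,2) X_essbdd[OF assms(3)] X_essbdd[OF assms(4)] X_essbdd[OF assms(5)] X_essbdd[OF X_diff[OF assms(3,4)]]
  let ?I = "\<lambda>f. (\<integral>x. f x \<partial>lebesgue_on D) :: real"
  have i: "integrable (lebesgue_on D) (\<lambda>x. (a x *\<^sub>R grad D v x) \<bullet> grad D w x)" "integrable (lebesgue_on D) (\<lambda>x. (a' x *\<^sub>R grad D v' x) \<bullet> grad D w x)"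
    "integrable (lebesgue_on D) (\<lambda>x. ((a x - a' x) *\<^sub>R grad D v x) \<bullet> grad D w x)"
    "integrable (lebesgue_on D) (\<lambda>x. (a' x *\<^sub>R grad D (\<lambda>x. v x - v' x) x) \<bullet> grad D w x)"
    by (intro essbdd_integrable essbdd_inner essbdd_scaleR essbdd_diff e)+
  have "?I (\<lambda>x. (a x *\<^sub>R grad D v x) \<bullet> grad D w x - (a' x *\<^sub>R grad D v' x) \<bullet> grad D w x)
      = ?I (\<lambda>x. ((a x - a' x) *\<^sub>R grad D v x) \<bullet> grad D w x + (a' x *\<^sub>R grad D (\<lambda>x. v x - v' x) x) \<bullet> grad D w x)"
  proof (rule integral_cong_AE)
    show "AE x in lebesgue_on D. (a x *\<^sub>R grad D v x) \<bullet> grad D w x - (a' x *\<^sub>R grad D v' x) \<bullet> grad D w x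
      = ((a x - a' x) *\<^sub>R grad D v x) \<bullet> grad D w x + (a' x *\<^sub>R grad D (\<lambda>x. v x - v' x) x) \<bullet> grad D w x"
      using X_grad_diff[OF assms(3,4)] 
    proof eventually_elim
      case (elim x)
      show ?case unfolding elim by (simp add: inner_diff_left algebra_simps)
    qed
  qed (use i in auto)
  then show ?thesis using i by (simp add: weighted_grad_inner_def L2_inner_def)
qed

lemma wgi_diff_same:
  assumes "essbdd a" "v \<in> X" "v' \<in> X" "w \<in> X"
  shows "weighted_grad_inner D a v w - weighted_grad_inner D a v' w = weighted_grad_inner D a (\<lambda>x. v x - v' x) w"
proof -
  have "weighted_grad_inner D (\<lambda>x. 0) v w = 0" by (simp add: weighted_grad_inner_def L2_inner_def)
  then show ?thesis using wgi_diff[OF assms(1) assms(1) assms(2-4)] by simp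
qed

lemma wgi_bound:
  assumes "essbdd a" "v \<in> X" "w \<in> X" "AE x in lebesgue_on D. \<bar>a x\<bar> \<le> c" "0 \<le> c"
  shows "\<bar>weighted_grad_inner D a v w\<bar> \<le> c * gnrm v * gnrm w"
  unfolding weighted_grad_inner_def
proof (rule L2_inner_bound)
  show "AE x in lebesgue_on D. norm (a x *\<^sub>R grad D v x) * norm (grad D w x) \<le> c * (norm (grad D v x) * norm (grad D w x))"
    using assms(4)
  proof eventually_elim
    case (elim x)
    from mult_right_mono[OF this, of "norm (grad D v x) * norm (grad D w x)"] show ?case by (simp add: mult_ac)
  qed
qed (use assms X_essbdd in \<open>auto intro: essbdd_scaleR\<close>)

lemma wgi_diff_3:
  assumes "essbdd a" "v \<in> X" "w \<in> X" "w' \<in> X"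
  shows "weighted_grad_inner D a v (\<lambda>x. w x - w' x) = weighted_grad_inner D a v w - weighted_grad_inner D a v w'"
proof -
  have sym: "weighted_grad_inner D a v w = weighted_grad_inner D a w v" for v w
    by (simp add: weighted_grad_inner_def L2_inner_def inner_commute)
  show ?thesis using wgi_diff_same[OF assms(1) assms(3,4,2)] sym by metis
qed

lemma trilinear_bound:
  assumes "u \<in> X" "v \<in> X" "w \<in> X" "AE x in lebesgue_on D. norm (u x) \<le> M" "0 \<le> M"
  shows "\<bar>trilinear D u v w\<bar> \<le> M * gnrm v * nrm w"
  unfolding trilinear_def
proof (rule L2_inner_bound)
  show "AE x in lebesgue_on D. norm (grad D v x *v u x) * norm (w x) \<le> M * (norm (grad D v x) * norm (w x))"
    using assms(4)
  proof eventually_elim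
    case (elim x)
    have "norm (grad D v x *v u x) \<le> norm (grad D v x) * norm (u x)" by (rule norm_matrix_vector_mult_le)
    also have "\<dots> \<le> norm (grad D v x) * M" using elim by (intro mult_left_mono) auto
    finally have "norm (grad D v x *v u x) \<le> norm (grad D v x) * M" .
    from mult_right_mono[OF this norm_ge_zero[of "w x"]] show ?case by (simp add: mult_ac)
  qed
qed (use assms X_essbdd in \<open>auto intro: essbdd_matvec\<close>)

lemma trilinear_bound_u:
  assumes "u \<in> X" "v \<in> X" "w \<in> X" "AE x in lebesgue_on D. norm (w x) \<le> M" "0 \<le> M"
  shows "\<bar>trilinear D u v w\<bar> \<le> M * nrm u * gnrm v"
  unfolding trilinear_def
proof (rule L2_inner_bound)
  show "AE x in lebesgue_on D. norm (grad D v x *v u x) * norm (w x) \<le> M * (norm (u x) * norm (grad D v x))"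
    using assms(4)
  proof eventually_elim
    case (elim x)
    have "norm (grad D v x *v u x) * norm (w x) \<le> (norm (grad D v x) * norm (u x)) * M"
      using elim by (intro mult_mono norm_matrix_vector_mult_le) auto
    then show ?case by (simp add: mult_ac)
  qed
qed (use assms X_essbdd in \<open>auto intro: essbdd_matvec\<close>)

lemma dvg_inner_bound:
  assumes "u \<in> X" "v \<in> X" "w \<in> X" "AE x in lebesgue_on D. norm (v x) \<le> M" "0 \<le> M"
  shows "\<bar>L2_inner D (dvg D u) (\<lambda>x. v x \<bullet> w x)\<bar> \<le> M * nrm (dvg D u) * nrm w"
proof (rule L2_inner_bound)
  show "AE x in lebesgue_on D. norm (dvg D u x) * norm (v x \<bullet> w x) \<le> M * (norm (dvg D u x) * norm (w x))"
    using assms(4)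
  proof eventually_elim
    case (elim x)
    have "norm (v x \<bullet> w x) \<le> norm (v x) * norm (w x)" using Cauchy_Schwarz_ineq2[of "v x" "w x"] by simp
    also have "\<dots> \<le> M * norm (w x)" using elim by (intro mult_right_mono) auto
    finally have "norm (dvg D u x) * norm (v x \<bullet> w x) \<le> norm (dvg D u x) * (M * norm (w x))" by (intro mult_left_mono) auto
    then show ?case by (simp add: mult_ac)
  qed
qed (use assms X_essbdd in \<open>auto intro: essbdd_inner\<close>)

lemma trilinear_skew_X:
  assumes "u \<in> X" "v \<in> X" "w \<in> X"
  shows "trilinear D u v w = - trilinear D u w v - L2_inner D (dvg D u) (\<lambda>x. v x \<bullet> w x)"
  by (rule trilinear_skew[OF X_H10[OF assms(1)] X_vplip[OF assms(1)] X_vplip[OF assms(2)] X_vplip[OF assms(3)]])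

text \<open>Skew symmetry moves the derivative from \<open>v\<close> to \<open>w\<close>, so that
  only the sup norm of \<open>v\<close> enters, at the price of the divergence of
  \<open>u\<close>.\<close>

lemma trilinear_bound_v:
  assumes "u \<in> X" "v \<in> X" "w \<in> X" "AE x in lebesgue_on D. norm (v x) \<le> M" "0 \<le> M"
  shows "\<bar>trilinear D u v w\<bar> \<le> M * (nrm u * gnrm w + L * gnrm u * nrm w)"
proof -
  have 1: "\<bar>trilinear D u w v\<bar> \<le> M * nrm u * gnrm w"
    by (rule trilinear_bound_u[OF assms(1,3,2,4,5)])
  have "\<bar>L2_inner D (dvg D u) (\<lambda>x. v x \<bullet> w x)\<bar> \<le> M * nrm (dvg D u) * nrm w"
    by (rule dvg_inner_bound[OF assms])
  also have "\<dots> \<le> M * (L * gnrm u) * nrm w"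
    using assms(5) by (intro mult_right_mono mult_left_mono nrm_dvg_le assms(1) L2_norm_nonneg) auto
  finally have "\<bar>L2_inner D (dvg D u) (\<lambda>x. v x \<bullet> w x)\<bar> \<le> M * (L * gnrm u) * nrm w" .
  then show ?thesis using 1 trilinear_skew_X[OF assms(1-3)] by (simp add: algebra_simps)
qed

end

section \<open>Absorption by Young inequalities\<close>

lemma young_weighted:
  fixes x y s :: real
  assumes "0 < s"
  shows "x * y \<le> s * x\<^sup>2 + y\<^sup>2 / (4 * s)"
proof -
  have "0 \<le> (2 * s * x - y)\<^sup>2 / (4 * s)" using assms by simp
  also have "\<dots> = s * x\<^sup>2 + y\<^sup>2 / (4 * s) - x * y"
    using assms by (simp add: power2_eq_square field_simps)
  finally show ?thesis by simp
qed

lemma young_simple: "x * y \<le> x\<^sup>2 + y\<^sup>2" for x y :: real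
  using young_weighted[of 1 x y] zero_le_power2[of y] by linarith

text \<open>The left-hand side is what the energy estimate of one step leaves on its right; the
  right-hand side is what the dissipation of the increment, a small share \<open>\<eta>\<close> of
  the viscosity and the Gronwall argument can take. As a predicate on \<open>K\<close> it can be
  passed on before mesh and step size are chosen.\<close>

definition young_const :: "real \<Rightarrow> real \<Rightarrow> real \<Rightarrow> bool" where
  "young_const L \<eta> K \<longleftrightarrow> (\<forall>\<Delta>t H B a g g' \<delta> R. 0 < \<Delta>t \<longrightarrow> \<Delta>t \<le> L \<longrightarrow> 0 \<le> H \<longrightarrow> 0 \<le> B \<longrightarrow> B \<le> L\<^sup>2 * (1 + H) \<longrightarrow>
     0 \<le> a \<longrightarrow> 0 \<le> g \<longrightarrow> 0 \<le> g' \<longrightarrow> 0 \<le> \<delta> \<longrightarrow> 0 \<le> R \<longrightarrow>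
     16 * L^5 * (a * g + a * g' + H * a * \<delta> + (a + g) * R + \<Delta>t * H * a * (g' + R) + B * g' * R)
       + (1 / \<Delta>t) * (L * \<delta> * R) + L * (g' + 2 * g) * R + 2 * L\<^sup>2 * \<Delta>t * B\<^sup>2 * R\<^sup>2
     \<le> \<delta>\<^sup>2 / (2 * \<Delta>t) + \<eta> * (g\<^sup>2 + g'\<^sup>2) + K * (1 + \<Delta>t * H\<^sup>2) * a\<^sup>2 + K * ((1 + \<Delta>t * H\<^sup>2) / \<Delta>t) * R\<^sup>2)"

lemma young_absorption:
  fixes L \<eta> :: real
  assumes L: "1 \<le> L" and \<eta>: "0 < \<eta>"
  shows "\<exists>K>0. young_const L \<eta> K"
proof -
  define c where "c = 16 * L^5"
  have c: "0 < c" using L by (simp add: c_def)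
  define K1 where "K1 = 2 * c\<^sup>2 / \<eta> + c + (c\<^sup>2 + c\<^sup>2 * L / \<eta> + c)"
  define K2 where "K2 = c * L + (c + 2 * L)\<^sup>2 * L / \<eta> + c * L\<^sup>2 + (4 * c\<^sup>2 * L^5 + 2 * L^3) / \<eta> + L\<^sup>2 + 4 * L^8"
  have K1: "0 < K1" unfolding K1_def using c \<eta> L by (intro add_pos_pos divide_pos_pos mult_pos_pos) auto
  have K2: "0 < K2" unfolding K2_def using c \<eta> L by (intro add_pos_pos divide_pos_pos mult_pos_pos) auto
  show ?thesis
    unfolding young_const_def
  proof (intro exI[of _ "K1 + K2"] conjI allI impI)
    show "0 < K1 + K2" using K1 K2 by simp
    fix \<Delta>t H B a g g' \<delta> R :: real
    assume A: "0 < \<Delta>t" "\<Delta>t \<le> L" "0 \<le> H" "0 \<le> B" "B \<le> L\<^sup>2 * (1 + H)" "0 \<le> a" "0 \<le> g" "0 \<le> g'" "0 \<le> \<delta>" "0 \<le> R"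
    define t where "t = \<Delta>t * H\<^sup>2"
    have t: "0 \<le> t" using A by (simp add: t_def)
    have p1: "c * (a * g) \<le> \<eta> / 4 * g\<^sup>2 + c\<^sup>2 / \<eta> * a\<^sup>2"
      using young_weighted[of "\<eta> / 4" g "c * a"] \<eta> by (simp add: power_mult_distrib mult_ac)
    have p2: "c * (a * g') \<le> \<eta> / 4 * g'\<^sup>2 + c\<^sup>2 / \<eta> * a\<^sup>2"
      using young_weighted[of "\<eta> / 4" g' "c * a"] \<eta> by (simp add: power_mult_distrib mult_ac)
    \<comment> \<open>Half of the available dissipation pays for this term; the price is the factor
      \<open>\<Delta>t * H^2\<close>, the only combination in which \<open>H\<close> appears in the
      result.\<close>
    have p3: "c * (H * a * \<delta>) \<le> \<delta>\<^sup>2 / (4 * \<Delta>t) + c\<^sup>2 * t * a\<^sup>2"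
      using young_weighted[of "1 / (4 * \<Delta>t)" \<delta> "c * H * a"] A(1) by (simp add: power_mult_distrib mult_ac t_def)
    have p4: "c * (a * R) \<le> c * a\<^sup>2 + c * R\<^sup>2"
      using mult_left_mono[OF young_simple[of a R], of c] c by (simp add: distrib_left)
    have p5: "(c + 2 * L) * (g * R) \<le> \<eta> / 4 * g\<^sup>2 + (c + 2 * L)\<^sup>2 / \<eta> * R\<^sup>2"
      using young_weighted[of "\<eta> / 4" g "(c + 2 * L) * R"] \<eta> by (simp add: power_mult_distrib mult_ac)
    have p6: "c * (\<Delta>t * H * a * g') \<le> \<eta> / 4 * g'\<^sup>2 + c\<^sup>2 * \<Delta>t / \<eta> * t * a\<^sup>2"
      using young_weighted[of "\<eta> / 4" g' "c * \<Delta>t * H * a"] \<eta>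
      by (simp add: power_mult_distrib mult_ac t_def) (simp add: power2_eq_square mult_ac)
    have p7: "c * (\<Delta>t * H * a * R) \<le> c * t * a\<^sup>2 + c * \<Delta>t * R\<^sup>2"
    proof -
      have "c * \<Delta>t * ((H * a) * R) \<le> c * \<Delta>t * ((H * a)\<^sup>2 + R\<^sup>2)"
        using c A(1) by (intro mult_left_mono young_simple) auto
      then show ?thesis by (simp add: power_mult_distrib algebra_simps t_def)
    qed
    have p8: "(c * B + L) * (g' * R) \<le> \<eta> / 4 * g'\<^sup>2 + (c * B + L)\<^sup>2 / \<eta> * R\<^sup>2"
      using young_weighted[of "\<eta> / 4" g' "(c * B + L) * R"] \<eta> by (simp add: power_mult_distrib mult_ac)
    \<comment> \<open>The other half of the dissipation goes here. What remains is of order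
      \<open>R^2 / \<Delta>t\<close>.\<close>
    have p9: "(1 / \<Delta>t) * (L * \<delta> * R) \<le> \<delta>\<^sup>2 / (4 * \<Delta>t) + L\<^sup>2 / \<Delta>t * R\<^sup>2"
      using young_weighted[of "1 / (4 * \<Delta>t)" \<delta> "L * R / \<Delta>t"] A(1)
      by (simp add: power_mult_distrib power_divide mult_ac) (simp add: power2_eq_square mult_ac)
    define Ca where "Ca = 2 * (c\<^sup>2 / \<eta>) + c\<^sup>2 * t + c + c\<^sup>2 * \<Delta>t / \<eta> * t + c * t"
    define Cr where "Cr = c + (c + 2 * L)\<^sup>2 / \<eta> + c * \<Delta>t + (c * B + L)\<^sup>2 / \<eta> + L\<^sup>2 / \<Delta>t + 2 * L\<^sup>2 * \<Delta>t * B\<^sup>2"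
    have lhs: "c * (a * g + a * g' + H * a * \<delta> + (a + g) * R + \<Delta>t * H * a * (g' + R) + B * g' * R)
       + (1 / \<Delta>t) * (L * \<delta> * R) + L * (g' + 2 * g) * R + 2 * L\<^sup>2 * \<Delta>t * B\<^sup>2 * R\<^sup>2
      = c * (a * g) + c * (a * g') + c * (H * a * \<delta>) + c * (a * R) + (c + 2 * L) * (g * R)
        + c * (\<Delta>t * H * a * g') + c * (\<Delta>t * H * a * R) + (c * B + L) * (g' * R)
        + (1 / \<Delta>t) * (L * \<delta> * R) + 2 * L\<^sup>2 * \<Delta>t * B\<^sup>2 * R\<^sup>2"
      by (simp add: algebra_simps)
    have rhs: "(\<eta> / 4 * g\<^sup>2 + c\<^sup>2 / \<eta> * a\<^sup>2) + (\<eta> / 4 * g'\<^sup>2 + c\<^sup>2 / \<eta> * a\<^sup>2) + (\<delta>\<^sup>2 / (4 * \<Delta>t) + c\<^sup>2 * t * a\<^sup>2)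
        + (c * a\<^sup>2 + c * R\<^sup>2) + (\<eta> / 4 * g\<^sup>2 + (c + 2 * L)\<^sup>2 / \<eta> * R\<^sup>2) + (\<eta> / 4 * g'\<^sup>2 + c\<^sup>2 * \<Delta>t / \<eta> * t * a\<^sup>2)
        + (c * t * a\<^sup>2 + c * \<Delta>t * R\<^sup>2) + (\<eta> / 4 * g'\<^sup>2 + (c * B + L)\<^sup>2 / \<eta> * R\<^sup>2)
        + (\<delta>\<^sup>2 / (4 * \<Delta>t) + L\<^sup>2 / \<Delta>t * R\<^sup>2) + 2 * L\<^sup>2 * \<Delta>t * B\<^sup>2 * R\<^sup>2
      = 2 * (\<delta>\<^sup>2 / (4 * \<Delta>t)) + (\<eta> / 2 * g\<^sup>2 + 3 * (\<eta> / 4) * g'\<^sup>2) + Ca * a\<^sup>2 + Cr * R\<^sup>2"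
      by (simp add: Ca_def Cr_def algebra_simps)
    have main: "c * (a * g + a * g' + H * a * \<delta> + (a + g) * R + \<Delta>t * H * a * (g' + R) + B * g' * R)
       + (1 / \<Delta>t) * (L * \<delta> * R) + L * (g' + 2 * g) * R + 2 * L\<^sup>2 * \<Delta>t * B\<^sup>2 * R\<^sup>2
      \<le> 2 * (\<delta>\<^sup>2 / (4 * \<Delta>t)) + (\<eta> / 2 * g\<^sup>2 + 3 * (\<eta> / 4) * g'\<^sup>2) + Ca * a\<^sup>2 + Cr * R\<^sup>2"
      unfolding lhs rhs[symmetric] by (intro add_mono p1 p2 p3 p4 p5 p6 p7 p8 p9 order_refl)
    have Ca: "Ca \<le> (K1 + K2) * (1 + t)"
    proof -
      have q: "c\<^sup>2 * \<Delta>t / \<eta> \<le> c\<^sup>2 * L / \<eta>" using A \<eta> by (intro divide_right_mono mult_left_mono) auto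
      have "Ca = (2 * c\<^sup>2 / \<eta> + c) + (c\<^sup>2 + c\<^sup>2 * \<Delta>t / \<eta> + c) * t" by (simp add: Ca_def algebra_simps)
      also have "\<dots> \<le> (2 * c\<^sup>2 / \<eta> + c) + (c\<^sup>2 + c\<^sup>2 * L / \<eta> + c) * t"
        using q t by (intro add_left_mono mult_right_mono) auto
      also have "\<dots> \<le> K1 + K1 * t"
      proof -
        have "0 \<le> 2 * c\<^sup>2 / \<eta> + c" "0 \<le> c\<^sup>2 + c\<^sup>2 * L / \<eta> + c" using c \<eta> L by simp_all
        then have "2 * c\<^sup>2 / \<eta> + c \<le> K1" "c\<^sup>2 + c\<^sup>2 * L / \<eta> + c \<le> K1" unfolding K1_def by linarith+
        then show ?thesis using t by (intro add_mono mult_right_mono)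
      qed
      also have "\<dots> \<le> (K1 + K2) * (1 + t)" using K2 t by (simp add: algebra_simps)
      finally show ?thesis .
    qed
    \<comment> \<open>The bound \<open>B\<close> may grow like \<open>H\<close>, but with
      \<open>\<Delta>t \<le> L\<close> its square times \<open>\<Delta>t\<close> is again of order
      \<open>1 + \<Delta>t * H^2\<close>.\<close>
    have Bsq: "\<Delta>t * B\<^sup>2 \<le> 2 * L^5 * (1 + t)"
    proof -
      have "B\<^sup>2 \<le> (L\<^sup>2 * (1 + H))\<^sup>2" using A by (intro power_mono) auto
      also have "\<dots> = L^4 * (1 + H)\<^sup>2" by (simp add: power_mult_distrib flip: power_mult)
      also have "\<dots> \<le> L^4 * (2 * (1 + H\<^sup>2))"
        using sum_squares_bound[of 1 H] L by (intro mult_left_mono) (auto simp: power2_sum)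
      finally have "\<Delta>t * B\<^sup>2 \<le> \<Delta>t * (L^4 * (2 * (1 + H\<^sup>2)))" using A(1) by (intro mult_left_mono) auto
      also have "\<dots> = 2 * L^4 * (\<Delta>t + t)" by (simp add: t_def algebra_simps)
      also have "\<dots> \<le> 2 * L^4 * (L * (1 + t))"
      proof (rule mult_left_mono)
        have "t \<le> L * t" using mult_right_mono[OF L t] by simp
        then show "\<Delta>t + t \<le> L * (1 + t)" using A(2) by (simp add: distrib_left)
      qed (use L in auto)
      also have "\<dots> = 2 * L^5 * (1 + t)" by (simp add: eval_nat_numeral)
      finally show ?thesis .
    qed
    have Cr: "Cr \<le> (K1 + K2) * ((1 + t) / \<Delta>t)"
    proof -
      have s1: "c * \<Delta>t \<le> c * L" using c A by simp
      have s2: "(c + 2 * L)\<^sup>2 / \<eta> * \<Delta>t \<le> (c + 2 * L)\<^sup>2 * L / \<eta>"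
        using A \<eta> by (simp add: divide_right_mono mult_left_mono)
      have s3: "c * \<Delta>t * \<Delta>t \<le> c * L\<^sup>2"
        using c A mult_mono[of \<Delta>t L \<Delta>t L] by (simp add: power2_eq_square mult.assoc)
      have s4: "(c * B + L)\<^sup>2 / \<eta> * \<Delta>t \<le> (4 * c\<^sup>2 * L^5 + 2 * L^3) / \<eta> * (1 + t)"
      proof -
        have "(c * B + L)\<^sup>2 \<le> 2 * (c\<^sup>2 * B\<^sup>2) + 2 * L\<^sup>2"
          using sum_squares_bound[of "c * B" L] by (simp add: power2_sum power_mult_distrib mult_ac)
        then have "(c * B + L)\<^sup>2 * \<Delta>t \<le> (2 * (c\<^sup>2 * B\<^sup>2) + 2 * L\<^sup>2) * \<Delta>t" using A(1) by (intro mult_right_mono) auto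
        also have "\<dots> = 2 * c\<^sup>2 * (\<Delta>t * B\<^sup>2) + 2 * L\<^sup>2 * \<Delta>t" by (simp add: algebra_simps)
        also have "\<dots> \<le> 2 * c\<^sup>2 * (2 * L^5 * (1 + t)) + 2 * L\<^sup>2 * (L * (1 + t))"
        proof (intro add_mono mult_left_mono Bsq)
          have "L * 1 \<le> L * (1 + t)" using L t by (intro mult_left_mono) auto
          then show "\<Delta>t \<le> L * (1 + t)" using A(2) by linarith
        qed auto
        also have "\<dots> = (4 * c\<^sup>2 * L^5 + 2 * L^3) * (1 + t)" by (simp add: algebra_simps eval_nat_numeral)
        finally show ?thesis using \<eta> by (simp add: divide_right_mono)
      qed
      have s6: "2 * L\<^sup>2 * \<Delta>t * B\<^sup>2 * \<Delta>t \<le> 4 * L^8 * (1 + t)"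
      proof -
        have "2 * L\<^sup>2 * \<Delta>t * B\<^sup>2 * \<Delta>t = (2 * L\<^sup>2 * \<Delta>t) * (\<Delta>t * B\<^sup>2)" by (simp only: mult_ac)
        also have "\<dots> \<le> (2 * L\<^sup>2 * L) * (2 * L^5 * (1 + t))"
          using A L t by (intro mult_mono Bsq mult_left_mono) auto
        also have "\<dots> = 4 * L^8 * (1 + t)" by (simp add: eval_nat_numeral)
        finally show ?thesis .
      qed
      have "Cr * \<Delta>t = c * \<Delta>t + (c + 2 * L)\<^sup>2 / \<eta> * \<Delta>t + c * \<Delta>t * \<Delta>t + (c * B + L)\<^sup>2 / \<eta> * \<Delta>t + L\<^sup>2 + 2 * L\<^sup>2 * \<Delta>t * B\<^sup>2 * \<Delta>t"
        using A(1) by (simp add: Cr_def distrib_right)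
      also have "\<dots> \<le> c * L + (c + 2 * L)\<^sup>2 * L / \<eta> + c * L\<^sup>2 + (4 * c\<^sup>2 * L^5 + 2 * L^3) / \<eta> * (1 + t) + L\<^sup>2 + 4 * L^8 * (1 + t)"
        by (intro add_mono s1 s2 s3 s4 s6 order_refl)
      also have "\<dots> \<le> K2 * (1 + t)"
      proof -
        have u: "x \<le> x * (1 + t)" if "0 \<le> x" for x using that t by (simp add: distrib_left)
        have "c * L \<le> c * L * (1 + t)" "(c + 2 * L)\<^sup>2 * L / \<eta> \<le> (c + 2 * L)\<^sup>2 * L / \<eta> * (1 + t)"
          "c * L\<^sup>2 \<le> c * L\<^sup>2 * (1 + t)" "L\<^sup>2 \<le> L\<^sup>2 * (1 + t)"
          using c L \<eta> by (intro u; simp)+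
        then show ?thesis unfolding K2_def distrib_right by linarith
      qed
      also have "\<dots> \<le> (K1 + K2) * (1 + t)" using K1 t by (intro mult_right_mono) auto
      finally show ?thesis using A(1) by (simp add: pos_le_divide_eq)
    qed
    have "c * (a * g + a * g' + H * a * \<delta> + (a + g) * R + \<Delta>t * H * a * (g' + R) + B * g' * R)
       + (1 / \<Delta>t) * (L * \<delta> * R) + L * (g' + 2 * g) * R + 2 * L\<^sup>2 * \<Delta>t * B\<^sup>2 * R\<^sup>2
      \<le> 2 * (\<delta>\<^sup>2 / (4 * \<Delta>t)) + (\<eta> / 2 * g\<^sup>2 + 3 * (\<eta> / 4) * g'\<^sup>2) + (K1 + K2) * (1 + t) * a\<^sup>2 + (K1 + K2) * ((1 + t) / \<Delta>t) * R\<^sup>2"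
      using main mult_right_mono[OF Ca zero_le_power2[of a]] mult_right_mono[OF Cr zero_le_power2[of R]] by linarith
    also have "\<dots> \<le> \<delta>\<^sup>2 / (2 * \<Delta>t) + \<eta> * (g\<^sup>2 + g'\<^sup>2) + (K1 + K2) * (1 + t) * a\<^sup>2 + (K1 + K2) * ((1 + t) / \<Delta>t) * R\<^sup>2"
    proof -
      have "\<eta> / 2 * g\<^sup>2 + 3 * (\<eta> / 4) * g'\<^sup>2 \<le> \<eta> * g\<^sup>2 + \<eta> * g'\<^sup>2"
        using \<eta> by (intro add_mono mult_right_mono) auto
      then show ?thesis by (simp add: distrib_left)
    qed
    finally show "16 * L^5 * (a * g + a * g' + H * a * \<delta> + (a + g) * R + \<Delta>t * H * a * (g' + R) + B * g' * R)
       + (1 / \<Delta>t) * (L * \<delta> * R) + L * (g' + 2 * g) * R + 2 * L\<^sup>2 * \<Delta>t * B\<^sup>2 * R\<^sup>2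
     \<le> \<delta>\<^sup>2 / (2 * \<Delta>t) + \<eta> * (g\<^sup>2 + g'\<^sup>2) + (K1 + K2) * (1 + \<Delta>t * H\<^sup>2) * a\<^sup>2 + (K1 + K2) * ((1 + \<Delta>t * H\<^sup>2) / \<Delta>t) * R\<^sup>2"
      by (simp only: c_def t_def)
  qed
qed

section \<open>The energy estimate for one field\<close>

context fe_space
begin

text \<open>Rounds products with up to four factors \<open>L\<close> up to the fifth power, so that
  all contributions share one coefficient.\<close>

lemma L_power_mono:
  assumes "0 \<le> x"
  shows "L * x \<le> L^5 * x" "L * (L * x) \<le> L^5 * x" "L * (L * (L * x)) \<le> L^5 * x"
    "L * (L * (L * (L * x))) \<le> L^5 * x" "x \<le> L^5 * x"
proof -
  have p: "L ^ n * x \<le> L ^ 5 * x" if "n \<le> 5" for n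
    using that L1 assms by (intro mult_right_mono power_increasing) auto
  show "L * x \<le> L^5 * x" using p[of 1] by simp
  show "L * (L * x) \<le> L^5 * x" using p[of 2] by (simp add: power2_eq_square mult.assoc)
  show "L * (L * (L * x)) \<le> L^5 * x" using p[of 3] by (simp add: power3_eq_cube mult.assoc)
  show "L * (L * (L * (L * x))) \<le> L^5 * x" using p[of 4] by (simp add: eval_nat_numeral mult.assoc)
  show "x \<le> L^5 * x" using p[of 0] by simp
qed

lemma trilinear_split_3:
  assumes "u \<in> X" "v \<in> X" "e \<in> X" "e' \<in> X" "\<rho> \<in> X"
  shows "trilinear D u v (\<lambda>x. e' x - \<rho> x) = trilinear D u v e' - trilinear D u v \<rho>"
    and "trilinear D u v e' = trilinear D u v e + trilinear D u v (\<lambda>x. e' x - e x)"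
  using trilinear_lincomb_3[OF assms(1,2,4,5), of 1 "-1"] trilinear_lincomb_3[OF assms(1,2,4,3), of 1 "-1"] by simp_all

text \<open>The new error is split into the old error and the increment. On the old error skew
  symmetry is used; on the increment the derivative stays on \<open>v\<close> and \<open>U\<close>
  is bounded by an inverse inequality, which is affordable because the increment is absorbed by the
  dissipation; the part with \<open>\<rho>\<close> goes through the Poincare inequality.\<close>

lemma trilinear_bound_error:
  assumes X: "U \<in> X" "v \<in> X" "e \<in> X" "e' \<in> X" "\<rho> \<in> X"
    and v: "AE x in lebesgue_on D. norm (v x) \<le> L" "gnrm v \<le> L"
    and U: "nrm U \<le> a" "gnrm U \<le> g" and e: "nrm e \<le> b" "gnrm e \<le> k"
  shows "\<bar>trilinear D U v (\<lambda>x. e' x - \<rho> x)\<bar>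
     \<le> L^5 * (a * k + g * b + H * a * nrm (\<lambda>x. e' x - e x) + (a + g) * gnrm \<rho>)"
proof -
  define d where "d = (\<lambda>x. e' x - e x)"
  have d: "d \<in> X" unfolding d_def by (rule X_diff[OF X(4,3)])
  have n: "0 \<le> nrm U" "0 \<le> gnrm U" "0 \<le> nrm d" "0 \<le> gnrm \<rho>" "0 \<le> nrm e" "0 \<le> gnrm e" "0 \<le> gnrm v" "0 \<le> nrm \<rho>"
    by (simp_all add: L2_norm_nonneg)
  have ag: "0 \<le> a" "0 \<le> g" "0 \<le> b" "0 \<le> k" using U e n by linarith+
  have 1: "\<bar>trilinear D U v e\<bar> \<le> L^5 * (a * k + g * b)"
  proof -
    have "\<bar>trilinear D U v e\<bar> \<le> L * (nrm U * gnrm e + L * gnrm U * nrm e)"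
      by (rule trilinear_bound_v[OF X(1-3) v(1) L0])
    also have "\<dots> \<le> L * (a * k + L * g * b)"
      using U e n ag L0 by (intro mult_left_mono add_mono mult_mono) auto
    also have "\<dots> \<le> L^5 * (a * k + g * b)"
      using L_power_mono(1)[of "a * k"] L_power_mono(2)[of "g * b"] ag by (simp add: distrib_left mult.assoc)
    finally show ?thesis .
  qed
  have 2: "\<bar>trilinear D U v d\<bar> \<le> L^5 * (H * a * nrm d)"
  proof -
    have "\<bar>trilinear D U v d\<bar> \<le> L * H * nrm U * gnrm v * nrm d"
      using X_inv_sup[OF X(1)] L0 H0 n by (intro trilinear_bound X d) auto
    also have "\<dots> \<le> L * H * a * L * nrm d"
      using U v n ag L0 H0 by (intro mult_right_mono mult_mono mult_left_mono) auto
    also have "\<dots> \<le> L^5 * (H * a * nrm d)"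
      using L_power_mono(2)[of "H * a * nrm d"] ag H0 n by (simp add: mult_ac)
    finally show ?thesis .
  qed
  have 3: "\<bar>trilinear D U v \<rho>\<bar> \<le> L^5 * ((a + g) * gnrm \<rho>)"
  proof -
    have "\<bar>trilinear D U v \<rho>\<bar> \<le> L * (nrm U * gnrm \<rho> + L * gnrm U * nrm \<rho>)"
      by (rule trilinear_bound_v[OF X(1,2,5) v(1) L0])
    also have "\<dots> \<le> L * (a * gnrm \<rho> + L * g * (L * gnrm \<rho>))"
      using U n ag L0 X_Poincare[OF X(5)] by (intro mult_left_mono add_mono mult_mono) auto
    also have "\<dots> \<le> L^5 * ((a + g) * gnrm \<rho>)"
      using L_power_mono(1)[of "a * gnrm \<rho>"] L_power_mono(3)[of "g * gnrm \<rho>"] ag n by (simp add: algebra_simps)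
    finally show ?thesis .
  qed
  have "trilinear D U v (\<lambda>x. e' x - \<rho> x) = trilinear D U v e + trilinear D U v d - trilinear D U v \<rho>"
    using trilinear_split_3[OF X] by (simp add: d_def)
  then show ?thesis using 1 2 3 unfolding d_def[symmetric] by (simp add: distrib_left)
qed

lemma X_zero: "u \<in> X \<Longrightarrow> (\<lambda>x. 0) \<in> X"
  using X_lincomb[of u u 0 0] by simp

lemma gnrm_zero:
  assumes "u \<in> X"
  shows "gnrm (\<lambda>x. 0) = 0"
proof -
  have "nrm (\<lambda>x. 0 :: real^'d) = 0" by (simp add: L2_norm_def L2_inner_def)
  then show ?thesis using X_inv_grad[OF X_zero[OF assms]] L2_norm_nonneg[of "grad D (\<lambda>x. 0)"] by simp
qed

lemma eddy_essbdd:
  assumes "\<And>i. i \<in> {1..N} \<Longrightarrow> z i \<in> X" "1 \<le> N"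
  shows "essbdd (eddy_viscosity N \<mu> \<Delta>t z)"
proof -
  have "essbdd (\<lambda>x. \<mu> * \<Delta>t * (\<Sum>j=1..N. (norm (fluct N z j x))\<^sup>2))"
  proof (intro essbdd_mult_const essbdd_sum essbdd_power2 essbdd_norm X_essbdd(1))
    fix j assume "j \<in> {1..N}"
    then show "fluct N z j \<in> X" by (intro fluct_X assms)
  qed
  then show ?thesis by (simp add: eddy_viscosity_def[abs_def])
qed

text \<open>
  The error equation \<open>err\<close> is tested with \<open>e' - \<rho>\<close>. In \<open>cases\<close>, the first alternative is the first
  time step, where the two schemes start from the same data but no bounds in \<open>L\<^sup>\<infinity>\<close> are available.
\<close>

lemma half_step:
  fixes zo zho :: "nat \<Rightarrow> real^'d \<Rightarrow> real^'d"
  assumes N: "1 \<le> N" "real N \<le> L" "j \<in> {1..N}"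
    and X: "un \<in> X" "uo \<in> X" "e \<in> X" "e' \<in> X" "\<rho> \<in> X"
    and zX: "\<And>i. i \<in> {1..N} \<Longrightarrow> zo i \<in> X" "\<And>i. i \<in> {1..N} \<Longrightarrow> zho i \<in> X"
    and \<epsilon>: "\<epsilon> = (\<lambda>i x. zo i x - zho i x)"
    and va: "essbdd va" "AE x in lebesgue_on D. m \<le> va x \<and> va x \<le> L" "0 \<le> m"
    and vb1: "essbdd vb1" "AE x in lebesgue_on D. \<bar>vb1 x\<bar> \<le> a1" "0 \<le> a1" "a1 \<le> L"
    and vb2: "essbdd vb2" "AE x in lebesgue_on D. \<bar>vb2 x\<bar> \<le> a2" "0 \<le> a2" "a2 \<le> L"
    and dt: "0 < \<Delta>t" "0 < \<mu>" "\<mu> \<le> L"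
    and e: "nrm e \<le> a" "gnrm e \<le> g" "gnrm e' \<le> g'"
    and es: "(\<Sum>i=1..N. nrm (\<epsilon> i)) \<le> a" "(\<Sum>i=1..N. gnrm (\<epsilon> i)) \<le> g"
    and dv: "AE x in lebesgue_on D. dvg D (avg N zo) x = 0" "AE x in lebesgue_on D. dvg D (fluct N zo j) x = 0"
    and B: "AE x in lebesgue_on D. \<forall>i\<in>{1..N}. norm (zho i x) \<le> B" "0 \<le> B"
    and cases: "(e = (\<lambda>x. 0) \<and> (\<forall>i\<in>{1..N}. zo i = zho i)) \<or>
       ((AE x in lebesgue_on D. norm (un x) \<le> L \<and> norm (uo x) \<le> L \<and> norm (e' x) \<le> 2 * L
          \<and> (\<forall>i\<in>{1..N}. norm (zo i x) \<le> L \<and> norm (zho i x) \<le> L)) \<and> gnrm un \<le> L \<and> gnrm uo \<le> L)"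
    and err: "\<And>\<tau>. \<tau> \<in> X \<Longrightarrow>
       (1 / \<Delta>t) * L2_inner D (\<lambda>x. e' x - e x) \<tau> + trilinear D (avg N \<epsilon>) un \<tau> + trilinear D (avg N zho) e' \<tau>
       + weighted_grad_inner D va e' \<tau>
       + weighted_grad_inner D (\<lambda>x. 2 * eddy_viscosity N \<mu> \<Delta>t zo x - 2 * eddy_viscosity N \<mu> \<Delta>t zho x) un \<tau>
       + weighted_grad_inner D (\<lambda>x. 2 * eddy_viscosity N \<mu> \<Delta>t zho x) e' \<tau>
       + P \<tau> + trilinear D (fluct N \<epsilon> j) uo \<tau> + trilinear D (fluct N zho j) e \<tau>
       + weighted_grad_inner D vb1 (\<epsilon> j) \<tau> + weighted_grad_inner D vb2 e \<tau> = 0"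
  defines "\<delta> \<equiv> nrm (\<lambda>x. e' x - e x)" and "R \<equiv> gnrm \<rho>"
  shows "((nrm e')\<^sup>2 - (nrm e)\<^sup>2) / (2 * \<Delta>t) + \<delta>\<^sup>2 / (2 * \<Delta>t) + m * (gnrm e')\<^sup>2
       - a1 * gnrm (\<epsilon> j) * gnrm e' - a2 * gnrm e * gnrm e' + P (\<lambda>x. e' x - \<rho> x)
     \<le> 16 * L^5 * (a * g + a * g' + H * a * \<delta> + (a + g) * R + \<Delta>t * H * a * (g' + R) + B * g' * R)
       + (1 / \<Delta>t) * (L * \<delta> * R) + L * (g' + 2 * g) * R + 2 * L\<^sup>2 * \<Delta>t * B\<^sup>2 * R\<^sup>2"
proof -
  define \<tau> where "\<tau> = (\<lambda>x. e' x - \<rho> x)"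
  define d where "d = (\<lambda>x. e' x - e x)"
  have \<tau>X: "\<tau> \<in> X" unfolding \<tau>_def by (rule X_diff[OF X(4,5)])
  have dX: "d \<in> X" unfolding d_def by (rule X_diff[OF X(4,3)])
  have \<epsilon>X: "\<epsilon> i \<in> X" if "i \<in> {1..N}" for i unfolding \<epsilon> by (rule X_diff[OF zX(1)[OF that] zX(2)[OF that]])
  define U where "U = avg N \<epsilon>"
  define F where "F = fluct N \<epsilon> j"
  define Z where "Z = avg N zho"
  define W where "W = fluct N zho j"
  have UX: "U \<in> X" unfolding U_def by (rule avg_X[OF \<epsilon>X N(1)])
  have FX: "F \<in> X" unfolding F_def by (rule fluct_X[OF \<epsilon>X N(1) N(3)])
  have ZX: "Z \<in> X" unfolding Z_def by (rule avg_X[OF zX(2) N(1)])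
  have WX: "W \<in> X" unfolding W_def by (rule fluct_X[OF zX(2) N(1) N(3)])
  have zoaX: "avg N zo \<in> X" by (rule avg_X[OF zX(1) N(1)])
  have zofX: "fluct N zo j \<in> X" by (rule fluct_X[OF zX(1) N(1) N(3)])
  have n: "0 \<le> nrm e" "0 \<le> gnrm e" "0 \<le> nrm e'" "0 \<le> gnrm e'" "0 \<le> nrm \<rho>" "0 \<le> R" "0 \<le> \<delta>" "0 \<le> nrm d" "0 \<le> gnrm (\<epsilon> j)"
    by (simp_all add: L2_norm_nonneg \<delta>_def R_def)
  have ag: "0 \<le> a" "0 \<le> g" "0 \<le> g'" using e n by linarith+
  have \<delta>d: "nrm d = \<delta>" by (simp add: d_def \<delta>_def)
  have \<rho>R: "nrm \<rho> \<le> L * R" using X_Poincare[OF X(5)] by (simp add: R_def)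
  have nU: "nrm U \<le> (\<Sum>i=1..N. nrm (\<epsilon> i))" "gnrm U \<le> (\<Sum>i=1..N. gnrm (\<epsilon> i))"
    unfolding U_def by (rule nrm_avg_le[OF \<epsilon>X N(1)]; assumption)+
  then have nU: "nrm U \<le> a" "gnrm U \<le> g" using es by linarith+
  have nF: "nrm F \<le> 2 * (\<Sum>i=1..N. nrm (\<epsilon> i))" "gnrm F \<le> 2 * (\<Sum>i=1..N. gnrm (\<epsilon> i))"
    unfolding F_def by (rule nrm_fluct_le[OF \<epsilon>X N(1) N(3)]; assumption)+
  then have nF: "nrm F \<le> 2 * a" "gnrm F \<le> 2 * g" using es by linarith+
  have g\<epsilon>: "gnrm (\<epsilon> j) \<le> g"
    using member_le_sum[of j "{1..N}" "\<lambda>i. gnrm (\<epsilon> i)"] N(3) es(2) by (auto simp: L2_norm_nonneg)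
  have Ufun: "U = (\<lambda>x. avg N zo x - Z x)" and Ffun: "F = (\<lambda>x. fluct N zo j x - W x)"
    unfolding U_def F_def Z_def W_def \<epsilon> by (rule avg_diff, rule fluct_diff)
  \<comment> \<open>The fields \<open>zo\<close> of the coupled scheme are divergence free, so the
    divergence of the average \<open>Z\<close> is due to the error alone.\<close>
  have dvgZ: "AE x in lebesgue_on D. dvg D Z x = - dvg D U x"
    using X_dvg_diff[OF zoaX ZX, folded Ufun] dv(1) by eventually_elim simp
  have dvgW: "AE x in lebesgue_on D. dvg D W x = - dvg D F x"
    using X_dvg_diff[OF zofX WX, folded Ffun] dv(2) by eventually_elim simp
  have nde: "nrm (dvg D U) \<le> L * g" "nrm (dvg D U) \<le> L * (L * H * a)" "nrm (dvg D W) \<le> L * (2 * g)"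
  proof -
    show "nrm (dvg D U) \<le> L * g" using nrm_dvg_le[OF UX] mult_left_mono[OF nU(2) L0] by linarith
    have "gnrm U \<le> L * H * a" using X_inv_grad[OF UX] mult_left_mono[OF nU(1), of "L * H"] L0 H0 by simp
    then show "nrm (dvg D U) \<le> L * (L * H * a)"
      using nrm_dvg_le[OF UX] mult_left_mono[OF _ L0, of "gnrm U" "L * H * a"] by linarith
    have "AE x in lebesgue_on D. dvg D W x = (-1) *\<^sub>R dvg D F x + 0 *\<^sub>R dvg D F x"
      using dvgW by eventually_elim simp
    then have "nrm (dvg D W) = nrm (\<lambda>x. (-1) *\<^sub>R dvg D F x + 0 *\<^sub>R dvg D F x)"
      using X_essbdd(3)[OF WX] X_essbdd(3)[OF FX] by (intro nrm_cong_AE essbdd_add essbdd_scaleR_const)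
    also have "\<dots> \<le> nrm (dvg D F)"
      using nrm_lincomb_le[OF X_essbdd(3)[OF FX] X_essbdd(3)[OF FX], of "-1" 0] by simp
    also have "\<dots> \<le> L * (2 * g)" using nrm_dvg_le[OF FX] mult_left_mono[OF nF(2) L0] by linarith
    finally show "nrm (dvg D W) \<le> L * (2 * g)" .
  qed
  have ZB: "AE x in lebesgue_on D. norm (Z x) \<le> B"
    using B(1) by eventually_elim (auto simp: Z_def intro!: norm_avg_le N(1))
  define E :: "(nat \<Rightarrow> real^'d \<Rightarrow> real^'d) \<Rightarrow> real^'d \<Rightarrow> real" where "E = eddy_viscosity N \<mu> \<Delta>t"
  have Eess: "essbdd (E zo)" "essbdd (E zho)" unfolding E_def by (intro eddy_essbdd zX N(1); assumption)+
  have \<mu>t: "0 \<le> \<mu> * \<Delta>t" using dt by simp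

  \<comment> \<open>The factor 16 is dictated by the eddy viscosity term; the multiplicities of all
    other products add up to less.\<close>
  have NL: "\<bar>trilinear D U un \<tau>\<bar> + \<bar>trilinear D F uo \<tau>\<bar> + \<bar>trilinear D Z e' e'\<bar>
      + \<bar>weighted_grad_inner D (\<lambda>x. 2 * E zo x - 2 * E zho x) un \<tau>\<bar> + \<bar>trilinear D W e \<tau>\<bar>
      \<le> 16 * L^5 * (a * g + a * g' + H * a * \<delta> + (a + g) * R + \<Delta>t * H * a * (g' + R))"
    using cases
  proof
    \<comment> \<open>In the first step all differences of the advecting fields vanish, and
      \<open>Z\<close> coincides with the divergence-free average of the common initial data, so
      each of the five terms is 0.\<close>
    assume z: "e = (\<lambda>x. 0) \<and> (\<forall>i\<in>{1..N}. zo i = zho i)"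
    have sums: "(\<Sum>i=1..N. zo i x) = (\<Sum>i=1..N. zho i x)" for x
      using z by (intro sum.cong) auto
    have avg_eq: "avg N zo = Z" by (rule ext) (simp only: Z_def avg_def sums)
    have fluct_eq: "fluct N zo i = fluct N zho i" if "i \<in> {1..N}" for i
    proof -
      have "zo i = zho i" using z that by blast
      then show ?thesis by (intro ext) (simp only: fluct_def avg_eq Z_def)
    qed
    have "E zo = E zho"
      unfolding E_def eddy_viscosity_def by (intro ext arg_cong2[where f="(*)"] refl sum.cong) (simp only: fluct_eq)
    moreover have "fluct N zo j = W" using fluct_eq[OF N(3)] by (simp only: W_def)
    ultimately have eqs: "avg N zo = Z" "fluct N zo j = W" "E zo = E zho" using avg_eq by blast+
    then have UF0: "U = (\<lambda>x. 0)" "F = (\<lambda>x. 0)" "E zo = E zho" using Ufun Ffun by simp_all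
    have t1: "trilinear D U un \<tau> = 0" "trilinear D F uo \<tau> = 0"
      unfolding UF0 trilinear_def by (rule L2_inner_eq_0_AE, simp)+
    have t2: "weighted_grad_inner D (\<lambda>x. 2 * E zo x - 2 * E zho x) un \<tau> = 0"
      unfolding UF0 weighted_grad_inner_def by (rule L2_inner_eq_0_AE, simp)
    obtain M where M: "0 < M" "AE x in lebesgue_on D. norm (W x) \<le> M" using X_essbdd(1)[OF WX] by (rule essbddE)
    have "\<bar>trilinear D W e \<tau>\<bar> \<le> M * gnrm e * nrm \<tau>"
      using M by (intro trilinear_bound WX X \<tau>X) auto
    moreover have "gnrm e = 0" using z gnrm_zero[OF X(1)] by simp
    ultimately have t3: "trilinear D W e \<tau> = 0" by simp
    have "AE x in lebesgue_on D. dvg D Z x = 0" using dv(1) avg_eq by simp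
    then have "L2_inner D (dvg D Z) (\<lambda>x. e' x \<bullet> e' x) = 0" by (rule L2_inner_eq_0_AE)
    then have "trilinear D Z e' e' = 0" using trilinear_skew_X[OF ZX X(4) X(4)] by simp
    then show ?thesis unfolding t1 t2 t3
      using L0 ag n H0 dt by (simp add: add_nonneg_nonneg)
  next
    assume "(AE x in lebesgue_on D. norm (un x) \<le> L \<and> norm (uo x) \<le> L \<and> norm (e' x) \<le> 2 * L
          \<and> (\<forall>i\<in>{1..N}. norm (zo i x) \<le> L \<and> norm (zho i x) \<le> L)) \<and> gnrm un \<le> L \<and> gnrm uo \<le> L"
    then have b: "AE x in lebesgue_on D. norm (un x) \<le> L" "AE x in lebesgue_on D. norm (uo x) \<le> L"
      "AE x in lebesgue_on D. norm (e' x) \<le> 2 * L"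
      "AE x in lebesgue_on D. \<forall>i\<in>{1..N}. norm (zo i x) \<le> L \<and> norm (zho i x) \<le> L"
      and gu: "gnrm un \<le> L" "gnrm uo \<le> L"
      by (auto elim: eventually_mono)
    have B1: "\<bar>trilinear D U un \<tau>\<bar> \<le> L^5 * (2 * (a * g) + H * a * \<delta> + (a + g) * R)"
      using trilinear_bound_error[OF UX X(1,3,4,5) b(1) gu(1) nU e(1,2)]
      by (simp add: \<tau>_def \<delta>_def R_def mult.commute)
    have B2: "\<bar>trilinear D F uo \<tau>\<bar> \<le> L^5 * (4 * (a * g) + 2 * (H * a * \<delta>) + 2 * ((a + g) * R))"
      using trilinear_bound_error[OF FX X(2,3,4,5) b(2) gu(2) nF e(1,2)]
      by (simp add: \<tau>_def \<delta>_def R_def algebra_simps)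
    \<comment> \<open>By skew symmetry twice this term is the divergence of \<open>U\<close> tested
      with the square of \<open>e'\<close>. One factor \<open>e'\<close> is bounded in the sup norm,
      the other is split into \<open>e\<close> and the increment \<open>d\<close>; for
      \<open>d\<close> the divergence of \<open>U\<close> is estimated by the inverse
      inequality.\<close>
    have B3: "\<bar>trilinear D Z e' e'\<bar> \<le> L^5 * (a * g + H * a * \<delta>)"
    proof -
      have "L2_inner D (dvg D Z) (\<lambda>x. e' x \<bullet> e' x) = L2_inner D (\<lambda>x. (-1) *\<^sub>R dvg D U x + 0 *\<^sub>R dvg D U x) (\<lambda>x. e' x \<bullet> e' x)"
        using dvgZ X_essbdd[OF ZX] X_essbdd[OF UX] X_essbdd[OF X(4)]
        by (intro L2_inner_cong_AE essbdd_add essbdd_scaleR_const essbdd_inner) (auto elim: eventually_mono)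
      also have "\<dots> = - L2_inner D (dvg D U) (\<lambda>x. e' x \<bullet> e' x)"
        using X_essbdd[OF UX] X_essbdd[OF X(4)] by (simp add: L2_inner_def)
      also have "L2_inner D (dvg D U) (\<lambda>x. e' x \<bullet> e' x)
          = L2_inner D (dvg D U) (\<lambda>x. 1 *\<^sub>R (e' x \<bullet> e x) + 1 *\<^sub>R (e' x \<bullet> d x))"
        by (simp add: d_def inner_diff_right)
      also have "\<dots> = L2_inner D (dvg D U) (\<lambda>x. e' x \<bullet> e x) + L2_inner D (dvg D U) (\<lambda>x. e' x \<bullet> d x)"
        using X_essbdd[OF UX] X_essbdd[OF X(4)] X_essbdd[OF X(3)] X_essbdd[OF dX]
        by (subst L2_inner_lincomb_right) (auto intro: essbdd_inner)
      finally have eq: "2 * trilinear D Z e' e' = L2_inner D (dvg D U) (\<lambda>x. e' x \<bullet> e x) + L2_inner D (dvg D U) (\<lambda>x. e' x \<bullet> d x)"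
        using trilinear_skew_X[OF ZX X(4) X(4)] by simp
      have "\<bar>L2_inner D (dvg D U) (\<lambda>x. e' x \<bullet> e x)\<bar> \<le> 2 * L * nrm (dvg D U) * nrm e"
        using L0 by (intro dvg_inner_bound UX X b(3)) simp
      also have "\<dots> \<le> 2 * L * (L * g) * a"
        using nde(1) e(1) L0 n ag L2_norm_nonneg[of "dvg D U"] by (intro mult_mono mult_left_mono) auto
      finally have i1: "\<bar>L2_inner D (dvg D U) (\<lambda>x. e' x \<bullet> e x)\<bar> \<le> 2 * L * (L * g) * a" .
      have "\<bar>L2_inner D (dvg D U) (\<lambda>x. e' x \<bullet> d x)\<bar> \<le> 2 * L * nrm (dvg D U) * nrm d"
        using L0 by (intro dvg_inner_bound UX X dX b(3)) simp
      also have "\<dots> \<le> 2 * L * (L * (L * H * a)) * \<delta>"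
        unfolding \<delta>d using nde(2) L0 n ag H0 L2_norm_nonneg[of "dvg D U"] by (intro mult_right_mono mult_left_mono) auto
      finally have i2: "\<bar>L2_inner D (dvg D U) (\<lambda>x. e' x \<bullet> d x)\<bar> \<le> 2 * L * (L * (L * H * a)) * \<delta>" .
      have "\<bar>trilinear D Z e' e'\<bar> \<le> L * (L * (a * g)) + L * (L * (L * (H * a * \<delta>)))"
        using eq i1 i2 by (simp add: mult_ac)
      also have "\<dots> \<le> L^5 * (a * g) + L^5 * (H * a * \<delta>)"
        using ag H0 n by (intro add_mono L_power_mono) auto
      finally show ?thesis by (simp add: distrib_left)
    qed
    have B4: "\<bar>weighted_grad_inner D (\<lambda>x. 2 * E zo x - 2 * E zho x) un \<tau>\<bar> \<le> 16 * L^5 * (\<Delta>t * H * a * (g' + R))"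
    proof -
      have fl: "AE x in lebesgue_on D. \<forall>i\<in>{1..N}. norm (fluct N \<epsilon> i x) \<le> 2 * (L * H * a)"
      proof (intro AE_finite_allI)
        fix i assume i: "i \<in> {1..N}"
        have fX: "fluct N \<epsilon> i \<in> X" by (rule fluct_X[OF \<epsilon>X N(1) i])
        have "nrm (fluct N \<epsilon> i) \<le> 2 * (\<Sum>i=1..N. nrm (\<epsilon> i))" by (rule nrm_fluct_le[OF \<epsilon>X N(1) i])
        then have "nrm (fluct N \<epsilon> i) \<le> 2 * a" using es(1) by linarith
        then have "L * H * nrm (fluct N \<epsilon> i) \<le> L * H * (2 * a)" using L0 H0 by (intro mult_left_mono) auto
        then show "AE x in lebesgue_on D. norm (fluct N \<epsilon> i x) \<le> 2 * (L * H * a)"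
          using X_inv_sup[OF fX] by (auto elim!: eventually_mono)
      qed simp
      define c where "c = 16 * L^4 * (\<Delta>t * H * a)"
      have c0: "0 \<le> c" using L0 dt H0 ag by (simp add: c_def)
      have "AE x in lebesgue_on D. \<bar>2 * E zo x - 2 * E zho x\<bar> \<le> c"
        using b(4) fl
      proof eventually_elim
        case (elim x)
        have "\<bar>E zo x - E zho x\<bar> \<le> \<mu> * \<Delta>t * (real N * (4 * L * (2 * (L * H * a))))"
          unfolding E_def
        proof (rule eddy_viscosity_diff_le[OF _ _ _ N(1) \<mu>t L0])
          fix i assume i: "i \<in> {1..N}"
          show "norm (zo i x) \<le> L" "norm (zho i x) \<le> L" using elim(1) i by auto
          show "norm (fluct N zo i x - fluct N zho i x) \<le> 2 * (L * H * a)"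
          proof -
            have "norm (fluct N \<epsilon> i x) \<le> 2 * (L * H * a)" using elim(2) i by blast
            then show ?thesis unfolding \<epsilon> fluct_diff .
          qed
        qed
        also have "\<dots> \<le> L * \<Delta>t * (L * (4 * L * (2 * (L * H * a))))"
          using dt N(2) L0 H0 ag by (intro mult_mono) auto
        also have "\<dots> = c / 2" by (simp add: c_def eval_nat_numeral)
        finally show ?case by linarith
      qed
      then have "\<bar>weighted_grad_inner D (\<lambda>x. 2 * E zo x - 2 * E zho x) un \<tau>\<bar> \<le> c * gnrm un * gnrm \<tau>"
        by (intro wgi_bound essbdd_diff essbdd_mult_const Eess X \<tau>X c0)
      also have "\<dots> \<le> c * L * (g' + R)"
      proof (intro mult_mono mult_left_mono gu c0)
        show "gnrm \<tau> \<le> g' + R" using gnrm_diff_le[OF X(4,5)] e(3) by (simp add: \<tau>_def R_def)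
      qed (use c0 L0 in \<open>auto simp: L2_norm_nonneg\<close>)
      also have "\<dots> = 16 * L^5 * (\<Delta>t * H * a * (g' + R))" by (simp add: c_def eval_nat_numeral)
      finally show ?thesis .
    qed
    \<comment> \<open>Against \<open>e'\<close> the derivative is moved off \<open>e\<close>, which
      leaves the L2 norm of \<open>e\<close> instead of its gradient; the divergence of
      \<open>W\<close> is again that of an error. Against \<open>\<rho>\<close> the derivative can
      stay.\<close>
    have B5: "\<bar>trilinear D W e \<tau>\<bar> \<le> L^5 * (2 * (a * g') + 4 * (a * g) + 2 * (g * R))"
    proof -
      have WB: "AE x in lebesgue_on D. norm (W x) \<le> 2 * L"
        using b(4) by eventually_elim (auto simp: W_def intro!: norm_fluct_le N)
      have L2: "0 \<le> 2 * L" using L0 by simp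
      have "\<bar>trilinear D W e' e\<bar> \<le> 2 * L * gnrm e' * nrm e" by (rule trilinear_bound[OF WX X(4,3) WB L2])
      also have "\<dots> \<le> 2 * L * g' * a" using e n ag L0 by (intro mult_mono mult_left_mono) auto
      finally have i1: "\<bar>trilinear D W e' e\<bar> \<le> 2 * L * g' * a" .
      have "\<bar>L2_inner D (dvg D W) (\<lambda>x. e' x \<bullet> e x)\<bar> \<le> 2 * L * nrm (dvg D W) * nrm e"
        by (rule dvg_inner_bound[OF WX X(4,3) b(3) L2])
      also have "\<dots> \<le> 2 * L * (L * (2 * g)) * a"
        using nde(3) e(1) L0 n ag L2_norm_nonneg[of "dvg D W"] by (intro mult_mono mult_left_mono) auto
      finally have i2: "\<bar>L2_inner D (dvg D W) (\<lambda>x. e x \<bullet> e' x)\<bar> \<le> 2 * L * (L * (2 * g)) * a"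
        by (simp add: inner_commute)
      have "\<bar>trilinear D W e \<rho>\<bar> \<le> 2 * L * gnrm e * nrm \<rho>" by (rule trilinear_bound[OF WX X(3,5) WB L2])
      also have "\<dots> \<le> 2 * L * g * (L * R)" using e n ag L0 \<rho>R by (intro mult_mono mult_left_mono) auto
      finally have i3: "\<bar>trilinear D W e \<rho>\<bar> \<le> 2 * L * g * (L * R)" .
      have "trilinear D W e \<tau> = trilinear D W e e' - trilinear D W e \<rho>"
        unfolding \<tau>_def by (rule trilinear_split_3[OF WX X(3,3,4,5)])
      then have "\<bar>trilinear D W e \<tau>\<bar> \<le> 2 * L * g' * a + 2 * L * (L * (2 * g)) * a + 2 * L * g * (L * R)"
        using trilinear_skew_X[OF WX X(3,4)] i1 i2 i3 by linarith
      also have "\<dots> = 2 * (L * (a * g')) + 4 * (L * (L * (a * g))) + 2 * (L * (L * (g * R)))" by (simp add: mult_ac)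
      also have "\<dots> \<le> 2 * (L^5 * (a * g')) + 4 * (L^5 * (a * g)) + 2 * (L^5 * (g * R))"
        using ag n by (intro add_mono mult_left_mono L_power_mono) auto
      finally show ?thesis by (simp add: algebra_simps)
    qed
    have pos: "0 \<le> L^5 * (a * g)" "0 \<le> L^5 * (a * g')" "0 \<le> L^5 * (H * a * \<delta>)" "0 \<le> L^5 * (a * R)" "0 \<le> L^5 * (g * R)"
      using L0 ag n H0 by simp_all
    show ?thesis using B1 B2 B3 B4 B5 pos unfolding distrib_left distrib_right by linarith
  qed

  have Zr: "\<bar>trilinear D Z e' \<rho>\<bar> \<le> 16 * L^5 * (B * g' * R)"
  proof -
    have "\<bar>trilinear D Z e' \<rho>\<bar> \<le> B * gnrm e' * nrm \<rho>" by (rule trilinear_bound[OF ZX X(4,5) ZB B(2)])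
    also have "\<dots> \<le> B * g' * (L * R)" using e n ag L0 \<rho>R B(2) by (intro mult_mono mult_left_mono) auto
    also have "\<dots> = L * (B * g' * R)" by (simp add: mult_ac)
    also have "\<dots> \<le> L^5 * (B * g' * R)" using B(2) ag n by (intro L_power_mono) auto
    also have "\<dots> \<le> 16 * L^5 * (B * g' * R)" using B(2) ag n L0 by simp
    finally show ?thesis .
  qed

  have visc: "m * (gnrm e')\<^sup>2 - L * g' * R \<le> weighted_grad_inner D va e' \<tau>"
  proof -
    have "weighted_grad_inner D va e' \<tau> = weighted_grad_inner D va e' e' - weighted_grad_inner D va e' \<rho>"
      unfolding \<tau>_def by (rule wgi_diff_3[OF va(1) X(4,4,5)])
    moreover have "m * (gnrm e')\<^sup>2 \<le> weighted_grad_inner D va e' e'"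
      unfolding weighted_grad_inner_def L2_inner_def L2_norm_power2 integral_mult_right_zero[symmetric]
    proof (rule integral_mono_AE)
      show "AE x in lebesgue_on D. m * (norm (grad D e' x))\<^sup>2 \<le> (va x *\<^sub>R grad D e' x) \<bullet> grad D e' x"
        using va(2) by eventually_elim (auto simp: power2_norm_eq_inner intro!: mult_right_mono)
    qed (intro essbdd_integrable essbdd_inner essbdd_scaleR va(1) X_essbdd X essbdd_mult_const essbdd_power2 essbdd_norm)+
    moreover have "\<bar>weighted_grad_inner D va e' \<rho>\<bar> \<le> L * g' * R"
    proof -
      have "AE x in lebesgue_on D. \<bar>va x\<bar> \<le> L" using va(2) by eventually_elim (use va(3) in auto)
      then have "\<bar>weighted_grad_inner D va e' \<rho>\<bar> \<le> L * gnrm e' * gnrm \<rho>" by (rule wgi_bound[OF va(1) X(4,5) _ L0])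
      also have "\<dots> \<le> L * g' * R" unfolding R_def
        using e(3) L0 L2_norm_nonneg[of "grad D \<rho>"] by (intro mult_right_mono mult_left_mono) auto
      finally show ?thesis .
    qed
    ultimately show ?thesis by linarith
  qed

  have expl: "- (c * gnrm f * gnrm e') - L * g * R \<le> weighted_grad_inner D vb f \<tau>"
    if vb: "essbdd vb" "AE x in lebesgue_on D. \<bar>vb x\<bar> \<le> c" "0 \<le> c" "c \<le> L" and f: "f \<in> X" "gnrm f \<le> g" for vb c f
  proof -
    have "weighted_grad_inner D vb f \<tau> = weighted_grad_inner D vb f e' - weighted_grad_inner D vb f \<rho>"
      unfolding \<tau>_def by (rule wgi_diff_3[OF vb(1) f(1) X(4,5)])
    moreover have "\<bar>weighted_grad_inner D vb f e'\<bar> \<le> c * gnrm f * gnrm e'"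
      by (rule wgi_bound[OF vb(1) f(1) X(4) vb(2,3)])
    moreover have "\<bar>weighted_grad_inner D vb f \<rho>\<bar> \<le> L * g * R"
    proof -
      have "\<bar>weighted_grad_inner D vb f \<rho>\<bar> \<le> c * gnrm f * gnrm \<rho>"
        by (rule wgi_bound[OF vb(1) f(1) X(5) vb(2,3)])
      also have "\<dots> \<le> L * g * R" unfolding R_def
        using vb(3,4) f(2) L0 ag by (intro mult_mono) (auto simp: L2_norm_nonneg)
      finally show ?thesis .
    qed
    ultimately show ?thesis by linarith
  qed
  note expl1 = expl[OF vb1 \<epsilon>X[OF N(3)] g\<epsilon>] and expl2 = expl[OF vb2 X(3) e(2)]

  have eddy: "- (2 * L\<^sup>2 * \<Delta>t * B\<^sup>2 * R\<^sup>2) \<le> weighted_grad_inner D (\<lambda>x. 2 * E zho x) e' \<tau>"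
  proof -
    have gX: "AE x in lebesgue_on D. grad D \<tau> x = grad D e' x - grad D \<rho> x"
      unfolding \<tau>_def by (rule X_grad_diff[OF X(4,5)])
    have "- (2 * L\<^sup>2 * \<Delta>t * B\<^sup>2) * (\<integral>x. (norm (grad D \<rho> x))\<^sup>2 \<partial>lebesgue_on D) \<le> (\<integral>x. ((2 * E zho x) *\<^sub>R grad D e' x) \<bullet> grad D \<tau> x \<partial>lebesgue_on D)"
      unfolding integral_mult_right_zero[symmetric]
    proof (rule integral_mono_AE)
      show "AE x in lebesgue_on D. - (2 * L\<^sup>2 * \<Delta>t * B\<^sup>2) * (norm (grad D \<rho> x))\<^sup>2 \<le> ((2 * E zho x) *\<^sub>R grad D e' x) \<bullet> grad D \<tau> x"
        using gX B(1)
      proof eventually_elim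
        case (elim x)
        define p q where "p = grad D e' x" and "q = grad D \<rho> x"
        have E: "0 \<le> E zho x" "E zho x \<le> \<mu> * \<Delta>t * (real N * (4 * B\<^sup>2))"
        proof -
          have zb: "norm (zho i x) \<le> B" if "i \<in> {1..N}" for i using elim(2) that by blast
          show "0 \<le> E zho x" "E zho x \<le> \<mu> * \<Delta>t * (real N * (4 * B\<^sup>2))"
            unfolding E_def by (rule eddy_viscosity_bounds[where z=zho and x=x and M=B and N=N, OF zb N(1) \<mu>t]; assumption)+
        qed
        note E(2)
        also have "\<mu> * \<Delta>t * (real N * (4 * B\<^sup>2)) \<le> L * \<Delta>t * (L * (4 * B\<^sup>2))"
        proof (rule mult_mono)
          show "\<mu> * \<Delta>t \<le> L * \<Delta>t" using dt by (intro mult_right_mono) auto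
          show "real N * (4 * B\<^sup>2) \<le> L * (4 * B\<^sup>2)" by (intro mult_right_mono N(2)) simp
        qed (use dt L0 in auto)
        finally have "E zho x \<le> L * \<Delta>t * (L * (4 * B\<^sup>2))" .
        then have "E zho x * (q \<bullet> q) / 2 \<le> L * \<Delta>t * (L * (4 * B\<^sup>2)) * (q \<bullet> q) / 2"
          by (intro divide_right_mono mult_right_mono) auto
        also have "\<dots> = 2 * L\<^sup>2 * \<Delta>t * B\<^sup>2 * (q \<bullet> q)" by (simp add: power2_eq_square)
        finally have 1: "E zho x * (q \<bullet> q) / 2 \<le> 2 * L\<^sup>2 * \<Delta>t * B\<^sup>2 * (q \<bullet> q)" .
        \<comment> \<open>Completing the square: the eddy viscosity is nonnegative, so the new
          gradient \<open>p\<close> needs no absorption and a multiple of the squared norm of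
          \<open>q\<close> is left.\<close>
        have "0 \<le> (p - (1/2) *\<^sub>R q) \<bullet> (p - (1/2) *\<^sub>R q)" by simp
        also have "\<dots> = p \<bullet> (p - q) + (q \<bullet> q) / 4"
          by (simp add: inner_diff_left inner_diff_right inner_commute field_simps)
        finally have "0 \<le> (2 * E zho x) * (p \<bullet> (p - q) + (q \<bullet> q) / 4)" using E(1) by simp
        then have "- (E zho x * (q \<bullet> q) / 2) \<le> (2 * E zho x) * (p \<bullet> (p - q))" by (simp add: distrib_left)
        with 1 have "- (2 * L\<^sup>2 * \<Delta>t * B\<^sup>2 * (q \<bullet> q)) \<le> (2 * E zho x) * (p \<bullet> (p - q))" by linarith
        then show ?case using elim(1) by (simp add: p_def q_def power2_norm_eq_inner)
      qed
    qed (intro essbdd_integrable essbdd_inner essbdd_scaleR essbdd_mult_const Eess X_essbdd X \<tau>X essbdd_power2 essbdd_norm)+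
    then show ?thesis by (simp add: weighted_grad_inner_def L2_inner_def R_def L2_norm_power2)
  qed

  \<comment> \<open>Polarization of the backward Euler difference produces the dissipation term; the
    part of the test function in \<open>\<rho>\<close> leaves the product of increment and
    \<open>R\<close>.\<close>
  have time: "((nrm e')\<^sup>2 - (nrm e)\<^sup>2) / (2 * \<Delta>t) + \<delta>\<^sup>2 / (2 * \<Delta>t) - (1 / \<Delta>t) * (L * \<delta> * R) \<le> (1 / \<Delta>t) * L2_inner D d \<tau>"
  proof -
    note es = X_essbdd(1)[OF X(4)] X_essbdd(1)[OF X(3)] X_essbdd(1)[OF X(5)] X_essbdd(1)[OF dX]
    have e_eq: "e = (\<lambda>x. 1 *\<^sub>R e' x + (-1) *\<^sub>R d x)" by (simp add: d_def)
    have "(nrm e)\<^sup>2 = L2_inner D e e" by (simp add: L2_inner_self)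
    also have "\<dots> = L2_inner D (\<lambda>x. 1 *\<^sub>R e' x + (-1) *\<^sub>R d x) (\<lambda>x. 1 *\<^sub>R e' x + (-1) *\<^sub>R d x)" by (simp add: d_def)
    also have "\<dots> = (nrm e')\<^sup>2 - 2 * L2_inner D d e' + \<delta>\<^sup>2"
      unfolding \<delta>d[symmetric] L2_inner_self[symmetric]
      using es by (subst L2_inner_lincomb_left) (auto intro: essbdd_add essbdd_scaleR_const essbdd_diff
         simp: L2_inner_lincomb_right[of e' d, where a=1 and b="-1", simplified] L2_inner_commute[of e' d])
    finally have 1: "L2_inner D d e' = ((nrm e')\<^sup>2 - (nrm e)\<^sup>2 + \<delta>\<^sup>2) / 2" by simp
    have "L2_inner D d \<tau> = L2_inner D d e' - L2_inner D d \<rho>"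
      using L2_inner_lincomb_right[OF es(1,3,4), of 1 "-1"] by (simp add: \<tau>_def)
    moreover have "\<bar>L2_inner D d \<rho>\<bar> \<le> L * \<delta> * R"
    proof -
      have "\<bar>L2_inner D d \<rho>\<bar> \<le> nrm d * nrm \<rho>" by (rule L2_inner_Cauchy_Schwarz[OF es(4,3)])
      also have "\<dots> \<le> \<delta> * (L * R)" unfolding \<delta>d using \<rho>R n by (intro mult_left_mono) auto
      finally show ?thesis by (simp add: mult_ac)
    qed
    ultimately have "((nrm e')\<^sup>2 - (nrm e)\<^sup>2 + \<delta>\<^sup>2) / 2 - L * \<delta> * R \<le> L2_inner D d \<tau>" using 1 by linarith
    then have "(1 / \<Delta>t) * (((nrm e')\<^sup>2 - (nrm e)\<^sup>2 + \<delta>\<^sup>2) / 2 - L * \<delta> * R) \<le> (1 / \<Delta>t) * L2_inner D d \<tau>"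
      using dt(1) by (intro mult_left_mono) auto
    moreover have "(1 / \<Delta>t) * (((nrm e')\<^sup>2 - (nrm e)\<^sup>2 + \<delta>\<^sup>2) / 2 - L * \<delta> * R)
        = ((nrm e')\<^sup>2 - (nrm e)\<^sup>2) / (2 * \<Delta>t) + \<delta>\<^sup>2 / (2 * \<Delta>t) - (1 / \<Delta>t) * (L * \<delta> * R)"
      using dt(1) by (simp add: field_simps)
    ultimately show ?thesis by linarith
  qed

  have Zs: "trilinear D Z e' \<tau> = trilinear D Z e' e' - trilinear D Z e' \<rho>"
    unfolding \<tau>_def by (rule trilinear_split_3[OF ZX X(4,3,4,5)])
  have "(1 / \<Delta>t) * L2_inner D d \<tau> + trilinear D U un \<tau> + trilinear D Z e' \<tau> + weighted_grad_inner D va e' \<tau>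
       + weighted_grad_inner D (\<lambda>x. 2 * E zo x - 2 * E zho x) un \<tau> + weighted_grad_inner D (\<lambda>x. 2 * E zho x) e' \<tau>
       + P \<tau> + trilinear D F uo \<tau> + trilinear D W e \<tau>
       + weighted_grad_inner D vb1 (\<epsilon> j) \<tau> + weighted_grad_inner D vb2 e \<tau> = 0"
    using err[OF \<tau>X] by (simp only: U_def F_def Z_def W_def E_def d_def)
  then have "((nrm e')\<^sup>2 - (nrm e)\<^sup>2) / (2 * \<Delta>t) + \<delta>\<^sup>2 / (2 * \<Delta>t) + m * (gnrm e')\<^sup>2
       - a1 * gnrm (\<epsilon> j) * gnrm e' - a2 * gnrm e * gnrm e' + P \<tau>
     \<le> 16 * L^5 * (a * g + a * g' + H * a * \<delta> + (a + g) * R + \<Delta>t * H * a * (g' + R)) + 16 * L^5 * (B * g' * R)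
       + (1 / \<Delta>t) * (L * \<delta> * R) + L * g' * R + 2 * (L * g * R) + 2 * L\<^sup>2 * \<Delta>t * B\<^sup>2 * R\<^sup>2"
    using time visc expl1 expl2 eddy Zr Zs NL by linarith
  then show ?thesis unfolding \<tau>_def by (simp add: algebra_simps)
qed

end


section \<open>Accumulation of the errors\<close>

text \<open>As \<open>1 + c\<close> is at least 1, the dissipation \<open>y\<close> collected so far
  may be multiplied by it as well, so the sum of \<open>x\<close> and the collected \<open>y\<close>
  obeys the same recursion as \<open>x\<close>.\<close>

lemma discrete_gronwall:
  fixes x y b :: "nat \<Rightarrow> real"
  assumes step: "\<And>n. n < M \<Longrightarrow> x (Suc n) + y (Suc n) \<le> (1 + c) * x n + b n"
    and x0: "x 0 = 0" and c: "0 \<le> c" and y: "\<And>n. 0 \<le> y n" and b: "\<And>n. 0 \<le> b n"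
    and n: "n \<le> M"
  shows "x n + (\<Sum>k=1..n. y k) \<le> (1 + c) ^ n * (\<Sum>k<n. b k)"
  using n
proof (induction n)
  case 0
  then show ?case using x0 by simp
next
  case (Suc n)
  have Y: "0 \<le> (\<Sum>k=1..n. y k)" by (rule sum_nonneg) (rule y)
  have "x (Suc n) + (\<Sum>k=1..Suc n. y k) = x (Suc n) + y (Suc n) + (\<Sum>k=1..n. y k)" by simp
  also have "\<dots> \<le> (1 + c) * x n + b n + (1 + c) * (\<Sum>k=1..n. y k)"
  proof (rule add_mono)
    show "x (Suc n) + y (Suc n) \<le> (1 + c) * x n + b n" using Suc(2) by (intro step) simp
    show "(\<Sum>k=1..n. y k) \<le> (1 + c) * (\<Sum>k=1..n. y k)" using c Y by (simp add: distrib_right)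
  qed
  also have "\<dots> = (1 + c) * (x n + (\<Sum>k=1..n. y k)) + b n" by (simp add: distrib_left)
  also have "\<dots> \<le> (1 + c) * ((1 + c) ^ n * (\<Sum>k<n. b k)) + (1 + c) ^ Suc n * b n"
  proof (intro add_mono mult_left_mono)
    show "x n + (\<Sum>k=1..n. y k) \<le> (1 + c) ^ n * (\<Sum>k<n. b k)" using Suc by simp
    have "1 * b n \<le> (1 + c) ^ Suc n * b n"
      by (intro mult_right_mono one_le_power b) (use c in simp)
    then show "b n \<le> (1 + c) ^ Suc n * b n" by simp
  qed (use c in simp)
  also have "\<dots> = (1 + c) ^ Suc n * (\<Sum>k<Suc n. b k)" by (simp add: distrib_left mult.assoc)
  finally show ?case .
qed

lemma sum_square_le:
  fixes x y :: "nat \<Rightarrow> real"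
  shows "(\<Sum>j=1..N. x j + y j)\<^sup>2 \<le> 2 * real N * (\<Sum>j=1..N. (x j)\<^sup>2 + (y j)\<^sup>2)"
proof -
  have "(\<Sum>j=1..N. 1 * (x j + y j))\<^sup>2 \<le> (\<Sum>j=1..N. 1\<^sup>2) * (\<Sum>j=1..N. (x j + y j)\<^sup>2)"
    by (rule Cauchy_Schwarz_ineq_sum)
  then have "(\<Sum>j=1..N. x j + y j)\<^sup>2 \<le> real N * (\<Sum>j=1..N. (x j + y j)\<^sup>2)" by simp
  also have "\<dots> \<le> real N * (\<Sum>j=1..N. 2 * ((x j)\<^sup>2 + (y j)\<^sup>2))"
  proof (intro mult_left_mono sum_mono)
    fix j
    show "(x j + y j)\<^sup>2 \<le> 2 * ((x j)\<^sup>2 + (y j)\<^sup>2)"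
      using sum_squares_bound[of "x j" "y j"] by (simp add: power2_sum)
  qed simp
  also have "\<dots> = 2 * real N * (\<Sum>j=1..N. (x j)\<^sup>2 + (y j)\<^sup>2)" by (simp add: sum_distrib_left mult_ac)
  finally show ?thesis .
qed

text \<open>
  In the sum over both fields and all realizations the explicit viscous terms telescope with the
  weights \<open>(A1 j + A2 j) / 2\<close>, and a multiple of \<open>\<alpha>\<close> of the new gradients is left over.
\<close>

lemma combine_half_steps:
  fixes x x' y y' gx gx' gy gy' p p' r r' A1 A2 :: "nat \<Rightarrow> real"
  assumes half1: "\<And>j. j \<in> {1..N} \<Longrightarrow> ((x' j)\<^sup>2 - (x j)\<^sup>2) / (2 * \<Delta>t) + m * (gx' j)\<^sup>2 - A1 j * gy j * gx' j - A2 j * gx j * gx' j + p j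
      \<le> \<eta> * (g\<^sup>2 + g'\<^sup>2) + \<kappa> * a\<^sup>2 + \<kappa>r * r j"
    and half2: "\<And>j. j \<in> {1..N} \<Longrightarrow> ((y' j)\<^sup>2 - (y j)\<^sup>2) / (2 * \<Delta>t) + m * (gy' j)\<^sup>2 - A1 j * gx j * gy' j - A2 j * gy j * gy' j + p' j
      \<le> \<eta> * (g\<^sup>2 + g'\<^sup>2) + \<kappa> * a\<^sup>2 + \<kappa>r * r' j"
    and a: "a = (\<Sum>j=1..N. x j + y j)" and g: "g = (\<Sum>j=1..N. gx j + gy j)" and g': "g' = (\<Sum>j=1..N. gx' j + gy' j)"
    and coef: "\<And>j. j \<in> {1..N} \<Longrightarrow> \<alpha> / 2 \<le> m - A1 j - A2 j" "\<And>j. j \<in> {1..N} \<Longrightarrow> 0 \<le> A1 j" "\<And>j. j \<in> {1..N} \<Longrightarrow> 0 \<le> A2 j"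
    and pos: "0 < \<Delta>t" "0 \<le> \<eta>" "0 \<le> \<kappa>" "0 < \<alpha>" and \<eta>: "32 * (real N)\<^sup>2 * \<eta> \<le> \<alpha>"
  defines "A \<equiv> (\<Sum>j=1..N. (x j)\<^sup>2 + (y j)\<^sup>2)" and "A' \<equiv> (\<Sum>j=1..N. (x' j)\<^sup>2 + (y' j)\<^sup>2)"
    and "G \<equiv> (\<Sum>j=1..N. (gx j)\<^sup>2 + (gy j)\<^sup>2)" and "G' \<equiv> (\<Sum>j=1..N. (gx' j)\<^sup>2 + (gy' j)\<^sup>2)"
    and "S \<equiv> (\<Sum>j=1..N. (A1 j + A2 j) / 2 * ((gx j)\<^sup>2 + (gy j)\<^sup>2))" and "S' \<equiv> (\<Sum>j=1..N. (A1 j + A2 j) / 2 * ((gx' j)\<^sup>2 + (gy' j)\<^sup>2))"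
  shows "A' / 2 + \<Delta>t * (S' + \<alpha> / 8 * G') + \<Delta>t * (\<alpha> / 4 * G') + \<Delta>t * (\<Sum>j=1..N. p j + p' j)
     \<le> (1 + \<Delta>t * (8 * (real N)\<^sup>2 * \<kappa>)) * (A / 2 + \<Delta>t * (S + \<alpha> / 8 * G)) + \<Delta>t * \<kappa>r * (\<Sum>j=1..N. r j + r' j)"
proof -
  have S0: "0 \<le> S" unfolding S_def using coef by (intro sum_nonneg mult_nonneg_nonneg) auto
  have G0: "0 \<le> G" "0 \<le> G'" "0 \<le> A" unfolding G_def G'_def A_def by (auto intro!: sum_nonneg)
  define E where "E = \<eta> * (g\<^sup>2 + g'\<^sup>2) + \<kappa> * a\<^sup>2"
  have yo: "c * s * t \<le> c / 2 * (s\<^sup>2 + t\<^sup>2)" if "0 \<le> c" for c s t :: real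
  proof -
    have "c / 2 * (2 * s * t) \<le> c / 2 * (s\<^sup>2 + t\<^sup>2)" by (intro mult_left_mono sum_squares_bound) (use that in simp)
    then show ?thesis by simp
  qed
  have pj: "((x' j)\<^sup>2 + (y' j)\<^sup>2 - ((x j)\<^sup>2 + (y j)\<^sup>2)) / (2 * \<Delta>t)
      + (A1 j + A2 j) / 2 * ((gx' j)\<^sup>2 + (gy' j)\<^sup>2) - (A1 j + A2 j) / 2 * ((gx j)\<^sup>2 + (gy j)\<^sup>2)
      + \<alpha> / 2 * ((gx' j)\<^sup>2 + (gy' j)\<^sup>2) + (p j + p' j) \<le> 2 * E + \<kappa>r * (r j + r' j)" if j: "j \<in> {1..N}" for j
  proof -
    note y1 = yo[OF coef(2)[OF j], of "gy j" "gx' j"] yo[OF coef(2)[OF j], of "gx j" "gy' j"]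
      yo[OF coef(3)[OF j], of "gx j" "gx' j"] yo[OF coef(3)[OF j], of "gy j" "gy' j"]
    have mm: "\<alpha> / 2 * ((gx' j)\<^sup>2 + (gy' j)\<^sup>2) \<le> (m - A1 j - A2 j) * ((gx' j)\<^sup>2 + (gy' j)\<^sup>2)"
      by (intro mult_right_mono coef(1)[OF j]) simp
    \<comment> \<open>The linear core, with every product replaced by a variable. The
      \<open>c\<close> variables stand for weighted new squared gradients and the \<open>d\<close>
      variables for old ones.\<close>
    have lin: "X + s' - s + al + P \<le> 2 * E + R"
      if "X = X1 + X2" "R = R1 + R2" "P = p j + p' j" "X1 + mx - a1 - a2 + p j \<le> E + R1" "X2 + my - a3 - a4 + p' j \<le> E + R2"
        "al \<le> mx + my - (c1 + c2 + c3 + c4)" "s' = (c1 + c2 + c3 + c4) / 2" "s = (d1 + d2 + d3 + d4) / 2"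
        "a1 \<le> (d2 + c1) / 2" "a3 \<le> (d1 + c2) / 2" "a2 \<le> (d3 + c3) / 2" "a4 \<le> (d4 + c4) / 2"
      for X X1 X2 R R1 R2 P s s' al mx my a1 a2 a3 a4 c1 c2 c3 c4 d1 d2 d3 d4 :: real
      using that by (linarith | argo | smt (verit))
    show ?thesis
    proof (rule lin)
      show "((x' j)\<^sup>2 + (y' j)\<^sup>2 - ((x j)\<^sup>2 + (y j)\<^sup>2)) / (2 * \<Delta>t)
          = ((x' j)\<^sup>2 - (x j)\<^sup>2) / (2 * \<Delta>t) + ((y' j)\<^sup>2 - (y j)\<^sup>2) / (2 * \<Delta>t)"
        by (simp add: add_divide_distrib[symmetric])
      show "\<kappa>r * (r j + r' j) = \<kappa>r * r j + \<kappa>r * r' j" by (rule distrib_left)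
      show "((x' j)\<^sup>2 - (x j)\<^sup>2) / (2 * \<Delta>t) + m * (gx' j)\<^sup>2 - A1 j * gy j * gx' j - A2 j * gx j * gx' j + p j \<le> E + \<kappa>r * r j"
        unfolding E_def by (rule half1[OF j])
      show "((y' j)\<^sup>2 - (y j)\<^sup>2) / (2 * \<Delta>t) + m * (gy' j)\<^sup>2 - A1 j * gx j * gy' j - A2 j * gy j * gy' j + p' j \<le> E + \<kappa>r * r' j"
        unfolding E_def by (rule half2[OF j])
      show "\<alpha> / 2 * ((gx' j)\<^sup>2 + (gy' j)\<^sup>2) \<le> m * (gx' j)\<^sup>2 + m * (gy' j)\<^sup>2
          - (A1 j * (gx' j)\<^sup>2 + A1 j * (gy' j)\<^sup>2 + A2 j * (gx' j)\<^sup>2 + A2 j * (gy' j)\<^sup>2)"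
        using mm by (simp add: algebra_simps)
      show "(A1 j + A2 j) / 2 * ((gx' j)\<^sup>2 + (gy' j)\<^sup>2)
          = (A1 j * (gx' j)\<^sup>2 + A1 j * (gy' j)\<^sup>2 + A2 j * (gx' j)\<^sup>2 + A2 j * (gy' j)\<^sup>2) / 2"
        "(A1 j + A2 j) / 2 * ((gx j)\<^sup>2 + (gy j)\<^sup>2)
          = (A1 j * (gx j)\<^sup>2 + A1 j * (gy j)\<^sup>2 + A2 j * (gx j)\<^sup>2 + A2 j * (gy j)\<^sup>2) / 2"
        by (simp_all add: algebra_simps add_divide_distrib)
    qed (use y1 in \<open>simp_all add: algebra_simps\<close>)
  qed
  have "(\<Sum>j=1..N. ((x' j)\<^sup>2 + (y' j)\<^sup>2 - ((x j)\<^sup>2 + (y j)\<^sup>2)) / (2 * \<Delta>t)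
      + (A1 j + A2 j) / 2 * ((gx' j)\<^sup>2 + (gy' j)\<^sup>2) - (A1 j + A2 j) / 2 * ((gx j)\<^sup>2 + (gy j)\<^sup>2)
      + \<alpha> / 2 * ((gx' j)\<^sup>2 + (gy' j)\<^sup>2) + (p j + p' j)) \<le> (\<Sum>j=1..N. 2 * E + \<kappa>r * (r j + r' j))"
    by (rule sum_mono) (rule pj)
  then have s1: "(\<Sum>j=1..N. ((x' j)\<^sup>2 + (y' j)\<^sup>2 - ((x j)\<^sup>2 + (y j)\<^sup>2)) / (2 * \<Delta>t)) + S' - S + \<alpha> / 2 * G' + (\<Sum>j=1..N. p j + p' j)
      \<le> real N * (2 * E) + \<kappa>r * (\<Sum>j=1..N. r j + r' j)"
    unfolding S_def S'_def G'_def
    by (simp only: sum.distrib sum_subtractf sum_distrib_left distrib_left sum_constant card_atLeastAtMost diff_Suc_1)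
  have s2: "(\<Sum>j=1..N. ((x' j)\<^sup>2 + (y' j)\<^sup>2 - ((x j)\<^sup>2 + (y j)\<^sup>2)) / (2 * \<Delta>t)) = (A' - A) / (2 * \<Delta>t)"
    unfolding A_def A'_def by (simp only: sum_divide_distrib[symmetric] sum_subtractf)
  \<comment> \<open>Summing over \<open>N\<close> realizations of two fields and bounding the
    squares of the sums by Cauchy-Schwarz turns \<open>\<eta>\<close> into
    \<open>4 N^2 \<eta>\<close>; the hypothesis with 32 makes this at most
    \<open>\<alpha> / 8\<close>.\<close>
  have Eb: "real N * (2 * E) \<le> \<alpha> / 8 * (G + G') + 4 * (real N)\<^sup>2 * \<kappa> * A"
  proof -
    have sq: "g\<^sup>2 \<le> 2 * real N * G" "g'\<^sup>2 \<le> 2 * real N * G'" "a\<^sup>2 \<le> 2 * real N * A"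
      unfolding g g' a G_def G'_def A_def by (rule sum_square_le)+
    have "E \<le> \<eta> * (2 * real N * G + 2 * real N * G') + \<kappa> * (2 * real N * A)"
      unfolding E_def using pos sq by (intro add_mono mult_left_mono) auto
    then have "real N * (2 * E) \<le> real N * (2 * (\<eta> * (2 * real N * G + 2 * real N * G') + \<kappa> * (2 * real N * A)))"
      by (intro mult_left_mono) auto
    also have "\<dots> = (4 * (real N)\<^sup>2 * \<eta>) * (G + G') + 4 * (real N)\<^sup>2 * \<kappa> * A"
      by (simp add: power2_eq_square algebra_simps)
    also have "\<dots> \<le> \<alpha> / 8 * (G + G') + 4 * (real N)\<^sup>2 * \<kappa> * A"
      using \<eta> G0 by (intro add_right_mono mult_right_mono) auto
    finally show ?thesis .
  qed
  from s1[unfolded s2] Eb have "(A' - A) / (2 * \<Delta>t) + S' - S + \<alpha> / 2 * G' + (\<Sum>j=1..N. p j + p' j)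
      \<le> \<alpha> / 8 * (G + G') + 4 * (real N)\<^sup>2 * \<kappa> * A + \<kappa>r * (\<Sum>j=1..N. r j + r' j)" by linarith
  then have "\<Delta>t * ((A' - A) / (2 * \<Delta>t) + S' - S + \<alpha> / 2 * G' + (\<Sum>j=1..N. p j + p' j))
      \<le> \<Delta>t * (\<alpha> / 8 * (G + G') + 4 * (real N)\<^sup>2 * \<kappa> * A + \<kappa>r * (\<Sum>j=1..N. r j + r' j))"
    using pos(1) by (intro mult_left_mono) auto
  \<comment> \<open>The surplus \<open>\<alpha> / 2\<close> consists of four eighths: one absorbs
    the new gradients of the Young terms, one is stored in the energy and pays for the old gradients
    of the next step, two are left over.\<close>
  moreover have "\<Delta>t * ((A' - A) / (2 * \<Delta>t) + S' - S + \<alpha> / 2 * G' + (\<Sum>j=1..N. p j + p' j))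
      = A' / 2 - A / 2 + \<Delta>t * S' - \<Delta>t * S + 4 * (\<Delta>t * (\<alpha> / 8 * G')) + \<Delta>t * (\<Sum>j=1..N. p j + p' j)"
    using pos(1) by (simp add: field_simps)
  moreover have "\<Delta>t * (\<alpha> / 8 * (G + G') + 4 * (real N)\<^sup>2 * \<kappa> * A + \<kappa>r * (\<Sum>j=1..N. r j + r' j))
      = \<Delta>t * (\<alpha> / 8 * G) + \<Delta>t * (\<alpha> / 8 * G') + \<Delta>t * (8 * (real N)\<^sup>2 * \<kappa>) * (A / 2) + \<Delta>t * \<kappa>r * (\<Sum>j=1..N. r j + r' j)"
    by (simp add: algebra_simps)
  moreover have "\<Delta>t * (8 * (real N)\<^sup>2 * \<kappa>) * (A / 2) \<le> \<Delta>t * (8 * (real N)\<^sup>2 * \<kappa>) * (A / 2 + \<Delta>t * (S + \<alpha> / 8 * G))"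
    using pos S0 G0 by (intro mult_left_mono) auto
  moreover have "(1 + \<Delta>t * (8 * (real N)\<^sup>2 * \<kappa>)) * (A / 2 + \<Delta>t * (S + \<alpha> / 8 * G))
      = A / 2 + \<Delta>t * S + \<Delta>t * (\<alpha> / 8 * G) + \<Delta>t * (8 * (real N)\<^sup>2 * \<kappa>) * (A / 2 + \<Delta>t * (S + \<alpha> / 8 * G))"
    by (simp only: distrib_right distrib_left mult_1_left add.assoc)
  moreover have "\<Delta>t * (S' + \<alpha> / 8 * G') = \<Delta>t * S' + \<Delta>t * (\<alpha> / 8 * G')" by (rule distrib_left)
  moreover have "\<Delta>t * (\<alpha> / 4 * G') = 2 * (\<Delta>t * (\<alpha> / 8 * G'))" by simp
  ultimately show ?thesis by linarith
qed

text \<open>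
  On \<open>X\<^sub>h\<close> the projection step turns the penalty-projection half into the coupled one with an additional
  grad-div term and the old pressure in place of the new one; this is why the differences
  \<open>q\<^sup>n\<^sup>+\<^sup>1 - q\<^sub>h\<^sup>n\<close> drive the error.
\<close>

lemma (in fe_space) error_equation:
  fixes zo zho uof uhof :: "nat \<Rightarrow> real^'d \<Rightarrow> real^'d"
  assumes N: "1 \<le> N" "j \<in> {1..N}"
    and X: "un \<in> X" "uhn \<in> X" "uof j \<in> X" "uhof j \<in> X" "\<tau> \<in> X"
    and zX: "\<And>i. i \<in> {1..N} \<Longrightarrow> zo i \<in> X" "\<And>i. i \<in> {1..N} \<Longrightarrow> zho i \<in> X"
    and ess: "essbdd ut" "essbdd p" "essbdd ph"
    and visc: "essbdd (\<lambda>x. (avg N \<nu> x + avg N \<nu>m x) / 2)" "essbdd (\<lambda>x. (\<nu> j x - \<nu>m j x) / 2)"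
      "essbdd (\<lambda>x. (fluct N \<nu> j x + fluct N \<nu>m j x) / 2)"
    and dv: "AE x in lebesgue_on D. dvg D un x = 0"
    and coupled: "L2_inner D (\<lambda>x. (1 / \<Delta>t) *\<^sub>R (un x - uof j x)) \<tau> + implicit_form D N \<nu> \<nu>m \<mu> \<Delta>t zo un \<tau>
        - L2_inner D p (dvg D \<tau>) = F - explicit_form D N \<nu> \<nu>m zo uof j \<tau>"
    and spp: "L2_inner D (\<lambda>x. (1 / \<Delta>t) *\<^sub>R (uhn x - ut x)) \<tau> + implicit_form D N \<nu> \<nu>m \<mu> \<Delta>t zho uhn \<tau>
        + \<gamma> * L2_inner D (dvg D uhn) (dvg D \<tau>) = F - explicit_form D N \<nu> \<nu>m zho uhof j \<tau>"
    and proj: "L2_inner D (\<lambda>x. (1 / \<Delta>t) *\<^sub>R (ut x - uhof j x)) \<tau> - L2_inner D ph (dvg D \<tau>) = 0"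
  defines "e' \<equiv> \<lambda>x. un x - uhn x" and "e \<equiv> \<lambda>x. uof j x - uhof j x" and "\<epsilon> \<equiv> \<lambda>i x. zo i x - zho i x"
  shows "(1 / \<Delta>t) * L2_inner D (\<lambda>x. e' x - e x) \<tau> + trilinear D (avg N \<epsilon>) un \<tau> + trilinear D (avg N zho) e' \<tau>
       + weighted_grad_inner D (\<lambda>x. (avg N \<nu> x + avg N \<nu>m x) / 2) e' \<tau>
       + weighted_grad_inner D (\<lambda>x. 2 * eddy_viscosity N \<mu> \<Delta>t zo x - 2 * eddy_viscosity N \<mu> \<Delta>t zho x) un \<tau>
       + weighted_grad_inner D (\<lambda>x. 2 * eddy_viscosity N \<mu> \<Delta>t zho x) e' \<tau>
       + (\<gamma> * L2_inner D (dvg D e') (dvg D \<tau>) - L2_inner D (\<lambda>x. p x - ph x) (dvg D \<tau>))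
       + trilinear D (fluct N \<epsilon> j) (uof j) \<tau> + trilinear D (fluct N zho j) e \<tau>
       + weighted_grad_inner D (\<lambda>x. (\<nu> j x - \<nu>m j x) / 2) (\<epsilon> j) \<tau>
       + weighted_grad_inner D (\<lambda>x. (fluct N \<nu> j x + fluct N \<nu>m j x) / 2) e \<tau> = 0"
proof -
  have zoa: "avg N zo \<in> X" "avg N zho \<in> X" by (rule avg_X[OF zX(1) N(1)], assumption, rule avg_X[OF zX(2) N(1)])
  have zof: "fluct N zo j \<in> X" "fluct N zho j \<in> X" by (rule fluct_X[OF zX(1) N], assumption, rule fluct_X[OF zX(2) N])
  have e'X: "e' \<in> X" unfolding e'_def by (rule X_diff[OF X(1,2)])
  have eX: "e \<in> X" unfolding e_def by (rule X_diff[OF X(3,4)])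
  have ev: "essbdd (\<lambda>x. 2 * eddy_viscosity N \<mu> \<Delta>t zo x)" "essbdd (\<lambda>x. 2 * eddy_viscosity N \<mu> \<Delta>t zho x)"
    by (intro essbdd_mult_const eddy_essbdd zX N(1); assumption)+
  have t1: "trilinear D (avg N zo) un \<tau> - trilinear D (avg N zho) uhn \<tau> = trilinear D (avg N \<epsilon>) un \<tau> + trilinear D (avg N zho) e' \<tau>"
    unfolding \<epsilon>_def avg_diff e'_def by (rule trilinear_diff[OF zoa(1) X(1) zoa(2) X(2) X(5)])
  have t2: "trilinear D (fluct N zo j) (uof j) \<tau> - trilinear D (fluct N zho j) (uhof j) \<tau>
      = trilinear D (fluct N \<epsilon> j) (uof j) \<tau> + trilinear D (fluct N zho j) e \<tau>"
    unfolding \<epsilon>_def fluct_diff e_def by (rule trilinear_diff[OF zof(1) X(3) zof(2) X(4) X(5)])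
  have w1: "weighted_grad_inner D (\<lambda>x. (avg N \<nu> x + avg N \<nu>m x) / 2) un \<tau> - weighted_grad_inner D (\<lambda>x. (avg N \<nu> x + avg N \<nu>m x) / 2) uhn \<tau>
      = weighted_grad_inner D (\<lambda>x. (avg N \<nu> x + avg N \<nu>m x) / 2) e' \<tau>"
    unfolding e'_def by (rule wgi_diff_same[OF visc(1) X(1,2,5)])
  have w2: "weighted_grad_inner D (\<lambda>x. 2 * eddy_viscosity N \<mu> \<Delta>t zo x) un \<tau> - weighted_grad_inner D (\<lambda>x. 2 * eddy_viscosity N \<mu> \<Delta>t zho x) uhn \<tau>
      = weighted_grad_inner D (\<lambda>x. 2 * eddy_viscosity N \<mu> \<Delta>t zo x - 2 * eddy_viscosity N \<mu> \<Delta>t zho x) un \<tau>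
       + weighted_grad_inner D (\<lambda>x. 2 * eddy_viscosity N \<mu> \<Delta>t zho x) e' \<tau>"
    unfolding e'_def by (rule wgi_diff[OF ev X(1,2,5)])
  have w3: "weighted_grad_inner D (\<lambda>x. (\<nu> j x - \<nu>m j x) / 2) (zo j) \<tau> - weighted_grad_inner D (\<lambda>x. (\<nu> j x - \<nu>m j x) / 2) (zho j) \<tau>
      = weighted_grad_inner D (\<lambda>x. (\<nu> j x - \<nu>m j x) / 2) (\<epsilon> j) \<tau>"
    unfolding \<epsilon>_def by (rule wgi_diff_same[OF visc(2) zX(1)[OF N(2)] zX(2)[OF N(2)] X(5)])
  have w4: "weighted_grad_inner D (\<lambda>x. (fluct N \<nu> j x + fluct N \<nu>m j x) / 2) (uof j) \<tau> - weighted_grad_inner D (\<lambda>x. (fluct N \<nu> j x + fluct N \<nu>m j x) / 2) (uhof j) \<tau>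
      = weighted_grad_inner D (\<lambda>x. (fluct N \<nu> j x + fluct N \<nu>m j x) / 2) e \<tau>"
    unfolding e_def by (rule wgi_diff_same[OF visc(3) X(3,4,5)])
  note es = X_essbdd(1)[OF X(1)] X_essbdd(1)[OF X(2)] X_essbdd(1)[OF X(3)] X_essbdd(1)[OF X(4)] X_essbdd(1)[OF X(5)]
  \<comment> \<open>Adding the two steps of the projection method cancels the projected field
    \<open>ut\<close>.\<close>
  have time: "L2_inner D (\<lambda>x. (1 / \<Delta>t) *\<^sub>R (un x - uof j x)) \<tau> - L2_inner D (\<lambda>x. (1 / \<Delta>t) *\<^sub>R (uhn x - ut x)) \<tau>
      - L2_inner D (\<lambda>x. (1 / \<Delta>t) *\<^sub>R (ut x - uhof j x)) \<tau> = (1 / \<Delta>t) * L2_inner D (\<lambda>x. e' x - e x) \<tau>"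
  proof -
    have i: "integrable (lebesgue_on D) (\<lambda>x. un x \<bullet> \<tau> x)" "integrable (lebesgue_on D) (\<lambda>x. uhn x \<bullet> \<tau> x)"
      "integrable (lebesgue_on D) (\<lambda>x. uof j x \<bullet> \<tau> x)" "integrable (lebesgue_on D) (\<lambda>x. uhof j x \<bullet> \<tau> x)"
      "integrable (lebesgue_on D) (\<lambda>x. ut x \<bullet> \<tau> x)"
      by (intro essbdd_integrable essbdd_inner es ess)+
    then show ?thesis by (simp add: L2_inner_def e'_def e_def inner_diff_left right_diff_distrib)
  qed
  have pr: "L2_inner D (\<lambda>x. p x - ph x) (dvg D \<tau>) = L2_inner D p (dvg D \<tau>) - L2_inner D ph (dvg D \<tau>)"
    using L2_inner_lincomb_left[OF ess(2,3) X_essbdd(3)[OF X(5)], of 1 "-1"] by simp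
  \<comment> \<open>The coupled solution is divergence free, so the penalty on the hatted field is a
    penalty on the error.\<close>
  have dd: "L2_inner D (dvg D e') (dvg D \<tau>) = - L2_inner D (dvg D uhn) (dvg D \<tau>)"
  proof -
    have "AE x in lebesgue_on D. dvg D e' x = (-1) *\<^sub>R dvg D uhn x + 0 *\<^sub>R dvg D uhn x"
      using X_dvg_diff[OF X(1,2), folded e'_def] dv by eventually_elim simp
    then have "L2_inner D (dvg D e') (dvg D \<tau>) = L2_inner D (\<lambda>x. (-1) *\<^sub>R dvg D uhn x + 0 *\<^sub>R dvg D uhn x) (dvg D \<tau>)"
      by (rule L2_inner_cong_AE) (intro essbdd_add essbdd_scaleR_const X_essbdd(3) e'X X)+
    also have "\<dots> = - L2_inner D (dvg D uhn) (dvg D \<tau>)"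
      using L2_inner_lincomb_left[OF X_essbdd(3)[OF X(2)] X_essbdd(3)[OF X(2)] X_essbdd(3)[OF X(5)], of "-1" 0] by simp
    finally show ?thesis .
  qed
  show ?thesis
    using coupled spp proj t1 t2 w1 w2 w3 w4 time pr unfolding dd implicit_form_def explicit_form_def
    by (simp only: mult_minus_right)
qed

section \<open>From the norms of the hypotheses to pointwise and L2 bounds\<close>

context bounded_domain
begin

text \<open>\<open>Linf_norm\<close> is the real part of an extended real, so the essential supremum
  has to be finite. The value -\<infinity> would put all norms below -\<infinity> almost everywhere,
  which makes the claim vacuous.\<close>

lemma AE_le_Linf_norm:
  assumes "essbdd u"
  shows "AE x in lebesgue_on D. norm (u x) \<le> Linf_norm D u"
proof -
  obtain B where B: "AE x in lebesgue_on D. norm (u x) \<le> B" using assms by (rule essbddE)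
  have um: "u \<in> borel_measurable (lebesgue_on D)" using assms by (rule essbdd_measurable)
  define S where "S = esssup (lebesgue_on D) (\<lambda>x. ereal (norm (u x)))"
  have le: "AE x in lebesgue_on D. ereal (norm (u x)) \<le> S" unfolding S_def by (rule esssup_AE)
  have "S \<le> ereal B" unfolding S_def
    by (rule esssup_I) (use um B in auto)
  then consider r where "S = ereal r" | "S = - \<infinity>" by (cases S) auto
  then show ?thesis
  proof cases
    case 1
    then show ?thesis using le unfolding Linf_norm_def S_def[symmetric] by simp
  next
    case 2
    then show ?thesis using le by (auto elim: eventually_mono)
  qed
qed

lemma Linf_norm_nonneg:
  assumes "essbdd u" "D \<noteq> {}"
  shows "0 \<le> Linf_norm D u"
proof (rule ccontr)
  assume n: "\<not> 0 \<le> Linf_norm D u"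
  have "AE x in lebesgue_on D. False"
    using AE_le_Linf_norm[OF assms(1)]
  proof eventually_elim
    case (elim x)
    then show False using n norm_ge_zero[of "u x"] by linarith
  qed
  then have "AE x in lebesgue. x \<notin> D" unfolding AE_lebesgue_on_iff[OF sets_D] by simp
  then have "D \<in> null_sets lebesgue" using sets_D by (simp add: AE_iff_null_sets)
  then have "negligible D" by (simp add: negligible_iff_null_sets)
  then show False using open_not_negligible[OF open_D assms(2)] by simp
qed

text \<open>The pointwise inequality \<open>r^2 \<le> 1 + r^3\<close> takes the place of Hoelder's
  inequality; any bound that does not depend on the mesh will do.\<close>

lemma nrm_le_L3_norm:
  assumes "essbdd G"
  shows "(nrm G)\<^sup>2 \<le> measure lebesgue D + (L3_norm D G) ^ 3" and "0 \<le> L3_norm D G"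
proof -
  have i3: "integrable (lebesgue_on D) (\<lambda>x. norm (G x) ^ 3)"
    unfolding power3_eq_cube by (intro essbdd_integrable essbdd_mult essbdd_norm assms)
  have I0: "0 \<le> (\<integral>x. norm (G x) ^ 3 \<partial>lebesgue_on D)" by (intro integral_nonneg_AE) auto
  then show "0 \<le> L3_norm D G" by (simp add: L3_norm_def)
  have "(nrm G)\<^sup>2 \<le> (\<integral>x. 1 + norm (G x) ^ 3 \<partial>lebesgue_on D)"
    unfolding L2_norm_power2
  proof (rule integral_mono)
    fix x
    define r where "r = norm (G x)"
    have r: "0 \<le> r" by (simp add: r_def)
    have "r\<^sup>2 \<le> 1 + r ^ 3"
    proof (cases "r \<le> 1")
      case True
      then have "r\<^sup>2 \<le> 1" using r by (simp add: power_le_one)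
      then show ?thesis using r by (simp add: add_increasing2)
    next
      case False
      then have "r ^ 2 \<le> r ^ 3" by (intro power_increasing) auto
      then show ?thesis by simp
    qed
    then show "(norm (G x))\<^sup>2 \<le> 1 + norm (G x) ^ 3" by (simp add: r_def)
  next
    show "integrable (lebesgue_on D) (\<lambda>x. (norm (G x))\<^sup>2)"
      by (intro essbdd_integrable essbdd_power2 essbdd_norm assms)
    show "integrable (lebesgue_on D) (\<lambda>x. 1 + norm (G x) ^ 3)" using i3 by simp
  qed
  also have "\<dots> = measure lebesgue D + (\<integral>x. norm (G x) ^ 3 \<partial>lebesgue_on D)"
    using i3 sets_D by (simp add: measure_restrict_space)
  also have "(\<integral>x. norm (G x) ^ 3 \<partial>lebesgue_on D) = (L3_norm D G) ^ 3"
    using I0 by (simp add: L3_norm_def)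
  finally show "(nrm G)\<^sup>2 \<le> measure lebesgue D + (L3_norm D G) ^ 3" .
qed

end

context sv_mesh
begin

lemma Qh_essbdd: "q \<in> Qh \<Longrightarrow> essbdd q"
  unfolding SV_pressure_def L20_def by (rule polys_disc_essbdd) (auto intro: L2_measurable)

text \<open>The projected field occurs in the error analysis only inside the discrete time
  derivative, where integrability allows it to cancel.\<close>

lemma Yh_essbdd:
  assumes Y: "conforming_Ytilde D \<T> Yh" and w: "w \<in> Yh"
  shows "essbdd w"
proof -
  have "w \<in> H1 D" using Y w by (auto simp: conforming_Ytilde_def Ytilde_def)
  then have m: "(\<lambda>x. w x $ i) \<in> borel_measurable (lebesgue_on D)" for i
    by (intro L2_measurable L2_nth H1_L2(1))
  obtain m where "\<forall>v\<in>Yh. \<forall>i. (\<lambda>x. v x $ i) \<in> polys_disc \<T> m"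
    using Y by (auto simp: conforming_Ytilde_def)
  then have p: "(\<lambda>x. w x $ i) \<in> polys_disc \<T> m" for i using w by blast
  show ?thesis by (rule essbdd_vecI) (rule polys_disc_essbdd[OF p m])
qed

end

section \<open>One field of the two schemes\<close>

text \<open>The equations for \<open>v\<close> and \<open>w\<close> have the same form, so both are
  instances of a field \<open>u\<close> driven by its partner \<open>z\<close>. Sup bounds start at
  time level 1, as in the theorem; at level 0 the L2 bound \<open>init\<close> takes their
  place.\<close>

locale smhd_half = sv_mesh D \<T>0 \<T> k \<sigma> h + fe_space D "SV_velocity D \<T> k" L H
  for D :: "(real^'d) set" and \<T>0 \<T> k \<sigma> h L H +
  fixes Yh :: "(real^'d \<Rightarrow> real^'d) set" and N :: nat and \<nu> \<nu>m :: "nat \<Rightarrow> real^'d \<Rightarrow> real"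
    and \<mu> \<gamma> \<Delta>t m :: real and M :: nat and f :: "nat \<Rightarrow> real \<Rightarrow> (real^'d \<Rightarrow> real^'d) \<Rightarrow> real"
    and u z uh zh ut :: "nat \<Rightarrow> nat \<Rightarrow> real^'d \<Rightarrow> real^'d" and p ph :: "nat \<Rightarrow> nat \<Rightarrow> real^'d \<Rightarrow> real"
    and A1 A2 :: "nat \<Rightarrow> real"
  assumes coupled: "coupled_half D Xh Qh N \<nu> \<nu>m \<mu> \<Delta>t M f u z p"
    and spp: "SPP_half D Xh Yh Qh N \<nu> \<nu>m \<mu> \<gamma> \<Delta>t M f (u 0) uh ut zh ph"
    and z_V: "\<And>n j. n \<le> M \<Longrightarrow> j \<in> {1..N} \<Longrightarrow> z n j \<in> Vspace D Xh Qh"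
    and zh_X: "\<And>n j. n \<le> M \<Longrightarrow> j \<in> {1..N} \<Longrightarrow> zh n j \<in> Xh"
    and zh_0: "\<And>j. j \<in> {1..N} \<Longrightarrow> zh 0 j = z 0 j"
    and conf: "conforming_Ytilde D \<T> Yh" and X_Y: "Xh \<subseteq> Yh"
    and N_pos: "1 \<le> N" and N_L: "real N \<le> L"
    and dt: "0 < \<Delta>t" "\<Delta>t \<le> L" and \<mu>: "0 < \<mu>" "\<mu> \<le> L" and \<gamma>: "0 < \<gamma>"
    and bound: "\<And>n j. n \<in> {1..M} \<Longrightarrow> j \<in> {1..N} \<Longrightarrow>
      (AE x in lebesgue_on D. norm (u n j x) \<le> L \<and> norm (z n j x) \<le> L \<and> norm (uh n j x) \<le> L \<and> norm (zh n j x) \<le> L)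
      \<and> gnrm (u n j) \<le> L"
    and init: "\<And>j. j \<in> {1..N} \<Longrightarrow> nrm (z 0 j) \<le> L"
    and visc: "essbdd (\<lambda>x. (avg N \<nu> x + avg N \<nu>m x) / 2)" "0 \<le> m"
      "AE x in lebesgue_on D. m \<le> (avg N \<nu> x + avg N \<nu>m x) / 2 \<and> (avg N \<nu> x + avg N \<nu>m x) / 2 \<le> L"
    and visc1: "\<And>j. j \<in> {1..N} \<Longrightarrow> essbdd (\<lambda>x. (\<nu> j x - \<nu>m j x) / 2)"
      "\<And>j. j \<in> {1..N} \<Longrightarrow> AE x in lebesgue_on D. \<bar>(\<nu> j x - \<nu>m j x) / 2\<bar> \<le> A1 j"
      "\<And>j. j \<in> {1..N} \<Longrightarrow> 0 \<le> A1 j" "\<And>j. j \<in> {1..N} \<Longrightarrow> A1 j \<le> L"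
    and visc2: "\<And>j. j \<in> {1..N} \<Longrightarrow> essbdd (\<lambda>x. (fluct N \<nu> j x + fluct N \<nu>m j x) / 2)"
      "\<And>j. j \<in> {1..N} \<Longrightarrow> AE x in lebesgue_on D. \<bar>(fluct N \<nu> j x + fluct N \<nu>m j x) / 2\<bar> \<le> A2 j"
      "\<And>j. j \<in> {1..N} \<Longrightarrow> 0 \<le> A2 j" "\<And>j. j \<in> {1..N} \<Longrightarrow> A2 j \<le> L"
begin

definition e :: "nat \<Rightarrow> nat \<Rightarrow> real^'d \<Rightarrow> real^'d" where "e n j = (\<lambda>x. u n j x - uh n j x)"
definition \<epsilon> :: "nat \<Rightarrow> nat \<Rightarrow> real^'d \<Rightarrow> real^'d" where "\<epsilon> n j = (\<lambda>x. z n j x - zh n j x)"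

lemma u_V: "n \<le> M \<Longrightarrow> j \<in> {1..N} \<Longrightarrow> u n j \<in> Vspace D Xh Qh"
  using coupled by (cases n) (auto simp: coupled_half_def Vspace_def)

lemma u_X: "n \<le> M \<Longrightarrow> j \<in> {1..N} \<Longrightarrow> u n j \<in> Xh"
  using u_V by (auto simp: Vspace_def)

lemma z_X: "n \<le> M \<Longrightarrow> j \<in> {1..N} \<Longrightarrow> z n j \<in> Xh"
  using z_V by (auto simp: Vspace_def)

lemma uh_0: "j \<in> {1..N} \<Longrightarrow> uh 0 j = u 0 j"
  using spp by (auto simp: SPP_half_def)

lemma uh_X: "n \<le> M \<Longrightarrow> j \<in> {1..N} \<Longrightarrow> uh n j \<in> Xh"
  using spp by (cases n) (auto simp: SPP_half_def Vspace_def)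

lemma e_X: "n \<le> M \<Longrightarrow> j \<in> {1..N} \<Longrightarrow> e n j \<in> Xh"
  unfolding e_def by (rule X_diff[OF u_X uh_X])

lemma half_error_equation:
  assumes n: "n < M" and j: "j \<in> {1..N}" and \<tau>: "\<tau> \<in> Xh"
  shows "(1 / \<Delta>t) * L2_inner D (\<lambda>x. e (Suc n) j x - e n j x) \<tau>
       + trilinear D (avg N (\<epsilon> n)) (u (Suc n) j) \<tau> + trilinear D (avg N (zh n)) (e (Suc n) j) \<tau>
       + weighted_grad_inner D (\<lambda>x. (avg N \<nu> x + avg N \<nu>m x) / 2) (e (Suc n) j) \<tau>
       + weighted_grad_inner D (\<lambda>x. 2 * eddy_viscosity N \<mu> \<Delta>t (z n) x - 2 * eddy_viscosity N \<mu> \<Delta>t (zh n) x) (u (Suc n) j) \<tau>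
       + weighted_grad_inner D (\<lambda>x. 2 * eddy_viscosity N \<mu> \<Delta>t (zh n) x) (e (Suc n) j) \<tau>
       + (\<gamma> * L2_inner D (dvg D (e (Suc n) j)) (dvg D \<tau>) - L2_inner D (\<lambda>x. p (Suc n) j x - ph n j x) (dvg D \<tau>))
       + trilinear D (fluct N (\<epsilon> n) j) (u n j) \<tau> + trilinear D (fluct N (zh n) j) (e n j) \<tau>
       + weighted_grad_inner D (\<lambda>x. (\<nu> j x - \<nu>m j x) / 2) (\<epsilon> n j) \<tau>
       + weighted_grad_inner D (\<lambda>x. (fluct N \<nu> j x + fluct N \<nu>m j x) / 2) (e n j) \<tau> = 0"
proof -
  have X: "u (Suc n) j \<in> Xh" "uh (Suc n) j \<in> Xh" "u n j \<in> Xh" "uh n j \<in> Xh"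
    using n j by (auto intro: u_X uh_X)
  have zX: "z n i \<in> Xh" "zh n i \<in> Xh" if "i \<in> {1..N}" for i
    using n that by (auto intro: z_X zh_X)
  have p: "essbdd (p (Suc n) j)"
    using coupled n j by (intro Qh_essbdd) (auto simp: coupled_half_def)
  have ph: "essbdd (ph n j)"
    using spp n j by (cases n) (auto simp: SPP_half_def intro: Qh_essbdd essbdd_const)
  have ut: "essbdd (ut n j)"
  proof (cases n)
    case 0
    then have "ut n j = u n j" using spp j by (auto simp: SPP_half_def)
    then show ?thesis using X_essbdd(1)[OF X(3)] by simp
  next
    case (Suc l)
    then show ?thesis using spp n j by (intro Yh_essbdd[OF conf]) (auto simp: SPP_half_def)
  qed
  \<comment> \<open>At level 0 no projection has been carried out; equal starting values and the
    initial pressure 0 make the equation hold trivially. Later it may be tested with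
    \<open>\<tau>\<close> because X_h is contained in Y_h.\<close>
  have proj: "L2_inner D (\<lambda>x. (1 / \<Delta>t) *\<^sub>R (ut n j x - uh n j x)) \<tau> - L2_inner D (ph n j) (dvg D \<tau>) = 0"
  proof (cases n)
    case 0
    have "ut 0 j = uh 0 j" "ph 0 j = (\<lambda>x. 0)" using spp j by (auto simp: SPP_half_def)
    then show ?thesis using 0 by (simp add: L2_inner_def)
  next
    case (Suc l)
    then have "l < M" using n by simp
    then show ?thesis using spp j X_Y \<tau> unfolding Suc SPP_half_def by blast
  qed
  have c: "L2_inner D (\<lambda>x. (1 / \<Delta>t) *\<^sub>R (u (Suc n) j x - u n j x)) \<tau> + implicit_form D N \<nu> \<nu>m \<mu> \<Delta>t (z n) (u (Suc n) j) \<tau>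
      - L2_inner D (p (Suc n) j) (dvg D \<tau>) = f j (real (Suc n) * \<Delta>t) \<tau> - explicit_form D N \<nu> \<nu>m (z n) (u n) j \<tau>"
    using coupled n j \<tau> unfolding coupled_half_def by blast
  have s: "L2_inner D (\<lambda>x. (1 / \<Delta>t) *\<^sub>R (uh (Suc n) j x - ut n j x)) \<tau> + implicit_form D N \<nu> \<nu>m \<mu> \<Delta>t (zh n) (uh (Suc n) j) \<tau>
      + \<gamma> * L2_inner D (dvg D (uh (Suc n) j)) (dvg D \<tau>) = f j (real (Suc n) * \<Delta>t) \<tau> - explicit_form D N \<nu> \<nu>m (zh n) (uh n) j \<tau>"
    using spp n j \<tau> unfolding SPP_half_def by blast
  have dv: "AE x in lebesgue_on D. dvg D (u (Suc n) j) x = 0"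
    using n j by (intro Vspace_dvg u_V) auto
  have "(\<epsilon> n) = (\<lambda>i x. z n i x - zh n i x)" by (simp add: \<epsilon>_def[abs_def])
  then show ?thesis unfolding e_def
    using error_equation[OF N_pos j X \<tau> zX ut p ph visc(1) visc1(1)[OF j] visc2(1)[OF j] dv c s proj]
    by simp
qed

lemma half_estimate:
  assumes K: "young_const L \<eta> K"
    and n: "n < M" and j: "j \<in> {1..N}" and \<rho>: "\<rho> \<in> Xh"
    and a: "nrm (e n j) \<le> a" "(\<Sum>i=1..N. nrm (\<epsilon> n i)) \<le> a"
    and g: "gnrm (e n j) \<le> g" "(\<Sum>i=1..N. gnrm (\<epsilon> n i)) \<le> g" and g': "gnrm (e (Suc n) j) \<le> g'"
  shows "((nrm (e (Suc n) j))\<^sup>2 - (nrm (e n j))\<^sup>2) / (2 * \<Delta>t) + m * (gnrm (e (Suc n) j))\<^sup>2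
       - A1 j * gnrm (\<epsilon> n j) * gnrm (e (Suc n) j) - A2 j * gnrm (e n j) * gnrm (e (Suc n) j)
       + (\<gamma> * L2_inner D (dvg D (e (Suc n) j)) (dvg D (\<lambda>x. e (Suc n) j x - \<rho> x))
          - L2_inner D (\<lambda>x. p (Suc n) j x - ph n j x) (dvg D (\<lambda>x. e (Suc n) j x - \<rho> x)))
     \<le> \<eta> * (g\<^sup>2 + g'\<^sup>2) + K * (1 + \<Delta>t * H\<^sup>2) * a\<^sup>2 + K * ((1 + \<Delta>t * H\<^sup>2) / \<Delta>t) * (gnrm \<rho>)\<^sup>2"
proof -
  \<comment> \<open>Bounds the advecting field in both cases: by \<open>L\<close> from level 1 on,
    and by \<open>L * H * L\<close> for the initial data, through the inverse inequality.\<close>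
  define B where "B = L\<^sup>2 * (1 + H)"
  have L01: "0 \<le> L" "1 \<le> L" "0 \<le> H" using L1 H0 by auto
  have B0: "0 \<le> B" using L01 by (simp add: B_def)
  have LB: "L \<le> B" "L * H * L \<le> B"
  proof -
    have "L * 1 \<le> L * (L * (1 + H))"
      using L01 mult_mono[of 1 L 1 "1 + H"] by (intro mult_left_mono) auto
    then show "L \<le> B" by (simp add: B_def power2_eq_square mult.assoc)
    show "L * H * L \<le> B" using L01 by (simp add: B_def power2_eq_square algebra_simps)
  qed
  have X: "u (Suc n) j \<in> Xh" "u n j \<in> Xh" "e n j \<in> Xh" "e (Suc n) j \<in> Xh"
    using n j by (auto intro: u_X e_X)
  have zX: "z n i \<in> Xh" "zh n i \<in> Xh" if "i \<in> {1..N}" for i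
    using n that by (auto intro: z_X zh_X)
  have zV: "z n i \<in> Vspace D Xh Qh" if "i \<in> {1..N}" for i using n that by (intro z_V) auto
  have dv: "AE x in lebesgue_on D. dvg D (avg N (z n)) x = 0" "AE x in lebesgue_on D. dvg D (fluct N (z n) j) x = 0"
    by (rule Vspace_dvg, rule avg_closed[OF Vspace_lincomb zV N_pos]; assumption)
       (rule Vspace_dvg, rule fluct_closed[OF Vspace_lincomb zV N_pos j]; assumption)
  have Bz: "AE x in lebesgue_on D. \<forall>i\<in>{1..N}. norm (zh n i x) \<le> B"
  proof -
    have "AE x in lebesgue_on D. norm (zh n i x) \<le> B" if i: "i \<in> {1..N}" for i
    proof (cases "n = 0")
      case True
      have "L * H * nrm (z 0 i) \<le> L * H * L" using init[OF i] L01 by (intro mult_left_mono) auto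
      then have "L * H * nrm (zh n i) \<le> B" using LB(2) zh_0[OF i] True by simp
      then show ?thesis using X_inv_sup[OF zX(2)[OF i]] by (auto elim: eventually_mono)
    next
      case False
      then have "n \<in> {1..M}" using n by auto
      from bound[OF this i] have "AE x in lebesgue_on D. norm (zh n i x) \<le> L" by (auto elim: eventually_mono)
      then show ?thesis using LB(1) by (auto elim: eventually_mono)
    qed
    then show ?thesis by (simp add: AE_finite_all)
  qed
  have cases: "(e n j = (\<lambda>x. 0) \<and> (\<forall>i\<in>{1..N}. z n i = zh n i)) \<or>
       ((AE x in lebesgue_on D. norm (u (Suc n) j x) \<le> L \<and> norm (u n j x) \<le> L \<and> norm (e (Suc n) j x) \<le> 2 * L
          \<and> (\<forall>i\<in>{1..N}. norm (z n i x) \<le> L \<and> norm (zh n i x) \<le> L)) \<and> gnrm (u (Suc n) j) \<le> L \<and> gnrm (u n j) \<le> L)"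
  proof (cases "n = 0")
    case True
    then show ?thesis using zh_0 uh_0[OF j] by (simp add: e_def)
  next
    case False
    then have n1: "n \<in> {1..M}" "Suc n \<in> {1..M}" using n by auto
    have "AE x in lebesgue_on D. \<forall>i\<in>{1..N}. norm (z n i x) \<le> L \<and> norm (zh n i x) \<le> L"
      using bound[OF n1(1)] by (auto simp: AE_finite_all elim: eventually_mono)
    moreover have "AE x in lebesgue_on D. norm (u n j x) \<le> L" using bound[OF n1(1) j] by (auto elim: eventually_mono)
    moreover have "AE x in lebesgue_on D. norm (u (Suc n) j x) \<le> L \<and> norm (uh (Suc n) j x) \<le> L"
      using bound[OF n1(2) j] by (auto elim: eventually_mono)
    ultimately have "AE x in lebesgue_on D. norm (u (Suc n) j x) \<le> L \<and> norm (u n j x) \<le> L \<and> norm (e (Suc n) j x) \<le> 2 * L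
          \<and> (\<forall>i\<in>{1..N}. norm (z n i x) \<le> L \<and> norm (zh n i x) \<le> L)"
    proof eventually_elim
      case (elim x)
      then show ?case using norm_triangle_ineq4[of "u (Suc n) j x" "uh (Suc n) j x"] by (auto simp: e_def)
    qed
    then show ?thesis using bound[OF n1(1) j] bound[OF n1(2) j] by blast
  qed
  have \<epsilon>eq: "\<epsilon> n = (\<lambda>i x. z n i x - zh n i x)" by (simp add: \<epsilon>_def[abs_def])
  define \<delta> where "\<delta> = nrm (\<lambda>x. e (Suc n) j x - e n j x)"
  have step: "((nrm (e (Suc n) j))\<^sup>2 - (nrm (e n j))\<^sup>2) / (2 * \<Delta>t) + \<delta>\<^sup>2 / (2 * \<Delta>t) + m * (gnrm (e (Suc n) j))\<^sup>2
       - A1 j * gnrm (\<epsilon> n j) * gnrm (e (Suc n) j) - A2 j * gnrm (e n j) * gnrm (e (Suc n) j)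
       + (\<gamma> * L2_inner D (dvg D (e (Suc n) j)) (dvg D (\<lambda>x. e (Suc n) j x - \<rho> x))
          - L2_inner D (\<lambda>x. p (Suc n) j x - ph n j x) (dvg D (\<lambda>x. e (Suc n) j x - \<rho> x)))
     \<le> 16 * L^5 * (a * g + a * g' + H * a * \<delta> + (a + g) * gnrm \<rho> + \<Delta>t * H * a * (g' + gnrm \<rho>) + B * g' * gnrm \<rho>)
       + (1 / \<Delta>t) * (L * \<delta> * gnrm \<rho>) + L * (g' + 2 * g) * gnrm \<rho> + 2 * L\<^sup>2 * \<Delta>t * B\<^sup>2 * (gnrm \<rho>)\<^sup>2"
    unfolding \<delta>_def
    by (rule half_step[OF N_pos N_L j X \<rho> zX \<epsilon>eq visc(1,3,2) visc1(1-4)[OF j] visc2(1-4)[OF j] dt(1) \<mu> a(1) g(1) g' a(2) g(2) dv Bz B0 cases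
      half_error_equation[OF n j]])
  have nn: "0 \<le> a" "0 \<le> g" "0 \<le> g'" "0 \<le> \<delta>" "0 \<le> gnrm \<rho>"
    by (rule order_trans[OF L2_norm_nonneg a(1)], rule order_trans[OF L2_norm_nonneg g(1)],
        rule order_trans[OF L2_norm_nonneg g']) (simp_all add: \<delta>_def L2_norm_nonneg)
  from K[unfolded young_const_def, rule_format, of \<Delta>t H B a g g' \<delta> "gnrm \<rho>"] dt L01(3) B0 nn B_def
  have "16 * L^5 * (a * g + a * g' + H * a * \<delta> + (a + g) * gnrm \<rho> + \<Delta>t * H * a * (g' + gnrm \<rho>) + B * g' * gnrm \<rho>)
       + (1 / \<Delta>t) * (L * \<delta> * gnrm \<rho>) + L * (g' + 2 * g) * gnrm \<rho> + 2 * L\<^sup>2 * \<Delta>t * B\<^sup>2 * (gnrm \<rho>)\<^sup>2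
     \<le> \<delta>\<^sup>2 / (2 * \<Delta>t) + \<eta> * (g\<^sup>2 + g'\<^sup>2) + K * (1 + \<Delta>t * H\<^sup>2) * a\<^sup>2 + K * ((1 + \<Delta>t * H\<^sup>2) / \<Delta>t) * (gnrm \<rho>)\<^sup>2"
    by simp
  with step show ?thesis by linarith
qed

text \<open>
  The two choices of the test function: the error itself controls the grad-div term by the pressure
  differences, and removing the part in \<open>R\<^sub>h\<close> gets rid of the pressures altogether.
\<close>

lemma grad_div_estimate:
  assumes n: "n < M" and j: "j \<in> {1..N}"
  shows "\<gamma> / 2 * (nrm (dvg D (e (Suc n) j)))\<^sup>2 - 1 / (2 * \<gamma>) * (nrm (\<lambda>x. p (Suc n) j x - ph n j x))\<^sup>2
     \<le> \<gamma> * L2_inner D (dvg D (e (Suc n) j)) (dvg D (\<lambda>x. e (Suc n) j x - 0))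
          - L2_inner D (\<lambda>x. p (Suc n) j x - ph n j x) (dvg D (\<lambda>x. e (Suc n) j x - 0))"
proof -
  have p: "essbdd (\<lambda>x. p (Suc n) j x - ph n j x)"
  proof (rule essbdd_diff)
    show "essbdd (p (Suc n) j)"
      using coupled n j by (intro Qh_essbdd) (auto simp: coupled_half_def)
    show "essbdd (ph n j)"
      using spp n j by (cases n) (auto simp: SPP_half_def intro: Qh_essbdd essbdd_const)
  qed
  have eX: "e (Suc n) j \<in> Xh" using n j by (intro e_X) auto
  define s t where "s = nrm (\<lambda>x. p (Suc n) j x - ph n j x)" and "t = nrm (dvg D (e (Suc n) j))"
  have "L2_inner D (\<lambda>x. p (Suc n) j x - ph n j x) (dvg D (e (Suc n) j)) \<le> s * t"
    using L2_inner_Cauchy_Schwarz[OF p X_essbdd(3)[OF eX]] by (simp add: s_def t_def)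
  also have "\<dots> \<le> \<gamma> / 2 * t\<^sup>2 + 1 / (2 * \<gamma>) * s\<^sup>2"
  proof -
    have "0 \<le> (\<gamma> * t - s)\<^sup>2 / (2 * \<gamma>)" using \<gamma> by simp
    also have "\<dots> = \<gamma> / 2 * t\<^sup>2 + 1 / (2 * \<gamma>) * s\<^sup>2 - s * t" using \<gamma> by (simp add: field_simps power2_eq_square)
    finally show ?thesis by simp
  qed
  finally show ?thesis using L2_inner_self[of "dvg D (e (Suc n) j)"] by (simp add: s_def t_def)
qed

text \<open>The component in V_h has zero divergence almost everywhere, so the remainder
  \<open>\<rho>\<close> carries the whole divergence of the error and the stability constant of R_h
  applies to it.\<close>

lemma Rspace_part:
  assumes CR: "\<forall>w\<in>Rspace D Xh Qh. gnrm w \<le> CR * nrm (dvg D w)"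
    and n: "n \<le> M" and j: "j \<in> {1..N}"
  obtains \<rho> where "\<rho> \<in> Xh" "AE x in lebesgue_on D. dvg D (\<lambda>x. e n j x - \<rho> x) x = 0"
    "gnrm \<rho> \<le> CR * nrm (dvg D (e n j))"
proof -
  have eX: "e n j \<in> Xh" by (rule e_X[OF n j])
  obtain w where w: "w \<in> Vspace D Xh Qh" "(\<lambda>x. e n j x - w x) \<in> Rspace D Xh Qh"
    by (rule Rspace_projection[OF \<sigma>_pos eX])
  define \<rho> where "\<rho> = (\<lambda>x. e n j x - w x)"
  have wX: "w \<in> Xh" using w(1) by (simp add: Vspace_def)
  have \<rho>X: "\<rho> \<in> Xh" unfolding \<rho>_def by (rule X_diff[OF eX wX])
  show thesis
  proof (rule that[OF \<rho>X])
    show "AE x in lebesgue_on D. dvg D (\<lambda>x. e n j x - \<rho> x) x = 0"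
      using Vspace_dvg[OF w(1)] by (simp add: \<rho>_def)
    have "nrm (dvg D \<rho>) = nrm (dvg D (e n j))"
    proof (rule nrm_cong_AE)
      show "AE x in lebesgue_on D. dvg D \<rho> x = dvg D (e n j) x"
        using X_dvg_diff[OF eX wX] Vspace_dvg[OF w(1)] unfolding \<rho>_def by eventually_elim simp
    qed (intro X_essbdd(3) \<rho>X eX)+
    then show "gnrm \<rho> \<le> CR * nrm (dvg D (e n j))" using CR w(2) unfolding \<rho>_def by fastforce
  qed
qed

end

section \<open>Both fields together\<close>

text \<open>\<open>\<eta>\<close> is the share of the viscosity that may be spent on Young
  inequalities before the summation over \<open>N\<close> realizations exhausts an eighth of
  \<open>\<alpha>\<close>.\<close>

locale smhd_pair =
  V: smhd_half D \<T>0 \<T> k \<sigma> h L H Yh N \<nu> \<nu>m \<mu> \<gamma> \<Delta>t m M f1 v w vh wh vt q qh A1 A2 +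
  W: smhd_half D \<T>0 \<T> k \<sigma> h L H Yh N \<nu> \<nu>m \<mu> \<gamma> \<Delta>t m M f2 w v wh vh wt r rh A1 A2
  for D :: "(real^'d) set" and \<T>0 \<T> k \<sigma> h L H Yh N \<nu> \<nu>m \<mu> \<gamma> \<Delta>t m M f1 f2 v w vh wh vt wt q qh r rh A1 A2 +
  fixes \<alpha> \<eta> K CR :: real
  assumes \<alpha>: "0 < \<alpha>" and coef: "\<And>j. j \<in> {1..N} \<Longrightarrow> \<alpha> / 2 \<le> m - A1 j - A2 j"
    and \<eta>: "\<eta> = \<alpha> / (32 * (real N)\<^sup>2)" and K0: "0 < K"
    and young: "young_const L \<eta> K"
    and CR: "\<forall>w\<in>Rspace D (SV_velocity D \<T> k) (SV_pressure D \<T> k). L2_norm D (grad D w) \<le> CR * L2_norm D (dvg D w)"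
      "0 < CR"
begin

abbreviation "nm \<equiv> V.nrm"
abbreviation "gn \<equiv> V.gnrm"

definition "\<kappa> = K * (1 + \<Delta>t * H\<^sup>2)"
definition "\<theta> = \<Delta>t * (8 * (real N)\<^sup>2 * \<kappa>)"
definition G :: "nat \<Rightarrow> real" where "G n = (\<Sum>j=1..N. (gn (V.e n j))\<^sup>2 + (gn (W.e n j))\<^sup>2)"
definition Dv :: "nat \<Rightarrow> real" where "Dv n = (\<Sum>j=1..N. (V.nrm (dvg D (V.e n j)))\<^sup>2 + (V.nrm (dvg D (W.e n j)))\<^sup>2)"
definition Qp :: "nat \<Rightarrow> real" where
  "Qp n = (\<Sum>j=1..N. (L2_norm D (\<lambda>x. q (Suc n) j x - qh n j x))\<^sup>2 + (L2_norm D (\<lambda>x. r (Suc n) j x - rh n j x))\<^sup>2)"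
text \<open>Kinetic energy of the errors plus the gradient terms that one step leaves for the next:
  the weights with \<open>A1\<close> and \<open>A2\<close> are the cost of the explicit viscous
  terms, \<open>\<alpha> / 8\<close> is that of the absorbed old gradients.\<close>

definition \<Phi> :: "nat \<Rightarrow> real" where
  "\<Phi> n = (\<Sum>j=1..N. (nm (V.e n j))\<^sup>2 + (nm (W.e n j))\<^sup>2) / 2
     + \<Delta>t * ((\<Sum>j=1..N. (A1 j + A2 j) / 2 * ((gn (V.e n j))\<^sup>2 + (gn (W.e n j))\<^sup>2)) + \<alpha> / 8 * G n)"

lemma \<epsilon>_eq: "V.\<epsilon> = W.e" "W.\<epsilon> = V.e"
  by (auto simp: V.\<epsilon>_def W.\<epsilon>_def V.e_def W.e_def fun_eq_iff)

lemma \<kappa>0: "0 < \<kappa>"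
  using K0 V.dt(1) by (simp add: \<kappa>_def add_pos_nonneg)

lemma \<theta>0: "0 \<le> \<theta>"
  using \<kappa>0 V.dt(1) by (simp add: \<theta>_def)

lemma nonneg: "0 \<le> G n" "0 \<le> Dv n" "0 \<le> Qp n" "0 \<le> \<Phi> n"
proof -
  show G: "0 \<le> G n" and "0 \<le> Dv n" "0 \<le> Qp n"
    by (auto simp: G_def Dv_def Qp_def intro!: sum_nonneg)
  have "0 \<le> (\<Sum>j=1..N. (A1 j + A2 j) / 2 * ((gn (V.e n j))\<^sup>2 + (gn (W.e n j))\<^sup>2))"
    using V.visc1(3) V.visc2(3) by (intro sum_nonneg mult_nonneg_nonneg) auto
  moreover have "0 \<le> (\<Sum>j=1..N. (nm (V.e n j))\<^sup>2 + (nm (W.e n j))\<^sup>2)"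
    by (intro sum_nonneg) simp
  ultimately show "0 \<le> \<Phi> n" unfolding \<Phi>_def using G \<alpha> V.dt(1)
    by (intro add_nonneg_nonneg mult_nonneg_nonneg divide_nonneg_nonneg) auto
qed

lemma \<Phi>_0: "\<Phi> 0 = 0"
proof -
  have "V.e 0 j = (\<lambda>x. 0)" "W.e 0 j = (\<lambda>x. 0)" if "j \<in> {1..N}" for j
    using V.uh_0[OF that] W.uh_0[OF that] by (simp_all add: V.e_def W.e_def)
  moreover have "gn (\<lambda>x. 0) = 0"
    using V.gnrm_zero[OF V.u_X[of 0 1]] V.N_pos by simp
  moreover have "nm (\<lambda>x. 0 :: real^'d) = 0" by (simp add: L2_norm_def L2_inner_def)
  ultimately show ?thesis by (simp add: \<Phi>_def G_def)
qed

lemma pair_step: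
  fixes \<rho> \<rho>' :: "nat \<Rightarrow> real^'d \<Rightarrow> real^'d"
  assumes n: "n < M" and \<rho>: "\<And>j. j \<in> {1..N} \<Longrightarrow> \<rho> j \<in> SV_velocity D \<T> k" "\<And>j. j \<in> {1..N} \<Longrightarrow> \<rho>' j \<in> SV_velocity D \<T> k"
  defines "P \<equiv> \<lambda>j. \<gamma> * L2_inner D (dvg D (V.e (Suc n) j)) (dvg D (\<lambda>x. V.e (Suc n) j x - \<rho> j x))
          - L2_inner D (\<lambda>x. q (Suc n) j x - qh n j x) (dvg D (\<lambda>x. V.e (Suc n) j x - \<rho> j x))"
    and "P' \<equiv> \<lambda>j. \<gamma> * L2_inner D (dvg D (W.e (Suc n) j)) (dvg D (\<lambda>x. W.e (Suc n) j x - \<rho>' j x))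
          - L2_inner D (\<lambda>x. r (Suc n) j x - rh n j x) (dvg D (\<lambda>x. W.e (Suc n) j x - \<rho>' j x))"
  shows "\<Phi> (Suc n) + \<Delta>t * (\<alpha> / 4 * G (Suc n)) + \<Delta>t * (\<Sum>j=1..N. P j + P' j)
     \<le> (1 + \<theta>) * \<Phi> n + \<Delta>t * (\<kappa> / \<Delta>t) * (\<Sum>j=1..N. (gn (\<rho> j))\<^sup>2 + (gn (\<rho>' j))\<^sup>2)"
proof -
  define a where "a = (\<Sum>j=1..N. nm (V.e n j) + nm (W.e n j))"
  define g where "g = (\<Sum>j=1..N. gn (V.e n j) + gn (W.e n j))"
  define g' where "g' = (\<Sum>j=1..N. gn (V.e (Suc n) j) + gn (W.e (Suc n) j))"
  have mem: "x j \<le> (\<Sum>j=1..N. x j + y j)" "y j \<le> (\<Sum>j=1..N. x j + y j)"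
    if "j \<in> {1..N}" "\<And>j. 0 \<le> x j" "\<And>j. 0 \<le> y j" for x y :: "nat \<Rightarrow> real" and j
  proof -
    have "x j + y j \<le> (\<Sum>j=1..N. x j + y j)"
      by (rule member_le_sum[OF that(1)]) (simp_all add: that)
    then show "x j \<le> (\<Sum>j=1..N. x j + y j)" "y j \<le> (\<Sum>j=1..N. x j + y j)"
      using that(2)[of j] that(3)[of j] by linarith+
  qed
  have sums: "(\<Sum>j=1..N. x j) \<le> (\<Sum>j=1..N. x j + y j)" "(\<Sum>j=1..N. y j) \<le> (\<Sum>j=1..N. x j + y j)"
    if "\<And>j. 0 \<le> x j" "\<And>j. 0 \<le> y j" for x y :: "nat \<Rightarrow> real"
    using that by (auto intro!: sum_mono)
  have eq: "\<kappa> / \<Delta>t = K * ((1 + \<Delta>t * H\<^sup>2) / \<Delta>t)" by (simp add: \<kappa>_def)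
  note nn = V.L2_norm_nonneg
  note V1 = V.half_estimate[OF young n _ \<rho>(1), where a=a and g=g and g'=g', unfolded \<epsilon>_eq]
  note W1 = W.half_estimate[OF young n _ \<rho>(2), where a=a and g=g and g'=g', unfolded \<epsilon>_eq]
  have V2: "((nm (V.e (Suc n) j))\<^sup>2 - (nm (V.e n j))\<^sup>2) / (2 * \<Delta>t) + m * (gn (V.e (Suc n) j))\<^sup>2
       - A1 j * gn (W.e n j) * gn (V.e (Suc n) j) - A2 j * gn (V.e n j) * gn (V.e (Suc n) j) + P j
     \<le> \<eta> * (g\<^sup>2 + g'\<^sup>2) + \<kappa> * a\<^sup>2 + (\<kappa> / \<Delta>t) * (gn (\<rho> j))\<^sup>2" if j: "j \<in> {1..N}" for j
    unfolding P_def eq unfolding \<kappa>_def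
    by (rule V1[OF j j]; unfold a_def g_def g'_def; (rule mem[OF j nn nn] sums[OF nn nn]))
  have W2: "((nm (W.e (Suc n) j))\<^sup>2 - (nm (W.e n j))\<^sup>2) / (2 * \<Delta>t) + m * (gn (W.e (Suc n) j))\<^sup>2
       - A1 j * gn (V.e n j) * gn (W.e (Suc n) j) - A2 j * gn (W.e n j) * gn (W.e (Suc n) j) + P' j
     \<le> \<eta> * (g\<^sup>2 + g'\<^sup>2) + \<kappa> * a\<^sup>2 + (\<kappa> / \<Delta>t) * (gn (\<rho>' j))\<^sup>2" if j: "j \<in> {1..N}" for j
    unfolding P'_def eq unfolding \<kappa>_def
    by (rule W1[OF j j]; unfold a_def g_def g'_def; (rule mem[OF j nn nn] sums[OF nn nn]))
  have \<eta>0: "0 \<le> \<eta>" "32 * (real N)\<^sup>2 * \<eta> \<le> \<alpha>" using \<alpha> V.N_pos by (simp_all add: \<eta>)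
  show ?thesis
    using combine_half_steps[OF V2 W2 a_def g_def g'_def coef V.visc1(3) V.visc2(3) V.dt(1) \<eta>0(1) less_imp_le[OF \<kappa>0] \<alpha> \<eta>0(2)]
    unfolding \<Phi>_def G_def \<theta>_def by simp
qed

text \<open>After absorption of half the penalty, \<open>\<gamma> / 2\<close> stands in front of the
  divergences and \<open>1 / (2 * \<gamma>)\<close> in front of the pressure differences; the
  quotient is the factor \<open>1 / \<gamma>^2\<close>.\<close>

lemma grad_div_sum:
  "(\<Sum>n=1..M. Dv n) \<le> (1 + \<theta>) ^ M / \<gamma>\<^sup>2 * (\<Sum>n<M. Qp n)"
proof -
  have zX: "(\<lambda>x. 0) \<in> SV_velocity D \<T> k" using V.X_zero[OF V.u_X[of 0 1]] V.N_pos by simp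
  have step: "\<Phi> (Suc n) + \<Delta>t * (\<gamma> / 2) * Dv (Suc n) \<le> (1 + \<theta>) * \<Phi> n + \<Delta>t / (2 * \<gamma>) * Qp n" if n: "n < M" for n
  proof -
    have "(\<Sum>j=1..N. (\<gamma> / 2 * (V.nrm (dvg D (V.e (Suc n) j)))\<^sup>2 - 1 / (2 * \<gamma>) * (V.nrm (\<lambda>x. q (Suc n) j x - qh n j x))\<^sup>2)
        + (\<gamma> / 2 * (V.nrm (dvg D (W.e (Suc n) j)))\<^sup>2 - 1 / (2 * \<gamma>) * (V.nrm (\<lambda>x. r (Suc n) j x - rh n j x))\<^sup>2))
      \<le> (\<Sum>j=1..N. (\<gamma> * L2_inner D (dvg D (V.e (Suc n) j)) (dvg D (\<lambda>x. V.e (Suc n) j x - 0))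
          - L2_inner D (\<lambda>x. q (Suc n) j x - qh n j x) (dvg D (\<lambda>x. V.e (Suc n) j x - 0)))
        + (\<gamma> * L2_inner D (dvg D (W.e (Suc n) j)) (dvg D (\<lambda>x. W.e (Suc n) j x - 0))
          - L2_inner D (\<lambda>x. r (Suc n) j x - rh n j x) (dvg D (\<lambda>x. W.e (Suc n) j x - 0))))" (is "_ \<le> ?P")
      by (intro sum_mono add_mono V.grad_div_estimate W.grad_div_estimate n)
    also have "(\<Sum>j=1..N. (\<gamma> / 2 * (V.nrm (dvg D (V.e (Suc n) j)))\<^sup>2 - 1 / (2 * \<gamma>) * (V.nrm (\<lambda>x. q (Suc n) j x - qh n j x))\<^sup>2)
        + (\<gamma> / 2 * (V.nrm (dvg D (W.e (Suc n) j)))\<^sup>2 - 1 / (2 * \<gamma>) * (V.nrm (\<lambda>x. r (Suc n) j x - rh n j x))\<^sup>2))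
      = \<gamma> / 2 * Dv (Suc n) - 1 / (2 * \<gamma>) * Qp n"
      unfolding Dv_def Qp_def by (simp only: sum.distrib sum_subtractf sum_distrib_left distrib_left)
    finally have "\<Delta>t * (\<gamma> / 2 * Dv (Suc n) - 1 / (2 * \<gamma>) * Qp n) \<le> \<Delta>t * ?P"
      using V.dt(1) by (intro mult_left_mono) auto
    moreover have "\<Phi> (Suc n) + \<Delta>t * (\<alpha> / 4 * G (Suc n)) + \<Delta>t * ?P \<le> (1 + \<theta>) * \<Phi> n"
      using pair_step[OF n, where \<rho>="\<lambda>_ _. 0" and \<rho>'="\<lambda>_ _. 0", OF zX zX] V.gnrm_zero[OF zX] by simp
    moreover have "0 \<le> \<Delta>t * (\<alpha> / 4 * G (Suc n))" using V.dt(1) \<alpha> nonneg(1) by simp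
    moreover have "\<Delta>t * (\<gamma> / 2 * Dv (Suc n) - 1 / (2 * \<gamma>) * Qp n) = \<Delta>t * (\<gamma> / 2) * Dv (Suc n) - \<Delta>t / (2 * \<gamma>) * Qp n"
      by (simp add: right_diff_distrib)
    ultimately show ?thesis by linarith
  qed
  have pos: "0 < \<Delta>t" "0 < \<gamma>" by (rule V.dt(1), rule V.\<gamma>)
  have "\<Phi> M + (\<Sum>n=1..M. \<Delta>t * (\<gamma> / 2) * Dv n) \<le> (1 + \<theta>) ^ M * (\<Sum>n<M. \<Delta>t / (2 * \<gamma>) * Qp n)"
    by (rule discrete_gronwall[of M \<Phi> "\<lambda>n. \<Delta>t * (\<gamma> / 2) * Dv n", OF step \<Phi>_0 \<theta>0])
       (simp_all add: nonneg pos less_imp_le)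
  then have "\<Delta>t * (\<gamma> / 2) * (\<Sum>n=1..M. Dv n) \<le> (1 + \<theta>) ^ M * (\<Delta>t / (2 * \<gamma>) * (\<Sum>n<M. Qp n))"
    using nonneg(4)[of M] by (simp add: sum_distrib_left)
  also have "\<dots> = \<Delta>t * (\<gamma> / 2) * ((1 + \<theta>) ^ M / \<gamma>\<^sup>2 * (\<Sum>n<M. Qp n))"
    using pos by (simp add: power2_eq_square field_simps)
  finally show ?thesis using pos by (simp only: mult_le_cancel_left_pos mult_pos_pos half_gt_zero)
qed

text \<open>The forcing of this Gronwall argument is the divergence sum of the previous one, so the
  growth factor appears squared. It carries no factor \<open>\<Delta>t\<close>, because the
  remainder \<open>R^2 / \<Delta>t\<close> of the energy estimate is multiplied by
  \<open>\<Delta>t\<close>.\<close>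

lemma gradient_error_sum:
  "\<Delta>t * (\<Sum>n=1..M. G n) \<le> 4 * \<kappa> / \<alpha> * ((1 + \<theta>) ^ M)\<^sup>2 * CR\<^sup>2 / \<gamma>\<^sup>2 * (\<Sum>n<M. Qp n)"
proof -
  have step: "\<Phi> (Suc n) + \<Delta>t * (\<alpha> / 4) * G (Suc n) \<le> (1 + \<theta>) * \<Phi> n + \<kappa> * CR\<^sup>2 * Dv (Suc n)" if n: "n < M" for n
  proof -
    have n': "Suc n \<le> M" using n by simp
    have "\<forall>j\<in>{1..N}. \<exists>\<rho>. \<rho> \<in> SV_velocity D \<T> k \<and> (AE x in lebesgue_on D. dvg D (\<lambda>x. V.e (Suc n) j x - \<rho> x) x = 0)
        \<and> gn \<rho> \<le> CR * V.nrm (dvg D (V.e (Suc n) j))" (is "\<forall>j\<in>_. \<exists>\<rho>. ?R j \<rho>")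
    proof
      fix j assume j: "j \<in> {1..N}"
      show "\<exists>\<rho>. ?R j \<rho>" by (rule V.Rspace_part[OF CR(1) n' j]) (rule exI, intro conjI)
    qed
    then obtain \<rho> where "\<forall>j\<in>{1..N}. ?R j (\<rho> j)" by (rule bchoice[THEN exE])
    then have \<rho>: "\<rho> j \<in> SV_velocity D \<T> k" "AE x in lebesgue_on D. dvg D (\<lambda>x. V.e (Suc n) j x - \<rho> j x) x = 0"
        "gn (\<rho> j) \<le> CR * V.nrm (dvg D (V.e (Suc n) j))" if "j \<in> {1..N}" for j
      using that by simp_all
    have "\<forall>j\<in>{1..N}. \<exists>\<rho>. \<rho> \<in> SV_velocity D \<T> k \<and> (AE x in lebesgue_on D. dvg D (\<lambda>x. W.e (Suc n) j x - \<rho> x) x = 0)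
        \<and> gn \<rho> \<le> CR * V.nrm (dvg D (W.e (Suc n) j))" (is "\<forall>j\<in>_. \<exists>\<rho>. ?R j \<rho>")
    proof
      fix j assume j: "j \<in> {1..N}"
      show "\<exists>\<rho>. ?R j \<rho>" by (rule W.Rspace_part[OF CR(1) n' j]) (rule exI, intro conjI)
    qed
    then obtain \<rho>' where "\<forall>j\<in>{1..N}. ?R j (\<rho>' j)" by (rule bchoice[THEN exE])
    then have \<rho>': "\<rho>' j \<in> SV_velocity D \<T> k" "AE x in lebesgue_on D. dvg D (\<lambda>x. W.e (Suc n) j x - \<rho>' j x) x = 0"
        "gn (\<rho>' j) \<le> CR * V.nrm (dvg D (W.e (Suc n) j))" if "j \<in> {1..N}" for j
      using that by simp_all
    have P: "(\<Sum>j=1..N. (\<gamma> * L2_inner D (dvg D (V.e (Suc n) j)) (dvg D (\<lambda>x. V.e (Suc n) j x - \<rho> j x))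
          - L2_inner D (\<lambda>x. q (Suc n) j x - qh n j x) (dvg D (\<lambda>x. V.e (Suc n) j x - \<rho> j x)))
        + (\<gamma> * L2_inner D (dvg D (W.e (Suc n) j)) (dvg D (\<lambda>x. W.e (Suc n) j x - \<rho>' j x))
          - L2_inner D (\<lambda>x. r (Suc n) j x - rh n j x) (dvg D (\<lambda>x. W.e (Suc n) j x - \<rho>' j x)))) = 0"
      by (rule sum.neutral) (simp add: V.L2_inner_eq_0_AE(2)[OF \<rho>(2)] V.L2_inner_eq_0_AE(2)[OF \<rho>'(2)])
    have "(\<Sum>j=1..N. (gn (\<rho> j))\<^sup>2 + (gn (\<rho>' j))\<^sup>2)
        \<le> (\<Sum>j=1..N. (CR * V.nrm (dvg D (V.e (Suc n) j)))\<^sup>2 + (CR * V.nrm (dvg D (W.e (Suc n) j)))\<^sup>2)"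
      by (intro sum_mono add_mono power_mono \<rho>(3) \<rho>'(3) V.L2_norm_nonneg)
    also have "\<dots> = CR\<^sup>2 * Dv (Suc n)" by (simp add: Dv_def power_mult_distrib sum_distrib_left distrib_left)
    finally have "\<kappa> * (\<Sum>j=1..N. (gn (\<rho> j))\<^sup>2 + (gn (\<rho>' j))\<^sup>2) \<le> \<kappa> * (CR\<^sup>2 * Dv (Suc n))"
      using \<kappa>0 by (intro mult_left_mono) auto
    moreover have "\<Phi> (Suc n) + \<Delta>t * (\<alpha> / 4 * G (Suc n))
        \<le> (1 + \<theta>) * \<Phi> n + \<Delta>t * (\<kappa> / \<Delta>t) * (\<Sum>j=1..N. (gn (\<rho> j))\<^sup>2 + (gn (\<rho>' j))\<^sup>2)"
      using pair_step[OF n, where \<rho>=\<rho> and \<rho>'=\<rho>', OF \<rho>(1) \<rho>'(1)] unfolding P by (simp only: mult_zero_right add_0_right)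
    moreover have "\<Delta>t * (\<kappa> / \<Delta>t) = \<kappa>" using V.dt(1) by simp
    ultimately show ?thesis by (simp add: mult_ac)
  qed
  have pos: "0 < \<Delta>t" "0 < \<gamma>" by (rule V.dt(1), rule V.\<gamma>)
  have E0: "0 \<le> (1 + \<theta>) ^ M" using \<theta>0 by simp
  have "\<Phi> M + (\<Sum>n=1..M. \<Delta>t * (\<alpha> / 4) * G n) \<le> (1 + \<theta>) ^ M * (\<Sum>n<M. \<kappa> * CR\<^sup>2 * Dv (Suc n))"
    by (rule discrete_gronwall[of M \<Phi> "\<lambda>n. \<Delta>t * (\<alpha> / 4) * G n", OF step \<Phi>_0 \<theta>0])
       (simp_all add: nonneg pos \<alpha> \<kappa>0 less_imp_le)
  \<comment> \<open>The step from level \<open>n\<close> is forced by the divergence at level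
    \<open>n + 1\<close>, so the shifted sum runs over exactly the levels that have been
    estimated.\<close>
  moreover have "(\<Sum>n<M. \<kappa> * CR\<^sup>2 * Dv (Suc n)) = \<kappa> * CR\<^sup>2 * (\<Sum>n=1..M. Dv n)"
    using sum.shift_bounds_Suc_ivl[of Dv 0 M] by (simp add: sum_distrib_left lessThan_atLeast0 atLeastLessThanSuc_atLeastAtMost)
  ultimately have "\<Delta>t * (\<alpha> / 4) * (\<Sum>n=1..M. G n) \<le> (1 + \<theta>) ^ M * (\<kappa> * CR\<^sup>2 * (\<Sum>n=1..M. Dv n))"
    using nonneg(4)[of M] by (simp add: sum_distrib_left)
  also have "\<dots> \<le> (1 + \<theta>) ^ M * (\<kappa> * CR\<^sup>2 * ((1 + \<theta>) ^ M / \<gamma>\<^sup>2 * (\<Sum>n<M. Qp n)))"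
    using grad_div_sum E0 \<kappa>0 by (intro mult_left_mono) auto
  also have "\<dots> = \<alpha> / 4 * (4 * \<kappa> / \<alpha> * ((1 + \<theta>) ^ M)\<^sup>2 * CR\<^sup>2 / \<gamma>\<^sup>2 * (\<Sum>n<M. Qp n))"
    using \<alpha> by (simp add: power2_eq_square field_simps)
  finally have "\<alpha> / 4 * (\<Delta>t * (\<Sum>n=1..M. G n)) \<le> \<alpha> / 4 * (4 * \<kappa> / \<alpha> * ((1 + \<theta>) ^ M)\<^sup>2 * CR\<^sup>2 / \<gamma>\<^sup>2 * (\<Sum>n<M. Qp n))"
    by (simp add: mult_ac)
  then show ?thesis using \<alpha> by (simp only: mult_le_cancel_left_pos divide_pos_pos zero_less_numeral)
qed

lemma average_error:
  assumes n: "n \<le> M"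
  shows "(L2_norm D (\<lambda>x. grad D (avg N (v n)) x - grad D (avg N (vh n)) x))\<^sup>2
     + (L2_norm D (\<lambda>x. grad D (avg N (w n)) x - grad D (avg N (wh n)) x))\<^sup>2 \<le> real N * G n"
proof -
  have avg1: "(V.nrm (\<lambda>x. grad D (avg N z) x - grad D (avg N y) x))\<^sup>2 \<le> real N * (\<Sum>j=1..N. (gn (\<lambda>x. z j x - y j x))\<^sup>2)"
    if X: "\<And>j. j \<in> {1..N} \<Longrightarrow> z j \<in> SV_velocity D \<T> k" "\<And>j. j \<in> {1..N} \<Longrightarrow> y j \<in> SV_velocity D \<T> k" for z y
  proof -
    have aX: "avg N z \<in> SV_velocity D \<T> k" "avg N y \<in> SV_velocity D \<T> k"
      by (rule V.avg_X[OF X(1) V.N_pos], assumption, rule V.avg_X[OF X(2) V.N_pos])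
    have dX: "(\<lambda>x. z j x - y j x) \<in> SV_velocity D \<T> k" if "j \<in> {1..N}" for j by (rule V.X_diff[OF X(1)[OF that] X(2)[OF that]])
    have "V.nrm (\<lambda>x. grad D (avg N z) x - grad D (avg N y) x) = gn (\<lambda>x. avg N z x - avg N y x)"
    proof (rule V.nrm_cong_AE)
      show "AE x in lebesgue_on D. grad D (avg N z) x - grad D (avg N y) x = grad D (\<lambda>x. avg N z x - avg N y x) x"
        using V.X_grad_diff[OF aX] by eventually_elim simp
    qed (intro V.essbdd_diff V.X_essbdd(2) V.X_diff aX)+
    also have "\<dots> = gn (avg N (\<lambda>j x. z j x - y j x))" unfolding avg_diff ..
    also have "\<dots> \<le> (\<Sum>j=1..N. gn (\<lambda>x. z j x - y j x))"
      by (rule V.nrm_avg_le(2)[OF dX V.N_pos])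
    finally have "(V.nrm (\<lambda>x. grad D (avg N z) x - grad D (avg N y) x))\<^sup>2 \<le> (\<Sum>j=1..N. 1 * gn (\<lambda>x. z j x - y j x))\<^sup>2"
      by (intro power_mono) (auto simp: V.L2_norm_nonneg)
    also have "\<dots> \<le> (\<Sum>j=1..N. 1\<^sup>2) * (\<Sum>j=1..N. (gn (\<lambda>x. z j x - y j x))\<^sup>2)" by (rule Cauchy_Schwarz_ineq_sum)
    finally show ?thesis by simp
  qed
  have "(V.nrm (\<lambda>x. grad D (avg N (v n)) x - grad D (avg N (vh n)) x))\<^sup>2 \<le> real N * (\<Sum>j=1..N. (gn (V.e n j))\<^sup>2)"
    unfolding V.e_def by (rule avg1) (auto intro: V.u_X V.uh_X n)
  moreover have "(V.nrm (\<lambda>x. grad D (avg N (w n)) x - grad D (avg N (wh n)) x))\<^sup>2 \<le> real N * (\<Sum>j=1..N. (gn (W.e n j))\<^sup>2)"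
    unfolding W.e_def by (rule avg1) (auto intro: W.u_X W.uh_X n)
  ultimately show ?thesis by (simp add: G_def sum.distrib distrib_left)
qed

text \<open>The first summand of \<open>C\<close> bounds the factor in front of the exponential. The
  second makes \<open>C / \<alpha>\<close> large enough for the exponent, since the growth rate is
  proportional to \<open>\<Delta>t / h^3\<close> without the factor
  \<open>1 / \<alpha>\<close>.\<close>

lemma average_gradient_error_bound:
  assumes H: "H\<^sup>2 = 1 / h ^ 3" and T: "real M * \<Delta>t = T"
    and C: "C = 4 * K * real N * exp (16 * (real N)\<^sup>2 * K * T) + \<alpha> * (1 + 16 * (real N)\<^sup>2 * K * T)"
  shows "\<Delta>t * (\<Sum>n=1..M.
          (L2_norm D (\<lambda>x. grad D (avg N (v n)) x - grad D (avg N (vh n)) x))\<^sup>2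
          + (L2_norm D (\<lambda>x. grad D (avg N (w n)) x - grad D (avg N (wh n)) x))\<^sup>2)
      \<le> C * CR\<^sup>2 / \<gamma>\<^sup>2 * (1 / (\<alpha> ^ 3 * \<Delta>t) + 1 / (\<alpha> * \<Delta>t) + \<Delta>t / \<alpha> + 1)
          * exp (C * Cs\<^sup>2 / \<alpha> + C * \<Delta>t / (h ^ 3 * \<alpha>)) * (\<Delta>t * (\<Sum>n<M. Qp n))"
proof -
  define t where "t = \<Delta>t * H\<^sup>2"
  \<comment> \<open>Twice the number of steps times \<open>\<theta>\<close> equals
    \<open>c * (1 + t)\<close>; the 2 comes from squaring the growth factor.\<close>
  define c where "c = 16 * (real N)\<^sup>2 * K * T"
  have pos: "0 < \<Delta>t" "0 < \<gamma>" "0 < \<alpha>" by (rule V.dt(1), rule V.\<gamma>, rule \<alpha>)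
  have t0: "0 \<le> t" using pos by (simp add: t_def)
  have "0 \<le> T" using T pos by (metis less_imp_le mult_nonneg_nonneg of_nat_0_le_iff)
  then have c0: "0 \<le> c" using K0 by (simp add: c_def)
  have \<kappa>t: "\<kappa> = K * (1 + t)" by (simp add: \<kappa>_def t_def)
  define S where "S = (\<Sum>n<M. Qp n)"
  have S0: "0 \<le> S" unfolding S_def by (rule sum_nonneg) (rule nonneg)
  have "1 + \<theta> \<le> exp \<theta>" by (rule exp_ge_add_one_self)
  then have "((1 + \<theta>) ^ M)\<^sup>2 \<le> (exp \<theta> ^ M)\<^sup>2" using \<theta>0 by (intro power_mono) auto
  also have "\<dots> = exp \<theta> ^ (2 * M)" by (rule power_even_eq[symmetric])
  also have "\<dots> = exp (real (2 * M) * \<theta>)" by (rule exp_of_nat_mult[symmetric])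
  also have "real (2 * M) * \<theta> = 16 * (real N)\<^sup>2 * K * (1 + t) * (real M * \<Delta>t)" by (simp add: \<theta>_def \<kappa>t)
  also have "\<dots> = c + c * t" unfolding T by (simp add: c_def algebra_simps)
  finally have E: "((1 + \<theta>) ^ M)\<^sup>2 \<le> exp (c + c * t)" .
  \<comment> \<open>The factor \<open>1 + t\<close> inside \<open>\<kappa>\<close> would blow up
    under refinement at a fixed time step; it is moved into the exponential by
    \<open>1 + t \<le> exp t\<close>.\<close>
  have \<kappa>E: "\<kappa> * ((1 + \<theta>) ^ M)\<^sup>2 \<le> K * exp c * exp ((1 + c) * t)"
  proof -
    have "\<kappa> * ((1 + \<theta>) ^ M)\<^sup>2 \<le> (K * exp t) * exp (c + c * t)"
      unfolding \<kappa>t using K0 t0 E exp_ge_add_one_self[of t] by (intro mult_mono mult_left_mono) auto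
    also have "\<dots> = K * exp c * exp ((1 + c) * t)"
      by (simp add: exp_add[symmetric] mult.assoc) (simp add: algebra_simps)
    finally show ?thesis .
  qed
  have C0: "4 * K * real N * exp c \<le> C" "\<alpha> * (1 + c) \<le> C"
    using C pos c0 K0 by (simp_all add: c_def)
  then have "0 \<le> C" using pos c0 by (auto intro: order_trans[OF _ C0(2)])
  have ex: "exp ((1 + c) * t) \<le> exp (C * Cs\<^sup>2 / \<alpha> + C * \<Delta>t / (h ^ 3 * \<alpha>))"
  proof (subst exp_le_cancel_iff)
    have "\<alpha> * (1 + c) * (t / \<alpha>) \<le> C * (t / \<alpha>)" using C0(2) pos t0 by (intro mult_right_mono) auto
    then have "(1 + c) * t \<le> C * (t / \<alpha>)" using pos by simp
    also have "\<dots> = C * \<Delta>t / (h ^ 3 * \<alpha>)" by (simp add: t_def H)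
    finally show "(1 + c) * t \<le> C * Cs\<^sup>2 / \<alpha> + C * \<Delta>t / (h ^ 3 * \<alpha>)"
      using \<open>0 \<le> C\<close> pos by (simp add: add_increasing)
  qed
  have "\<Delta>t * (\<Sum>n=1..M.
          (L2_norm D (\<lambda>x. grad D (avg N (v n)) x - grad D (avg N (vh n)) x))\<^sup>2
          + (L2_norm D (\<lambda>x. grad D (avg N (w n)) x - grad D (avg N (wh n)) x))\<^sup>2)
      \<le> \<Delta>t * (\<Sum>n=1..M. real N * G n)"
    using pos by (intro mult_left_mono sum_mono average_error) auto
  also have "\<dots> = real N * (\<Delta>t * (\<Sum>n=1..M. G n))" by (simp add: sum_distrib_left mult_ac)
  also have "\<dots> \<le> real N * (4 * \<kappa> / \<alpha> * ((1 + \<theta>) ^ M)\<^sup>2 * CR\<^sup>2 / \<gamma>\<^sup>2 * S)"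
    unfolding S_def by (intro mult_left_mono gradient_error_sum) simp
  also have "\<dots> = (4 * real N * (\<kappa> * ((1 + \<theta>) ^ M)\<^sup>2)) * (CR\<^sup>2 / \<gamma>\<^sup>2 * S / \<alpha>)" by (simp add: mult_ac)
  also have "\<dots> \<le> (4 * real N * (K * exp c * exp ((1 + c) * t))) * (CR\<^sup>2 / \<gamma>\<^sup>2 * S / \<alpha>)"
    using S0 pos by (intro mult_right_mono mult_left_mono \<kappa>E) auto
  also have "\<dots> = (4 * K * real N * exp c) * exp ((1 + c) * t) * (CR\<^sup>2 / \<gamma>\<^sup>2 * S / \<alpha>)" by (simp add: mult_ac)
  also have "\<dots> \<le> C * exp (C * Cs\<^sup>2 / \<alpha> + C * \<Delta>t / (h ^ 3 * \<alpha>)) * (CR\<^sup>2 / \<gamma>\<^sup>2 * S / \<alpha>)"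
    using C0(1) ex \<open>0 \<le> C\<close> S0 pos by (intro mult_right_mono mult_mono) auto
  \<comment> \<open>Writing the sum of the pressure differences with its factor
    \<open>\<Delta>t\<close> produces \<open>1 / (\<alpha> * \<Delta>t)\<close>, one of the four
    summands of the bracket; the others are nonnegative and are added afterwards.\<close>
  also have "\<dots> = (C * CR\<^sup>2 / \<gamma>\<^sup>2 * exp (C * Cs\<^sup>2 / \<alpha> + C * \<Delta>t / (h ^ 3 * \<alpha>)) * (\<Delta>t * S)) * (1 / (\<alpha> * \<Delta>t))"
    using pos by (simp add: field_simps)
  also have "\<dots> \<le> (C * CR\<^sup>2 / \<gamma>\<^sup>2 * exp (C * Cs\<^sup>2 / \<alpha> + C * \<Delta>t / (h ^ 3 * \<alpha>)) * (\<Delta>t * S))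
      * (1 / (\<alpha> ^ 3 * \<Delta>t) + 1 / (\<alpha> * \<Delta>t) + \<Delta>t / \<alpha> + 1)"
    using \<open>0 \<le> C\<close> S0 pos by (intro mult_left_mono) auto
  finally show ?thesis unfolding S_def by (simp only: mult_ac)
qed

end

section \<open>Constants independent of the mesh\<close>

context sv_mesh
begin

lemma h_le:
  assumes R: "\<And>x. x \<in> D \<Longrightarrow> norm x \<le> R"
  shows "h \<le> 2 * R"
proof -
  have "diameter K \<le> 2 * R" if K: "K \<in> \<T>" for K
  proof -
    have "closure D \<subseteq> cball 0 R" using R by (intro closure_minimal) auto
    then have KR: "K \<subseteq> cball 0 R" using Union_\<T> K by blast
    have "diameter K \<le> diameter (cball (0::real^'d) R)" by (rule diameter_subset[OF KR]) simp
    moreover obtain x where "x \<in> D" using D_nonempty by blast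
    then have "0 \<le> R" using R[of x] norm_ge_zero[of x] by linarith
    ultimately show ?thesis by simp
  qed
  then show ?thesis unfolding h_def mesh_size_def using finite_\<T> \<T>_nonempty by simp
qed

text \<open>In dimension 2 or 3 the factors \<open>1 / h^d\<close> and \<open>1 / h^2\<close> are at
  most a constant times \<open>1 / h^3\<close>, because \<open>h\<close> does not exceed the
  diameter of a ball around the domain. Hence the same \<open>H\<close> serves both dimensions and
  both inverse inequalities.\<close>

lemma fe_space_mesh:
  assumes d: "CARD('d) \<in> {2, 3}" and R: "\<And>x. x \<in> D \<Longrightarrow> norm x \<le> R" "0 \<le> R"
    and C1: "\<And>p (x0::real^'d) h x. p \<in> polys k \<Longrightarrow> 0 < h \<Longrightarrow> x \<in> cball x0 (2 * h) \<Longrightarrow>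
     (p x)\<^sup>2 \<le> C1 / h ^ CARD('d) * (\<integral>z. indicator (cball x0 (h / \<sigma>)) z * (p z)\<^sup>2 \<partial>lborel)" "0 < C1"
    and C2: "\<And>p (x0::real^'d) h x i. p \<in> polys k \<Longrightarrow> 0 < h \<Longrightarrow> x \<in> cball x0 h \<Longrightarrow>
     (partial i p x)\<^sup>2 \<le> C2 / (h ^ CARD('d) * h\<^sup>2) * (\<integral>z. indicator (cball x0 (h / \<sigma>)) z * (p z)\<^sup>2 \<partial>lborel)" "0 < C2"
    and L: "1 \<le> L" "real CARD('d) \<le> L" "2 * real CARD('d) * R \<le> L"
      "real CARD('d) * C1 * (1 + 2 * R) \<le> L"
      "(real CARD('d))\<^sup>2 * unit_ball_vol (real CARD('d)) * real (CARD('d) + 1) * C2 * (1 + 2 * R) \<le> L"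
    and H: "H = sqrt (1 / h ^ 3)"
  shows "fe_space D Xh L H"
proof -
  have hR: "h \<le> 1 + 2 * R" using h_le[OF R(1)] by simp
  have H2: "H\<^sup>2 = 1 / h ^ 3" using h_pos by (simp add: H)
  have H0: "0 < H" using h_pos by (simp add: H)
  have LL: "L \<le> L\<^sup>2" using L(1) by (simp add: power2_eq_square)
  have sc: "c / h ^ m \<le> L\<^sup>2 * H\<^sup>2" if c: "0 \<le> c" "c * (1 + 2 * R) \<le> L" and m: "m \<in> {2, 3}" for c m
  proof -
    have "h ^ 3 / h ^ m \<le> 1 + 2 * R"
      using m hR h_pos R(2) by (auto simp: power3_eq_cube power2_eq_square)
    then have "c * (h ^ 3 / h ^ m) \<le> c * (1 + 2 * R)" using c(1) by (rule mult_left_mono)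
    also have "\<dots> \<le> L\<^sup>2" using c(2) LL by linarith
    finally have "c * (h ^ 3 / h ^ m) / h ^ 3 \<le> L\<^sup>2 / h ^ 3" using h_pos by (intro divide_right_mono) auto
    moreover have "c * (h ^ 3 / h ^ m) / h ^ 3 = c / h ^ m" using h_pos by simp
    ultimately show ?thesis by (simp add: H2)
  qed
  have root: "x \<le> L * H * y" if "x\<^sup>2 \<le> c * y\<^sup>2" "c \<le> L\<^sup>2 * H\<^sup>2" "0 \<le> y" for x y c :: real
  proof (rule power2_le_imp_le)
    have "c * y\<^sup>2 \<le> L\<^sup>2 * H\<^sup>2 * y\<^sup>2" by (rule mult_right_mono[OF that(2)]) simp
    then show "x\<^sup>2 \<le> (L * H * y)\<^sup>2" using that(1) by (simp add: power_mult_distrib)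
    show "0 \<le> L * H * y" using L(1) H0 that(3) by simp
  qed
  show ?thesis
  proof unfold_locales
    fix u assume u: "u \<in> Xh"
    show "u \<in> H10 D" "vplip u" by (rule SV_H10[OF u], rule SV_vplip[OF u])
    have "nrm u \<le> 2 * real CARD('d) * R * gnrm u" by (rule Poincare[OF SV_H10[OF u] SV_vplip[OF u] R])
    also have "\<dots> \<le> L * gnrm u" by (rule mult_right_mono[OF L(3) L2_norm_nonneg])
    finally show "nrm u \<le> L * gnrm u" .
    have "norm (u x) \<le> L * H * nrm u" if x: "x \<in> D" for x
    proof (rule root[OF value_bound_on_cell[OF C1 u]])
      show "x \<in> closure D" using x closure_subset by blast
      show "real CARD('d) * C1 / h ^ CARD('d) \<le> L\<^sup>2 * H\<^sup>2" by (rule sc[OF _ L(4) d]) (use C1(2) in simp)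
    qed (assumption | rule L2_norm_nonneg)+
    then show "AE x in lebesgue_on D. norm (u x) \<le> L * H * nrm u"
      by (intro AE_I2) (simp add: space_restrict_space)
    show "gnrm u \<le> L * H * nrm u"
    proof (rule root[OF gradient_inverse_bound[OF C2 u]])
      show "(real CARD('d))\<^sup>2 * unit_ball_vol (real CARD('d)) * real (CARD('d) + 1) * C2 / h\<^sup>2 \<le> L\<^sup>2 * H\<^sup>2"
        by (rule sc[OF _ L(5)]) (use C2(2) in simp_all)
    qed (assumption | rule L2_norm_nonneg)+
  qed (use SV_lincomb L H0 in auto)
qed

end

lemma smhd_halfI:
  fixes D :: "(real^'d) set"
  assumes mesh: "sv_mesh D \<T>0 \<T> \<sigma> h" and fe: "fe_space D (SV_velocity D \<T> k) L H"
    and cu: "coupled_half D (SV_velocity D \<T> k) (SV_pressure D \<T> k) N \<nu> \<nu>m \<mu> \<Delta>t M f u z p"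
    and cz: "coupled_half D (SV_velocity D \<T> k) (SV_pressure D \<T> k) N \<nu> \<nu>m \<mu> \<Delta>t M f' z u r"
    and su: "SPP_half D (SV_velocity D \<T> k) Yh (SV_pressure D \<T> k) N \<nu> \<nu>m \<mu> \<gamma> \<Delta>t M f (u 0) uh ut zh ph"
    and sz: "SPP_half D (SV_velocity D \<T> k) Yh (SV_pressure D \<T> k) N \<nu> \<nu>m \<mu> \<gamma> \<Delta>t M f' (z 0) zh zt uh rh"
    and Y: "conforming_Ytilde D \<T> Yh" "SV_velocity D \<T> k \<subseteq> Yh"
    and N: "1 \<le> N" "real N \<le> L" and dt: "0 < \<Delta>t" "\<Delta>t \<le> L" and \<mu>: "0 < \<mu>" "\<mu> \<le> L" and \<gamma>: "0 < \<gamma>"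
    and bd: "\<And>j n. j \<in> {1..N} \<Longrightarrow> n \<in> {1..M} \<Longrightarrow> L3_norm D (grad D (u n j)) + L3_norm D (grad D (z n j))
           + Linf_norm D (u n j) + Linf_norm D (z n j) \<le> Cs \<and> Linf_norm D (uh n j) \<le> Cs \<and> Linf_norm D (zh n j) \<le> Cs"
    and init: "\<And>j. j \<in> {1..N} \<Longrightarrow> L2_norm D (z 0 j) \<le> L"
    and Cs: "Cs \<le> L" "measure lebesgue D + \<bar>Cs\<bar> ^ 3 \<le> L"
    and visc: "bounded_domain.essbdd D (\<lambda>x. (avg N \<nu> x + avg N \<nu>m x) / 2)" "0 \<le> m"
      "AE x in lebesgue_on D. m \<le> (avg N \<nu> x + avg N \<nu>m x) / 2 \<and> (avg N \<nu> x + avg N \<nu>m x) / 2 \<le> L"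
    and visc1: "\<And>j. j \<in> {1..N} \<Longrightarrow> bounded_domain.essbdd D (\<lambda>x. (\<nu> j x - \<nu>m j x) / 2)"
      "\<And>j. j \<in> {1..N} \<Longrightarrow> AE x in lebesgue_on D. \<bar>(\<nu> j x - \<nu>m j x) / 2\<bar> \<le> A1 j"
      "\<And>j. j \<in> {1..N} \<Longrightarrow> 0 \<le> A1 j" "\<And>j. j \<in> {1..N} \<Longrightarrow> A1 j \<le> L"
    and visc2: "\<And>j. j \<in> {1..N} \<Longrightarrow> bounded_domain.essbdd D (\<lambda>x. (fluct N \<nu> j x + fluct N \<nu>m j x) / 2)"
      "\<And>j. j \<in> {1..N} \<Longrightarrow> AE x in lebesgue_on D. \<bar>(fluct N \<nu> j x + fluct N \<nu>m j x) / 2\<bar> \<le> A2 j"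
      "\<And>j. j \<in> {1..N} \<Longrightarrow> 0 \<le> A2 j" "\<And>j. j \<in> {1..N} \<Longrightarrow> A2 j \<le> L"
  shows "smhd_half D \<T>0 \<T> k \<sigma> h L H Yh N \<nu> \<nu>m \<mu> \<gamma> \<Delta>t m M f u z uh zh ut p ph A1 A2"
proof -
  interpret sv_mesh D \<T>0 \<T> k \<sigma> h by (rule mesh)
  interpret fe_space D "SV_velocity D \<T> k" L H by (rule fe)
  have V: "u n j \<in> Vspace D Xh Qh" "z n j \<in> Vspace D Xh Qh" if "n \<le> M" "j \<in> {1..N}" for n j
    using cu cz that by (cases n; auto simp: coupled_half_def Vspace_def)+
  then have X: "u n j \<in> Xh" "z n j \<in> Xh" if "n \<le> M" "j \<in> {1..N}" for n j using that by (auto simp: Vspace_def)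
  have hX: "uh n j \<in> Xh" "zh n j \<in> Xh" if "n \<le> M" "j \<in> {1..N}" for n j
    using su sz that by (cases n; auto simp: SPP_half_def Vspace_def)+
  have zh0: "zh 0 j = z 0 j" if "j \<in> {1..N}" for j using sz that by (auto simp: SPP_half_def)
  have bound: "(AE x in lebesgue_on D. norm (u n j x) \<le> L \<and> norm (z n j x) \<le> L \<and> norm (uh n j x) \<le> L \<and> norm (zh n j x) \<le> L)
      \<and> gnrm (u n j) \<le> L" if n: "n \<in> {1..M}" and j: "j \<in> {1..N}" for n j
  proof -
    have n': "n \<le> M" using n by simp
    note xx = X[OF n' j] hX[OF n' j]
    have l3: "0 \<le> L3_norm D (grad D (u n j))" "0 \<le> L3_norm D (grad D (z n j))"
      by (intro nrm_le_L3_norm(2) X_essbdd(2) xx)+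
    have li: "0 \<le> Linf_norm D (u n j)" "0 \<le> Linf_norm D (z n j)"
      by (intro Linf_norm_nonneg X_essbdd(1) xx D_nonempty)+
    \<comment> \<open>The summands bounded together by \<open>Cs\<close> are nonnegative, so each of
      them is bounded by it.\<close>
    have le: "Linf_norm D (u n j) \<le> L" "Linf_norm D (z n j) \<le> L" "Linf_norm D (uh n j) \<le> L" "Linf_norm D (zh n j) \<le> L"
      "L3_norm D (grad D (u n j)) \<le> \<bar>Cs\<bar>"
      using bd[OF j n] l3 li Cs(1) by linarith+
    have "AE x in lebesgue_on D. norm (u n j x) \<le> L \<and> norm (z n j x) \<le> L \<and> norm (uh n j x) \<le> L \<and> norm (zh n j x) \<le> L"
      using AE_le_Linf_norm[OF X_essbdd(1)[OF xx(1)]] AE_le_Linf_norm[OF X_essbdd(1)[OF xx(2)]]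
        AE_le_Linf_norm[OF X_essbdd(1)[OF xx(3)]] AE_le_Linf_norm[OF X_essbdd(1)[OF xx(4)]]
    proof eventually_elim
      case (elim x)
      then show ?case using le by linarith
    qed
    moreover have "gnrm (u n j) \<le> L"
    proof (rule power2_le_imp_le)
      have "(gnrm (u n j))\<^sup>2 \<le> measure lebesgue D + (L3_norm D (grad D (u n j))) ^ 3"
        by (rule nrm_le_L3_norm(1)[OF X_essbdd(2)[OF xx(1)]])
      also have "\<dots> \<le> measure lebesgue D + \<bar>Cs\<bar> ^ 3" by (intro add_left_mono power_mono le(5) l3)
      also have "\<dots> \<le> L" by (rule Cs(2))
      also have "\<dots> \<le> L\<^sup>2" using L1 by (simp add: power2_eq_square)
      finally show "(gnrm (u n j))\<^sup>2 \<le> L\<^sup>2" .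
      show "0 \<le> L" using L1 by simp
    qed
    ultimately show ?thesis ..
  qed
  show ?thesis
    by (intro smhd_half.intro mesh fe smhd_half_axioms.intro)
       (fact cu su V hX zh0 Y N dt \<mu> \<gamma> bound init visc visc1 visc2)+
qed

section \<open>The penalty error estimate\<close>

theorem theorem4p3:
  fixes D :: "(real^'d) set"
    and \<nu> \<nu>m :: "nat \<Rightarrow> real^'d \<Rightarrow> real"
    and f1 f2 :: "nat \<Rightarrow> real \<Rightarrow> (real^'d \<Rightarrow> real^'d) \<Rightarrow> real"
    and N k :: nat
    and T \<mu> \<sigma> \<beta> Cstar C0 :: real
  assumes "CARD('d) \<in> {2, 3}"
    and "convex_polytopal_domain D"
    and "CARD('d) \<le> k"
    and "1 \<le> N" "0 < T" "0 < \<mu>" "0 < \<sigma>" "0 < \<beta>"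
    and "\<forall>j\<in>{1..N}. \<nu> j \<in> borel_measurable (lebesgue_on D) \<and> bounded (\<nu> j ` D)"
    and "\<forall>j\<in>{1..N}. \<nu>m j \<in> borel_measurable (lebesgue_on D) \<and> bounded (\<nu>m j ` D)"
    and "\<forall>j\<in>{1..N}. f1 j \<in> L2_Hm1 D T \<inter> Linf_Hm1 D T \<and> f2 j \<in> L2_Hm1 D T \<inter> Linf_Hm1 D T"
    and "0 < alpha_min D N \<nu> \<nu>m"
  shows "\<exists>C>0. \<forall>CR \<T>0 \<T> h Xh Yh Qh \<Delta>t M \<gamma> v w q r vh wh vt wt qh rh.
      0 < CR \<and> 0 < \<Delta>t \<and> real M * \<Delta>t = T \<and> 0 < \<gamma> \<and>
      triangulation_of D \<T>0 \<and> \<T> = barycenter_refinement \<T>0 \<and> quasi_uniform \<sigma> \<T> \<and>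
      h = mesh_size \<T> \<and>
      Xh = SV_velocity D \<T> k \<and> Qh = SV_pressure D \<T> k \<and>
      conforming_Ytilde D \<T> Yh \<and> Xh \<subseteq> Yh \<and>
      inf_sup \<beta> D Xh Qh \<and>
      (\<forall>u\<in>Rspace D Xh Qh. L2_norm D (grad D u) \<le> CR * L2_norm D (dvg D u)) \<and>
      coupled_SMHD D Xh Qh N \<nu> \<nu>m \<mu> \<Delta>t M f1 f2 v w q r \<and>
      SCM_SPP_SMHD D Xh Yh Qh N \<nu> \<nu>m \<mu> \<gamma> \<Delta>t M f1 f2 (v 0) (w 0) vh wh vt wt qh rh \<and>
      (\<forall>j\<in>{1..N}. L2_norm D (v 0 j) \<le> C0 \<and> L2_norm D (w 0 j) \<le> C0) \<and>
      (\<forall>j\<in>{1..N}. \<forall>n\<in>{1..M}.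
         L3_norm D (grad D (v n j)) + L3_norm D (grad D (w n j))
           + Linf_norm D (v n j) + Linf_norm D (w n j) \<le> Cstar \<and>
         Linf_norm D (vh n j) \<le> Cstar \<and> Linf_norm D (wh n j) \<le> Cstar)
      \<longrightarrow>
      \<Delta>t * (\<Sum>n=1..M.
          (L2_norm D (\<lambda>x. grad D (avg N (v n)) x - grad D (avg N (vh n)) x))\<^sup>2
          + (L2_norm D (\<lambda>x. grad D (avg N (w n)) x - grad D (avg N (wh n)) x))\<^sup>2)
      \<le> C * CR\<^sup>2 / \<gamma>\<^sup>2
          * (1 / (alpha_min D N \<nu> \<nu>m ^ 3 * \<Delta>t) + 1 / (alpha_min D N \<nu> \<nu>m * \<Delta>t)
             + \<Delta>t / alpha_min D N \<nu> \<nu>m + 1)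
          * exp (C * Cstar\<^sup>2 / alpha_min D N \<nu> \<nu>m + C * \<Delta>t / (h ^ 3 * alpha_min D N \<nu> \<nu>m))
          * (\<Delta>t * (\<Sum>n<M. \<Sum>j=1..N.
              (L2_norm D (\<lambda>x. q (Suc n) j x - qh n j x))\<^sup>2
              + (L2_norm D (\<lambda>x. r (Suc n) j x - rh n j x))\<^sup>2))"
proof -
  let ?\<alpha> = "alpha_min D N \<nu> \<nu>m"
  have d23: "CARD('d) \<in> {2, 3}" and N: "1 \<le> N" and T: "0 < T" and \<mu>: "0 < \<mu>" and \<sigma>: "0 < \<sigma>" and \<alpha>: "0 < ?\<alpha>"
    by (fact assms)+
  have D: "open D" "D \<noteq> {}" "convex D" "bounded D"
    using assms(2) bounded_subset[OF polytope_imp_bounded closure_subset] by (auto simp: convex_polytopal_domain_def)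
  interpret bounded_domain D by unfold_locales (rule D)+
  obtain R where R: "\<And>x. x \<in> D \<Longrightarrow> norm x \<le> R" "0 \<le> R"
    using D(4) unfolding bounded_pos by (meson less_imp_le)
  have "\<exists>B. \<forall>x\<in>D. \<bar>\<nu> j x\<bar> \<le> B \<and> \<bar>\<nu>m j x\<bar> \<le> B" if j: "j \<in> {1..N}" for j
  proof -
    have "bounded (\<nu> j ` D)" "bounded (\<nu>m j ` D)" using assms(9,10) j by blast+
    then obtain B B' where "\<forall>x\<in>D. \<bar>\<nu> j x\<bar> \<le> B" "\<forall>x\<in>D. \<bar>\<nu>m j x\<bar> \<le> B'"
      unfolding bounded_iff by auto
    then show ?thesis by (intro exI[of _ "max B B'"]) (auto intro: le_max_iff_disj[THEN iffD2])
  qed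
  then obtain Bj where Bj: "\<And>j x. j \<in> {1..N} \<Longrightarrow> x \<in> D \<Longrightarrow> \<bar>\<nu> j x\<bar> \<le> Bj j \<and> \<bar>\<nu>m j x\<bar> \<le> Bj j" by metis
  define B where "B = (\<Sum>j=1..N. \<bar>Bj j\<bar>)"
  have B0: "0 \<le> B" by (simp add: B_def sum_nonneg)
  have B: "norm (\<nu> j x) \<le> B" "norm (\<nu>m j x) \<le> B" if j: "j \<in> {1..N}" and x: "x \<in> D" for j x
  proof -
    have "\<bar>Bj j\<bar> \<le> B" unfolding B_def by (rule member_le_sum[OF j]) auto
    then show "norm (\<nu> j x) \<le> B" "norm (\<nu>m j x) \<le> B" using Bj[OF j x] by auto
  qed
  have av: "\<bar>avg N \<nu> x\<bar> \<le> B" "\<bar>avg N \<nu>m x\<bar> \<le> B" if x: "x \<in> D" for x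
    using norm_avg_le[of N \<nu> x B, OF B(1)[OF _ x] N] norm_avg_le[of N \<nu>m x B, OF B(2)[OF _ x] N] by simp_all
  have AE_D: "AE x in lebesgue_on D. P x" if "\<And>x. x \<in> D \<Longrightarrow> P x" for P
    using that by (intro AE_I2) (simp add: space_restrict_space)
  have e\<nu>: "essbdd (\<nu> j)" "essbdd (\<nu>m j)" if j: "j \<in> {1..N}" for j
    using assms(9,10) j by (auto intro!: essbddI[of _ B] AE_D B)
  have ea: "essbdd (avg N \<nu>)" "essbdd (avg N \<nu>m)"
    unfolding avg_def[abs_def] by (intro essbdd_scaleR_const essbdd_sum e\<nu>; assumption)+
  have half: "essbdd g \<Longrightarrow> essbdd (\<lambda>x. g x / 2)" for g :: "real^'d \<Rightarrow> real"
    using essbdd_mult_const[of g "1 / 2"] by simp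
  have ed: "essbdd (\<lambda>x. \<nu> j x - \<nu>m j x)" if j: "j \<in> {1..N}" for j by (intro essbdd_diff e\<nu> j)
  have ef: "essbdd (\<lambda>x. fluct N \<nu> j x + fluct N \<nu>m j x)" if j: "j \<in> {1..N}" for j
    unfolding fluct_def[abs_def] by (intro essbdd_add essbdd_diff e\<nu> ea j)
  define A1 where "A1 j = Linf_norm D (\<lambda>x. \<nu> j x - \<nu>m j x) / 2" for j
  define A2 where "A2 j = Linf_norm D (\<lambda>x. fluct N \<nu> j x + fluct N \<nu>m j x) / 2" for j
  define m where "m = ((INF x\<in>D. avg N \<nu> x) + (INF x\<in>D. avg N \<nu>m x)) / 2"
  have A: "0 \<le> A1 j" "0 \<le> A2 j" if j: "j \<in> {1..N}" for j
    using Linf_norm_nonneg[OF ed[OF j] D(2)] Linf_norm_nonneg[OF ef[OF j] D(2)] by (simp_all add: A1_def A2_def)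
  \<comment> \<open>\<open>m\<close>, \<open>A1\<close> and \<open>A2\<close> are halves of the
    terms of \<open>alpha\<close>, as the schemes carry all viscosities with the factor 1/2; what
    the implicit viscosity has in excess of the explicit ones is therefore half of
    \<open>\<alpha>\<close>.\<close>
  have coef: "?\<alpha> / 2 \<le> m - A1 j - A2 j" if j: "j \<in> {1..N}" for j
  proof -
    have "?\<alpha> \<le> alpha D N \<nu> \<nu>m j" unfolding alpha_min_def using j by (intro Min_le) auto
    also have "\<dots> = 2 * (m - A1 j - A2 j)" by (simp add: alpha_def m_def A1_def A2_def)
    finally show ?thesis by simp
  qed
  have m0: "0 \<le> m" using coef[of 1] A[of 1] \<alpha> N by auto
  have mle: "m \<le> (avg N \<nu> x + avg N \<nu>m x) / 2" if x: "x \<in> D" for x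
  proof -
    have "bdd_below (avg N \<nu> ` D)" "bdd_below (avg N \<nu>m ` D)"
      using av by (auto intro!: bdd_belowI2[of _ "- B"] simp: abs_le_iff minus_le_iff)
    then have "(INF x\<in>D. avg N \<nu> x) \<le> avg N \<nu> x" "(INF x\<in>D. avg N \<nu>m x) \<le> avg N \<nu>m x"
      using x by (auto intro: cINF_lower)
    then show ?thesis by (simp add: m_def)
  qed
  obtain C1 where C1: "0 < C1" "\<And>p (x0::real^'d) h x. p \<in> polys k \<Longrightarrow> 0 < h \<Longrightarrow> x \<in> cball x0 (2 * h) \<Longrightarrow>
     (p x)\<^sup>2 \<le> C1 / h ^ CARD('d) * (\<integral>z. indicator (cball x0 (h / \<sigma>)) z * (p z)\<^sup>2 \<partial>lborel)"
    using polys_value_bound[OF \<sigma>, of k] by blast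
  obtain C2 where C2: "0 < C2" "\<And>p (x0::real^'d) h x i. p \<in> polys k \<Longrightarrow> 0 < h \<Longrightarrow> x \<in> cball x0 h \<Longrightarrow>
     (partial i p x)\<^sup>2 \<le> C2 / (h ^ CARD('d) * h\<^sup>2) * (\<integral>z. indicator (cball x0 (h / \<sigma>)) z * (p z)\<^sup>2 \<partial>lborel)"
    using polys_partial_bound[OF \<sigma>, of k] by blast
  define l1 where "l1 = 2 * real CARD('d) * R"
  define l2 where "l2 = real CARD('d) * C1 * (1 + 2 * R)"
  define l3 where "l3 = (real CARD('d))\<^sup>2 * unit_ball_vol (real CARD('d)) * real (CARD('d) + 1) * C2 * (1 + 2 * R)"
  define l4 where "l4 = measure lebesgue D + \<bar>Cstar\<bar> ^ 3"
  define l5 where "l5 = (\<Sum>j=1..N. A1 j + A2 j)"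
  have lpos: "0 \<le> l1" "0 \<le> l2" "0 \<le> l3" "0 \<le> l4"
    using R(2) C1(1) C2(1) by (simp_all add: l1_def l2_def l3_def l4_def)
  have l5: "0 \<le> l5" unfolding l5_def using A by (intro sum_nonneg add_nonneg_nonneg) auto
  \<comment> \<open>A sum of nonnegative numbers that depend on the data only, hence above each of
    them. Mesh, time step and penalty parameter are introduced later, so \<open>K\<close> and
    \<open>C\<close> cannot depend on them.\<close>
  define L where "L = 1 + real CARD('d) + l1 + l2 + l3 + l4 + l5 + real N + \<mu> + T + \<bar>C0\<bar> + \<bar>Cstar\<bar> + B"
  have L: "1 \<le> L" "real CARD('d) \<le> L" "l1 \<le> L" "l2 \<le> L" "l3 \<le> L" "l4 \<le> L" "l5 \<le> L" "real N \<le> L" "\<mu> \<le> L" "T \<le> L"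
      "\<bar>C0\<bar> \<le> L" "\<bar>Cstar\<bar> \<le> L" "B \<le> L"
    unfolding L_def using lpos l5 \<mu> T B0 by auto
  have AL: "A1 j \<le> L" "A2 j \<le> L" if j: "j \<in> {1..N}" for j
  proof -
    have "A1 j + A2 j \<le> l5" unfolding l5_def by (rule member_le_sum[OF j]) (simp_all add: add_nonneg_nonneg A)
    then show "A1 j \<le> L" "A2 j \<le> L" using A[OF j] L(7) by linarith+
  qed
  define \<eta> where "\<eta> = ?\<alpha> / (32 * (real N)\<^sup>2)"
  have "0 < \<eta>" using \<alpha> N by (simp add: \<eta>_def)
  from young_absorption[OF L(1) this] obtain K where K: "0 < K" and young: "young_const L \<eta> K"
    by (elim exE conjE)
  define C where "C = 4 * K * real N * exp (16 * (real N)\<^sup>2 * K * T) + ?\<alpha> * (1 + 16 * (real N)\<^sup>2 * K * T)"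
  have C: "0 < C" unfolding C_def using K \<alpha> N T by (intro add_pos_pos mult_pos_pos add_pos_nonneg) auto
  show ?thesis
  proof (rule exI[of _ C], rule conjI[OF C], intro allI impI, elim conjE)
    fix CR \<T>0 \<T> h Xh Yh Qh \<Delta>t M \<gamma> v w q r vh wh vt wt qh rh
    assume CR: "0 < CR" and dt: "0 < \<Delta>t" and M: "real M * \<Delta>t = T" and \<gamma>: "0 < \<gamma>"
      and tri: "triangulation_of D \<T>0" and \<T>: "\<T> = barycenter_refinement \<T>0" and qu: "quasi_uniform \<sigma> \<T>" and h: "h = mesh_size \<T>"
      and Xh: "Xh = SV_velocity D \<T> k" and Qh: "Qh = SV_pressure D \<T> k"
      and Y: "conforming_Ytilde D \<T> Yh" "Xh \<subseteq> Yh"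
      and R_CR: "\<forall>u\<in>Rspace D Xh Qh. L2_norm D (grad D u) \<le> CR * L2_norm D (dvg D u)"
      and coupled: "coupled_SMHD D Xh Qh N \<nu> \<nu>m \<mu> \<Delta>t M f1 f2 v w q r"
      and spp: "SCM_SPP_SMHD D Xh Yh Qh N \<nu> \<nu>m \<mu> \<gamma> \<Delta>t M f1 f2 (v 0) (w 0) vh wh vt wt qh rh"
      and init: "\<forall>j\<in>{1..N}. L2_norm D (v 0 j) \<le> C0 \<and> L2_norm D (w 0 j) \<le> C0"
      and bd: "\<forall>j\<in>{1..N}. \<forall>n\<in>{1..M}.
         L3_norm D (grad D (v n j)) + L3_norm D (grad D (w n j)) + Linf_norm D (v n j) + Linf_norm D (w n j) \<le> Cstar \<and>
         Linf_norm D (vh n j) \<le> Cstar \<and> Linf_norm D (wh n j) \<le> Cstar"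
    interpret mesh: sv_mesh D \<T>0 \<T> k \<sigma> h
      by unfold_locales (rule D tri \<T> qu h \<sigma>)+
    define H where "H = sqrt (1 / h ^ 3)"
    have fe: "fe_space D (SV_velocity D \<T> k) L H"
      by (rule mesh.fe_space_mesh[OF d23 R C1(2,1) C2(2,1) L(1,2) L(3)[unfolded l1_def] L(4)[unfolded l2_def] L(5)[unfolded l3_def] H_def])
    have H2: "H\<^sup>2 = 1 / h ^ 3" using mesh.h_pos by (simp add: H_def)
    \<comment> \<open>As \<open>T\<close> is positive there is at least one step, so
      \<open>\<Delta>t\<close> is at most \<open>T\<close>; this bounds the step size without any
      restriction by the mesh.\<close>
    have "M \<noteq> 0" using M T by (cases M) auto
    then have "1 * \<Delta>t \<le> real M * \<Delta>t" using dt by (intro mult_right_mono) auto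
    then have dtL: "\<Delta>t \<le> L" using M L(10) by simp
    note cs = coupled[unfolded coupled_SMHD_def Xh Qh] spp[unfolded SCM_SPP_SMHD_def Xh Qh]
    have CsL: "Cstar \<le> L" "measure lebesgue D + \<bar>Cstar\<bar> ^ 3 \<le> L" using L(6,12) by (simp_all add: l4_def)
    have vi: "AE x in lebesgue_on D. m \<le> (avg N \<nu> x + avg N \<nu>m x) / 2 \<and> (avg N \<nu> x + avg N \<nu>m x) / 2 \<le> L"
    proof (rule AE_D)
      fix x assume "x \<in> D"
      then show "m \<le> (avg N \<nu> x + avg N \<nu>m x) / 2 \<and> (avg N \<nu> x + avg N \<nu>m x) / 2 \<le> L"
        using mle[of x] av[of x] L(13) by auto
    qed
    have v1: "AE x in lebesgue_on D. \<bar>(\<nu> j x - \<nu>m j x) / 2\<bar> \<le> A1 j" if "j \<in> {1..N}" for j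
      using AE_le_Linf_norm[OF ed[OF that]] by eventually_elim (simp add: A1_def)
    have v2: "AE x in lebesgue_on D. \<bar>(fluct N \<nu> j x + fluct N \<nu>m j x) / 2\<bar> \<le> A2 j" if "j \<in> {1..N}" for j
      using AE_le_Linf_norm[OF ef[OF that]] by eventually_elim (simp add: A2_def)
    note vis = half[OF essbdd_add[OF ea]] m0 vi half[OF ed] v1 A(1) AL(1) half[OF ef] v2 A(2) AL(2)
    have V: "smhd_half D \<T>0 \<T> k \<sigma> h L H Yh N \<nu> \<nu>m \<mu> \<gamma> \<Delta>t m M f1 v w vh wh vt q qh A1 A2"
    proof (rule smhd_halfI[OF mesh.sv_mesh_axioms fe cs(1)[THEN conjunct1] cs(1)[THEN conjunct2] cs(2)[THEN conjunct1] cs(2)[THEN conjunct2]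
          Y(1) Y(2)[unfolded Xh] N L(8) dt dtL \<mu> L(9) \<gamma> _ _ CsL vis])
      show "L3_norm D (grad D (v n j)) + L3_norm D (grad D (w n j)) + Linf_norm D (v n j) + Linf_norm D (w n j) \<le> Cstar \<and>
         Linf_norm D (vh n j) \<le> Cstar \<and> Linf_norm D (wh n j) \<le> Cstar" if "j \<in> {1..N}" "n \<in> {1..M}" for j n
        using bd that by blast
      show "L2_norm D (w 0 j) \<le> L" if "j \<in> {1..N}" for j using init[rule_format, OF that] L(11) by linarith
    qed assumption+
    have W: "smhd_half D \<T>0 \<T> k \<sigma> h L H Yh N \<nu> \<nu>m \<mu> \<gamma> \<Delta>t m M f2 w v wh vh wt r rh A1 A2"
    proof (rule smhd_halfI[OF mesh.sv_mesh_axioms fe cs(1)[THEN conjunct2] cs(1)[THEN conjunct1] cs(2)[THEN conjunct2] cs(2)[THEN conjunct1]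
          Y(1) Y(2)[unfolded Xh] N L(8) dt dtL \<mu> L(9) \<gamma> _ _ CsL vis])
      show "L3_norm D (grad D (w n j)) + L3_norm D (grad D (v n j)) + Linf_norm D (w n j) + Linf_norm D (v n j) \<le> Cstar \<and>
         Linf_norm D (wh n j) \<le> Cstar \<and> Linf_norm D (vh n j) \<le> Cstar" if "j \<in> {1..N}" "n \<in> {1..M}" for j n
        using bd[rule_format, OF that] by linarith
      show "L2_norm D (v 0 j) \<le> L" if "j \<in> {1..N}" for j using init[rule_format, OF that] L(11) by linarith
    qed assumption+
    interpret pair: smhd_pair D \<T>0 \<T> k \<sigma> h L H Yh N \<nu> \<nu>m \<mu> \<gamma> \<Delta>t m M f1 f2 v w vh wh vt wt q qh r rh A1 A2 ?\<alpha> \<eta> K CR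
      by (intro smhd_pair.intro smhd_pair_axioms.intro V W \<alpha> coef \<eta>_def K young CR R_CR[unfolded Xh Qh])
    show "\<Delta>t * (\<Sum>n=1..M.
          (L2_norm D (\<lambda>x. grad D (avg N (v n)) x - grad D (avg N (vh n)) x))\<^sup>2
          + (L2_norm D (\<lambda>x. grad D (avg N (w n)) x - grad D (avg N (wh n)) x))\<^sup>2)
      \<le> C * CR\<^sup>2 / \<gamma>\<^sup>2
          * (1 / (?\<alpha> ^ 3 * \<Delta>t) + 1 / (?\<alpha> * \<Delta>t) + \<Delta>t / ?\<alpha> + 1)
          * exp (C * Cstar\<^sup>2 / ?\<alpha> + C * \<Delta>t / (h ^ 3 * ?\<alpha>))
          * (\<Delta>t * (\<Sum>n<M. \<Sum>j=1..N.
              (L2_norm D (\<lambda>x. q (Suc n) j x - qh n j x))\<^sup>2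
              + (L2_norm D (\<lambda>x. r (Suc n) j x - rh n j x))\<^sup>2))"
      by (rule pair.average_gradient_error_bound[OF H2 M C_def, unfolded pair.Qp_def])
  qed
qed

end
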